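(* In the setting described in the context ($\mathcal L$ is either the Maxwell operator with a smart layer, or the Bérenger split Maxwell operator with absorption in $x_1$): (i) Given the incoming amplitudes $a^I_j$ there are uniquely determined amplitudes $a^T_j$ and $a^R_j$ so that for any choice of $a^{I,R,T}(t,x,\varepsilon)\sim\sum_j\varepsilon^ja^{I,R,T}_j(t,x)$, the functions $\mathcal U^\varepsilon,\mathcal V^\varepsilon,\mathcal W^\varepsilon$ are infinitely accurate solutions of the differential equations and the transmission condition is also satisfied to infinite order: for all $(t,x')\in\mathbb R\times\mathbb R^2$, $$\mathcal A_1(\mathcal U^\varepsilon+\mathcal V^\varepsilon)(t,0_-,x')=\mathcal A_1\mathcal W^\varepsilon(t,0_+,x')+O(\varepsilon^\infty).$$ (ii) In the case of Bérenger's PML, the coefficients $a^R_j$ vanish identically for $j\ge0$. (iii) For the smart layer with $\sigma=\mathbf 1_{x_1>0}$, the coefficient $a^R_0$ vanishes identically. The reflection coefficient of the layer is equal to $$R(\tau,\xi)=i\mu(1+\nu)\frac{\xi_1^2-\tau^2}{8\tau\xi_1^2}=i\frac{\mu(1+\nu)}{8\tau}\,\frac{v_1^2-1}{v_1^2}.$$ That is, if $a^I_0(t,0_-,x')=\alpha(t,x')\Phi(\tau,\xi)\in\ker L_1(\tau,\xi)$, then $$a^R(t,0_-,x')=\varepsilon R(\tau,\xi)\,\alpha(t,x')\,\Phi(\tau,\xi^R)+O(\varepsilon^2).$$ Furthermore, the amplitudes $a^{T,R}$ are such that on the interface $\Gamma=\{x_1=0\}$, for all $(i,j)\in\mathbb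 N^2$ with $i=0$ and $j\le1$, or $i\ge1$ and $j\ge0$, $$\partial_1^ja^T_i-\partial_1^ja^I_i\in\mu\,(\mathbb C_{i+j-1}[\mu]\otimes\mathbb C^3),\qquad\partial_1^ja^R_i\in\mu\,(\mathbb C_{i+j-1}[\mu]\otimes\mathbb C^3).$$ (iv) The smart layer with $\sigma(x_1)$ satisfying $\sigma(0)=\cdots=\sigma^{(k-1)}(0)=0$, $\sigma^{(k)}(0)\ne0$ is nonreflecting at order $k$ for any angle of incidence, i.e. if $a^I_0(t,0_-,x')=\alpha(t,x')\Phi(\tau,\xi)$, there exists $R_k(\tau,\xi)$ such that $$a^R(t,0_-,x')=\varepsilon^{k}\sigma^{(k)}(0)\,R_k(\tau,\xi)\,\alpha(t,x')\,\Phi(\tau,\xi^R)+O(\varepsilon^{k+1}).$$ Furthermore the amplitudes $a^{T,R}$ are linear functions of $\mu$ on the interface $\Gamma$. That is, denoting $c^R_i(\mu)=a^R_i|_\Gamma$ and $c^T_i(\mu)=a^T_i|_\Gamma-a^I_i|_\Gamma$, one has for all $i\ge k$ in $\mathbb N$, $c^{R,T}_i(\mu)\in\mu\,(\mathbb C_{i-1}[\mu]\otimes\mathbb C^3)$.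
   Context: Maxwell operator on $\mathbb R^{1+3}$: $L_1=\partial_t+\sum_{l=1}^3A_l\partial_l$ on $\mathbb C^3$-valued functions, $A_1=\begin{pmatrix}0&0&0\\0&0&-i\\0&i&0\end{pmatrix}$, $A_2=\begin{pmatrix}0&0&i\\0&0&0\\-i&0&0\end{pmatrix}$, $A_3=\begin{pmatrix}0&-i&0\\i&0&0\\0&0&0\end{pmatrix}$; $L_1(\tau,\xi)=\tau I+\sum\xi_lA_l$. Two cases for $\mathcal L=\mathcal L_1+\mu C$, $\mu\ge0$; $\mathcal A_1$ denotes the coefficient of $\partial_1$ in $\mathcal L_1$. Smart layer: $\mathcal L_1=L_1$, $C=\sigma(x_1)(\pi_+(A_1)+\nu\pi_-(A_1))$, $\nu\ge0$, with $\pi_\pm(A_1)$ the spectral projectors of $A_1$ on its positive/negative eigenvalues. Bérenger's PML: $\mathcal L_1=\widetilde L_1$ acting on $(U^1,U^2,U^3)\in(\mathbb C^3)^3$ by $(\widetilde L_1\widetilde U)_l=\partial_tU^l+A_l\partial_l(\sum_jU^j)$, $C=\sigma(x_1)\,\mathrm{diag}(I_3,0,0)$. In both cases $\mathrm{supp}\,\sigma\subset[0,\infty[$; values and derivatives of $\sigma$ at $0$ are taken from the layer side $x_1>0$. Incident wave: $\tau\ne0$, $\tau=\pm|\xi|$, $\xi\in\mathbb R^3$, with group velocity $\mathbf v=-\xi/\tau$ satisfying $v_1>0$; $x'=(x_2,x_3)$, $\xi'=(\xi_2,\xi_3)$. Phases: $S^I=\tau t+\xi\cdot x$, $S^R=\tau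 t+\xi^R\cdot x$, $\xi^R=(-\xi_1,\xi')$. The incident wave is $\mathcal U^\varepsilon=e^{iS^I/\varepsilon}a^I(t,x,\varepsilon)$, $a^I\sim\sum_j\varepsilon^ja^I_j(t,x)$, with $\mathcal L_1\mathcal U^\varepsilon=O(\varepsilon^\infty)$, given independently of $\mu$, with amplitudes supported in a tube of rays (lines of velocity $\mathbf v$) whose section at $t=0$ is a compact subset of $\{x_1<0\}$. The reflected wave $\mathcal V^\varepsilon=e^{iS^R/\varepsilon}a^R$, $a^R\sim\sum\varepsilon^ja^R_j$, lives in $x_1\le0$ with $\mathcal L_1\mathcal V^\varepsilon=O(\varepsilon^\infty)$; the transmitted wave $\mathcal W^\varepsilon=e^{iS^I/\varepsilon}a^T$, $a^T\sim\sum\varepsilon^ja^T_j$, lives in $x_1\ge0$ with $\mathcal L\mathcal W^\varepsilon=O(\varepsilon^\infty)$. The reflected and transmitted amplitudes have zero initial values in time. $\sim$ is in the sense of Taylor series at $\varepsilon=0$; $O(\varepsilon^\infty)$ means $O(\varepsilon^n)$ for all $n$; infinitely accurate means residual $O(\varepsilon^\infty)$. In (iii) and (iv), $\Phi(\tau,\xi)=\big(\xi_1-\tfrac{\tau^2}{\xi_1},\ \xi_2+i\tfrac{\tau}{\xi_1}\xi_3,\ \xi_3-i\tfrac{\tau}{\xi_1}\xi_2\big)$, a vector of the one-dimensional space $\ker L_1(\tau,\xi)$. $\mathbb C_j[\mu]$ is the space of polynomials in $\mu$ of degree less than or equal to $j$ with complex coefficients (only the zero polynomial if $j=-1$), and $\mathbb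 C_j[\mu]\otimes\mathbb C^3$ the corresponding space with coefficients in $\mathbb C^3$. *)

theory Defs
  imports "HOL-Analysis.Analysis" "HOL-Computational_Algebra.Polynomial"
begin

section \<open>Smooth functions\<close>

definition ddir :: "'a::real_normed_vector \<Rightarrow> ('a \<Rightarrow> 'b::real_normed_vector) \<Rightarrow> 'a \<Rightarrow> 'b"
  where "ddir v f = (\<lambda>x. frechet_derivative f (at x) v)"

primrec Ck :: "nat \<Rightarrow> ('a::real_normed_vector \<Rightarrow> 'b::real_normed_vector) \<Rightarrow> bool"
  where
    "Ck 0 f \<longleftrightarrow> continuous_on UNIV f"
  | "Ck (Suc n) f \<longleftrightarrow> (\<forall>x. f differentiable (at x)) \<and> (\<forall>v. Ck n (ddir v f))"

definition smooth :: "('a::real_normed_vector \<Rightarrow> 'b::real_normed_vector) \<Rightarrow> bool"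
  where "smooth f \<longleftrightarrow> (\<forall>n. Ck n f)"

text \<open>For a half space or a half line (open or closed), being the restriction of a smooth
  function on the whole space amounts to being smooth up to the boundary.\<close>

definition smooth_upto :: "'a set \<Rightarrow> ('a::real_normed_vector \<Rightarrow> 'b::real_normed_vector) \<Rightarrow> bool"
  where "smooth_upto S f \<longleftrightarrow> (\<exists>g. smooth g \<and> (\<forall>x\<in>S. f x = g x))"


section \<open>Space-time\<close>

type_synonym spacetime = "real \<times> (real^3)"

definition left :: "spacetime set" where "left = {(t, x). x $ 1 \<le> 0}"
definition right :: "spacetime set" where "right = {(t, x). x $ 1 \<ge> 0}"
definition interface :: "spacetime set" where "interface = {(t, x). x $ 1 = 0}"

abbreviation Dt :: "(spacetime \<Rightarrow> 'b::real_normed_vector) \<Rightarrow> spacetime \<Rightarrow> 'b"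
  where "Dt \<equiv> ddir (1, 0)"

abbreviation Dx :: "3 \<Rightarrow> (spacetime \<Rightarrow> 'b::real_normed_vector) \<Rightarrow> spacetime \<Rightarrow> 'b"
  where "Dx l \<equiv> ddir (0, axis l 1)"

text \<open>Derivative with respect to \<open>x\<^sub>1\<close> of a function living on \<open>S\<close>; it is one-sided at points
  of the interface when \<open>S\<close> is \<^const>\<open>left\<close> or \<^const>\<open>right\<close>.\<close>

definition Dx1_within :: "spacetime set \<Rightarrow> (spacetime \<Rightarrow> 'b::real_normed_vector) \<Rightarrow> spacetime \<Rightarrow> 'b"
  where "Dx1_within S f = (\<lambda>p. vector_derivative (\<lambda>s. f (p + s *\<^sub>R (0, axis 1 1)))
           (at 0 within {s. p + s *\<^sub>R (0, axis 1 1) \<in> S}))"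


section \<open>Asymptotics at \<open>\<epsilon> = 0\<close>\<close>

text \<open>\<open>r = O(\<epsilon>\<^sup>n)\<close> uniformly on bounded subsets of \<open>D\<close>; when \<open>D\<close> is an open half space, this
  is uniform up to the boundary.\<close>

definition O_eps :: "nat \<Rightarrow> 'a::metric_space set \<Rightarrow> (real \<Rightarrow> 'a \<Rightarrow> 'b::real_normed_vector) \<Rightarrow> bool"
  where "O_eps n D r \<longleftrightarrow> (\<forall>K. compact K \<longrightarrow>
           (\<exists>B. \<exists>\<epsilon>\<^sub>0>0. \<forall>\<epsilon>. 0 < \<epsilon> \<and> \<epsilon> < \<epsilon>\<^sub>0 \<longrightarrow> (\<forall>p\<in>K \<inter> D. norm (r \<epsilon> p) \<le> B * \<epsilon> ^ n)))"

definition O_eps_infinity :: "'a::metric_space set \<Rightarrow> (real \<Rightarrow> 'a \<Rightarrow> 'b::real_normed_vector) \<Rightarrow> bool"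
  where "O_eps_infinity D r \<longleftrightarrow> (\<forall>n. O_eps n D r)"

text \<open>\<open>a(p, \<epsilon>) \<sim> \<Sum>\<^sub>j \<epsilon>\<^sup>j c\<^sub>j(p)\<close> on \<open>D\<close>: \<open>a\<close> is smooth in \<open>(\<epsilon>, p)\<close> up to \<open>\<epsilon> = 0\<close> (and up to the
  boundary of \<open>D\<close>), and the \<open>c\<^sub>j\<close> are its Taylor coefficients in \<open>\<epsilon>\<close>.\<close>

definition expansion ::
    "spacetime set \<Rightarrow> (real \<Rightarrow> spacetime \<Rightarrow> 'b::real_normed_vector) \<Rightarrow> (nat \<Rightarrow> spacetime \<Rightarrow> 'b) \<Rightarrow> bool"
  where "expansion D a c \<longleftrightarrow> (\<exists>g \<epsilon>\<^sub>0. smooth g \<and> \<epsilon>\<^sub>0 > 0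
           \<and> (\<forall>\<epsilon> p. 0 < \<epsilon> \<and> \<epsilon> < \<epsilon>\<^sub>0 \<and> p \<in> D \<longrightarrow> a \<epsilon> p = g (\<epsilon>, p))
           \<and> (\<forall>j. \<forall>p\<in>D. c j p = (1 / fact j) *\<^sub>R (ddir (1, 0) ^^ j) g (0, p)))"


section \<open>Operators\<close>

definition principal ::
    "(3 \<Rightarrow> complex^'n^'n) \<Rightarrow> (spacetime \<Rightarrow> complex^'n) \<Rightarrow> spacetime \<Rightarrow> complex^'n"
  where "principal \<A> f p = Dt f p + (\<Sum>l\<in>UNIV. \<A> l *v Dx l f p)"

definition full_op ::
    "(3 \<Rightarrow> complex^'n^'n) \<Rightarrow> (real \<Rightarrow> complex^'n^'n) \<Rightarrow> real \<Rightarrow> (spacetime \<Rightarrow> complex^'n)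
      \<Rightarrow> spacetime \<Rightarrow> complex^'n"
  where "full_op \<A> C \<mu> f p = principal \<A> f p + \<mu> *\<^sub>R (C (snd p $ 1) *v f p)"

definition maxwell :: "3 \<Rightarrow> complex^3^3"
  where "maxwell l =
     (if l = 1 then vector [vector [0, 0, 0], vector [0, 0, -\<i>], vector [0, \<i>, 0]]
      else if l = 2 then vector [vector [0, 0, \<i>], vector [0, 0, 0], vector [-\<i>, 0, 0]]
      else vector [vector [0, -\<i>, 0], vector [\<i>, 0, 0], vector [0, 0, 0]])"

text \<open>The index \<open>(l, m)\<close> stands for the component \<open>m\<close> of \<open>U\<^sup>l\<close> in \<open>(U\<^sup>1, U\<^sup>2, U\<^sup>3)\<close>: the
  matrix \<open>berenger l\<close> maps it to \<open>A\<^sub>l (\<Sum>\<^sub>j U\<^sup>j)\<close> in block \<open>l\<close> and to \<open>0\<close> in the other blocks.\<close>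

definition berenger :: "3 \<Rightarrow> complex^(3 \<times> 3)^(3 \<times> 3)"
  where "berenger l = (\<chi> r c. if fst r = l then maxwell l $ snd r $ snd c else 0)"

definition berenger_C :: "(real \<Rightarrow> real) \<Rightarrow> real \<Rightarrow> complex^(3 \<times> 3)^(3 \<times> 3)"
  where "berenger_C \<sigma> x1 = \<sigma> x1 *\<^sub>R (\<chi> r c. if r = c \<and> fst r = 1 then 1 else 0)"

text \<open>Spectral projector of a diagonalizable matrix on its eigenvalues lying in \<open>\<Lambda>\<close>.\<close>

definition spectral_projector :: "complex set \<Rightarrow> complex^'n^'n \<Rightarrow> complex^'n^'n"
  where "spectral_projector \<Lambda> M =
     (THE P. \<forall>l u. M *v u = l *s u \<longrightarrow> P *v u = (if l \<in> \<Lambda> then u else 0))"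

definition smart_C :: "(real \<Rightarrow> real) \<Rightarrow> real \<Rightarrow> real \<Rightarrow> complex^3^3"
  where "smart_C \<sigma> \<nu> x1 = \<sigma> x1 *\<^sub>R
     (spectral_projector (complex_of_real ` {0<..}) (maxwell 1)
      + \<nu> *\<^sub>R spectral_projector (complex_of_real ` {..<0}) (maxwell 1))"

text \<open>The value of \<open>\<sigma>\<close> at \<open>0\<close> itself is irrelevant: values and derivatives at \<open>0\<close> are limits
  from the layer side.\<close>

definition absorption :: "(real \<Rightarrow> real) \<Rightarrow> bool"
  where "absorption \<sigma> \<longleftrightarrow> (\<forall>x<0. \<sigma> x = 0) \<and> smooth_upto {0<..} \<sigma>"

definition layer_deriv :: "nat \<Rightarrow> (real \<Rightarrow> real) \<Rightarrow> real"
  where "layer_deriv k \<sigma> = Lim (at_right 0) ((deriv ^^ k) \<sigma>)"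


section \<open>Waves\<close>

definition group_velocity :: "real \<Rightarrow> real^3 \<Rightarrow> real^3"
  where "group_velocity \<tau> \<xi> = - (1 / \<tau>) *\<^sub>R \<xi>"

definition reflect :: "real^3 \<Rightarrow> real^3"
  where "reflect \<xi> = (\<chi> l. if l = 1 then - \<xi> $ 1 else \<xi> $ l)"

definition phase :: "real \<Rightarrow> real^3 \<Rightarrow> spacetime \<Rightarrow> real"
  where "phase \<tau> \<xi> p = \<tau> * fst p + \<xi> \<bullet> snd p"

definition wave ::
    "real \<Rightarrow> real^3 \<Rightarrow> (real \<Rightarrow> spacetime \<Rightarrow> complex^'n) \<Rightarrow> real \<Rightarrow> spacetime \<Rightarrow> complex^'n"
  where "wave \<tau> \<xi> a \<epsilon> p = exp (\<i> * complex_of_real (phase \<tau> \<xi> p / \<epsilon>)) *s a \<epsilon> p"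

definition tube :: "real^3 \<Rightarrow> (real^3) set \<Rightarrow> spacetime set"
  where "tube v K = {(t, x). x - t *\<^sub>R v \<in> K}"

definition incident ::
    "(3 \<Rightarrow> complex^'n^'n) \<Rightarrow> real \<Rightarrow> real^3 \<Rightarrow> (nat \<Rightarrow> spacetime \<Rightarrow> complex^'n) \<Rightarrow> bool"
  where "incident \<A> \<tau> \<xi> aI \<longleftrightarrow>
     (\<forall>j. smooth (aI j))
     \<and> (\<exists>K. compact K \<and> K \<subseteq> {x. x $ 1 < 0}
          \<and> (\<forall>j p. aI j p \<noteq> 0 \<longrightarrow> p \<in> tube (group_velocity \<tau> \<xi>) K))
     \<and> (\<exists>a. expansion UNIV a aI
          \<and> O_eps_infinity UNIV (\<lambda>\<epsilon>. principal \<A> (wave \<tau> \<xi> a \<epsilon>)))"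

text \<open>The amplitudes \<open>aR\<close>, \<open>aT\<close> answer the incident amplitudes \<open>aI\<close>. Only the values of \<open>aR\<close> on
  \<^const>\<open>left\<close> and of \<open>aT\<close> on \<^const>\<open>right\<close> matter. The residuals are taken at interior points,
  where these functions are differentiable in the usual sense.\<close>

definition transmission ::
    "(3 \<Rightarrow> complex^'n^'n) \<Rightarrow> (real \<Rightarrow> complex^'n^'n) \<Rightarrow> real \<Rightarrow> real \<Rightarrow> real^3
      \<Rightarrow> (nat \<Rightarrow> spacetime \<Rightarrow> complex^'n) \<Rightarrow> (nat \<Rightarrow> spacetime \<Rightarrow> complex^'n)
      \<Rightarrow> (nat \<Rightarrow> spacetime \<Rightarrow> complex^'n) \<Rightarrow> bool"
  where "transmission \<A> C \<mu> \<tau> \<xi> aI aR aT \<longleftrightarrow>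
     (\<forall>j. smooth_upto left (aR j) \<and> smooth_upto right (aT j)
        \<and> (\<forall>x. (0, x) \<in> left \<longrightarrow> aR j (0, x) = 0)
        \<and> (\<forall>x. (0, x) \<in> right \<longrightarrow> aT j (0, x) = 0))
     \<and> (\<forall>bI bR bT. expansion UNIV bI aI \<and> expansion left bR aR \<and> expansion right bT aT \<longrightarrow>
          (let U = wave \<tau> \<xi> bI; V = wave \<tau> (reflect \<xi>) bR; W = wave \<tau> \<xi> bT in
             O_eps_infinity UNIV (\<lambda>\<epsilon>. principal \<A> (U \<epsilon>))
           \<and> O_eps_infinity (interior left) (\<lambda>\<epsilon>. principal \<A> (V \<epsilon>))
           \<and> O_eps_infinity (interior right) (\<lambda>\<epsilon>. full_op \<A> C \<mu> (W \<epsilon>))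
           \<and> O_eps_infinity interface (\<lambda>\<epsilon> p. \<A> 1 *v (U \<epsilon> p + V \<epsilon> p) - \<A> 1 *v W \<epsilon> p)))"


section \<open>Reflection\<close>

definition \<Phi> :: "real \<Rightarrow> real^3 \<Rightarrow> complex^3"
  where "\<Phi> \<tau> \<xi> = vector
     [of_real (\<xi> $ 1 - \<tau>\<^sup>2 / \<xi> $ 1),
      of_real (\<xi> $ 2) + \<i> * of_real (\<tau> / \<xi> $ 1) * of_real (\<xi> $ 3),
      of_real (\<xi> $ 3) - \<i> * of_real (\<tau> / \<xi> $ 1) * of_real (\<xi> $ 2)]"

definition refl_coeff :: "real \<Rightarrow> real \<Rightarrow> real \<Rightarrow> real^3 \<Rightarrow> complex"
  where "refl_coeff \<mu> \<nu> \<tau> \<xi> =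
     \<i> * of_real (\<mu> * (1 + \<nu>) * (((\<xi> $ 1)\<^sup>2 - \<tau>\<^sup>2) / (8 * \<tau> * (\<xi> $ 1)\<^sup>2)))"

text \<open>\<open>\<complex>\<^sub>d[\<mu>] \<otimes> \<complex>\<^sup>3\<close>, reduced to \<open>0\<close> if \<open>d < 0\<close>, as functions of the real variable \<open>\<mu>\<close>.\<close>

definition poly_space :: "int \<Rightarrow> (real \<Rightarrow> complex^3) set"
  where "poly_space d = {f. \<exists>q :: 3 \<Rightarrow> complex poly.
           (\<forall>l. q l = 0 \<or> int (degree (q l)) \<le> d)
           \<and> (\<forall>\<mu>. f \<mu> = (\<chi> l. poly (q l) (of_real \<mu>)))}"

definition in_mu_times :: "(real \<Rightarrow> complex^3) \<Rightarrow> (real \<Rightarrow> complex^3) set \<Rightarrow> bool"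
  where "in_mu_times f P \<longleftrightarrow> (\<exists>q\<in>P. \<forall>\<mu>\<ge>0. f \<mu> = \<mu> *\<^sub>R q \<mu>)"

end

theory Submission
  imports Defs
begin

text \<open>
  Comparing the powers of \<open>\<epsilon>\<close> turns the conditions on the waves into linear equations for the
  coefficients: \<open>i L\<^sub>1(\<tau>, \<xi>) a\<^sub>j + (L\<^sub>1(\<partial>) + \<mu> C) a\<^sub>j\<^sub>-\<^sub>1 = 0\<close>, together with a jump condition on the interface.
  The component of \<open>a\<^sub>j\<close> off the kernel of the symbol is given by \<open>a\<^sub>j\<^sub>-\<^sub>1\<close>, the one in the kernel solves a
  transport equation along the rays, and the jump condition fixes its values on the interface, because the
  tangential components of the kernel vectors for \<open>\<xi>\<close> and its reflection are independent. All rays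
  in the two half spaces pass through the interface, so this determines all coefficients.

  For the layer of Berenger, the incident wave stretched in \<open>x\<^sub>1\<close> solves the equations in the layer
  and agrees with the incident wave on the interface, so that by uniqueness nothing is reflected.
  For the smart layer, one follows the
  normal derivatives of the coefficients on the interface: each \<open>\<epsilon>\<close> costs at most one
  derivative or one factor \<open>\<mu>\<close>. If \<open>\<sigma>\<close> vanishes to order \<open>k\<close>, then the reflected coefficients vanish up to the
  index \<open>k\<close>, so that the constant \<open>R\<^sub>k\<close> can be taken to be \<open>0\<close>.
\<close>

section \<open>Calculus of smooth functions\<close>

text \<open>\<open>transmission\<close> speaks of all amplitudes with given coefficients. Borel's
  lemma supplies one, and one choice decides all: without the phase factor, \<epsilon> times a
  residual is smooth up to \<epsilon> = 0, hence of infinite order exactly if its Taylor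
  coefficients vanish. Amplitudes on half spaces enter through smooth extensions; identities in the
  interior reach the interface by density. The kernel projector P satisfies P A_l P = v_l P, and P C
  P is a scalar multiple of P for the smart matrix, a polynomial in A_1. So the transport equations
  are ordinary differential equations with a scalar rate, solved by an integrating factor. Their
  data sit on the interface; the zero initial values follow because the incident tube stays in x_1 <
  0 for t \<le> 0. For split fields, uniqueness passes to their sum, which obeys equations of
  Maxwell type; the symbol recovers the summands because \<tau> is nonzero. Polynomial dependence on
  \<mu> and vanishing up to order k are one induction, run with two gradings in which a step in
  \<epsilon> and a normal derivative each weigh one.\<close>

lemma Ck_SucD: "Ck (Suc n) f \<Longrightarrow> Ck n f"
proof (induction n arbitrary: f)
  case 0
  then show ?case
    by (auto intro!: differentiable_imp_continuous_on simp: differentiable_on_def)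
next
  case (Suc n)
  then show ?case by (metis Ck.simps(2))
qed

lemma Ck_imp_continuous: "Ck n f \<Longrightarrow> continuous_on S f"
proof (induction n arbitrary: f)
  case 0
  then show ?case by (auto intro: continuous_on_subset)
next
  case (Suc n)
  then show ?case using Ck_SucD by blast
qed

text \<open>Shifting the order by one: the right side gives \<open>Ck (Suc n)\<close> for every
  \<open>n\<close>, and \<open>Ck_SucD\<close> turns this into \<open>Ck n\<close>, which covers
  order 0.\<close>

lemma smooth_iff: "smooth f \<longleftrightarrow> (\<forall>x. f differentiable (at x)) \<and> (\<forall>v. smooth (ddir v f))"
proof
  assume f: "smooth f"
  then have "Ck (Suc n) f" for n by (auto simp: smooth_def)
  then show "(\<forall>x. f differentiable (at x)) \<and> (\<forall>v. smooth (ddir v f))"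
    by (auto simp: smooth_def)
next
  assume "(\<forall>x. f differentiable (at x)) \<and> (\<forall>v. smooth (ddir v f))"
  then have "Ck (Suc n) f" for n by (auto simp: smooth_def)
  then show "smooth f" using Ck_SucD unfolding smooth_def by blast
qed

lemma smooth_differentiable: "smooth f \<Longrightarrow> f differentiable (at x within S)"
  using smooth_iff differentiable_at_withinI by blast

lemma smooth_ddir [intro]: "smooth f \<Longrightarrow> smooth (ddir v f)"
  using smooth_iff by blast

lemma smooth_ddir_funpow: "smooth f \<Longrightarrow> smooth ((ddir v ^^ n) f)"
  by (induction n) auto

lemma smooth_imp_continuous: "smooth f \<Longrightarrow> continuous_on S f"
  using Ck_imp_continuous smooth_def by blast

lemma ddir_eqI: "(f has_derivative f') (at x) \<Longrightarrow> ddir v f x = f' v"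
  by (metis ddir_def frechet_derivative_at)

lemma differentiable_has_derivative_ddir:
  "f differentiable (at x) \<Longrightarrow> (f has_derivative (\<lambda>v. ddir v f x)) (at x within S)"
  by (simp add: ddir_def frechet_derivative_works has_derivative_at_withinI)

lemma smooth_has_derivative:
  "smooth f \<Longrightarrow> (f has_derivative (\<lambda>v. ddir v f x)) (at x within S)"
  by (simp add: differentiable_has_derivative_ddir smooth_differentiable)

lemma bounded_linear_ddir: "smooth f \<Longrightarrow> bounded_linear (\<lambda>v. ddir v f x)"
  by (rule has_derivative_bounded_linear, rule smooth_has_derivative)

lemmas linear_ddir = bounded_linear_ddir[THEN bounded_linear.linear]

lemma ddir_dir_add: "smooth f \<Longrightarrow> ddir (u + v) f x = ddir u f x + ddir v f x"
  using linear_add[OF linear_ddir] .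

lemma ddir_dir_scaleR: "smooth f \<Longrightarrow> ddir (c *\<^sub>R u) f x = c *\<^sub>R ddir u f x"
  using linear_cmul[OF linear_ddir] .

lemma ddir_dir_zero: "smooth f \<Longrightarrow> ddir 0 f x = 0"
  using linear_0[OF linear_ddir] .

lemma ddir_dir_sum: "smooth f \<Longrightarrow> ddir (\<Sum>i\<in>I. g i) f x = (\<Sum>i\<in>I. ddir (g i) f x)"
  using linear_sum[OF linear_ddir] .

lemma ddir_euclidean:
  fixes f :: "'a::euclidean_space \<Rightarrow> 'b::real_normed_vector"
  assumes "f differentiable (at x)"
  shows "ddir v f x = (\<Sum>b\<in>Basis. (v \<bullet> b) *\<^sub>R ddir b f x)"
proof -
  have l: "linear (\<lambda>v. ddir v f x)"
    using differentiable_has_derivative_ddir[OF assms, where S=UNIV] has_derivative_linear by auto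
  have "ddir v f x = ddir (\<Sum>b\<in>Basis. (v \<bullet> b) *\<^sub>R b) f x"
    by (simp add: euclidean_representation)
  also have "\<dots> = (\<Sum>b\<in>Basis. (v \<bullet> b) *\<^sub>R ddir b f x)"
    by (simp only: linear_sum[OF l] linear_cmul[OF l])
  finally show ?thesis .
qed

lemma has_vector_derivative_line:
  assumes "smooth f"
  shows "((\<lambda>s. f (p + s *\<^sub>R v)) has_vector_derivative ddir v f (p + t *\<^sub>R v)) (at t within S)"
proof -
  have "((\<lambda>s. f (p + s *\<^sub>R v)) has_derivative (\<lambda>h. ddir (h *\<^sub>R v) f (p + t *\<^sub>R v))) (at t within S)"
    by (rule has_derivative_compose[OF _ smooth_has_derivative[OF assms]])
      (auto intro!: derivative_eq_intros)
  then show ?thesis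
    by (simp add: has_vector_derivative_def ddir_dir_scaleR[OF assms])
qed

lemma ddir_cong_open:
  assumes "open U" "x \<in> U" "\<And>y. y \<in> U \<Longrightarrow> f y = g y" "smooth g"
  shows "ddir v f x = ddir v g x"
  by (rule ddir_eqI, rule has_derivative_transform_within_open[OF smooth_has_derivative[OF assms(4), where S=UNIV] assms(1,2)])
    (use assms(3) in auto)

section \<open>Rules of differentiation, each for \<open>Ck\<close> first and then for
  \<open>smooth\<close>\<close>

lemma ddir_const [simp]: "ddir v (\<lambda>x. c) = (\<lambda>x. 0)"
  by (rule ext, rule ddir_eqI) auto

lemma Ck_const [simp]: "Ck n (\<lambda>x. c)"
  by (induction n arbitrary: c) auto

lemma smooth_const [simp]: "smooth (\<lambda>x. c)"
  by (simp add: smooth_def)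

lemma ddir_bounded_linear: "bounded_linear L \<Longrightarrow> ddir v L = (\<lambda>x. L v)"
  by (rule ext, rule ddir_eqI) (rule bounded_linear_imp_has_derivative)

lemma smooth_bounded_linear: "bounded_linear L \<Longrightarrow> smooth L"
  using smooth_iff[of L]
  by (auto simp: ddir_bounded_linear bounded_linear_imp_differentiable)

lemma ddir_add_at:
  assumes "f differentiable (at x)" "g differentiable (at x)"
  shows "ddir v (\<lambda>x. f x + g x) x = ddir v f x + ddir v g x"
  by (rule ddir_eqI)
    (intro has_derivative_add differentiable_has_derivative_ddir assms)

lemma Ck_add: "Ck n f \<Longrightarrow> Ck n g \<Longrightarrow> Ck n (\<lambda>x. f x + g x)"
proof (induction n arbitrary: f g)
  case 0
  then show ?case by (auto intro: continuous_on_add)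
next
  case (Suc n)
  have "ddir v (\<lambda>x. f x + g x) = (\<lambda>x. ddir v f x + ddir v g x)" for v
    by (rule ext, rule ddir_add_at) (use Suc.prems in auto)
  then show ?case using Suc by auto
qed

lemma smooth_add [intro]: "smooth f \<Longrightarrow> smooth g \<Longrightarrow> smooth (\<lambda>x. f x + g x)"
  by (simp add: smooth_def Ck_add)

lemma ddir_add:
  "smooth f \<Longrightarrow> smooth g \<Longrightarrow> ddir v (\<lambda>x. f x + g x) = (\<lambda>x. ddir v f x + ddir v g x)"
  by (rule ext, rule ddir_add_at) (auto intro: smooth_differentiable)

context bounded_bilinear
begin

text \<open>Proved once for bounded bilinear maps, to cover real scaling, complex multiplication and
  complex scaling of vectors at the same time.\<close>

lemma ddir_prod_at:
  assumes "f differentiable (at x)" "g differentiable (at x)"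
  shows "ddir v (\<lambda>x. prod (f x) (g x)) x = prod (f x) (ddir v g x) + prod (ddir v f x) (g x)"
  by (rule ddir_eqI) (intro FDERIV differentiable_has_derivative_ddir assms)

lemma Ck_prod: "Ck n f \<Longrightarrow> Ck n g \<Longrightarrow> Ck n (\<lambda>x. prod (f x) (g x))"
proof (induction n arbitrary: f g)
  case 0
  then show ?case by (auto intro: continuous_on)
next
  case (Suc n)
  have "ddir v (\<lambda>x. prod (f x) (g x)) = (\<lambda>x. prod (f x) (ddir v g x) + prod (ddir v f x) (g x))" for v
    by (rule ext, rule ddir_prod_at) (use Suc.prems in auto)
  moreover have "(\<lambda>x. prod (f x) (g x)) differentiable (at x)" for x
    using FDERIV[of f _ x UNIV g] Suc.prems unfolding differentiable_def Ck.simps by blast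
  ultimately show ?case
    using Suc.IH Suc.prems Ck_SucD[OF Suc.prems(1)] Ck_SucD[OF Suc.prems(2)] by (auto intro!: Ck_add)
qed

lemma smooth_prod: "smooth f \<Longrightarrow> smooth g \<Longrightarrow> smooth (\<lambda>x. prod (f x) (g x))"
  by (simp add: smooth_def Ck_prod)

lemma ddir_prod:
  "smooth f \<Longrightarrow> smooth g \<Longrightarrow>
     ddir v (\<lambda>x. prod (f x) (g x)) = (\<lambda>x. prod (f x) (ddir v g x) + prod (ddir v f x) (g x))"
  by (rule ext, rule ddir_prod_at) (auto intro: smooth_differentiable)

end

context bounded_linear
begin

lemma ddir_image_at:
  assumes "g differentiable (at x)"
  shows "ddir v (\<lambda>x. f (g x)) x = f (ddir v g x)"
  by (rule ddir_eqI) (rule has_derivative[OF differentiable_has_derivative_ddir[OF assms]])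

lemma Ck_image: "Ck n g \<Longrightarrow> Ck n (\<lambda>x. f (g x))"
proof (induction n arbitrary: g)
  case 0
  then show ?case by (auto intro: continuous_on)
next
  case (Suc n)
  have "ddir v (\<lambda>x. f (g x)) = (\<lambda>x. f (ddir v g x))" for v
    by (rule ext, rule ddir_image_at) (use Suc.prems in auto)
  moreover have "(\<lambda>x. f (g x)) differentiable (at x)" for x
    using has_derivative[of g _ "at x"] Suc.prems unfolding differentiable_def Ck.simps by blast
  ultimately show ?case using Suc by auto
qed

lemma smooth_image: "smooth g \<Longrightarrow> smooth (\<lambda>x. f (g x))"
  by (simp add: smooth_def Ck_image)

lemma ddir_image: "smooth g \<Longrightarrow> ddir v (\<lambda>x. f (g x)) = (\<lambda>x. f (ddir v g x))"
  by (rule ext, rule ddir_image_at) (auto intro: smooth_differentiable)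

end

lemma Ck_sum: "(\<And>i. i \<in> I \<Longrightarrow> Ck n (f i)) \<Longrightarrow> Ck n (\<lambda>x. \<Sum>i\<in>I. f i x)"
  by (induction I rule: infinite_finite_induct) (auto intro: Ck_add)

lemma smooth_sum [intro]: "(\<And>i. i \<in> I \<Longrightarrow> smooth (f i)) \<Longrightarrow> smooth (\<lambda>x. \<Sum>i\<in>I. f i x)"
  by (simp add: smooth_def Ck_sum)

lemma ddir_sum:
  assumes "\<And>i. i \<in> I \<Longrightarrow> smooth (f i)"
  shows "ddir v (\<lambda>x. \<Sum>i\<in>I. f i x) = (\<lambda>x. \<Sum>i\<in>I. ddir v (f i) x)"
  by (rule ext, rule ddir_eqI)
    (auto intro!: has_derivative_sum smooth_has_derivative assms)

lemma ddir_compose_at: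
  fixes f :: "'b::euclidean_space \<Rightarrow> 'c::real_normed_vector"
  assumes "f differentiable (at (g x))" "g differentiable (at x)"
  shows "ddir v (\<lambda>x. f (g x)) x = ddir (ddir v g x) f (g x)"
  by (rule ddir_eqI, rule has_derivative_compose[OF differentiable_has_derivative_ddir[OF assms(2)]])
    (rule differentiable_has_derivative_ddir[OF assms(1)])

text \<open>The derivative of the composite is expanded over \<open>Basis\<close> and becomes a
  finite sum of products of \<open>Ck n\<close> functions; this is why the middle space is
  Euclidean. In the induction \<open>f\<close> is replaced by its derivatives while \<open>g\<close>
  stays.\<close>

lemma Ck_compose:
  fixes f :: "'b::euclidean_space \<Rightarrow> 'c::real_normed_vector"
  shows "Ck n f \<Longrightarrow> Ck n g \<Longrightarrow> Ck n (\<lambda>x. f (g x))"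
proof (induction n arbitrary: f)
  case 0
  then show ?case by (auto intro: continuous_on_compose2)
next
  case (Suc n)
  have "ddir v (\<lambda>x. f (g x)) = (\<lambda>x. \<Sum>b\<in>Basis. (ddir v g x \<bullet> b) *\<^sub>R ddir b f (g x))" for v
  proof
    fix x
    have "ddir v (\<lambda>x. f (g x)) x = ddir (ddir v g x) f (g x)"
      by (rule ddir_compose_at) (use Suc.prems in auto)
    then show "ddir v (\<lambda>x. f (g x)) x = (\<Sum>b\<in>Basis. (ddir v g x \<bullet> b) *\<^sub>R ddir b f (g x))"
      using Suc.prems by (subst ddir_euclidean[symmetric]) auto
  qed
  moreover have "(\<lambda>x. f (g x)) differentiable (at x)" for x
    using Suc.prems differentiable_compose[of f g x UNIV] by auto
  moreover have "Ck n (\<lambda>x. \<Sum>b\<in>Basis. (ddir v g x \<bullet> b) *\<^sub>R ddir b f (g x))" for v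
    using Suc.prems
    by (intro Ck_sum bounded_bilinear.Ck_prod[OF bounded_bilinear_scaleR]
        bounded_linear.Ck_image[OF bounded_linear_inner_left] Suc.IH)
      (auto intro: Ck_SucD[OF Suc.prems(2)])
  ultimately show ?case by simp
qed

lemma smooth_compose:
  fixes f :: "'b::euclidean_space \<Rightarrow> 'c::real_normed_vector"
  shows "smooth f \<Longrightarrow> smooth g \<Longrightarrow> smooth (\<lambda>x. f (g x))"
  by (simp add: smooth_def Ck_compose)

lemma ddir_compose:
  fixes f :: "'b::euclidean_space \<Rightarrow> 'c::real_normed_vector"
  shows "smooth f \<Longrightarrow> smooth g \<Longrightarrow> ddir v (\<lambda>x. f (g x)) x = ddir (ddir v g x) f (g x)"
  by (rule ddir_compose_at) (auto intro: smooth_differentiable)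

lemma ddir_exp:
  fixes f :: "'a::real_normed_vector \<Rightarrow> complex"
  assumes "f differentiable (at x)"
  shows "ddir v (\<lambda>x. exp (f x)) x = exp (f x) * ddir v f x"
proof (rule ddir_eqI)
  have "(exp has_derivative (*) (exp (f x))) (at (f x))"
    using DERIV_exp has_field_derivative_def by blast
  then show "((\<lambda>x. exp (f x)) has_derivative (\<lambda>v. exp (f x) * ddir v f x)) (at x)"
    by (rule has_derivative_compose[OF differentiable_has_derivative_ddir[OF assms]])
qed

lemma Ck_exp:
  fixes f :: "'a::real_normed_vector \<Rightarrow> complex"
  shows "Ck n f \<Longrightarrow> Ck n (\<lambda>x. exp (f x))"
proof (induction n)
  case 0
  then show ?case by (auto intro: continuous_on_exp)
next
  case (Suc n)
  have "ddir v (\<lambda>x. exp (f x)) = (\<lambda>x. exp (f x) * ddir v f x)" for v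
    by (rule ext, rule ddir_exp) (use Suc.prems in auto)
  moreover have "(\<lambda>x. exp (f x)) differentiable (at x)" for x
    using Suc.prems differentiable_compose[of exp f x UNIV]
    by (auto simp: field_differentiable_imp_differentiable field_differentiable_within_exp)
  ultimately show ?case
    using Suc Ck_SucD[OF Suc.prems] by (auto intro!: bounded_bilinear.Ck_prod[OF bounded_bilinear_mult])
qed

lemma smooth_exp: "smooth f \<Longrightarrow> smooth (\<lambda>x. exp (f x :: complex))"
  by (simp add: smooth_def Ck_exp)

lemma norm_vector_smult: "norm (c *s (v::complex^'n)) = norm c * norm v"
proof -
  have "norm (c *s v) = L2_set (\<lambda>i. norm c * norm (v $ i)) UNIV"
    by (simp add: norm_vec_def norm_mult)
  then show ?thesis by (simp add: L2_set_right_distrib norm_vec_def)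
qed

lemma bounded_bilinear_vector_smult:
  "bounded_bilinear (\<lambda>(c::complex) (v::complex^'n). c *s v)"
proof
  fix a b :: complex and u v :: "complex^'n" and r :: real
  show "(a + b) *s v = a *s v + b *s v" by (simp add: vector_sadd_rdistrib)
  show "a *s (u + v) = a *s u + a *s v" by (simp add: vector_add_ldistrib)
  show "(r *\<^sub>R a) *s v = r *\<^sub>R (a *s v)" by (simp add: vec_eq_iff)
  show "a *s (r *\<^sub>R v) = r *\<^sub>R (a *s v)" by (simp add: vec_eq_iff)
next
  show "\<exists>K. \<forall>a (b::complex^'n). norm (a *s b) \<le> norm a * norm b * K"
    by (intro exI[of _ 1]) (simp add: norm_vector_smult)
qed

lemmas smooth_smult = bounded_bilinear.smooth_prod[OF bounded_bilinear_vector_smult]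
lemmas ddir_smult = bounded_bilinear.ddir_prod[OF bounded_bilinear_vector_smult]
lemmas smooth_scaleR = bounded_bilinear.smooth_prod[OF bounded_bilinear_scaleR]
lemmas ddir_scaleR = bounded_bilinear.ddir_prod[OF bounded_bilinear_scaleR]
lemmas smooth_mult = bounded_bilinear.smooth_prod[OF bounded_bilinear_mult]
lemmas ddir_mult = bounded_bilinear.ddir_prod[OF bounded_bilinear_mult]

lemma smooth_matrix_vector:
  fixes A :: "complex^'n^'m"
  shows "smooth f \<Longrightarrow> smooth (\<lambda>x. A *v f x)"
  by (rule bounded_linear.smooth_image[OF matrix_vector_mul_bounded_linear])

lemma ddir_matrix_vector:
  fixes A :: "complex^'n^'m"
  shows "smooth f \<Longrightarrow> ddir v (\<lambda>x. A *v f x) = (\<lambda>x. A *v ddir v f x)"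
  by (rule bounded_linear.ddir_image[OF matrix_vector_mul_bounded_linear])

lemma smooth_scaleR_const: "smooth f \<Longrightarrow> smooth (\<lambda>x. c *\<^sub>R f x)"
  by (rule smooth_scaleR) auto

lemma ddir_scaleR_const: "smooth f \<Longrightarrow> ddir v (\<lambda>x. c *\<^sub>R f x) = (\<lambda>x. c *\<^sub>R ddir v f x)"
  by (simp add: ddir_scaleR)

lemma smooth_smult_const: "smooth f \<Longrightarrow> smooth (\<lambda>x. c *s (f x :: complex^'n))"
  by (rule smooth_smult) auto

lemma ddir_smult_const: "smooth f \<Longrightarrow> ddir v (\<lambda>x. c *s (f x :: complex^'n)) = (\<lambda>x. c *s ddir v f x)"
  by (simp add: ddir_smult)

lemma smooth_uminus: "smooth f \<Longrightarrow> smooth (\<lambda>x. - f x)"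
  using smooth_scaleR_const[of f "-1"] by simp

lemma ddir_uminus: "smooth f \<Longrightarrow> ddir v (\<lambda>x. - f x) = (\<lambda>x. - ddir v f x)"
  using ddir_scaleR_const[of f v "-1"] by simp

lemma smooth_diff: "smooth f \<Longrightarrow> smooth g \<Longrightarrow> smooth (\<lambda>x. f x - g x)"
  using smooth_add[of f "\<lambda>x. - g x"] smooth_uminus[of g] by simp

lemma ddir_diff:
  "smooth f \<Longrightarrow> smooth g \<Longrightarrow> ddir v (\<lambda>x. f x - g x) = (\<lambda>x. ddir v f x - ddir v g x)"
  using ddir_add[of f "\<lambda>x. - g x" v] ddir_uminus[of g] smooth_uminus[of g] by simp

lemma bounded_linear_coord: "bounded_linear (\<lambda>p::spacetime. snd p $ l)"
  using bounded_linear_compose[OF bounded_linear_vec_nth bounded_linear_snd] .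

lemma smooth_fst: "smooth f \<Longrightarrow> smooth (\<lambda>x. fst (f x))"
  by (rule bounded_linear.smooth_image[OF bounded_linear_fst])

lemma smooth_snd: "smooth f \<Longrightarrow> smooth (\<lambda>x. snd (f x))"
  by (rule bounded_linear.smooth_image[OF bounded_linear_snd])

lemma smooth_id: "smooth (\<lambda>x. x)"
  by (rule smooth_bounded_linear) (rule bounded_linear_ident)

lemma smooth_Pair:
  assumes "smooth f" "smooth g"
  shows "smooth (\<lambda>x. (f x, g x))"
proof -
  have "smooth (\<lambda>x. (f x, 0) + (0, g x))"
    by (intro smooth_add bounded_linear.smooth_image[OF bounded_linear_Pair] assms)
      (auto intro: bounded_linear.smooth_image[OF _ assms(1)] bounded_linear.smooth_image[OF _ assms(2)]
        bounded_linear_Pair bounded_linear_ident bounded_linear_zero)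
  then show ?thesis by simp
qed

lemmas smooth_intros = smooth_const smooth_id smooth_add smooth_diff smooth_uminus smooth_sum
  smooth_ddir smooth_ddir_funpow smooth_smult smooth_scaleR smooth_mult smooth_matrix_vector
  smooth_exp smooth_fst smooth_snd smooth_Pair

text \<open>\<open>leibniz_rule\<close> asks for a continuous family of bounded linear maps. In
  finite dimension its continuity can be tested on basis vectors, where it is that of a directional
  derivative of \<open>F\<close>.\<close>

lemma has_derivative_parameter_integral:
  fixes F :: "'a::euclidean_space \<times> real \<Rightarrow> 'b::banach"
  assumes F: "smooth F"
  shows "((\<lambda>p. integral {0..1} (\<lambda>s. F (p, s))) has_derivative
           (\<lambda>v. integral {0..1} (\<lambda>s. ddir (v, 0) F (p, s)))) (at p)"
proof -
  define D where "D p s = Blinfun (\<lambda>v. ddir (v, 0) F (p, s))" for p s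
  have bl: "bounded_linear (\<lambda>v. ddir (v, 0) F (p, s))" for p s
    by (rule bounded_linear_compose[OF bounded_linear_ddir[OF F]])
      (auto intro: bounded_linear_Pair bounded_linear_ident bounded_linear_zero)
  have D: "blinfun_apply (D p s) = (\<lambda>v. ddir (v, 0) F (p, s))" for p s
    by (simp add: D_def bounded_linear_Blinfun_apply[OF bl])
  have cD: "continuous_on UNIV (\<lambda>(p, s). D p s)"
  proof (rule continuous_on_blinfun_componentwise)
    fix i :: 'a
    have eq: "(\<lambda>x. blinfun_apply (case x of (p, s) \<Rightarrow> D p s) i) = ddir (i, 0) F"
      by (auto simp: D)
    show "continuous_on UNIV (\<lambda>x. blinfun_apply (case x of (p, s) \<Rightarrow> D p s) i)"
      unfolding eq by (rule smooth_imp_continuous[OF smooth_ddir[OF F]])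
  qed
  have hd: "((\<lambda>p. F (p, s)) has_derivative blinfun_apply (D p s)) (at p)" for p s
    unfolding D
    by (rule has_derivative_compose[OF _ smooth_has_derivative[OF F]])
      (auto intro!: derivative_eq_intros)
  have cF: "continuous_on {0..1} (\<lambda>s. F (p, s))" for p
    by (rule continuous_on_compose2[OF smooth_imp_continuous[OF F, where S=UNIV]])
      (auto intro!: continuous_intros)
  have "((\<lambda>p. integral (cbox 0 1) (\<lambda>s. F (p, s))) has_derivative integral (cbox 0 1) (D p)) (at p within UNIV)"
    by (rule leibniz_rule)
      (use hd cF in \<open>auto intro!: integrable_continuous_real continuous_on_subset[OF cD]\<close>)
  moreover have "blinfun_apply (integral (cbox 0 1) (D p)) = (\<lambda>v. integral {0..1} (\<lambda>s. ddir (v, 0) F (p, s)))"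
  proof
    fix v
    have "continuous_on {0..1} (D p)"
      using continuous_on_compose2[OF cD, of "{0..1}" "\<lambda>s. (p, s)"]
      by (simp add: continuous_on_Pair continuous_on_const continuous_on_id)
    then have "D p integrable_on {0..1}" by (rule integrable_continuous_real)
    then have "integral {0..1} ((\<lambda>f. blinfun_apply f v) \<circ> D p) = blinfun_apply (integral {0..1} (D p)) v"
      by (rule integral_linear) (rule blinfun.bounded_linear_left)
    then show "blinfun_apply (integral (cbox 0 1) (D p)) v = integral {0..1} (\<lambda>s. ddir (v, 0) F (p, s))"
      by (simp add: o_def D)
  qed
  ultimately show ?thesis by (simp add: cbox_interval)
qed

text \<open>A derivative of the integral is again such an integral, with
  \<open>ddir (v, 0) F\<close> in place of \<open>F\<close>, so the induction closes.\<close>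

lemma Ck_parameter_integral:
  fixes F :: "'a::euclidean_space \<times> real \<Rightarrow> 'b::banach"
  shows "smooth F \<Longrightarrow> Ck n (\<lambda>p. integral {0..1} (\<lambda>s. F (p, s)))"
proof (induction n arbitrary: F)
  case 0
  then show ?case
    by (auto intro!: continuous_at_imp_continuous_on has_derivative_continuous[OF has_derivative_parameter_integral])
next
  case (Suc n)
  have "ddir v (\<lambda>p. integral {0..1} (\<lambda>s. F (p, s))) = (\<lambda>p. integral {0..1} (\<lambda>s. ddir (v, 0) F (p, s)))" for v
    by (rule ext, rule ddir_eqI, rule has_derivative_parameter_integral[OF Suc.prems])
  then show ?case
    using has_derivative_parameter_integral[OF Suc.prems] Suc.IH[OF smooth_ddir[OF Suc.prems]]
    unfolding Ck.simps differentiable_def by metis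
qed

lemma smooth_parameter_integral:
  fixes F :: "'a::euclidean_space \<times> real \<Rightarrow> 'b::banach"
  shows "smooth F \<Longrightarrow> smooth (\<lambda>p. integral {0..1} (\<lambda>s. F (p, s)))"
  by (simp add: smooth_def[of "\<lambda>p. integral {0..1} (\<lambda>s. F (p, s))"] Ck_parameter_integral)

lemma ddir_parameter_integral:
  fixes F :: "'a::euclidean_space \<times> real \<Rightarrow> 'b::banach"
  shows "smooth F \<Longrightarrow> ddir v (\<lambda>p. integral {0..1} (\<lambda>s. F (p, s))) p
    = integral {0..1} (\<lambda>s. ddir (v, 0) F (p, s))"
  by (rule ddir_eqI, rule has_derivative_parameter_integral)

lemma smooth_line_increment:
  fixes f :: "'a::euclidean_space \<Rightarrow> 'b::banach"
  assumes "smooth f"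
  shows "integral {0..1} (\<lambda>s. ddir v f (p + s *\<^sub>R v)) = f (p + v) - f p"
proof -
  have "((\<lambda>s. ddir v f (p + s *\<^sub>R v)) has_integral f (p + 1 *\<^sub>R v) - f (p + 0 *\<^sub>R v)) {0..1}"
    by (rule fundamental_theorem_of_calculus) (auto intro: has_vector_derivative_line[OF assms])
  then show ?thesis by (simp add: integral_unique)
qed

text \<open>Differentiating \<open>f (x + t v) - f x = t \<integral> \<partial>\<^sub>v f (x + s t v) ds\<close> in the direction \<open>u\<close>, and
  then in \<open>t\<close> at \<open>0\<close>, gives the symmetry of second derivatives.\<close>

lemma ddir_commute:
  fixes f :: "'a::euclidean_space \<Rightarrow> 'b::banach"
  assumes f: "smooth f"
  shows "ddir u (ddir v f) = ddir v (ddir u f)"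
proof
  fix x
  define G where "G = (\<lambda>q :: (real \<times> 'a) \<times> real. ddir v f (snd (fst q) + (snd q * fst (fst q)) *\<^sub>R v))"
  have sm: "smooth (\<lambda>q :: (real \<times> 'a) \<times> real. snd (fst q) + (snd q * fst (fst q)) *\<^sub>R v)"
    by (intro smooth_intros)
  have G: "smooth G"
    unfolding G_def by (rule smooth_compose[OF smooth_ddir[OF f] sm])
  have inc: "f (y + t *\<^sub>R v) = f y + t *\<^sub>R integral {0..1} (\<lambda>s. G ((t, y), s))" for t y
    using smooth_line_increment[OF f, of "t *\<^sub>R v" y]
    by (simp add: G_def ddir_dir_scaleR[OF f] mult.commute)
  define J where "J = (\<lambda>q. integral {0..1} (\<lambda>s. G (q, s)))"
  have J: "smooth J" unfolding J_def by (rule smooth_parameter_integral[OF G])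
  have dG: "ddir ((0, u), 0) G q = ddir u (ddir v f) (snd (fst q) + (snd q * fst (fst q)) *\<^sub>R v)" for q
  proof -
    have "((\<lambda>q :: (real \<times> 'a) \<times> real. snd (fst q) + (snd q * fst (fst q)) *\<^sub>R v) has_derivative
      (\<lambda>h. snd (fst h) + (snd q * fst (fst h) + snd h * fst (fst q)) *\<^sub>R v)) (at q)"
      by (auto intro!: derivative_eq_intros simp: algebra_simps)
    from ddir_eqI[OF this, of "((0, u), 0)"] show ?thesis
      unfolding G_def by (subst ddir_compose[OF smooth_ddir[OF f] sm]) simp
  qed
  have du: "ddir u f (x + t *\<^sub>R v) = ddir u f x + t *\<^sub>R ddir (0, u) J (t, x)" for t
  proof -
    have 1: "ddir u (\<lambda>y. f (y + t *\<^sub>R v)) x = ddir u f (x + t *\<^sub>R v)"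
    proof -
      have "ddir u (\<lambda>y. y + t *\<^sub>R v) x = u"
        by (rule ddir_eqI) (auto intro!: derivative_eq_intros)
      then show ?thesis by (subst ddir_compose[OF f]) (auto intro!: smooth_intros)
    qed
    have "ddir u (\<lambda>y. (t, y)) x = (0, u)"
      by (rule ddir_eqI) (auto intro!: derivative_eq_intros)
    then have 2: "ddir u (\<lambda>y. J (t, y)) x = ddir (0, u) J (t, x)"
      by (subst ddir_compose[OF J]) (auto intro!: smooth_intros)
    have Jt: "smooth (\<lambda>y. J (t, y))"
      by (rule smooth_compose[OF J]) (auto intro!: smooth_intros)
    have "(\<lambda>y. f (y + t *\<^sub>R v)) = (\<lambda>y. f y + t *\<^sub>R J (t, y))"
      using inc by (simp add: J_def)
    then have "ddir u (\<lambda>y. f (y + t *\<^sub>R v)) x = ddir u (\<lambda>y. f y + t *\<^sub>R J (t, y)) x"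
      by simp
    then show ?thesis
      using Jt f by (simp add: 1 2 ddir_add ddir_scaleR_const smooth_scaleR_const)
  qed
  have "((\<lambda>t. ddir u f (x + t *\<^sub>R v)) has_vector_derivative ddir v (ddir u f) (x + 0 *\<^sub>R v)) (at 0)"
    by (rule has_vector_derivative_line) (rule smooth_ddir[OF f])
  \<comment> \<open>The derivative of \<open>t *\<^sub>R h t\<close> at \<open>0\<close> is
    \<open>h 0\<close>, so no derivative of the second factor enters.\<close>
  moreover have "((\<lambda>t. ddir u f x + t *\<^sub>R ddir (0, u) J (t, x)) has_vector_derivative ddir (0, u) J (0, x)) (at 0)"
  proof -
    have "smooth (\<lambda>t. ddir (0, u) J (t, x))"
      by (rule smooth_compose[OF smooth_ddir[OF J]]) (auto intro!: smooth_intros)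
    from smooth_has_derivative[OF this] show ?thesis
      by (auto simp: has_vector_derivative_def intro!: derivative_eq_intros)
  qed
  ultimately have "ddir v (ddir u f) x = ddir (0, u) J (0, x)"
    unfolding du by (simp add: vector_derivative_unique_at)
  also have "\<dots> = ddir u (ddir v f) x"
    unfolding J_def ddir_parameter_integral[OF G] dG by simp
  finally show "ddir u (ddir v f) x = ddir v (ddir u f) x" by simp
qed

lemma ddir_funpow_commute:
  fixes f :: "'a::euclidean_space \<Rightarrow> 'b::banach"
  shows "smooth f \<Longrightarrow> ddir u ((ddir v ^^ n) f) = (ddir v ^^ n) (ddir u f)"
proof (induction n)
  case (Suc n)
  have "ddir u ((ddir v ^^ Suc n) f) = ddir v (ddir u ((ddir v ^^ n) f))"
    using ddir_commute[OF smooth_ddir_funpow[OF Suc.prems], of u v n v] by simp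
  then show ?case using Suc by simp
qed simp

text \<open>Here \<open>u p = \<integral> f (p - r w) dr\<close> over \<open>0 \<le> r \<le> l p\<close>, written as an integral over a fixed
  interval.\<close>

lemma smooth_directional_primitive:
  fixes f :: "'a::euclidean_space \<Rightarrow> 'b::banach"
  assumes f: "smooth f" and l: "bounded_linear l" and lw: "l w = (1::real)"
  obtains u where "smooth u" "ddir w u = f"
    "\<And>p. (\<forall>s\<in>{0..1}. f (p - (s * l p) *\<^sub>R w) = 0) \<Longrightarrow> u p = 0" "\<And>p. l p = 0 \<Longrightarrow> u p = 0"
proof -
  \<comment> \<open>\<open>m (p, s)\<close> runs from the foot of \<open>p\<close> on the hyperplane
    \<open>l = 0\<close> at \<open>s = 0\<close> to \<open>p\<close> at \<open>s = 1\<close>, so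
    that the domain of integration does not depend on \<open>p\<close>.\<close>
  define m where "m = (\<lambda>q :: 'a \<times> real. fst q - ((1 - snd q) * l (fst q)) *\<^sub>R w)"
  have sl: "smooth l" by (rule smooth_bounded_linear[OF l])
  have m: "smooth m" unfolding m_def by (intro smooth_intros smooth_compose[OF sl])
  have dm: "(m has_derivative (\<lambda>h. fst h - ((1 - snd q) * l (fst h) + (- snd h) * l (fst q)) *\<^sub>R w)) (at q)" for q
    unfolding m_def
    by (auto intro!: derivative_eq_intros bounded_linear.has_derivative[OF l])
  define F where "F = (\<lambda>q. f (m q))"
  have F: "smooth F" unfolding F_def by (rule smooth_compose[OF f m])
  have F1: "ddir (w, 0) F (p, s) = s *\<^sub>R ddir w f (m (p, s))" for p s
  proof -
    have "ddir (w, 0) m (p, s) = s *\<^sub>R w"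
      using ddir_eqI[OF dm, of "(w, 0)" "(p, s)"] lw by (simp add: algebra_simps)
    then show ?thesis
      unfolding F_def by (simp add: ddir_compose[OF f m] ddir_dir_scaleR[OF f])
  qed
  have F2: "ddir (0, 1) F (p, s) = l p *\<^sub>R ddir w f (m (p, s))" for p s
  proof -
    have "ddir (0, 1) m (p, s) = l p *\<^sub>R w"
      using ddir_eqI[OF dm, of "(0, 1)" "(p, s)"] linear_0[OF bounded_linear.linear[OF l]] by (simp add: algebra_simps)
    then show ?thesis
      unfolding F_def by (simp add: ddir_compose[OF f m] ddir_dir_scaleR[OF f])
  qed
  define I where "I = (\<lambda>p. integral {0..1} (\<lambda>s. F (p, s)))"
  have I: "smooth I" unfolding I_def by (rule smooth_parameter_integral[OF F])
  define u where "u = (\<lambda>p. l p *\<^sub>R I p)"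
  have u: "smooth u" unfolding u_def by (intro smooth_scaleR sl I)
  have "ddir w u p = f p" for p
  proof -
    have "((\<lambda>s. F (p, s)) has_vector_derivative l p *\<^sub>R ddir w f (m (p, s))) (at s within {0..1})" for s
      using has_vector_derivative_line[OF F, of "(p, 0)" "(0, 1)" s "{0..1}"] by (simp add: F2)
    note d = this
    \<comment> \<open>By \<open>F1\<close> and \<open>F2\<close> the integrand of the derivative of
      \<open>u\<close> along \<open>w\<close> is the derivative of
      \<open>s *\<^sub>R F (p, s)\<close> in \<open>s\<close>; only the endpoint
      \<open>s = 1\<close>, where \<open>F\<close> is \<open>f p\<close>, contributes.\<close>
    have "((\<lambda>s. s *\<^sub>R F (p, s)) has_vector_derivative s *\<^sub>R (l p *\<^sub>R ddir w f (m (p, s))) + 1 *\<^sub>R F (p, s))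
        (at s within {0..1})" for s
      by (rule has_vector_derivative_scaleR[OF _ d]) (auto intro!: derivative_eq_intros)
    then have "((\<lambda>s. s *\<^sub>R (l p *\<^sub>R ddir w f (m (p, s))) + 1 *\<^sub>R F (p, s)) has_integral
        1 *\<^sub>R F (p, 1) - 0 *\<^sub>R F (p, 0)) {0..1}"
      by (intro fundamental_theorem_of_calculus) auto
    from integral_unique[OF this]
    have "f p = integral {0..1} (\<lambda>s. s *\<^sub>R (l p *\<^sub>R ddir w f (m (p, s))) + F (p, s))"
      by (simp add: F_def m_def)
    also have "\<dots> = integral {0..1} (\<lambda>s. l p *\<^sub>R ddir (w, 0) F (p, s) + F (p, s))"
      by (simp add: F1 mult.commute)
    also have "\<dots> = integral {0..1} (\<lambda>s. l p *\<^sub>R ddir (w, 0) F (p, s)) + integral {0..1} (\<lambda>s. F (p, s))"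
      by (intro integral_add integrable_continuous_real continuous_intros
          continuous_on_compose2[OF smooth_imp_continuous[OF F, where S=UNIV]]
          continuous_on_compose2[OF smooth_imp_continuous[OF smooth_ddir[OF F], where S=UNIV]]) auto
    also have "\<dots> = l p *\<^sub>R ddir w I p + I p"
      unfolding I_def by (simp add: ddir_parameter_integral[OF F])
    also have "\<dots> = ddir w u p"
      unfolding u_def by (simp add: ddir_scaleR[OF sl I] ddir_bounded_linear[OF l] lw)
    finally show ?thesis ..
  qed
  then have dw: "ddir w u = f" by auto
  have "u p = 0" if 0: "\<forall>s\<in>{0..1}. f (p - (s * l p) *\<^sub>R w) = 0" for p
  proof -
    have "F (p, s) = 0" if "s \<in> {0..1}" for s
      using bspec[OF 0, of "1 - s"] that by (simp add: F_def m_def)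
    then have "I p = integral {0..1} (\<lambda>s::real. 0 :: 'b)"
      unfolding I_def by (intro Henstock_Kurzweil_Integration.integral_cong) auto
    then show ?thesis by (simp add: u_def)
  qed
  then show ?thesis using that[OF u dw] by (simp add: u_def)
qed

section \<open>Taylor expansions at \<open>\<epsilon> = 0\<close>\<close>

abbreviation taylor :: "nat \<Rightarrow> (real \<times> 'a \<Rightarrow> 'b) \<Rightarrow> 'a::real_normed_vector \<Rightarrow> 'b::real_normed_vector"
  where "taylor j g p \<equiv> (1 / fact j) *\<^sub>R (ddir (1, 0) ^^ j) g (0, p)"

text \<open>The \<epsilon>-derivative of the remainder is the remainder, one order lower, of
  \<open>ddir (1, 0) g\<close>; the mean value inequality between 0 and \<epsilon> supplies the
  additional factor \<epsilon>. Nonnegativity of \<open>B\<close> is what makes the bound monotone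
  in \<epsilon>.\<close>

lemma taylor_remainder:
  fixes g :: "real \<times> 'a::euclidean_space \<Rightarrow> 'b::banach"
  assumes K: "compact K"
  shows "smooth g \<Longrightarrow>
    \<exists>B\<ge>0. \<forall>\<epsilon>\<in>{0..1}. \<forall>p\<in>K. norm (g (\<epsilon>, p) - (\<Sum>j<n. \<epsilon> ^ j *\<^sub>R taylor j g p)) \<le> B * \<epsilon> ^ n"
proof (induction n arbitrary: g)
  case 0
  have "compact (g ` ({0..1} \<times> K))"
    by (intro compact_continuous_image smooth_imp_continuous 0 compact_Times K) auto
  from compact_imp_bounded[OF this] obtain B where "\<forall>x\<in>g ` ({0..1} \<times> K). norm x \<le> B"
    unfolding bounded_iff by blast
  then have "\<forall>\<epsilon>\<in>{0..1}. \<forall>p\<in>K. norm (g (\<epsilon>, p)) \<le> \<bar>B\<bar>"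
    by (meson SigmaI abs_ge_self image_eqI order_trans)
  then show ?case by (intro exI[of _ "\<bar>B\<bar>"]) auto
next
  case (Suc n)
  obtain B where B: "B \<ge> 0" "\<And>\<epsilon> p. \<epsilon>\<in>{0..1} \<Longrightarrow> p \<in> K \<Longrightarrow>
      norm (ddir (1, 0) g (\<epsilon>, p) - (\<Sum>j<n. \<epsilon> ^ j *\<^sub>R taylor j (ddir (1, 0) g) p)) \<le> B * \<epsilon> ^ n"
    using Suc.IH[OF smooth_ddir[OF Suc.prems]] by blast
  have "norm (g (\<epsilon>, p) - (\<Sum>j<Suc n. \<epsilon> ^ j *\<^sub>R taylor j g p)) \<le> B * \<epsilon> ^ Suc n"
    if \<epsilon>: "\<epsilon> \<in> {0..1}" and p: "p \<in> K" for \<epsilon> p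
  proof -
    define R where "R s = g (s, p) - (\<Sum>j<Suc n. s ^ j *\<^sub>R taylor j g p)" for s
    define R' where "R' s = ddir (1, 0) g (s, p) - (\<Sum>j<n. s ^ j *\<^sub>R taylor j (ddir (1, 0) g) p)" for s
    have dR: "(R has_vector_derivative R' s) (at s within {0..\<epsilon>})" for s
    proof -
      have 1: "((\<lambda>s. g (s, p)) has_vector_derivative ddir (1, 0) g (s, p)) (at s within {0..\<epsilon>})"
        using has_vector_derivative_line[OF Suc.prems, of "(0, p)" "(1, 0)" s "{0..\<epsilon>}"] by simp
      have 2: "((\<lambda>s. \<Sum>j<Suc n. s ^ j *\<^sub>R taylor j g p) has_vector_derivative
          (\<Sum>j<Suc n. (real j * s ^ (j - 1)) *\<^sub>R taylor j g p)) (at s within {0..\<epsilon>})"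
        by (intro has_vector_derivative_sum)
          (auto simp: has_vector_derivative_def intro!: derivative_eq_intros)
      have 3: "(\<Sum>j<Suc n. (real j * s ^ (j - 1)) *\<^sub>R taylor j g p)
          = (\<Sum>j<n. s ^ j *\<^sub>R taylor j (ddir (1, 0) g) p)"
      proof -
        have "(\<Sum>j<Suc n. (real j * s ^ (j - 1)) *\<^sub>R taylor j g p)
          = (\<Sum>j<n. (real (Suc j) * s ^ j) *\<^sub>R taylor (Suc j) g p)"
          by (subst sum.lessThan_Suc_shift) simp
        also have "\<dots> = (\<Sum>j<n. s ^ j *\<^sub>R taylor j (ddir (1, 0) g) p)"
          by (rule sum.cong) (auto simp: funpow_swap1 field_simps simp del: of_nat_Suc)
        finally show ?thesis .
      qed
      show ?thesis
        using has_vector_derivative_diff[OF 1 2] unfolding R_def R'_def 3 .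
    qed
    have "norm (R \<epsilon> - R 0) \<le> B * \<epsilon> ^ n * norm (\<epsilon> - 0)"
    proof (rule differentiable_bound[of "{0..\<epsilon>}" _ "\<lambda>s h. h *\<^sub>R R' s"])
      fix s assume s: "s \<in> {0..\<epsilon>}"
      have "norm (R' s) \<le> B * s ^ n"
        unfolding R'_def using B(2)[of s p] s \<epsilon> p by auto
      also have "\<dots> \<le> B * \<epsilon> ^ n"
        using s B(1) by (intro mult_left_mono power_mono) auto
      finally show "onorm (\<lambda>h. h *\<^sub>R R' s) \<le> B * \<epsilon> ^ n"
        by (intro onorm_le) (auto simp: mult.commute[of _ "\<bar>_\<bar>"] intro!: mult_left_mono)
    qed (use \<epsilon> dR in \<open>auto simp: has_vector_derivative_def\<close>)
    moreover have "R 0 = 0"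
      unfolding R_def by (subst sum.lessThan_Suc_shift) simp
    ultimately show ?thesis using \<epsilon> by (simp add: R_def mult_ac)
  qed
  then show ?case using B(1) by blast
qed

text \<open>The power \<open>\<epsilon> ^ m\<close> accounts for the factor
  \<open>1 / \<epsilon>\<close> that differentiating the phase produces: there \<open>h\<close> has
  the size of \<epsilon> times the residual. Otherwise \<open>m = 0\<close>.\<close>

lemma O_eps_if_taylor_zero:
  fixes h :: "real \<times> 'a::euclidean_space \<Rightarrow> 'b::banach"
  assumes h: "smooth h" and z: "\<And>j p. j < n \<Longrightarrow> p \<in> D \<Longrightarrow> (ddir (1, 0) ^^ j) h (0, p) = 0"
    and \<epsilon>\<^sub>0: "0 < \<epsilon>\<^sub>0"
    and r: "\<And>\<epsilon> p. 0 < \<epsilon> \<Longrightarrow> \<epsilon> < \<epsilon>\<^sub>0 \<Longrightarrow> p \<in> D \<Longrightarrow> \<epsilon> ^ m * norm (r \<epsilon> p) \<le> norm (h (\<epsilon>, p))"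
    and m: "m \<le> n"
  shows "O_eps (n - m) D r"
  unfolding O_eps_def
proof (intro allI impI)
  fix K :: "'a set" assume "compact K"
  then obtain B where B: "\<And>\<epsilon> p. \<epsilon> \<in> {0..1} \<Longrightarrow> p \<in> K \<Longrightarrow>
      norm (h (\<epsilon>, p) - (\<Sum>j<n. \<epsilon> ^ j *\<^sub>R taylor j h p)) \<le> B * \<epsilon> ^ n"
    using taylor_remainder[OF _ h, of K n] by meson
  have "norm (r \<epsilon> p) \<le> B * \<epsilon> ^ (n - m)" if "0 < \<epsilon>" "\<epsilon> < min \<epsilon>\<^sub>0 1" "p \<in> K \<inter> D" for \<epsilon> p
  proof -
    have "\<epsilon> ^ m * norm (r \<epsilon> p) \<le> norm (h (\<epsilon>, p))" using r that by auto
    also have "\<dots> \<le> B * \<epsilon> ^ n" using B[of \<epsilon> p] that z by simp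
    also have "\<dots> = \<epsilon> ^ m * (B * \<epsilon> ^ (n - m))"
      using m by (simp add: power_add[symmetric] mult.left_commute)
    finally show ?thesis using that by simp
  qed
  then show "\<exists>B. \<exists>\<epsilon>\<^sub>0>0. \<forall>\<epsilon>. 0 < \<epsilon> \<and> \<epsilon> < \<epsilon>\<^sub>0 \<longrightarrow> (\<forall>p\<in>K \<inter> D. norm (r \<epsilon> p) \<le> B * \<epsilon> ^ (n - m))"
    using \<epsilon>\<^sub>0 by (intro exI[of _ B] exI[of _ "min \<epsilon>\<^sub>0 1"]) auto
qed

text \<open>Once the lower coefficients vanish, \<open>\<epsilon> ^ n\<close> times the norm of the
  \<open>n\<close>-th one is at most a multiple of \<open>\<epsilon> ^ Suc n\<close>; divide and let
  \<epsilon> tend to zero.\<close>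

lemma taylor_zero_if_O_eps:
  fixes h :: "real \<times> 'a::euclidean_space \<Rightarrow> 'b::banach"
  assumes h: "smooth h" and O: "O_eps_infinity D r" and \<epsilon>\<^sub>0: "0 < \<epsilon>\<^sub>0"
    and r: "\<And>\<epsilon>. 0 < \<epsilon> \<Longrightarrow> \<epsilon> < \<epsilon>\<^sub>0 \<Longrightarrow> norm (h (\<epsilon>, p)) \<le> norm (r \<epsilon> p)" and p: "p \<in> D"
  shows "(ddir (1, 0) ^^ j) h (0, p) = 0"
proof (induction j rule: less_induct)
  case (less n)
  obtain B where B: "\<And>\<epsilon>. \<epsilon> \<in> {0..1} \<Longrightarrow>
      norm (h (\<epsilon>, p) - (\<Sum>j<Suc n. \<epsilon> ^ j *\<^sub>R taylor j h p)) \<le> B * \<epsilon> ^ Suc n"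
    using taylor_remainder[OF compact_sing h, of p "Suc n"] by (meson singletonI)
  obtain B' e where B': "e > 0" "\<And>\<epsilon>. 0 < \<epsilon> \<Longrightarrow> \<epsilon> < e \<Longrightarrow> norm (r \<epsilon> p) \<le> B' * \<epsilon> ^ Suc n"
    using O p unfolding O_eps_infinity_def O_eps_def
    by (metis IntI compact_sing insertI1)
  define C where "C = \<bar>B\<bar> + \<bar>B'\<bar> + 1"
  have bound: "norm (taylor n h p) \<le> C * \<epsilon>" if \<epsilon>: "0 < \<epsilon>" "\<epsilon> < min e (min \<epsilon>\<^sub>0 1)" for \<epsilon>
  proof -
    have s: "(\<Sum>j<Suc n. \<epsilon> ^ j *\<^sub>R taylor j h p) = \<epsilon> ^ n *\<^sub>R taylor n h p"
      using less.IH by simp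
    have "\<epsilon> ^ n * norm (taylor n h p) = norm (\<epsilon> ^ n *\<^sub>R taylor n h p)"
      using \<epsilon> by simp
    also have "\<dots> \<le> norm (h (\<epsilon>, p)) + norm (h (\<epsilon>, p) - \<epsilon> ^ n *\<^sub>R taylor n h p)"
      by (metis add.commute diff_add_cancel norm_minus_commute norm_triangle_ineq)
    also have "\<dots> \<le> B' * \<epsilon> ^ Suc n + B * \<epsilon> ^ Suc n"
      using B[of \<epsilon>] s B'(2)[of \<epsilon>] r[of \<epsilon>] \<epsilon> by (intro add_mono) auto
    also have "\<dots> \<le> C * \<epsilon> ^ Suc n"
      using \<epsilon> by (auto simp: C_def distrib_right[symmetric] intro!: mult_right_mono simp del: power_Suc)
    also have "\<dots> = \<epsilon> ^ n * (C * \<epsilon>)" by simp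
    finally show ?thesis using \<epsilon> mult_le_cancel_left_pos[of "\<epsilon> ^ n"] by (metis zero_less_power)
  qed
  have "norm (taylor n h p) \<le> 0"
  proof (rule field_le_epsilon)
    fix d :: real assume d: "0 < d"
    define \<epsilon> where "\<epsilon> = min (d / C) (min e (min \<epsilon>\<^sub>0 1) / 2)"
    have C: "C > 0" by (simp add: C_def)
    have "0 < \<epsilon>" "\<epsilon> < min e (min \<epsilon>\<^sub>0 1)"
      using d C B'(1) \<epsilon>\<^sub>0 unfolding \<epsilon>_def by (auto simp: min_less_iff_disj intro!: divide_pos_pos)
    from bound[OF this] have "norm (taylor n h p) \<le> C * \<epsilon>" .
    also have "\<dots> \<le> d" using C by (simp add: \<epsilon>_def field_simps min_le_iff_disj min_def)
    finally show "norm (taylor n h p) \<le> 0 + d" by simp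
  qed
  then have "taylor n h p = 0" using norm_le_zero_iff by blast
  then show ?case by simp
qed

section \<open>Borel's lemma\<close>

text \<open>No cutoff function is needed: functions of \<open>\<epsilon>\<close> all of whose derivatives are bounded suffice, and
  polynomials in \<open>sin\<close> and \<open>cos\<close> are such functions.\<close>

inductive_set trig :: "(real \<Rightarrow> real) set" where
  trig_const: "(\<lambda>x. c) \<in> trig"
| trig_sin: "sin \<in> trig"
| trig_cos: "cos \<in> trig"
| trig_add: "f \<in> trig \<Longrightarrow> g \<in> trig \<Longrightarrow> (\<lambda>x. f x + g x) \<in> trig"
| trig_mult: "f \<in> trig \<Longrightarrow> g \<in> trig \<Longrightarrow> (\<lambda>x. f x * g x) \<in> trig"

lemma trig_derivative:
  "f \<in> trig \<Longrightarrow> \<exists>f'\<in>trig. \<forall>x. (f has_real_derivative f' x) (at x)"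
proof (induction rule: trig.induct)
  case (trig_const c)
  show ?case by (rule bexI[of _ "\<lambda>x. 0"]) (auto intro: trig.intros)
next
  case trig_sin
  show ?case by (rule bexI[of _ cos]) (auto intro: trig.intros)
next
  case trig_cos
  have "(\<lambda>x. (-1) * sin x) \<in> trig" by (intro trig.intros)
  then show ?case by (rule bexI[rotated]) (auto intro!: derivative_eq_intros)
next
  case (trig_add f g)
  then obtain f' g' where "f' \<in> trig" "g' \<in> trig"
    "\<And>x. (f has_real_derivative f' x) (at x)" "\<And>x. (g has_real_derivative g' x) (at x)" by blast
  then show ?case
    by (intro bexI[of _ "\<lambda>x. f' x + g' x"]) (auto intro!: derivative_eq_intros trig.intros)
next
  case (trig_mult f g)
  then obtain f' g' where "f' \<in> trig" "g' \<in> trig"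
    "\<And>x. (f has_real_derivative f' x) (at x)" "\<And>x. (g has_real_derivative g' x) (at x)" by blast
  with trig_mult.hyps show ?case
    by (intro bexI[of _ "\<lambda>x. f x * g' x + f' x * g x"]) (auto intro!: derivative_eq_intros trig.intros)
qed

lemma trig_bounded: "f \<in> trig \<Longrightarrow> \<exists>B\<ge>0. \<forall>x. \<bar>f x\<bar> \<le> B"
proof (induction rule: trig.induct)
  case (trig_add f g)
  then obtain B C where "\<And>x. \<bar>f x\<bar> \<le> B" "\<And>x. \<bar>g x\<bar> \<le> C" "B \<ge> 0" "C \<ge> 0" by blast
  then show ?case
    by (intro exI[of _ "B + C"]) (auto intro: order_trans[OF abs_triangle_ineq] add_mono)
next
  case (trig_mult f g)
  then obtain B C where "\<And>x. \<bar>f x\<bar> \<le> B" "\<And>x. \<bar>g x\<bar> \<le> C" "B \<ge> 0" "C \<ge> 0" by blast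
  then show ?case
    by (intro exI[of _ "B * C"]) (auto simp: abs_mult intro!: mult_mono)
next
  case (trig_const c)
  show ?case by (intro exI[of _ "\<bar>c\<bar>"]) auto
next
  case trig_sin
  show ?case by (intro exI[of _ 1]) auto
next
  case trig_cos
  show ?case by (intro exI[of _ 1]) auto
qed

lemma ddir_real_derivative:
  "(f has_real_derivative f') (at x) \<Longrightarrow> ddir v f x = v * f'"
  using ddir_eqI[of f "(*) f'" x v] by (simp add: has_field_derivative_def)

lemma smooth_trig:
  assumes "f \<in> trig"
  shows "smooth f"
proof -
  have "Ck n f" for n
    using assms
  proof (induction n arbitrary: f)
    case 0
    then obtain f' where "\<And>x. (f has_real_derivative f' x) (at x)" using trig_derivative by blast
    then show ?case by (auto intro!: continuous_at_imp_continuous_on DERIV_isCont)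
  next
    case (Suc n)
    then obtain f' where f': "f' \<in> trig" "\<And>x. (f has_real_derivative f' x) (at x)"
      using trig_derivative by blast
    then have "ddir v f = (\<lambda>x. v * f' x)" for v by (auto simp: ddir_real_derivative)
    moreover have "Ck n (\<lambda>x. v * f' x)" for v
      using f'(1) by (intro Suc.IH trig.intros)
    ultimately show ?case
      using f'(2) by (auto simp: differentiable_def has_field_derivative_def)
  qed
  then show ?thesis by (simp add: smooth_def)
qed

lemma trig_sin_power: "f \<in> trig \<Longrightarrow> (\<lambda>x. sin x ^ n * f x) \<in> trig"
proof (induction n)
  case (Suc n)
  have "(\<lambda>x. sin x * (sin x ^ n * f x)) \<in> trig" by (rule trig_mult[OF trig_sin Suc.IH[OF Suc.prems]])
  then show ?case by (simp add: mult.assoc)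
qed simp

text \<open>Building block of the Borel series: frequency \<open>\<kappa>\<close> in \<epsilon>,
  coefficient \<open>d\<close> in the remaining variables.\<close>

definition osc :: "real \<Rightarrow> (real \<Rightarrow> real) \<Rightarrow> ('a \<Rightarrow> 'b::real_normed_vector) \<Rightarrow> real \<times> 'a::real_normed_vector \<Rightarrow> 'b"
  where "osc \<kappa> f d = (\<lambda>q. f (\<kappa> * fst q) *\<^sub>R d (snd q))"

lemma smooth_osc:
  fixes d :: "'a::euclidean_space \<Rightarrow> 'b::real_normed_vector"
  shows "f \<in> trig \<Longrightarrow> smooth d \<Longrightarrow> smooth (osc \<kappa> f d)"
  unfolding osc_def
  by (rule smooth_scaleR, rule smooth_compose[OF smooth_trig], assumption, intro smooth_intros,
      rule smooth_compose, assumption, intro smooth_intros)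

lemma ddir_osc:
  fixes d :: "'a::euclidean_space \<Rightarrow> 'b::real_normed_vector"
  assumes "smooth d" "\<And>x. (f has_real_derivative f' x) (at x)"
  shows "ddir v (osc \<kappa> f d) = (\<lambda>q. (fst v * \<kappa>) *\<^sub>R osc \<kappa> f' d q + osc \<kappa> f (ddir (snd v) d) q)"
proof
  fix q :: "real \<times> 'a"
  have "((\<lambda>q :: real \<times> 'a. \<kappa> * fst q) has_derivative (\<lambda>h. \<kappa> * fst h)) (at q)"
    by (auto intro!: derivative_eq_intros)
  from has_derivative_compose[OF this assms(2)[unfolded has_field_derivative_def]]
  have "((\<lambda>q. f (\<kappa> * fst q)) has_derivative (\<lambda>h. \<kappa> * fst h * f' (\<kappa> * fst q))) (at q)"
    by (simp add: mult_ac)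
  moreover have "((\<lambda>q. d (snd q)) has_derivative (\<lambda>h. ddir (snd h) d (snd q))) (at q)"
    by (rule has_derivative_compose[OF _ smooth_has_derivative[OF assms(1)]])
      (auto intro!: derivative_eq_intros)
  ultimately have "(osc \<kappa> f d has_derivative (\<lambda>h. f (\<kappa> * fst q) *\<^sub>R ddir (snd h) d (snd q)
      + (\<kappa> * fst h * f' (\<kappa> * fst q)) *\<^sub>R d (snd q))) (at q)"
    unfolding osc_def by (rule has_derivative_scaleR)
  from ddir_eqI[OF this] show "ddir v (osc \<kappa> f d) q
      = (fst v * \<kappa>) *\<^sub>R osc \<kappa> f' d q + osc \<kappa> f (ddir (snd v) d) q"
    by (simp add: osc_def mult_ac)
qed

text \<open>\<open>sin (\<kappa> \<epsilon>) ^ j\<close> vanishes to order \<open>j\<close> at 0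
  with leading coefficient \<open>\<kappa> ^ j\<close>. The factor \<open>f\<close> is there for the
  induction: a derivative lowers the power of the sine by one and replaces \<open>f\<close> by some
  \<open>h\<close> with \<open>h 0 = j * f 0\<close>.\<close>

lemma ddir_funpow_osc_sin:
  fixes d :: "'a::euclidean_space \<Rightarrow> 'b::real_normed_vector"
  assumes d: "smooth d"
  shows "f \<in> trig \<Longrightarrow> m \<le> j \<Longrightarrow>
    (ddir (1, 0) ^^ m) (osc \<kappa> (\<lambda>x. sin x ^ j * f x) d) (0, p)
      = (if m = j then (\<kappa> ^ j * fact j * f 0) *\<^sub>R d p else 0)"
proof (induction m arbitrary: j f)
  case 0
  then show ?case by (auto simp: osc_def)
next
  case (Suc m)
  then obtain i where j: "j = Suc i" by (metis Suc_le_D)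
  obtain f' where f': "f' \<in> trig" "\<And>x. (f has_real_derivative f' x) (at x)"
    using trig_derivative Suc.prems by blast
  define h where "h = (\<lambda>x. real j * (cos x * f x) + sin x * f' x)"
  have h: "h \<in> trig" unfolding h_def using f'(1) Suc.prems by (intro trig.intros)
  have "((\<lambda>x. sin x ^ j * f x) has_real_derivative sin x ^ i * h x) (at x)" for x
    using DERIV_mult[OF DERIV_power_Suc[OF DERIV_sin[of x], of i] f'(2)[of x]]
    by (simp add: j h_def algebra_simps)
  from ddir_osc[OF d this, of "(1, 0)" \<kappa>]
  have "ddir (1, 0) (osc \<kappa> (\<lambda>x. sin x ^ j * f x) d) = (\<lambda>q. \<kappa> *\<^sub>R osc \<kappa> (\<lambda>x. sin x ^ i * h x) d q)"
    by (simp add: ddir_dir_zero[OF d] osc_def)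
  moreover have "(ddir (1, 0) ^^ m) (\<lambda>q. c *\<^sub>R u q) = (\<lambda>q. c *\<^sub>R (ddir (1, 0) ^^ m) u q)"
    if "smooth u" for c and u :: "real \<times> 'a \<Rightarrow> 'b"
    by (induction m) (auto simp: ddir_scaleR_const smooth_ddir_funpow[OF that])
  ultimately have "(ddir (1, 0) ^^ Suc m) (osc \<kappa> (\<lambda>x. sin x ^ j * f x) d) (0, p)
      = \<kappa> *\<^sub>R (ddir (1, 0) ^^ m) (osc \<kappa> (\<lambda>x. sin x ^ i * h x) d) (0, p)"
    using smooth_osc[OF trig_sin_power[OF h] d] by (simp add: funpow_Suc_right del: funpow.simps)
  also have "\<dots> = (if Suc m = j then (\<kappa> ^ j * fact j * f 0) *\<^sub>R d p else 0)"
    using Suc.prems by (subst Suc.IH[OF h]) (auto simp: j h_def mult_ac)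
  finally show ?case .
qed

text \<open>Derivatives scale with their direction, so a uniform bound is asked for basis directions
  only; \<open>ddir_euclidean\<close> recovers the others.\<close>

primrec deriv_bound :: "nat \<Rightarrow> 'a set \<Rightarrow> real \<Rightarrow> ('a::euclidean_space \<Rightarrow> 'b::real_normed_vector) \<Rightarrow> bool"
  where
    "deriv_bound 0 S B f \<longleftrightarrow> (\<forall>x\<in>S. norm (f x) \<le> B)"
  | "deriv_bound (Suc n) S B f \<longleftrightarrow> (\<forall>x\<in>S. norm (f x) \<le> B) \<and> (\<forall>b\<in>Basis. deriv_bound n S B (ddir b f))"

lemma deriv_bound_mono:
  "deriv_bound n S B f \<Longrightarrow> m \<le> n \<Longrightarrow> T \<subseteq> S \<Longrightarrow> B \<le> C \<Longrightarrow> deriv_bound m T C f"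
proof (induction n arbitrary: m f)
  case 0
  then show ?case by force
next
  case (Suc n)
  then show ?case by (cases m) force+
qed

lemma deriv_bound_imp: "deriv_bound n S B f \<Longrightarrow> x \<in> S \<Longrightarrow> norm (f x) \<le> B"
  by (cases n) auto

lemma deriv_bound_add:
  "smooth f \<Longrightarrow> smooth g \<Longrightarrow> deriv_bound n S B f \<Longrightarrow> deriv_bound n S C g \<Longrightarrow>
    deriv_bound n S (B + C) (\<lambda>x. f x + g x)"
  by (induction n arbitrary: f g)
    (auto simp: ddir_add smooth_ddir intro!: norm_triangle_le add_mono)

lemma deriv_bound_scaleR:
  "smooth f \<Longrightarrow> deriv_bound n S B f \<Longrightarrow> deriv_bound n S (\<bar>c\<bar> * B) (\<lambda>x. c *\<^sub>R f x)"
  by (induction n arbitrary: f) (auto simp: ddir_scaleR_const smooth_ddir intro: mult_left_mono)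

lemma deriv_bound_zero: "deriv_bound n S 0 (\<lambda>x. 0)"
  by (induction n) auto

lemma deriv_bound_sum:
  "(\<And>i. i \<in> I \<Longrightarrow> smooth (f i)) \<Longrightarrow> (\<And>i. i \<in> I \<Longrightarrow> deriv_bound n S (B i) (f i)) \<Longrightarrow>
    deriv_bound n S (\<Sum>i\<in>I. B i) (\<lambda>x. \<Sum>i\<in>I. f i x)"
  by (induction I rule: infinite_finite_induct) (auto intro!: deriv_bound_zero deriv_bound_add)

text \<open>A derivative in \<epsilon> brings out one factor \<open>\<kappa>\<close> and stays
  within \<open>trig\<close>; other directions only change \<open>d\<close>. For
  \<open>\<kappa> \<ge> 1\<close> lower powers are absorbed, so one constant \<open>C\<close> serves
  all frequencies.\<close>

lemma deriv_bound_osc: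
  fixes d :: "'a::euclidean_space \<Rightarrow> 'b::real_normed_vector"
  assumes S: "compact S"
  shows "f \<in> trig \<Longrightarrow> smooth d \<Longrightarrow> \<exists>C\<ge>0. \<forall>\<kappa>\<ge>1. deriv_bound n S (C * \<kappa> ^ n) (osc \<kappa> f d)"
proof (induction n arbitrary: f d)
  case (0 f d)
  obtain B where B: "B \<ge> 0" "\<And>x. \<bar>f x\<bar> \<le> B" using trig_bounded[OF 0(1)] by blast
  have "compact (d ` snd ` S)"
    by (intro compact_continuous_image smooth_imp_continuous[OF 0(2)] continuous_intros S)
  from compact_imp_bounded[OF this] obtain D where D: "\<forall>x\<in>S. norm (d (snd x)) \<le> D"
    unfolding bounded_iff by blast
  then have "\<forall>x\<in>S. norm (d (snd x)) \<le> \<bar>D\<bar>" by force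
  with B show ?case
    by (intro exI[of _ "B * \<bar>D\<bar>"]) (auto simp: osc_def intro!: mult_mono)
next
  case (Suc n f d)
  obtain f' where f': "f' \<in> trig" "\<And>x. (f has_real_derivative f' x) (at x)"
    using trig_derivative Suc.prems by blast
  obtain C0 where C0: "C0 \<ge> 0" "\<And>\<kappa>. \<kappa> \<ge> 1 \<Longrightarrow> deriv_bound n S (C0 * \<kappa> ^ n) (osc \<kappa> f d)"
    using Suc.IH[OF Suc.prems] by blast
  obtain C1 where C1: "C1 \<ge> 0" "\<And>\<kappa>. \<kappa> \<ge> 1 \<Longrightarrow> deriv_bound n S (C1 * \<kappa> ^ n) (osc \<kappa> f' d)"
    using Suc.IH[OF f'(1) Suc.prems(2)] by blast
  have "\<forall>b::real \<times> 'a. \<exists>C\<ge>0. \<forall>\<kappa>\<ge>1. deriv_bound n S (C * \<kappa> ^ n) (osc \<kappa> f (ddir (snd b) d))"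
    using Suc.IH[OF Suc.prems(1) smooth_ddir[OF Suc.prems(2)]] by blast
  then obtain C2 where C2: "\<And>b::real \<times> 'a. C2 b \<ge> 0"
    "\<And>b \<kappa>. \<kappa> \<ge> 1 \<Longrightarrow> deriv_bound n S (C2 b * \<kappa> ^ n) (osc \<kappa> f (ddir (snd b) d))" by metis
  define C where "C = C0 + C1 + (\<Sum>b\<in>Basis. C2 b)"
  have "deriv_bound (Suc n) S (C * \<kappa> ^ Suc n) (osc \<kappa> f d)" if \<kappa>: "\<kappa> \<ge> 1" for \<kappa>
  proof -
    have pow: "\<kappa> ^ n \<le> \<kappa> ^ Suc n" using \<kappa> by (intro power_increasing) auto
    have "norm (osc \<kappa> f d x) \<le> C * \<kappa> ^ Suc n" if "x \<in> S" for x
    proof -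
      have "norm (osc \<kappa> f d x) \<le> C0 * \<kappa> ^ n" using deriv_bound_imp[OF C0(2)[OF \<kappa>] that] .
      also have "\<dots> \<le> C * \<kappa> ^ Suc n"
        using pow C0 C1 C2 \<kappa> by (intro mult_mono) (auto simp: C_def sum_nonneg)
      finally show ?thesis .
    qed
    moreover have "deriv_bound n S (C * \<kappa> ^ Suc n) (ddir b (osc \<kappa> f d))" if b: "b \<in> Basis" for b
    proof -
      have "norm b = 1" using b by (rule norm_Basis)
      then have fb: "\<bar>fst b\<bar> \<le> 1" using norm_fst_le[of "fst b" "snd b"] by (simp del: norm_Pair)
      have "deriv_bound n S (\<bar>fst b * \<kappa>\<bar> * (C1 * \<kappa> ^ n) + C2 b * \<kappa> ^ n) (ddir b (osc \<kappa> f d))"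
        unfolding ddir_osc[OF Suc.prems(2) f'(2)]
        by (intro deriv_bound_add deriv_bound_scaleR C1(2) C2(2) \<kappa> smooth_scaleR_const smooth_osc
            Suc.prems f'(1) smooth_ddir)
      moreover have "\<bar>fst b * \<kappa>\<bar> * (C1 * \<kappa> ^ n) + C2 b * \<kappa> ^ n \<le> C * \<kappa> ^ Suc n"
      proof -
        have "\<bar>fst b * \<kappa>\<bar> * (C1 * \<kappa> ^ n) \<le> \<kappa> * (C1 * \<kappa> ^ n)"
          using fb \<kappa> C1(1) by (intro mult_right_mono) (auto simp: abs_mult mult_left_le_one_le)
        also have "\<dots> = C1 * \<kappa> ^ Suc n" by simp
        finally have "\<bar>fst b * \<kappa>\<bar> * (C1 * \<kappa> ^ n) + C2 b * \<kappa> ^ n \<le> C1 * \<kappa> ^ Suc n + C2 b * \<kappa> ^ Suc n"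
          using mult_left_mono[OF pow C2(1)[of b]] by (rule add_mono)
        also have "\<dots> = (C1 + C2 b) * \<kappa> ^ Suc n" by (simp add: algebra_simps)
        also have "\<dots> \<le> C * \<kappa> ^ Suc n"
          using C0(1) member_le_sum[OF b, of C2] C2(1) \<kappa> by (intro mult_right_mono) (auto simp: C_def)
        finally show ?thesis .
      qed
      ultimately show ?thesis using deriv_bound_mono[OF _ order_refl subset_refl] by blast
    qed
    ultimately show ?thesis by simp
  qed
  moreover have "C \<ge> 0" using C0 C1 C2 by (auto simp: C_def sum_nonneg)
  ultimately show ?case by blast
qed

section \<open>Termwise differentiation of rapidly convergent series\<close>

lemma geometric_tail:
  fixes a :: "nat \<Rightarrow> 'b::banach"
  assumes a: "\<And>i. i \<ge> N \<Longrightarrow> norm (a i) \<le> c / 2 ^ i"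
  shows "summable a" "n \<ge> N \<Longrightarrow> norm (sum a {..<n} - suminf a) \<le> 2 * c / 2 ^ n"
proof -
  have g: "summable (\<lambda>i. c / 2 ^ i)"
  proof -
    have "(\<lambda>i. c * (1 / 2) ^ i) = (\<lambda>i. c / 2 ^ i)" by (simp add: power_one_over)
    then show ?thesis using summable_mult[OF summable_geometric[of "1 / 2 :: real"], of c] by simp
  qed
  show s: "summable a"
    by (rule summable_comparison_test[OF _ g]) (use a in blast)
  assume n: "n \<ge> N"
  have g': "(\<lambda>i. c / 2 ^ (i + n)) sums (2 * c / 2 ^ n)"
  proof -
    have "(\<lambda>i. c / 2 ^ n * (1 / 2) ^ i) = (\<lambda>i. c / 2 ^ (i + n))"
      by (simp add: power_one_over power_add mult.commute)
    then show ?thesis using sums_mult[OF geometric_sums[of "1 / 2 :: real"], of "c / 2 ^ n"] by (simp add: mult.commute)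
  qed
  have "norm (sum a {..<n} - suminf a) = norm (\<Sum>i. a (i + n))"
    by (subst suminf_split_initial_segment[OF s, of n]) simp
  also have "\<dots> \<le> (\<Sum>i. c / 2 ^ (i + n))"
    by (rule norm_suminf_le) (use a n g' sums_summable in auto)
  also have "\<dots> = 2 * c / 2 ^ n" using g' sums_unique by metis
  finally show "norm (sum a {..<n} - suminf a) \<le> 2 * c / 2 ^ n" .
qed

text \<open>The threshold \<open>N\<close> depends on the order and the radius because the Borel
  term of index \<open>j\<close> is controlled only for fewer than \<open>j\<close> derivatives and
  on the ball of radius \<open>j\<close>.\<close>

definition rapid :: "(nat \<Rightarrow> 'a::euclidean_space \<Rightarrow> 'b::banach) \<Rightarrow> bool"
  where "rapid f \<longleftrightarrow> (\<forall>j. smooth (f j))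
    \<and> (\<forall>n R. \<exists>N. \<exists>K\<ge>0. \<forall>j\<ge>N. deriv_bound n (cball 0 R) (K / 2 ^ j) (f j))"

lemma rapid_ddir:
  fixes f :: "nat \<Rightarrow> 'a::euclidean_space \<Rightarrow> 'b::banach"
  assumes "rapid f"
  shows "rapid (\<lambda>j. ddir v (f j))"
  unfolding rapid_def
proof (intro conjI allI)
  fix n R
  have s: "smooth (f j)" for j using assms by (auto simp: rapid_def)
  show "smooth (ddir v (f j))" for j by (rule smooth_ddir[OF s])
  from assms obtain N K where K: "K \<ge> 0"
    and b: "\<And>j. j \<ge> N \<Longrightarrow> deriv_bound (Suc n) (cball 0 R) (K / 2 ^ j) (f j)"
    unfolding rapid_def by meson
  have "ddir v (f j) = (\<lambda>x. \<Sum>b\<in>Basis. (v \<bullet> b) *\<^sub>R ddir b (f j) x)" for j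
    by (rule ext, rule ddir_euclidean, rule smooth_differentiable, rule s)
  moreover have "deriv_bound n (cball 0 R) (\<Sum>b\<in>Basis. \<bar>v \<bullet> b\<bar> * (K / 2 ^ j))
      (\<lambda>x. \<Sum>b\<in>Basis. (v \<bullet> b) *\<^sub>R ddir b (f j) x)" if "j \<ge> N" for j
    using b[OF that] s
    by (intro deriv_bound_sum deriv_bound_scaleR smooth_scaleR_const smooth_ddir) auto
  moreover have "(\<Sum>b\<in>Basis. \<bar>v \<bullet> b\<bar> * (K / 2 ^ j)) = (\<Sum>b\<in>Basis. \<bar>v \<bullet> b\<bar>) * K / 2 ^ j" for j
    by (simp add: sum_distrib_right sum_divide_distrib)
  ultimately have "\<forall>j\<ge>N. deriv_bound n (cball 0 R) ((\<Sum>b\<in>Basis. \<bar>v \<bullet> b\<bar>) * K / 2 ^ j) (ddir v (f j))"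
    by simp
  moreover have "(\<Sum>b\<in>Basis. \<bar>v \<bullet> b\<bar>) * K \<ge> 0" using K by (simp add: sum_nonneg)
  ultimately show "\<exists>N. \<exists>K\<ge>0. \<forall>j\<ge>N. deriv_bound n (cball 0 R) (K / 2 ^ j) (ddir v (f j))" by blast
qed

lemma rapid_summable:
  fixes f :: "nat \<Rightarrow> 'a::euclidean_space \<Rightarrow> 'b::banach"
  assumes "rapid f"
  shows "summable (\<lambda>j. f j x)"
proof -
  obtain N K where "\<forall>j\<ge>N. deriv_bound 0 (cball 0 (norm x)) (K / 2 ^ j) (f j)"
    using assms unfolding rapid_def by meson
  then have "norm (f j x) \<le> K / 2 ^ j" if "j \<ge> N" for j using that by auto
  then show ?thesis by (rule geometric_tail(1))
qed

text \<open>The series theorem needs a convex set on which the derivatives converge uniformly; a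
  ball around \<open>x\<close> serves, and being open it gives back the full derivative at
  \<open>x\<close>.\<close>

lemma rapid_has_derivative:
  fixes f :: "nat \<Rightarrow> 'a::euclidean_space \<Rightarrow> 'b::banach"
  assumes f: "rapid f"
  shows "((\<lambda>x. \<Sum>j. f j x) has_derivative (\<lambda>v. \<Sum>j. ddir v (f j) x)) (at x)"
proof -
  have s: "smooth (f j)" for j using f by (auto simp: rapid_def)
  define S where "S = ball (0 :: 'a) (norm x + 1)"
  have "\<exists>N K. K \<ge> 0 \<and> (\<forall>j\<ge>N. deriv_bound (Suc 0) (cball 0 (norm x + 1)) (K / 2 ^ j) (f j))"
    using f unfolding rapid_def by meson
  then obtain N K where K: "K \<ge> 0"
    and b: "\<And>j. j \<ge> N \<Longrightarrow> deriv_bound (Suc 0) (cball 0 (norm x + 1)) (K / 2 ^ j) (f j)" by blast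
  define D where "D = real DIM('a) * K"
  have D: "D \<ge> 0" using K by (simp add: D_def)
  have dir: "norm (ddir h (f i) y) \<le> (norm h * D) / 2 ^ i" if "i \<ge> N" "y \<in> S" for h i y
  proof -
    have "norm (ddir h (f i) y) \<le> (\<Sum>e\<in>Basis. norm ((h \<bullet> e) *\<^sub>R ddir e (f i) y))"
      by (subst ddir_euclidean[OF smooth_differentiable[OF s]]) (rule norm_sum)
    also have "\<dots> = (\<Sum>e\<in>Basis. \<bar>h \<bullet> e\<bar> * norm (ddir e (f i) y))" by simp
    also have "\<dots> \<le> (\<Sum>e\<in>(Basis::'a set). norm h * (K / 2 ^ i))"
      using b[OF that(1)] that(2)
      by (intro sum_mono mult_mono Basis_le_norm) (auto simp: S_def)
    also have "\<dots> = (norm h * D) / 2 ^ i" by (simp add: D_def)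
    finally show ?thesis .
  qed
  have "\<exists>g. \<forall>y\<in>S. (\<lambda>j. f j y) sums g y \<and> (g has_derivative (\<lambda>v. \<Sum>j. ddir v (f j) y)) (at y within S)"
  proof (rule has_derivative_series)
    show "convex S" by (simp add: S_def)
    show "(f n has_derivative (\<lambda>v. ddir v (f n) y)) (at y within S)" for n y
      by (rule smooth_has_derivative[OF s])
    show "x \<in> S" by (simp add: S_def)
    show "(\<lambda>n. f n x) sums (\<Sum>j. f j x)" by (rule summable_sums[OF rapid_summable[OF f]])
    fix e :: real assume e: "e > 0"
    have "(\<lambda>n. (2 * D) * (1 / 2) ^ n) \<longlonglongrightarrow> 0"
      using tendsto_mult_right_zero[OF LIMSEQ_power_zero[of "1 / 2 :: real"], of "2 * D"] by simp
    then have "(\<lambda>n. (2 * D) / 2 ^ n) \<longlonglongrightarrow> 0" by (simp add: power_one_over)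
    then have "\<forall>\<^sub>F n in sequentially. (2 * D) / 2 ^ n < e"
      using e by (rule order_tendstoD)
    then show "\<forall>\<^sub>F n in sequentially. \<forall>y\<in>S. \<forall>h. norm ((\<Sum>i<n. ddir h (f i) y) - (\<Sum>j. ddir h (f j) y)) \<le> e * norm h"
      using eventually_ge_at_top[of N]
    proof eventually_elim
      case (elim n)
      show ?case
      proof (intro ballI allI)
        fix y h assume y: "y \<in> S"
        have "norm ((\<Sum>i<n. ddir h (f i) y) - (\<Sum>j. ddir h (f j) y)) \<le> 2 * (norm h * D) / 2 ^ n"
          by (rule geometric_tail(2)[of N]) (use dir y elim in auto)
        also have "\<dots> = (2 * D) / 2 ^ n * norm h" by simp
        also have "\<dots> \<le> e * norm h" using elim by (intro mult_right_mono) auto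
        finally show "norm ((\<Sum>i<n. ddir h (f i) y) - (\<Sum>j. ddir h (f j) y)) \<le> e * norm h" .
      qed
    qed
  qed
  then obtain g where g: "\<And>y. y \<in> S \<Longrightarrow> (\<lambda>j. f j y) sums g y"
    "\<And>y. y \<in> S \<Longrightarrow> (g has_derivative (\<lambda>v. \<Sum>j. ddir v (f j) y)) (at y within S)" by blast
  have "x \<in> S" "open S" by (auto simp: S_def)
  then have "(g has_derivative (\<lambda>v. \<Sum>j. ddir v (f j) x)) (at x)"
    using g(2)[of x] at_within_open by metis
  then show ?thesis
    by (rule has_derivative_transform_within_open[OF _ \<open>open S\<close> \<open>x \<in> S\<close>])
      (use g(1) sums_unique in auto)
qed

lemma ddir_rapid_suminf:
  fixes f :: "nat \<Rightarrow> 'a::euclidean_space \<Rightarrow> 'b::banach"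
  shows "rapid f \<Longrightarrow> ddir v (\<lambda>x. \<Sum>j. f j x) = (\<lambda>x. \<Sum>j. ddir v (f j) x)"
  by (rule ext, rule ddir_eqI, rule rapid_has_derivative)

lemma smooth_rapid_suminf:
  fixes f :: "nat \<Rightarrow> 'a::euclidean_space \<Rightarrow> 'b::banach"
  assumes "rapid f"
  shows "smooth (\<lambda>x. \<Sum>j. f j x)"
proof -
  have "Ck n (\<lambda>x. \<Sum>j. f j x)" for n
    using assms
  proof (induction n arbitrary: f)
    case 0
    then show ?case
      by (auto intro!: continuous_at_imp_continuous_on has_derivative_continuous[OF rapid_has_derivative])
  next
    case (Suc n)
    have "(\<lambda>x. \<Sum>j. f j x) differentiable at x" for x
      using rapid_has_derivative[OF Suc.prems] unfolding differentiable_def by blast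
    then show ?case
      using Suc.IH[OF rapid_ddir[OF Suc.prems]] by (simp add: ddir_rapid_suminf[OF Suc.prems])
  qed
  then show ?thesis by (simp add: smooth_def[of "\<lambda>x. \<Sum>j. f j x"])
qed

lemma ddir_funpow_rapid_suminf:
  fixes f :: "nat \<Rightarrow> 'a::euclidean_space \<Rightarrow> 'b::banach"
  assumes "rapid f"
  shows "(ddir v ^^ n) (\<lambda>x. \<Sum>j. f j x) = (\<lambda>x. \<Sum>j. (ddir v ^^ n) (f j) x)"
proof -
  have "rapid (\<lambda>j. (ddir v ^^ n) (f j))" for n
    by (induction n) (auto intro: assms rapid_ddir)
  then show ?thesis by (induction n) (auto simp: ddir_rapid_suminf)
qed

text \<open>In the series \<open>\<Sum>\<^sub>j (sin (\<kappa>\<^sub>j \<epsilon>) / \<kappa>\<^sub>j)\<^sup>j d\<^sub>j\<close> the \<open>j\<close>-th term is \<open>\<epsilon>\<^sup>j d\<^sub>j\<close> plus terms of higher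
  order, so that \<open>d\<^sub>j\<close> corrects the contributions of the terms before it; large \<open>\<kappa>\<^sub>j\<close> give convergence.\<close>

theorem borel:
  fixes c :: "nat \<Rightarrow> 'a::euclidean_space \<Rightarrow> 'b::banach"
  assumes c: "\<And>j. smooth (c j)"
  obtains g where "smooth g" "\<And>j p. taylor j g p = c j p"
proof -
  define T where "T = (\<lambda>j (r :: ('a \<Rightarrow> 'b) \<times> real) q.
    (1 / snd r ^ j) *\<^sub>R osc (snd r) (\<lambda>x. sin x ^ j * 1) (fst r) q)"
  \<comment> \<open>The choice principle asks for a next term after every history \<open>f\<close>,
    also one with nonsmooth terms; the implication makes \<open>P\<close> trivial for those.\<close>
  define P where "P f n r \<longleftrightarrow> ((\<forall>j<n. smooth (fst (f j))) \<longrightarrow>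
      smooth (fst r) \<and> snd r \<ge> 1 \<and> (\<forall>p. fst r p = c n p - (\<Sum>j<n. taylor n (T j (f j)) p))
      \<and> (n > 0 \<longrightarrow> deriv_bound (n - 1) (cball 0 (real n)) (1 / 2 ^ n) (T n r)))" for f n r
  have one: "(\<lambda>x. sin x ^ j * 1) \<in> trig" for j by (rule trig_sin_power, rule trig_const)
  have sT: "smooth (T j r)" if "smooth (fst r)" for j r
    unfolding T_def by (intro smooth_scaleR_const smooth_osc one that)
  have "\<exists>f. \<forall>n. P f n (f n)"
  proof (rule dependent_wellorder_choice)
    fix f g :: "nat \<Rightarrow> ('a \<Rightarrow> 'b) \<times> real" and n r
    assume "\<And>m. m < n \<Longrightarrow> f m = g m"
    then show "P f n r = P g n r" unfolding P_def by auto
  next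
    fix n f
    define d where "d = (\<lambda>p. c n p - (\<Sum>j<n. taylor n (T j (f j)) p))"
    show "\<exists>r. P f n r"
    proof (cases "\<forall>j<n. smooth (fst (f j))")
      case True
      have d: "smooth d"
        unfolding d_def using True
        by (intro smooth_diff c smooth_sum smooth_scaleR_const smooth_compose[OF smooth_ddir_funpow[OF sT]]
            smooth_Pair smooth_const smooth_id) auto
      obtain C where C: "C \<ge> 0" "\<And>\<kappa>. \<kappa> \<ge> 1 \<Longrightarrow>
          deriv_bound (n - 1) (cball 0 (real n)) (C * \<kappa> ^ (n - 1)) (osc \<kappa> (\<lambda>x. sin x ^ n * 1) d)"
        using deriv_bound_osc[OF _ one d, of "cball 0 (real n)" "n - 1" n] compact_cball by blast
      \<comment> \<open>For \<open>n > 0\<close>, the \<open>n - 1\<close> derivatives cost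
        \<open>C * \<kappa> ^ (n - 1)\<close> against the prefactor \<open>1 / \<kappa> ^ n\<close>
        of the term; the remaining \<open>C / \<kappa>\<close> is at most \<open>1 / 2 ^ n\<close>
        for this choice.\<close>
      define \<kappa> where "\<kappa> = 1 + C * 2 ^ n"
      have \<kappa>: "\<kappa> \<ge> 1" using C(1) by (simp add: \<kappa>_def)
      have "deriv_bound (n - 1) (cball 0 (real n)) (1 / 2 ^ n) (T n (d, \<kappa>))" if "n > 0"
      proof -
        have "deriv_bound (n - 1) (cball 0 (real n)) (\<bar>1 / \<kappa> ^ n\<bar> * (C * \<kappa> ^ (n - 1))) (T n (d, \<kappa>))"
          unfolding T_def fst_conv snd_conv
          by (intro deriv_bound_scaleR C(2) \<kappa> smooth_osc one d)
        moreover have "\<bar>1 / \<kappa> ^ n\<bar> * (C * \<kappa> ^ (n - 1)) \<le> 1 / 2 ^ n"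
        proof -
          have "\<kappa> ^ n = \<kappa> * \<kappa> ^ (n - 1)" using that by (metis Suc_pred' power_Suc)
          then have "\<bar>1 / \<kappa> ^ n\<bar> * (C * \<kappa> ^ (n - 1)) = C / \<kappa>" using \<kappa> by (simp add: field_simps)
          also have "\<dots> \<le> 1 / 2 ^ n" using C(1) by (simp add: \<kappa>_def divide_le_eq pos_le_divide_eq add_pos_nonneg)
          finally show ?thesis .
        qed
        ultimately show ?thesis using deriv_bound_mono[OF _ order_refl subset_refl] by blast
      qed
      then have "P f n (d, \<kappa>)" using d \<kappa> unfolding P_def by (simp add: d_def)
      then show ?thesis ..
    qed (unfold P_def, blast)
  qed
  then obtain f where f: "\<And>n. P f n (f n)" by blast
  have sm: "smooth (fst (f n))" for n
    using f unfolding P_def by (induction n rule: less_induct) blast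
  have f1: "snd (f n) \<ge> 1" and f2: "fst (f n) p = c n p - (\<Sum>j<n. taylor n (T j (f j)) p)"
    and f3: "n > 0 \<Longrightarrow> deriv_bound (n - 1) (cball 0 (real n)) (1 / 2 ^ n) (T n (f n))" for n p
    using f[of n] sm unfolding P_def by auto
  have rT: "rapid (\<lambda>j. T j (f j))"
    unfolding rapid_def
  proof (intro conjI allI)
    show "smooth (T j (f j))" for j by (rule sT[OF sm])
    fix n and R :: real
    have "deriv_bound n (cball 0 R) (1 / 2 ^ j) (T j (f j))" if "j \<ge> max (Suc n) (nat \<lceil>R\<rceil>)" for j
    proof (rule deriv_bound_mono[OF f3[of j]])
      have "R \<le> real j" using that by linarith
      then show "cball 0 R \<subseteq> (cball 0 (real j) :: (real \<times> 'a) set)" by (rule subset_cball)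
    qed (use that in auto)
    then show "\<exists>N. \<exists>K\<ge>0. \<forall>j\<ge>N. deriv_bound n (cball 0 R) (K / 2 ^ j) (T j (f j))"
      by (intro exI[of _ "max (Suc n) (nat \<lceil>R\<rceil>)"] exI[of _ 1]) simp
  qed
  define g where "g = (\<lambda>q. \<Sum>j. T j (f j) q)"
  have scale: "(ddir v ^^ m) (\<lambda>q. a *\<^sub>R u q) = (\<lambda>q. a *\<^sub>R (ddir v ^^ m) u q)"
    if "smooth u" for a m v and u :: "real \<times> 'a \<Rightarrow> 'b"
    by (induction m) (auto simp: ddir_scaleR_const smooth_ddir_funpow[OF that])
  have tT: "taylor m (T j (f j)) p = (if m = j then fst (f j) p else 0)" if "m \<le> j" for m j p
  proof -
    have "(ddir (1, 0) ^^ m) (T j (f j)) (0, p) = (1 / snd (f j) ^ j) *\<^sub>R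
        (if m = j then (snd (f j) ^ j * fact j * 1) *\<^sub>R fst (f j) p else 0)"
      unfolding T_def scale[OF smooth_osc[OF one sm]]
      by (subst ddir_funpow_osc_sin[OF sm trig_const that]) simp
    then show ?thesis using f1[of j] by auto
  qed
  have "taylor n g p = c n p" for n p
  proof -
    have "taylor n g p = (1 / fact n) *\<^sub>R (\<Sum>j. (ddir (1, 0) ^^ n) (T j (f j)) (0, p))"
      unfolding g_def ddir_funpow_rapid_suminf[OF rT] ..
    also have "(\<Sum>j. (ddir (1, 0) ^^ n) (T j (f j)) (0, p)) = (\<Sum>j<Suc n. (ddir (1, 0) ^^ n) (T j (f j)) (0, p))"
    proof (rule suminf_finite)
      fix j assume "j \<notin> {..<Suc n}"
      then show "(ddir (1, 0) ^^ n) (T j (f j)) (0, p) = 0" using tT[of n j p] by simp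
    qed simp
    finally have "taylor n g p = (\<Sum>j<Suc n. taylor n (T j (f j)) p)"
      by (simp add: scaleR_sum_right scaleR_add_right)
    then show ?thesis using tT[of n n p] by (simp add: f2[of n p])
  qed
  moreover have "smooth g" unfolding g_def by (rule smooth_rapid_suminf[OF rT])
  ultimately show ?thesis using that by blast
qed

section \<open>WKB expansions\<close>

definition symb :: "(3 \<Rightarrow> complex^'n^'n) \<Rightarrow> real \<Rightarrow> real^3 \<Rightarrow> complex^'n \<Rightarrow> complex^'n"
  where "symb \<A> \<tau> \<xi> u = \<tau> *\<^sub>R u + (\<Sum>l\<in>UNIV. \<xi> $ l *\<^sub>R (\<A> l *v u))"

text \<open>The layer term is split into a scalar \<open>\<kappa>\<close>, smooth on the whole
  space-time, and a constant matrix. In the layer \<open>\<kappa>\<close> is \<open>\<mu>\<close>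
  times a smooth extension of the absorption, which itself may jump at the interface.\<close>

definition lower_op :: "(3 \<Rightarrow> complex^'n^'n) \<Rightarrow> (spacetime \<Rightarrow> real) \<Rightarrow> complex^'n^'n \<Rightarrow>
    (spacetime \<Rightarrow> complex^'n) \<Rightarrow> spacetime \<Rightarrow> complex^'n"
  where "lower_op \<A> \<kappa> C f p = principal \<A> f p + \<kappa> p *\<^sub>R (C *v f p)"

definition wkb :: "(3 \<Rightarrow> complex^'n^'n) \<Rightarrow> (spacetime \<Rightarrow> real) \<Rightarrow> complex^'n^'n \<Rightarrow> real \<Rightarrow> real^3 \<Rightarrow>
    spacetime set \<Rightarrow> (nat \<Rightarrow> spacetime \<Rightarrow> complex^'n) \<Rightarrow> bool"
  where "wkb \<A> \<kappa> C \<tau> \<xi> S G \<longleftrightarrow> (\<forall>j. \<forall>p\<in>S.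
    \<i> *s symb \<A> \<tau> \<xi> (G j p) + (if j = 0 then 0 else lower_op \<A> \<kappa> C (G (j - 1)) p) = 0)"

lemma bounded_linear_symb: "bounded_linear (symb \<A> \<tau> \<xi>)"
  unfolding symb_def
  by (intro bounded_linear_add bounded_linear_sum bounded_linear_const_scaleR
      bounded_linear_ident matrix_vector_mul_bounded_linear bounded_linear_compose[OF bounded_linear_scaleR_right])

lemma bounded_linear_smult: "bounded_linear (\<lambda>v::complex^'n. c *s v)"
  by (rule bounded_bilinear.bounded_linear_right[OF bounded_bilinear_vector_smult])

lemmas smooth_symb = bounded_linear.smooth_image[OF bounded_linear_symb]

lemma matrix_vector_scaleR: "(A :: complex^'n^'m) *v (c *\<^sub>R u) = c *\<^sub>R (A *v u)"
  by (rule linear_cmul[OF bounded_linear.linear[OF matrix_vector_mul_bounded_linear]])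

lemma scaleR_matrix_vector: "(c *\<^sub>R (A :: complex^'n^'m)) *v u = c *\<^sub>R (A *v u)"
  by (simp add: vec_eq_iff matrix_vector_mult_def scaleR_sum_right)

lemma symb_linear:
  "symb \<A> \<tau> \<xi> 0 = 0" "symb \<A> \<tau> \<xi> (u + v) = symb \<A> \<tau> \<xi> u + symb \<A> \<tau> \<xi> v"
  "symb \<A> \<tau> \<xi> (u - v) = symb \<A> \<tau> \<xi> u - symb \<A> \<tau> \<xi> v" "symb \<A> \<tau> \<xi> (- u) = - symb \<A> \<tau> \<xi> u"
  using bounded_linear.linear[OF bounded_linear_symb, of \<A> \<tau> \<xi>]
  by (auto simp: linear_0 linear_add linear_diff linear_neg)

lemma symb_smult: "symb \<A> \<tau> \<xi> (c *s u) = c *s symb \<A> \<tau> \<xi> u"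
  by (simp add: symb_def vector_scalar_commute vec_eq_iff sum_distrib_left algebra_simps)

lemma smooth_principal: "smooth f \<Longrightarrow> smooth (principal \<A> f)"
  unfolding principal_def[abs_def] by (intro smooth_intros)

lemma smooth_lower_op: "smooth f \<Longrightarrow> smooth \<kappa> \<Longrightarrow> smooth (lower_op \<A> \<kappa> C f)"
  unfolding lower_op_def[abs_def] by (intro smooth_intros smooth_principal)

lemma principal_cong_open:
  assumes "open U" "p \<in> U" "\<And>q. q \<in> U \<Longrightarrow> f q = g q" "smooth g"
  shows "principal \<A> f p = principal \<A> g p"
  unfolding principal_def using ddir_cong_open[OF assms] by simp

lemma lower_op_cong_open:
  assumes "open U" "p \<in> U" "\<And>q. q \<in> U \<Longrightarrow> f q = g q" "smooth g"
  shows "lower_op \<A> \<kappa> C f p = lower_op \<A> \<kappa> C g p"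
  unfolding lower_op_def using principal_cong_open[OF assms] assms by simp

lemma bounded_linear_phase: "bounded_linear (phase \<tau> \<xi>)"
  unfolding phase_def
  by (intro bounded_linear_add bounded_linear_compose[OF bounded_linear_mult_right bounded_linear_fst]
      bounded_linear_compose[OF bounded_linear_inner_right bounded_linear_snd])

text \<open>The phase is linear, so its derivatives are the constants \<open>\<tau>\<close> and
  \<open>\<xi> $ l\<close>, and conjugation by the exponential adds just the symbol with factor
  \<open>\<i> / \<epsilon>\<close>.\<close>

lemma principal_wave:
  fixes f :: "spacetime \<Rightarrow> complex^'n" and \<tau> \<epsilon> :: real and \<xi> :: "real^3"
  assumes f: "smooth f"
  defines "e \<equiv> \<lambda>p. exp (\<i> * complex_of_real (phase \<tau> \<xi> p / \<epsilon>))"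
  shows "principal \<A> (\<lambda>p. e p *s f p) p = e p *s ((\<i> / of_real \<epsilon>) *s symb \<A> \<tau> \<xi> (f p) + principal \<A> f p)"
proof -
  define k where "k = (\<lambda>p. \<i> * complex_of_real (phase \<tau> \<xi> p / \<epsilon>))"
  have k: "bounded_linear k"
    unfolding k_def
    by (intro bounded_linear_compose[OF bounded_linear_mult_right] bounded_linear_compose[OF bounded_linear_of_real]
        bounded_linear_compose[OF bounded_linear_divide] bounded_linear_phase)
  have ek: "e = (\<lambda>p. exp (k p))" by (simp add: e_def k_def)
  have e: "smooth e" unfolding ek by (rule smooth_exp[OF smooth_bounded_linear[OF k]])
  have de: "ddir v e = (\<lambda>p. e p * k v)" for v
    unfolding ek using ddir_exp[OF smooth_differentiable[OF smooth_bounded_linear[OF k]]]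
    by (simp add: ddir_bounded_linear[OF k] fun_eq_iff)
  have d: "ddir v (\<lambda>p. e p *s f p) p = e p *s (ddir v f p + k v *s f p)" for v
    by (simp add: ddir_smult[OF e f] de vector_add_ldistrib vector_smult_assoc)
  have kt: "k (1, 0) = (\<i> / of_real \<epsilon>) * of_real \<tau>" and kx: "k (0, axis l 1) = (\<i> / of_real \<epsilon>) * of_real (\<xi> $ l)" for l
    by (simp_all add: k_def phase_def inner_axis)
  have "principal \<A> (\<lambda>p. e p *s f p) p
    = e p *s ((Dt f p + k (1, 0) *s f p) + (\<Sum>l\<in>UNIV. \<A> l *v (Dx l f p + k (0, axis l 1) *s f p)))"
    unfolding principal_def d vector_scalar_commute
    by (simp only: vector_add_ldistrib linear_sum[OF bounded_linear.linear[OF bounded_linear_smult]])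
  also have "\<dots> = e p *s ((\<i> / of_real \<epsilon>) *s symb \<A> \<tau> \<xi> (f p) + principal \<A> f p)"
    unfolding kt kx principal_def symb_def
    by (simp add: vec_eq_iff matrix_vector_right_distrib vector_scalar_commute sum.distrib sum_distrib_left
        scaleR_conv_of_real[where 'a = complex] algebra_simps)
  finally show ?thesis .
qed

section \<open>Taylor coefficients in \<epsilon> of the residual of a wave\<close>

lemma ddir_funpow_bounded_linear:
  assumes "bounded_linear L" "smooth f"
  shows "(ddir v ^^ j) (\<lambda>x. L (f x)) = (\<lambda>x. L ((ddir v ^^ j) f x))"
  by (induction j)
    (simp_all add: bounded_linear.ddir_image[OF assms(1)] smooth_ddir_funpow[OF assms(2)])

lemma ddir_funpow_add:
  "smooth f \<Longrightarrow> smooth g \<Longrightarrow> (ddir v ^^ j) (\<lambda>x. f x + g x) = (\<lambda>x. (ddir v ^^ j) f x + (ddir v ^^ j) g x)"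
  by (induction j) (simp_all add: ddir_add smooth_ddir_funpow)

lemma ddir_funpow_sum:
  "(\<And>i. i \<in> I \<Longrightarrow> smooth (f i)) \<Longrightarrow>
    (ddir v ^^ j) (\<lambda>x. \<Sum>i\<in>I. f i x) = (\<lambda>x. \<Sum>i\<in>I. (ddir v ^^ j) (f i) x)"
  by (induction j) (simp_all add: ddir_sum smooth_ddir_funpow)

text \<open>At \<epsilon> = 0 only the second term survives: multiplication by \<epsilon> shifts
  Taylor coefficients. For \<open>j = 0\<close> the truncated \<open>j - 1\<close> is harmless
  because of the factor \<open>real j\<close>.\<close>

lemma ddir_funpow_fst_scaleR:
  fixes f :: "real \<times> 'a::euclidean_space \<Rightarrow> 'b::real_normed_vector"
  assumes f: "smooth f"
  shows "(ddir (1, 0) ^^ j) (\<lambda>q. fst q *\<^sub>R f q)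
    = (\<lambda>q. fst q *\<^sub>R (ddir (1, 0) ^^ j) f q + real j *\<^sub>R (ddir (1, 0) ^^ (j - 1)) f q)"
proof (induction j)
  case (Suc j)
  have s: "smooth (\<lambda>q::real \<times> 'a. fst q)" by (intro smooth_intros)
  have d: "ddir (1, 0) (\<lambda>q::real \<times> 'a. fst q) = (\<lambda>q. 1)"
    by (simp add: ddir_bounded_linear bounded_linear_fst)
  have "(ddir (1, 0) ^^ Suc j) (\<lambda>q. fst q *\<^sub>R f q)
    = ddir (1, 0) (\<lambda>q. fst q *\<^sub>R (ddir (1, 0) ^^ j) f q + real j *\<^sub>R (ddir (1, 0) ^^ (j - 1)) f q)"
    by (simp add: Suc)
  also have "\<dots> = (\<lambda>q. fst q *\<^sub>R (ddir (1, 0) ^^ Suc j) f q + (ddir (1, 0) ^^ j) f q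
      + real j *\<^sub>R ddir (1, 0) ((ddir (1, 0) ^^ (j - 1)) f) q)"
    using f by (simp add: ddir_add ddir_scaleR s d smooth_scaleR smooth_ddir_funpow smooth_scaleR_const
        ddir_scaleR_const)
  also have "\<dots> = (\<lambda>q. fst q *\<^sub>R (ddir (1, 0) ^^ Suc j) f q + real (Suc j) *\<^sub>R (ddir (1, 0) ^^ j) f q)"
    by (cases j) (auto simp: algebra_simps scaleR_2)
  finally show ?case by simp
qed simp

lemma ddir_funpow_snd_scaleR:
  fixes f :: "real \<times> 'a::euclidean_space \<Rightarrow> 'b::real_normed_vector"
  assumes f: "smooth f" and k: "smooth k"
  shows "(ddir (1, 0) ^^ j) (\<lambda>q. k (snd q) *\<^sub>R f q) = (\<lambda>q. k (snd q) *\<^sub>R (ddir (1, 0) ^^ j) f q)"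
proof (induction j)
  case (Suc j)
  have s: "smooth (\<lambda>q::real \<times> 'a. snd q)" by (intro smooth_intros)
  have d: "ddir (1, 0) (\<lambda>q::real \<times> 'a. k (snd q)) = (\<lambda>q. 0)"
    by (rule ext) (simp add: ddir_compose[OF k s] ddir_bounded_linear bounded_linear_snd ddir_dir_zero[OF k])
  show ?case
    using f by (simp add: Suc ddir_scaleR smooth_compose[OF k s] d smooth_ddir_funpow)
qed simp

lemma smooth_slice:
  fixes g :: "real \<times> 'a::euclidean_space \<Rightarrow> 'b::real_normed_vector"
  shows "smooth g \<Longrightarrow> smooth (\<lambda>p. g (c, p))"
  by (rule smooth_compose, assumption, intro smooth_intros)

lemma ddir_slice:
  fixes g :: "real \<times> 'a::euclidean_space \<Rightarrow> 'b::real_normed_vector"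
  assumes "smooth g"
  shows "ddir u (\<lambda>p. g (c, p)) p = ddir (0, u) g (c, p)"
proof -
  have "ddir u (\<lambda>p. (c, p)) p = (0, u)"
    by (rule ddir_eqI) (auto intro!: derivative_eq_intros)
  then show ?thesis
    by (subst ddir_compose[OF assms]) (auto intro!: smooth_intros)
qed

lemma smooth_taylor:
  fixes g :: "real \<times> 'a::euclidean_space \<Rightarrow> 'b::real_normed_vector"
  shows "smooth g \<Longrightarrow> smooth (taylor j g)"
  by (intro smooth_scaleR_const smooth_slice smooth_ddir_funpow)

text \<open>This is \<epsilon> times the residual of the wave with amplitude \<open>g\<close>,
  stripped of the exponential, and therefore smooth up to \<epsilon> = 0.\<close>

definition wkb_residual :: "(3 \<Rightarrow> complex^'n^'n) \<Rightarrow> (spacetime \<Rightarrow> real) \<Rightarrow> complex^'n^'n \<Rightarrow> real \<Rightarrow> real^3 \<Rightarrow>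
    (real \<times> spacetime \<Rightarrow> complex^'n) \<Rightarrow> real \<times> spacetime \<Rightarrow> complex^'n"
  where "wkb_residual \<A> \<kappa> C \<tau> \<xi> g q = \<i> *s symb \<A> \<tau> \<xi> (g q)
    + fst q *\<^sub>R (ddir (0, (1, 0)) g q + (\<Sum>l\<in>UNIV. \<A> l *v ddir (0, (0, axis l 1)) g q)
        + \<kappa> (snd q) *\<^sub>R (C *v g q))"

lemma smooth_wkb_residual:
  assumes "smooth g" "smooth \<kappa>"
  shows "smooth (wkb_residual \<A> \<kappa> C \<tau> \<xi> g)"
  unfolding wkb_residual_def[abs_def]
  by (intro smooth_intros smooth_symb smooth_compose[OF assms(2)] assms)

text \<open>The factor \<epsilon> in front of the lower-order part shifts its index by one, and the
  factor \<open>j\<close> from the product rule cancels against the factorials. This produces the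
  recursion in \<open>wkb\<close>.\<close>

lemma taylor_wkb_residual:
  assumes g: "smooth g" and \<kappa>: "smooth \<kappa>"
  shows "taylor j (wkb_residual \<A> \<kappa> C \<tau> \<xi> g) p = \<i> *s symb \<A> \<tau> \<xi> (taylor j g p)
    + (if j = 0 then 0 else lower_op \<A> \<kappa> C (taylor (j - 1) g) p)"
proof -
  have bl: "bounded_linear (\<lambda>u. \<i> *s symb \<A> \<tau> \<xi> u)"
    by (rule bounded_linear_compose[OF bounded_linear_smult bounded_linear_symb])
  define F where "F = (\<lambda>q. ddir (0, (1, 0)) g q + (\<Sum>l\<in>UNIV. \<A> l *v ddir (0, (0, axis l 1)) g q)
        + \<kappa> (snd q) *\<^sub>R (C *v g q))"
  have F: "smooth F"
    unfolding F_def by (intro smooth_intros smooth_compose[OF \<kappa>] g)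
  have 1: "(ddir (1, 0) ^^ j) (wkb_residual \<A> \<kappa> C \<tau> \<xi> g) (0, p)
    = \<i> *s symb \<A> \<tau> \<xi> ((ddir (1, 0) ^^ j) g (0, p)) + real j *\<^sub>R (ddir (1, 0) ^^ (j - 1)) F (0, p)"
  proof -
    have "wkb_residual \<A> \<kappa> C \<tau> \<xi> g = (\<lambda>q. \<i> *s symb \<A> \<tau> \<xi> (g q) + fst q *\<^sub>R F q)"
      by (simp add: wkb_residual_def F_def fun_eq_iff)
    moreover have "smooth (\<lambda>q. \<i> *s symb \<A> \<tau> \<xi> (g q))"
      by (rule bounded_linear.smooth_image[OF bl g])
    moreover have "smooth (\<lambda>q. fst q *\<^sub>R F q)" by (intro smooth_intros F)
    ultimately show ?thesis
      by (simp add: ddir_funpow_add ddir_funpow_bounded_linear[OF bl g] ddir_funpow_fst_scaleR[OF F])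
  qed
  have 2: "(ddir (1, 0) ^^ i) F (0, p) = fact i *\<^sub>R lower_op \<A> \<kappa> C (taylor i g) p" for i
  proof -
    have "(ddir (1, 0) ^^ i) F (0, p) = (ddir (1, 0) ^^ i) (ddir (0, (1, 0)) g) (0, p)
      + (\<Sum>l\<in>UNIV. \<A> l *v (ddir (1, 0) ^^ i) (ddir (0, (0, axis l 1)) g) (0, p))
      + \<kappa> p *\<^sub>R (C *v (ddir (1, 0) ^^ i) g (0, p))"
    proof -
      have s1: "smooth (ddir (0, (1, 0)) g)" "smooth (\<lambda>q. C *v g q)"
        "\<And>l. smooth (\<lambda>q. \<A> l *v ddir (0, (0, axis l 1)) g q)"
        "\<And>l. smooth (ddir (0, (0, axis l 1)) g)"
        by (intro smooth_intros g)+
      then have s2: "smooth (\<lambda>q. \<Sum>l\<in>UNIV. \<A> l *v ddir (0, (0, axis l 1)) g q)"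
        "smooth (\<lambda>q. \<kappa> (snd q) *\<^sub>R (C *v g q))"
        "smooth (\<lambda>q. ddir (0, (1, 0)) g q + (\<Sum>l\<in>UNIV. \<A> l *v ddir (0, (0, axis l 1)) g q))"
        by (intro smooth_intros smooth_compose[OF \<kappa>] g)+
      show ?thesis
        unfolding F_def ddir_funpow_add[OF s2(3,2)] ddir_funpow_add[OF s1(1) s2(1)] ddir_funpow_sum[OF s1(3)]
          ddir_funpow_snd_scaleR[OF s1(2) \<kappa>] ddir_funpow_bounded_linear[OF matrix_vector_mul_bounded_linear g]
          ddir_funpow_bounded_linear[OF matrix_vector_mul_bounded_linear s1(4)] by simp
    qed
    also have "\<dots> = ddir (0, (1, 0)) ((ddir (1, 0) ^^ i) g) (0, p)
      + (\<Sum>l\<in>UNIV. \<A> l *v ddir (0, (0, axis l 1)) ((ddir (1, 0) ^^ i) g) (0, p))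
      + \<kappa> p *\<^sub>R (C *v (ddir (1, 0) ^^ i) g (0, p))"
      by (simp add: ddir_funpow_commute[OF g])
    also have "\<dots> = fact i *\<^sub>R lower_op \<A> \<kappa> C (taylor i g) p"
      using g
      by (simp add: lower_op_def principal_def ddir_scaleR_const smooth_slice smooth_ddir_funpow ddir_slice
          scaleR_add_right scaleR_sum_right matrix_vector_scaleR)
    finally show ?thesis .
  qed
  have "taylor j (wkb_residual \<A> \<kappa> C \<tau> \<xi> g) p = \<i> *s symb \<A> \<tau> \<xi> (taylor j g p)
      + (real j / fact j * fact (j - 1)) *\<^sub>R lower_op \<A> \<kappa> C (taylor (j - 1) g) p"
    unfolding 1 2
    using linear_cmul[OF bounded_linear.linear[OF bl], of "1 / fact j" "(ddir (1, 0) ^^ j) g (0, p)"]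
    by (simp add: scaleR_add_right)
  moreover have "real j / fact j * fact (j - 1) = (if j = 0 then 0 else 1)"
    by (cases j) auto
  ultimately show ?thesis by simp
qed

text \<open>The phase factor has modulus one, so \<epsilon> times the residual has the norm of
  \<open>wkb_residual\<close>; one lost power of \<epsilon> does not matter at infinite order.
  \<open>B\<close> is the actual layer coefficient, which has to agree with \<open>\<kappa>\<close>
  times \<open>C\<close> on \<open>U\<close> alone.\<close>

lemma O_eps_wave_iff:
  fixes b :: "real \<Rightarrow> spacetime \<Rightarrow> complex^'n"
  assumes U: "open U" and g: "smooth g" and \<epsilon>\<^sub>0: "\<epsilon>\<^sub>0 > 0"
    and b: "\<And>\<epsilon> p. 0 < \<epsilon> \<Longrightarrow> \<epsilon> < \<epsilon>\<^sub>0 \<Longrightarrow> p \<in> U \<Longrightarrow> b \<epsilon> p = g (\<epsilon>, p)"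
    and \<kappa>: "smooth \<kappa>" and B: "\<And>p u. p \<in> U \<Longrightarrow> B p *v u = \<kappa> p *\<^sub>R (C *v u)"
  shows "O_eps_infinity U (\<lambda>\<epsilon> p. principal \<A> (wave \<tau> \<xi> b \<epsilon>) p + B p *v wave \<tau> \<xi> b \<epsilon> p)
    \<longleftrightarrow> wkb \<A> \<kappa> C \<tau> \<xi> U (\<lambda>j. taylor j g)" (is "O_eps_infinity U ?r \<longleftrightarrow> _")
proof -
  define h where "h = wkb_residual \<A> \<kappa> C \<tau> \<xi> g"
  have h: "smooth h" unfolding h_def by (rule smooth_wkb_residual[OF g \<kappa>])
  have r: "norm (h (\<epsilon>, p)) = \<epsilon> * norm (?r \<epsilon> p)" if \<epsilon>: "0 < \<epsilon>" "\<epsilon> < \<epsilon>\<^sub>0" and p: "p \<in> U" for \<epsilon> p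
  proof -
    define e where "e = (\<lambda>p. exp (\<i> * complex_of_real (phase \<tau> \<xi> p / \<epsilon>)))"
    have ge: "smooth (\<lambda>p. g (\<epsilon>, p))" by (rule smooth_slice[OF g])
    have es: "smooth e" unfolding e_def
      by (intro smooth_exp smooth_bounded_linear bounded_linear_compose[OF bounded_linear_mult_right]
          bounded_linear_compose[OF bounded_linear_of_real] bounded_linear_compose[OF bounded_linear_divide] bounded_linear_phase)
    have w: "wave \<tau> \<xi> b \<epsilon> q = e q *s g (\<epsilon>, q)" if "q \<in> U" for q
      using b[OF \<epsilon> that] by (simp add: wave_def e_def)
    have "principal \<A> (wave \<tau> \<xi> b \<epsilon>) p = principal \<A> (\<lambda>p. e p *s g (\<epsilon>, p)) p"
      by (rule principal_cong_open[OF U p w]) (auto intro: smooth_smult es ge)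
    also have "\<dots> = e p *s ((\<i> / of_real \<epsilon>) *s symb \<A> \<tau> \<xi> (g (\<epsilon>, p)) + principal \<A> (\<lambda>p. g (\<epsilon>, p)) p)"
      unfolding e_def by (rule principal_wave[OF ge])
    finally have pr: "principal \<A> (wave \<tau> \<xi> b \<epsilon>) p
      = e p *s ((\<i> / of_real \<epsilon>) *s symb \<A> \<tau> \<xi> (g (\<epsilon>, p)) + principal \<A> (\<lambda>p. g (\<epsilon>, p)) p)" .
    have "of_real \<epsilon> *s ?r \<epsilon> p = e p *s h (\<epsilon>, p)"
      using \<epsilon>(1) unfolding pr w[OF p] B[OF p]
      by (simp add: h_def wkb_residual_def principal_def ddir_slice[OF g] vec_eq_iff vector_scalar_commute
          scaleR_conv_of_real[where 'a = complex] algebra_simps)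
    then have "norm (of_real \<epsilon> *s ?r \<epsilon> p) = norm (e p *s h (\<epsilon>, p))" by (rule arg_cong)
    then show ?thesis using \<epsilon>(1) unfolding norm_vector_smult by (simp add: e_def)
  qed
  have "O_eps_infinity U ?r \<longleftrightarrow> (\<forall>j. \<forall>p\<in>U. (ddir (1, 0) ^^ j) h (0, p) = 0)"
  proof
    assume O: "O_eps_infinity U ?r"
    have "norm (h (\<epsilon>, p)) \<le> norm (?r \<epsilon> p)" if "0 < \<epsilon>" "\<epsilon> < min \<epsilon>\<^sub>0 1" "p \<in> U" for \<epsilon> p
      using r[of \<epsilon> p] that by (simp add: mult_left_le_one_le)
    then show "\<forall>j. \<forall>p\<in>U. (ddir (1, 0) ^^ j) h (0, p) = 0"
      using taylor_zero_if_O_eps[OF h O, of "min \<epsilon>\<^sub>0 1"] \<epsilon>\<^sub>0 by auto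
  next
    assume z: "\<forall>j. \<forall>p\<in>U. (ddir (1, 0) ^^ j) h (0, p) = 0"
    show "O_eps_infinity U ?r"
      unfolding O_eps_infinity_def
    proof
      fix n
      have "O_eps (Suc n - 1) U ?r"
        by (rule O_eps_if_taylor_zero[OF h _ \<epsilon>\<^sub>0]) (use z r in auto)
      then show "O_eps n U ?r" by simp
    qed
  qed
  also have "\<dots> \<longleftrightarrow> (\<forall>j. \<forall>p\<in>U. taylor j h p = 0)" by simp
  also have "\<dots> \<longleftrightarrow> wkb \<A> \<kappa> C \<tau> \<xi> U (\<lambda>j. taylor j g)"
    unfolding h_def taylor_wkb_residual[OF g \<kappa>] wkb_def ..
  finally show ?thesis .
qed

lemma wkb_cong_open:
  assumes U: "open U" and "\<And>j p. p \<in> U \<Longrightarrow> G j p = H j p" "\<And>j. smooth (H j)"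
  shows "wkb \<A> \<kappa> C \<tau> \<xi> U G \<longleftrightarrow> wkb \<A> \<kappa> C \<tau> \<xi> U H"
  unfolding wkb_def using lower_op_cong_open[OF U _ assms(2,3)] assms(2) by (auto cong: if_cong)

section \<open>From the open half spaces to their closures\<close>

lemma convex_left: "convex left" and convex_right: "convex right"
  and closed_left: "closed left" and closed_right: "closed right"
  and closure_interior_left: "closure (interior left) = left"
  and closure_interior_right: "closure (interior right) = right"
proof -
  define a :: spacetime where "a = (0, axis 1 1)"
  have a: "a \<bullet> p = snd p $ 1" for p
    by (simp add: a_def inner_prod_def inner_axis' )
  have L: "left = {p. a \<bullet> p \<le> 0}" and R: "right = {p. a \<bullet> p \<ge> 0}"
    by (auto simp: left_def right_def a)
  have a0: "a \<noteq> 0" by (simp add: a_def prod_eq_iff axis_eq_0_iff)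
  show c: "convex left" "convex right" "closed left" "closed right"
    unfolding L R by (auto intro: convex_halfspace_le convex_halfspace_ge closed_halfspace_le closed_halfspace_ge)
  have "interior left = {p. a \<bullet> p < 0}" "interior right = {p. a \<bullet> p > 0}"
    unfolding L R using a0 by auto
  moreover have "- a \<in> {p. a \<bullet> p < 0}" "a \<in> {p. a \<bullet> p > 0}" using a0 by auto
  ultimately have "interior left \<noteq> {}" "interior right \<noteq> {}" by blast+
  then show "closure (interior left) = left" "closure (interior right) = right"
    using convex_closure_interior c closure_closed by metis+
qed

lemma interior_left: "interior left = {p. snd p $ 1 < 0}"
  and interior_right: "interior right = {p. snd p $ 1 > 0}"
proof -
  define a :: spacetime where "a = (0, axis 1 1)"
  have a: "a \<bullet> p = snd p $ 1" for p
    by (simp add: a_def inner_prod_def inner_axis')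
  have a0: "a \<noteq> 0" by (simp add: a_def prod_eq_iff axis_eq_0_iff)
  have L: "left = {p. a \<bullet> p \<le> 0}" and R: "right = {p. a \<bullet> p \<ge> 0}"
    by (auto simp: left_def right_def a)
  have "interior left = {p. a \<bullet> p < 0}" "interior right = {p. a \<bullet> p > 0}"
    unfolding L R using a0 by auto
  then show "interior left = {p. snd p $ 1 < 0}" "interior right = {p. snd p $ 1 > 0}"
    by (simp_all add: a)
qed

text \<open>Residuals are controlled at interior points; continuity carries the resulting identities
  to the interface, where traces are taken.\<close>

lemma vanish_on_closure:
  assumes "smooth f" "\<And>p. p \<in> interior S \<Longrightarrow> f p = 0" "closure (interior S) = S" "p \<in> S"
  shows "f p = 0"
proof -
  have "closed {p. f p = 0}"
    using closed_Collect_eq[of f "\<lambda>_. 0"] smooth_imp_continuous[OF assms(1)] by simp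
  then have "closure (interior S) \<subseteq> {p. f p = 0}"
    using assms(2) by (intro closure_minimal) auto
  then show ?thesis using assms(3,4) by auto
qed

lemma wkb_closure:
  assumes G: "\<And>j. smooth (G j)" and \<kappa>: "smooth \<kappa>" and S: "closure (interior S) = S"
  shows "wkb \<A> \<kappa> C \<tau> \<xi> (interior S) G \<longleftrightarrow> wkb \<A> \<kappa> C \<tau> \<xi> S G"
proof
  assume w: "wkb \<A> \<kappa> C \<tau> \<xi> (interior S) G"
  show "wkb \<A> \<kappa> C \<tau> \<xi> S G"
    unfolding wkb_def
  proof (intro allI ballI)
    fix j p assume p: "p \<in> S"
    have "smooth (\<lambda>p. \<i> *s symb \<A> \<tau> \<xi> (G j p) + (if j = 0 then 0 else lower_op \<A> \<kappa> C (G (j - 1)) p))"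
      by (cases j) (auto intro!: smooth_add smooth_smult_const smooth_symb smooth_lower_op G \<kappa>)
    from vanish_on_closure[OF this _ S p] w
    show "\<i> *s symb \<A> \<tau> \<xi> (G j p) + (if j = 0 then 0 else lower_op \<A> \<kappa> C (G (j - 1)) p) = 0"
      unfolding wkb_def by blast
  qed
next
  assume "wkb \<A> \<kappa> C \<tau> \<xi> S G"
  then show "wkb \<A> \<kappa> C \<tau> \<xi> (interior S) G"
    unfolding wkb_def using interior_subset by blast
qed

section \<open>The conditions on the waves as equations for the coefficients\<close>

lemma expansionE:
  assumes "expansion S b a"
  obtains g \<epsilon>\<^sub>0 where "smooth g" "\<epsilon>\<^sub>0 > 0"
    "\<And>\<epsilon> p. 0 < \<epsilon> \<Longrightarrow> \<epsilon> < \<epsilon>\<^sub>0 \<Longrightarrow> p \<in> S \<Longrightarrow> b \<epsilon> p = g (\<epsilon>, p)"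
    "\<And>j p. p \<in> S \<Longrightarrow> a j p = taylor j g p"
proof -
  from assms obtain g \<epsilon>\<^sub>0 where *: "smooth g \<and> \<epsilon>\<^sub>0 > 0
     \<and> (\<forall>\<epsilon> p. 0 < \<epsilon> \<and> \<epsilon> < \<epsilon>\<^sub>0 \<and> p \<in> S \<longrightarrow> b \<epsilon> p = g (\<epsilon>, p))
     \<and> (\<forall>j. \<forall>p\<in>S. a j p = taylor j g p)"
    unfolding expansion_def by (elim exE)
  from * have 1: "smooth g" "\<epsilon>\<^sub>0 > 0"
    and 2: "\<forall>\<epsilon> p. 0 < \<epsilon> \<and> \<epsilon> < \<epsilon>\<^sub>0 \<and> p \<in> S \<longrightarrow> b \<epsilon> p = g (\<epsilon>, p)"
    and 3: "\<forall>j. \<forall>p\<in>S. a j p = taylor j g p" by blast+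
  show ?thesis by (rule that[OF 1]) (use 2 3 in blast)+
qed

lemma expansion_exists:
  fixes G :: "nat \<Rightarrow> spacetime \<Rightarrow> complex^'n"
  assumes "\<And>j. smooth (G j)" "\<And>j p. p \<in> S \<Longrightarrow> a j p = G j p"
  obtains b where "expansion S b a"
proof -
  obtain g where g: "smooth g" "\<And>j p. taylor j g p = G j p"
    using borel[of G] assms(1) by blast
  have "expansion S (\<lambda>\<epsilon> p. g (\<epsilon>, p)) a"
    unfolding expansion_def using g assms(2) by (intro exI[of _ g] exI[of _ 1]) auto
  then show ?thesis using that by blast
qed

text \<open>The conditions depend on the amplitudes only through their coefficients, so they are
  rewritten for fixed amplitudes first. \<open>\<kappa>\<close> and \<open>C\<^sub>0\<close> have to
  match the layer only for positive \<open>x_1\<close>, which admits a jump of the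
  absorption.\<close>

lemma transmission_iff:
  fixes \<A> :: "3 \<Rightarrow> complex^'n^'n"
  assumes aI: "\<And>j. smooth (aI j)"
    and HR: "\<And>j. smooth (HR j)" "\<And>j p. p \<in> left \<Longrightarrow> aR j p = HR j p"
    and HT: "\<And>j. smooth (HT j)" "\<And>j p. p \<in> right \<Longrightarrow> aT j p = HT j p"
    and \<kappa>: "smooth \<kappa>" and C: "\<And>p u. snd p $ 1 > 0 \<Longrightarrow> \<mu> *\<^sub>R (C (snd p $ 1) *v u) = \<kappa> p *\<^sub>R (C\<^sub>0 *v u)"
  shows "transmission \<A> C \<mu> \<tau> \<xi> aI aR aT \<longleftrightarrow>
    (\<forall>j x. ((0, x) \<in> left \<longrightarrow> HR j (0, x) = 0) \<and> ((0, x) \<in> right \<longrightarrow> HT j (0, x) = 0))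
    \<and> wkb \<A> (\<lambda>_. 0) 0 \<tau> \<xi> UNIV aI
    \<and> wkb \<A> (\<lambda>_. 0) 0 \<tau> (reflect \<xi>) left HR
    \<and> wkb \<A> \<kappa> C\<^sub>0 \<tau> \<xi> right HT
    \<and> (\<forall>j. \<forall>p\<in>interface. \<A> 1 *v (aI j p + HR j p - HT j p) = 0)"
proof -
  have pre: "(\<forall>j. smooth_upto left (aR j) \<and> smooth_upto right (aT j)
        \<and> (\<forall>x. (0, x) \<in> left \<longrightarrow> aR j (0, x) = 0)
        \<and> (\<forall>x. (0, x) \<in> right \<longrightarrow> aT j (0, x) = 0))
    \<longleftrightarrow> (\<forall>j x. ((0, x) \<in> left \<longrightarrow> HR j (0, x) = 0) \<and> ((0, x) \<in> right \<longrightarrow> HT j (0, x) = 0))"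
  proof -
    have "smooth_upto left (aR j)" for j
      unfolding smooth_upto_def by (rule exI[of _ "HR j"]) (simp add: HR)
    moreover have "smooth_upto right (aT j)" for j
      unfolding smooth_upto_def by (rule exI[of _ "HT j"]) (simp add: HT)
    ultimately show ?thesis using HR(2) HT(2) by auto
  qed
  have iff: "(let U = wave \<tau> \<xi> bI; V = wave \<tau> (reflect \<xi>) bR; W = wave \<tau> \<xi> bT in
             O_eps_infinity UNIV (\<lambda>\<epsilon>. principal \<A> (U \<epsilon>))
           \<and> O_eps_infinity (interior left) (\<lambda>\<epsilon>. principal \<A> (V \<epsilon>))
           \<and> O_eps_infinity (interior right) (\<lambda>\<epsilon>. full_op \<A> C \<mu> (W \<epsilon>))
           \<and> O_eps_infinity interface (\<lambda>\<epsilon> p. \<A> 1 *v (U \<epsilon> p + V \<epsilon> p) - \<A> 1 *v W \<epsilon> p))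
    \<longleftrightarrow> wkb \<A> (\<lambda>_. 0) 0 \<tau> \<xi> UNIV aI
    \<and> wkb \<A> (\<lambda>_. 0) 0 \<tau> (reflect \<xi>) left HR
    \<and> wkb \<A> \<kappa> C\<^sub>0 \<tau> \<xi> right HT
    \<and> (\<forall>j. \<forall>p\<in>interface. \<A> 1 *v (aI j p + HR j p - HT j p) = 0)"
    if b: "expansion UNIV bI aI" "expansion left bR aR" "expansion right bT aT" for bI bR bT
  proof -
    from b(1) obtain gI eI where gI: "smooth gI" "eI > 0" "\<And>\<epsilon> p. 0 < \<epsilon> \<Longrightarrow> \<epsilon> < eI \<Longrightarrow> bI \<epsilon> p = gI (\<epsilon>, p)"
      "\<And>j p. aI j p = taylor j gI p" by (rule expansionE) simp
    from b(2) obtain gR eR where gR: "smooth gR" "eR > 0"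
      "\<And>\<epsilon> p. 0 < \<epsilon> \<Longrightarrow> \<epsilon> < eR \<Longrightarrow> p \<in> left \<Longrightarrow> bR \<epsilon> p = gR (\<epsilon>, p)"
      "\<And>j p. p \<in> left \<Longrightarrow> aR j p = taylor j gR p" by (rule expansionE) (rule that; simp)
    from b(3) obtain gT eT where gT: "smooth gT" "eT > 0"
      "\<And>\<epsilon> p. 0 < \<epsilon> \<Longrightarrow> \<epsilon> < eT \<Longrightarrow> p \<in> right \<Longrightarrow> bT \<epsilon> p = gT (\<epsilon>, p)"
      "\<And>j p. p \<in> right \<Longrightarrow> aT j p = taylor j gT p" by (rule expansionE) (rule that; simp)
    have intL: "p \<in> interior left \<Longrightarrow> p \<in> left" and intR: "p \<in> interior right \<Longrightarrow> p \<in> right" for p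
      using interior_subset by blast+
    have 1: "O_eps_infinity UNIV (\<lambda>\<epsilon>. principal \<A> (wave \<tau> \<xi> bI \<epsilon>)) \<longleftrightarrow> wkb \<A> (\<lambda>_. 0) 0 \<tau> \<xi> UNIV aI"
    proof -
      have "O_eps_infinity UNIV (\<lambda>\<epsilon>. principal \<A> (wave \<tau> \<xi> bI \<epsilon>)) \<longleftrightarrow> wkb \<A> (\<lambda>_. 0) 0 \<tau> \<xi> UNIV (\<lambda>j. taylor j gI)"
        using O_eps_wave_iff[OF open_UNIV gI(1,2) gI(3), where B = "\<lambda>_. 0" and \<kappa> = "\<lambda>_. 0" and C = 0] by simp
      moreover have "aI = (\<lambda>j. taylor j gI)" using gI(4) by (simp add: fun_eq_iff)
      ultimately show ?thesis by simp
    qed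
    have 2: "O_eps_infinity (interior left) (\<lambda>\<epsilon>. principal \<A> (wave \<tau> (reflect \<xi>) bR \<epsilon>))
        \<longleftrightarrow> wkb \<A> (\<lambda>_. 0) 0 \<tau> (reflect \<xi>) left HR"
    proof -
      have "O_eps_infinity (interior left) (\<lambda>\<epsilon>. principal \<A> (wave \<tau> (reflect \<xi>) bR \<epsilon>))
        \<longleftrightarrow> wkb \<A> (\<lambda>_. 0) 0 \<tau> (reflect \<xi>) (interior left) (\<lambda>j. taylor j gR)"
        using O_eps_wave_iff[OF open_interior gR(1,2) gR(3)[OF _ _ intL], where B = "\<lambda>_. 0" and \<kappa> = "\<lambda>_. 0" and C = 0]
        by simp
      also have "\<dots> \<longleftrightarrow> wkb \<A> (\<lambda>_. 0) 0 \<tau> (reflect \<xi>) (interior left) HR"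
        by (rule wkb_cong_open) (use HR gR(4) intL in auto)
      also have "\<dots> \<longleftrightarrow> wkb \<A> (\<lambda>_. 0) 0 \<tau> (reflect \<xi>) left HR"
        by (rule wkb_closure[OF HR(1) _ closure_interior_left]) simp
      finally show ?thesis .
    qed
    have 3: "O_eps_infinity (interior right) (\<lambda>\<epsilon>. full_op \<A> C \<mu> (wave \<tau> \<xi> bT \<epsilon>)) \<longleftrightarrow> wkb \<A> \<kappa> C\<^sub>0 \<tau> \<xi> right HT"
    proof -
      have "O_eps_infinity (interior right) (\<lambda>\<epsilon>. full_op \<A> C \<mu> (wave \<tau> \<xi> bT \<epsilon>))
        \<longleftrightarrow> O_eps_infinity (interior right) (\<lambda>\<epsilon> p. principal \<A> (wave \<tau> \<xi> bT \<epsilon>) p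
             + (\<mu> *\<^sub>R C (snd p $ 1)) *v wave \<tau> \<xi> bT \<epsilon> p)"
        by (simp add: full_op_def[abs_def] scaleR_matrix_vector)
      also have "\<dots> \<longleftrightarrow> wkb \<A> \<kappa> C\<^sub>0 \<tau> \<xi> (interior right) (\<lambda>j. taylor j gT)"
        by (rule O_eps_wave_iff[OF open_interior gT(1,2) gT(3)[OF _ _ intR] \<kappa>])
          (use C in \<open>auto simp: interior_right scaleR_matrix_vector\<close>)
      also have "\<dots> \<longleftrightarrow> wkb \<A> \<kappa> C\<^sub>0 \<tau> \<xi> (interior right) HT"
        by (rule wkb_cong_open) (use HT gT(4) intR in auto)
      also have "\<dots> \<longleftrightarrow> wkb \<A> \<kappa> C\<^sub>0 \<tau> \<xi> right HT"
        by (rule wkb_closure[OF HT(1) \<kappa> closure_interior_right])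
      finally show ?thesis .
    qed
    have 4: "O_eps_infinity interface (\<lambda>\<epsilon> p. \<A> 1 *v (wave \<tau> \<xi> bI \<epsilon> p + wave \<tau> (reflect \<xi>) bR \<epsilon> p) - \<A> 1 *v wave \<tau> \<xi> bT \<epsilon> p)
      \<longleftrightarrow> (\<forall>j. \<forall>p\<in>interface. \<A> 1 *v (aI j p + HR j p - HT j p) = 0)"
      (is "O_eps_infinity interface ?r \<longleftrightarrow> _")
    proof -
      define h where "h = (\<lambda>q. \<A> 1 *v (gI q + gR q - gT q))"
      have h: "smooth h" unfolding h_def by (intro smooth_intros gI gR gT)
      have IL: "p \<in> left" and IR: "p \<in> right" if "p \<in> interface" for p
        using that by (auto simp: interface_def left_def right_def)
      define e0 where "e0 = min eI (min eR eT)"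
      have e0: "e0 > 0" using gI gR gT by (simp add: e0_def)
      have r: "norm (?r \<epsilon> p) = norm (h (\<epsilon>, p))" if \<epsilon>: "0 < \<epsilon>" "\<epsilon> < e0" and p: "p \<in> interface" for \<epsilon> p
      proof -
        \<comment> \<open>The wave vectors differ only in the normal component, which the phase does
          not see on the interface; all three waves share one oscillating factor.\<close>
        have "phase \<tau> (reflect \<xi>) p = phase \<tau> \<xi> p"
          using p by (auto simp: phase_def interface_def reflect_def inner_vec_def sum_3)
        moreover have "bI \<epsilon> p = gI (\<epsilon>, p)" "bR \<epsilon> p = gR (\<epsilon>, p)" "bT \<epsilon> p = gT (\<epsilon>, p)"
          using gI(3)[of \<epsilon> p] gR(3)[OF _ _ IL[OF p], of \<epsilon>] gT(3)[OF _ _ IR[OF p], of \<epsilon>] \<epsilon>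
          by (simp_all add: e0_def)
        ultimately have "?r \<epsilon> p = exp (\<i> * complex_of_real (phase \<tau> \<xi> p / \<epsilon>)) *s h (\<epsilon>, p)"
          by (simp only: wave_def h_def matrix_vector_mult_diff_distrib matrix_vector_right_distrib
              vector_scalar_commute) (simp add: vec_eq_iff algebra_simps)
        then show ?thesis by (simp add: norm_vector_smult)
      qed
      have t: "taylor j h p = \<A> 1 *v (aI j p + HR j p - HT j p)" if p: "p \<in> interface" for j p
      proof -
        have "(ddir (1, 0) ^^ j) (\<lambda>q. gI q + gR q - gT q) = (\<lambda>q. (ddir (1, 0) ^^ j) gI q + (ddir (1, 0) ^^ j) gR q - (ddir (1, 0) ^^ j) gT q)"
          by (induction j) (simp_all add: ddir_add ddir_diff smooth_add smooth_diff smooth_ddir_funpow gI(1) gR(1) gT(1))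
        moreover have "smooth (\<lambda>q. gI q + gR q - gT q)" by (intro smooth_intros gI gR gT)
        ultimately have "taylor j h p = \<A> 1 *v (taylor j gI p + taylor j gR p - taylor j gT p)"
          unfolding h_def
          by (simp add: ddir_funpow_bounded_linear[OF matrix_vector_mul_bounded_linear]
              matrix_vector_scaleR[symmetric] scaleR_add_right scaleR_diff_right)
        then show ?thesis using gI(4) gR(4)[OF IL[OF p]] gT(4)[OF IR[OF p]] HR(2)[OF IL[OF p]] HT(2)[OF IR[OF p]] by simp
      qed
      have "O_eps_infinity interface ?r \<longleftrightarrow> (\<forall>j. \<forall>p\<in>interface. (ddir (1, 0) ^^ j) h (0, p) = 0)"
      proof
        assume O: "O_eps_infinity interface ?r"
        show "\<forall>j. \<forall>p\<in>interface. (ddir (1, 0) ^^ j) h (0, p) = 0"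
          using taylor_zero_if_O_eps[OF h O e0] r by auto
      next
        assume z: "\<forall>j. \<forall>p\<in>interface. (ddir (1, 0) ^^ j) h (0, p) = 0"
        show "O_eps_infinity interface ?r"
          unfolding O_eps_infinity_def
        proof
          fix n
          have "O_eps (n - 0) interface ?r"
            by (rule O_eps_if_taylor_zero[OF h _ e0]) (use z r in auto)
          then show "O_eps n interface ?r" by simp
        qed
      qed
      also have "\<dots> \<longleftrightarrow> (\<forall>j. \<forall>p\<in>interface. taylor j h p = 0)" by simp
      finally show ?thesis using t by simp
    qed
    show ?thesis unfolding Let_def 1 2 3 4 ..
  qed
  \<comment> \<open>Borel's lemma provides amplitudes with the given coefficients, so the
    universally quantified condition is not vacuous and implies the equations.\<close>
  obtain bI where bI: "expansion UNIV bI aI" using expansion_exists[of aI UNIV aI] aI by blast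
  obtain bR where bR: "expansion left bR aR" using expansion_exists[of HR left aR] HR by blast
  obtain bT where bT: "expansion right bT aT" using expansion_exists[of HT right aT] HT by blast
  show ?thesis
    unfolding transmission_def pre
    using iff iff[OF bI bR bT] bI bR bT by blast
qed

lemma transmission_extensions:
  assumes "transmission \<A> C \<mu> \<tau> \<xi> aI aR aT"
  obtains HR HT where "\<And>j. smooth (HR j)" "\<And>j p. p \<in> left \<Longrightarrow> aR j p = HR j p"
    "\<And>j. smooth (HT j)" "\<And>j p. p \<in> right \<Longrightarrow> aT j p = HT j p"
proof -
  have "\<forall>j. \<exists>g. smooth g \<and> (\<forall>p\<in>left. aR j p = g p)" "\<forall>j. \<exists>g. smooth g \<and> (\<forall>p\<in>right. aT j p = g p)"
    using assms unfolding transmission_def smooth_upto_def by blast+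
  then obtain HR HT where "\<forall>j. smooth (HR j) \<and> (\<forall>p\<in>left. aR j p = HR j p)"
    "\<forall>j. smooth (HT j) \<and> (\<forall>p\<in>right. aT j p = HT j p)" by metis
  then show ?thesis using that by blast
qed

lemma incident_wkb:
  assumes "incident \<A> \<tau> \<xi> aI"
  shows "wkb \<A> (\<lambda>_. 0) 0 \<tau> \<xi> UNIV aI"
proof -
  from assms obtain a where a: "expansion UNIV a aI" "O_eps_infinity UNIV (\<lambda>\<epsilon>. principal \<A> (wave \<tau> \<xi> a \<epsilon>))"
    unfolding incident_def by blast
  from a(1) obtain gI eI where gI: "smooth gI" "eI > 0" "\<And>\<epsilon> p. 0 < \<epsilon> \<Longrightarrow> \<epsilon> < eI \<Longrightarrow> a \<epsilon> p = gI (\<epsilon>, p)"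
    "\<And>j p. aI j p = taylor j gI p" by (rule expansionE) simp
  have "wkb \<A> (\<lambda>_. 0) 0 \<tau> \<xi> UNIV (\<lambda>j. taylor j gI)"
    using O_eps_wave_iff[OF open_UNIV gI(1,2) gI(3), where B = "\<lambda>_. 0" and \<kappa> = "\<lambda>_. 0" and C = 0] a(2) by simp
  moreover have "aI = (\<lambda>j. taylor j gI)" using gI(4) by (simp add: fun_eq_iff)
  ultimately show ?thesis by simp
qed

section \<open>The Maxwell symbol\<close>

text \<open>This is \<open>\<i>\<close> times the cross product of \<open>a\<close> and
  \<open>u\<close>, the common form of the three Maxwell matrices and of their combinations.\<close>

definition curl :: "real^3 \<Rightarrow> complex^3 \<Rightarrow> complex^3"
  where "curl a u = vector
    [\<i> * (of_real (a $ 2) * u $ 3 - of_real (a $ 3) * u $ 2),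
     \<i> * (of_real (a $ 3) * u $ 1 - of_real (a $ 1) * u $ 3),
     \<i> * (of_real (a $ 1) * u $ 2 - of_real (a $ 2) * u $ 1)]"

lemma curl_nth [simp]:
  "curl a u $ 1 = \<i> * (of_real (a $ 2) * u $ 3 - of_real (a $ 3) * u $ 2)"
  "curl a u $ 2 = \<i> * (of_real (a $ 3) * u $ 1 - of_real (a $ 1) * u $ 3)"
  "curl a u $ 3 = \<i> * (of_real (a $ 1) * u $ 2 - of_real (a $ 2) * u $ 1)"
  by (simp_all add: curl_def vector_3)

lemma maxwell_vector: "maxwell l *v u = curl (axis l 1) u"
  using exhaust_3[of l]
  by (auto simp: vec_eq_iff forall_3 matrix_vector_mult_def sum_3 maxwell_def vector_3 axis_def)

lemma curl_sum: "(\<Sum>l\<in>UNIV. a $ l *\<^sub>R (maxwell l *v u)) = curl a u"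
  by (simp add: sum_3 vec_eq_iff forall_3 maxwell_vector axis_def scaleR_conv_of_real[where 'a = complex] algebra_simps)

lemma symb_maxwell: "symb maxwell \<tau> \<xi> u = \<tau> *\<^sub>R u + curl \<xi> u"
  by (simp add: symb_def curl_sum)

lemma curl_linear:
  "curl a (u + v) = curl a u + curl a v" "curl a (u - v) = curl a u - curl a v"
  "curl a (r *\<^sub>R u) = r *\<^sub>R curl a u" "curl a (c *s u) = c *s curl a u"
  "curl a 0 = 0" "curl a (- u) = - curl a u"
  by (simp_all add: vec_eq_iff forall_3 scaleR_conv_of_real[where 'a = complex] algebra_simps)

text \<open>The cross product of \<open>b\<close> with that of \<open>a\<close> and \<open>u\<close>
  is a multiple of \<open>a\<close> minus \<open>a \<bullet> b\<close> times \<open>u\<close>, and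
  the outer product with \<open>a\<close> removes the first term. Taking \<open>b = a\<close> gives
  the cubic relation of the symbol, an axis for \<open>b\<close> the group velocity, an axis for
  both the cube of \<open>maxwell 1\<close>.\<close>

lemma curl_curl_curl: "curl a (curl b (curl a u)) = (a \<bullet> b) *\<^sub>R curl a u"
  by (simp add: vec_eq_iff forall_3 inner_vec_def sum_3 scaleR_conv_of_real[where 'a = complex])
    (simp add: algebra_simps)

lemma bounded_linear_curl: "bounded_linear (curl a)"
  unfolding curl_sum[symmetric, abs_def]
  by (intro bounded_linear_sum bounded_linear_compose[OF bounded_linear_scaleR_right] matrix_vector_mul_bounded_linear)

text \<open>The eigenvalues of \<open>curl \<xi>\<close> are \<open>0\<close> and \<open>\<plusminus>\<tau>\<close>; \<open>proj\<close> projects onto the eigenspace of \<open>-\<tau>\<close>, the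
  kernel of the symbol, and \<open>pinv\<close> inverts the symbol on the other eigenspaces.\<close>

definition proj :: "real \<Rightarrow> real^3 \<Rightarrow> complex^3 \<Rightarrow> complex^3"
  where "proj \<tau> \<xi> u = (1 / (2 * \<tau>\<^sup>2)) *\<^sub>R (curl \<xi> (curl \<xi> u) - \<tau> *\<^sub>R curl \<xi> u)"

definition pinv :: "real \<Rightarrow> real^3 \<Rightarrow> complex^3 \<Rightarrow> complex^3"
  where "pinv \<tau> \<xi> u = (1 / \<tau>) *\<^sub>R (u - (1 / \<tau>\<^sup>2) *\<^sub>R curl \<xi> (curl \<xi> u))
    + (1 / (4 * \<tau> ^ 3)) *\<^sub>R (curl \<xi> (curl \<xi> u) + \<tau> *\<^sub>R curl \<xi> u)"

lemma bounded_linear_proj: "bounded_linear (proj \<tau> \<xi>)"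
  unfolding proj_def
  by (intro bounded_linear_compose[OF bounded_linear_scaleR_right] bounded_linear_sub
      bounded_linear_compose[OF bounded_linear_curl] bounded_linear_curl)

lemma bounded_linear_pinv: "bounded_linear (pinv \<tau> \<xi>)"
  unfolding pinv_def
  by (intro bounded_linear_add bounded_linear_compose[OF bounded_linear_scaleR_right] bounded_linear_sub
      bounded_linear_compose[OF bounded_linear_curl] bounded_linear_curl bounded_linear_ident)

lemmas smooth_proj = bounded_linear.smooth_image[OF bounded_linear_proj]
lemmas smooth_pinv = bounded_linear.smooth_image[OF bounded_linear_pinv]

lemma proj_linear:
  "proj \<tau> \<xi> (u + v) = proj \<tau> \<xi> u + proj \<tau> \<xi> v" "proj \<tau> \<xi> (u - v) = proj \<tau> \<xi> u - proj \<tau> \<xi> v"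
  "proj \<tau> \<xi> (r *\<^sub>R u) = r *\<^sub>R proj \<tau> \<xi> u" "proj \<tau> \<xi> (c *s u) = c *s proj \<tau> \<xi> u"
  "proj \<tau> \<xi> 0 = 0" "proj \<tau> \<xi> (- u) = - proj \<tau> \<xi> u"
  by (simp_all add: proj_def curl_linear vec_eq_iff scaleR_conv_of_real[where 'a = complex] algebra_simps)

text \<open>The squared form of the dispersion relation covers both signs of \<open>\<tau>\<close>
  and passes to the reflected wave vector.\<close>

locale light_ray =
  fixes \<tau> :: real and \<xi> :: "real^3"
  assumes \<tau>: "\<tau> \<noteq> 0" and dispersion: "\<tau>\<^sup>2 = \<xi> \<bullet> \<xi>"
begin

lemma curl3: "curl \<xi> (curl \<xi> (curl \<xi> u)) = \<tau>\<^sup>2 *\<^sub>R curl \<xi> u"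
  by (simp add: curl_curl_curl dispersion)

text \<open>Applied to the recursion, \<open>proj\<close> removes the next coefficient and leaves a
  transport equation for the current one. By \<open>symb_pinv_eq\<close> this is also sufficient for
  solvability.\<close>

lemma proj_symb: "proj \<tau> \<xi> (symb maxwell \<tau> \<xi> u) = 0"
  by (simp add: proj_def symb_maxwell curl_linear curl3 power2_eq_square algebra_simps)

lemma symb_proj: "symb maxwell \<tau> \<xi> (proj \<tau> \<xi> u) = 0"
  using \<tau> by (simp add: proj_def symb_maxwell curl_linear curl3 power2_eq_square algebra_simps)

lemma pinv_symb: "pinv \<tau> \<xi> (symb maxwell \<tau> \<xi> u) = u - proj \<tau> \<xi> u"
proof -
  define A B where "A = curl \<xi> u" and "B = curl \<xi> A"
  have AB: "curl \<xi> B = \<tau>\<^sup>2 *\<^sub>R A" by (simp add: A_def B_def curl3)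
  show ?thesis
    using \<tau>
    by (simp add: pinv_def proj_def symb_maxwell curl_linear A_def[symmetric] B_def[symmetric] AB)
      (simp add: vec_eq_iff scaleR_conv_of_real[where 'a = complex] field_simps power2_eq_square power3_eq_cube)
qed

lemma symb_pinv: "symb maxwell \<tau> \<xi> (pinv \<tau> \<xi> u) = u - proj \<tau> \<xi> u"
proof -
  define A B where "A = curl \<xi> u" and "B = curl \<xi> A"
  have AB: "curl \<xi> B = \<tau>\<^sup>2 *\<^sub>R A" by (simp add: A_def B_def curl3)
  show ?thesis
    using \<tau>
    by (simp add: pinv_def proj_def symb_maxwell curl_linear A_def[symmetric] B_def[symmetric] AB)
      (simp add: vec_eq_iff scaleR_conv_of_real[where 'a = complex] field_simps power2_eq_square power3_eq_cube)
qed

lemma proj_eqI: "symb maxwell \<tau> \<xi> u = 0 \<Longrightarrow> proj \<tau> \<xi> u = u"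
  using pinv_symb[of u] by (simp add: linear_0[OF bounded_linear.linear[OF bounded_linear_pinv]])

lemma proj_proj: "proj \<tau> \<xi> (proj \<tau> \<xi> u) = proj \<tau> \<xi> u"
  by (rule proj_eqI) (rule symb_proj)

lemma symb_pinv_eq: "proj \<tau> \<xi> u = 0 \<Longrightarrow> symb maxwell \<tau> \<xi> (pinv \<tau> \<xi> u) = u"
  by (simp add: symb_pinv)

text \<open>The compression of a coefficient matrix to the kernel is a component of the group
  velocity, as in first-order perturbation of an eigenvalue. It comes from
  \<open>curl_curl_curl\<close> with an axis as middle vector.\<close>

lemma proj_maxwell_proj: "proj \<tau> \<xi> (maxwell l *v proj \<tau> \<xi> u) = group_velocity \<tau> \<xi> $ l *\<^sub>R proj \<tau> \<xi> u"
proof -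
  define A B where "A = curl \<xi> u" and "B = curl \<xi> A"
  have c: "curl \<xi> (curl (axis l 1) A) = (\<xi> $ l) *\<^sub>R A"
    using curl_curl_curl[of \<xi> "axis l 1" u] by (simp add: A_def inner_axis)
  have c': "curl \<xi> (curl (axis l 1) B) = (\<xi> $ l) *\<^sub>R B"
    using curl_curl_curl[of \<xi> "axis l 1" A] by (simp add: B_def inner_axis)
  have AB: "curl \<xi> B = \<tau>\<^sup>2 *\<^sub>R A" by (simp add: A_def B_def curl3)
  show ?thesis
    using \<tau>
    by (simp add: proj_def maxwell_vector curl_linear A_def[symmetric] B_def[symmetric] c c' AB group_velocity_def)
      (simp add: vec_eq_iff scaleR_conv_of_real[where 'a = complex] field_simps power2_eq_square power3_eq_cube)
qed

text \<open>The smart matrix is quadratic in \<open>maxwell 1\<close>, so its absorption rate also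
  needs the compression of the square.\<close>

lemma proj_maxwell_maxwell_proj:
  "proj \<tau> \<xi> (maxwell 1 *v (maxwell 1 *v proj \<tau> \<xi> u)) = ((1 + (group_velocity \<tau> \<xi> $ 1)\<^sup>2) / 2) *\<^sub>R proj \<tau> \<xi> u"
proof -
  define t x y z u1 u2 u3 where "t = complex_of_real \<tau>" and "x = complex_of_real (\<xi> $ 1)"
    and "y = complex_of_real (\<xi> $ 2)" and "z = complex_of_real (\<xi> $ 3)"
    and "u1 = u $ 1" and "u2 = u $ 2" and "u3 = u $ 3"
  note d = this
  have t2: "t\<^sup>2 = x\<^sup>2 + y\<^sup>2 + z\<^sup>2"
    using arg_cong[OF dispersion, of complex_of_real]
    by (simp add: d inner_vec_def sum_3 power2_eq_square)
  have t0: "t \<noteq> 0" using \<tau> by (simp add: d)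
  have i2: "\<i>\<^sup>2 = -1" by simp
  \<comment> \<open>\<open>N\<close> is \<open>proj\<close> times \<open>2 * \<tau>\<^sup>2\<close>;
    without the denominator the claim is a polynomial identity modulo the dispersion
    relation.\<close>
  define N where "N v = curl \<xi> (curl \<xi> v) - \<tau> *\<^sub>R curl \<xi> v" for v
  have "N (maxwell 1 *v (maxwell 1 *v N u)) = (\<tau>\<^sup>2 + (\<xi> $ 1)\<^sup>2) *\<^sub>R N u"
    unfolding N_def maxwell_vector vec_eq_iff forall_3
    apply (simp add: axis_def scaleR_conv_of_real[where 'a = complex] d[symmetric])
    using t2 i2 by (intro conjI; algebra)
  moreover have "proj \<tau> \<xi> v = (1 / (2 * \<tau>\<^sup>2)) *\<^sub>R N v" for v by (simp add: proj_def N_def)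
  moreover have "N (r *\<^sub>R v) = r *\<^sub>R N v" for r v
    by (simp add: N_def curl_linear scaleR_diff_right scaleR_left_commute)
  moreover have "(1 / (2 * \<tau>\<^sup>2)) * (\<tau>\<^sup>2 + (\<xi> $ 1)\<^sup>2) = (1 + (group_velocity \<tau> \<xi> $ 1)\<^sup>2) / 2"
    using \<tau> by (simp add: group_velocity_def field_simps power2_eq_square)
  ultimately show ?thesis
    by (simp only: matrix_vector_scaleR scaleR_scaleR mult_ac)
qed

text \<open>Summing \<open>proj_maxwell_proj\<close> over the axes gives differentiation along the
  group velocity.\<close>

lemma proj_principal:
  assumes f: "smooth f"
  shows "proj \<tau> \<xi> (principal maxwell (\<lambda>p. proj \<tau> \<xi> (f p)) p)
    = ddir (1, group_velocity \<tau> \<xi>) (\<lambda>p. proj \<tau> \<xi> (f p)) p"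
proof -
  have g: "smooth (\<lambda>p. proj \<tau> \<xi> (f p))" by (rule smooth_proj[OF f])
  have d: "ddir v (\<lambda>p. proj \<tau> \<xi> (f p)) p = proj \<tau> \<xi> (ddir v f p)" for v
    by (simp add: bounded_linear.ddir_image[OF bounded_linear_proj f])
  have "(1, group_velocity \<tau> \<xi>) = (1, 0) + (\<Sum>l\<in>UNIV. group_velocity \<tau> \<xi> $ l *\<^sub>R (0 :: real, axis l (1 :: real)))"
    by (simp add: sum_3 prod_eq_iff vec_eq_iff forall_3 axis_def)
  then have "ddir (1, group_velocity \<tau> \<xi>) (\<lambda>p. proj \<tau> \<xi> (f p)) p
    = ddir (1, 0) (\<lambda>p. proj \<tau> \<xi> (f p)) p
      + (\<Sum>l\<in>UNIV. group_velocity \<tau> \<xi> $ l *\<^sub>R ddir (0, axis l 1) (\<lambda>p. proj \<tau> \<xi> (f p)) p)"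
    by (simp only: ddir_dir_add[OF g] ddir_dir_sum[OF g] ddir_dir_scaleR[OF g])
  also have "\<dots> = proj \<tau> \<xi> (principal maxwell (\<lambda>p. proj \<tau> \<xi> (f p)) p)"
    unfolding principal_def d
    by (simp add: proj_linear linear_sum[OF bounded_linear.linear[OF bounded_linear_proj]] proj_proj proj_maxwell_proj)
  finally show ?thesis ..
qed

end

section \<open>Reflection and tangential components on the interface\<close>

lemma reflect_nth [simp]: "reflect \<xi> $ 1 = - \<xi> $ 1" "reflect \<xi> $ 2 = \<xi> $ 2" "reflect \<xi> $ 3 = \<xi> $ 3"
  by (simp_all add: reflect_def)

lemma (in light_ray) light_ray_reflect: "light_ray \<tau> (reflect \<xi>)"
  using \<tau> dispersion by unfold_locales (simp_all add: inner_vec_def sum_3)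

lemma maxwell_1_eq_0_iff: "maxwell 1 *v u = 0 \<longleftrightarrow> u $ 2 = 0 \<and> u $ 3 = 0"
  by (auto simp: maxwell_vector vec_eq_iff forall_3 axis_def)

text \<open>\<open>jump \<tau> \<xi> y\<close> and \<open>- jump \<tau> (reflect \<xi>) y\<close> are the kernel vectors for \<open>\<xi>\<close> and \<open>reflect \<xi>\<close> whose
  tangential components differ by those of \<open>y\<close>. Eliminating the normal component from the symbol \<open>A\<close> leaves
  \<open>\<plusminus>\<xi>\<^sub>1 J + B\<close> with \<open>J\<^sup>2 = 1\<close>, so that the tangential component of the first one is \<open>(y - J B y / \<xi>\<^sub>1) / 2\<close>.\<close>

definition jump :: "real \<Rightarrow> real^3 \<Rightarrow> complex^3 \<Rightarrow> complex^3"
  where "jump \<tau> \<xi> y = (let x1 = complex_of_real (\<xi> $ 1); x2 = complex_of_real (\<xi> $ 2);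
      x3 = complex_of_real (\<xi> $ 3); t = complex_of_real \<tau>;
      u2 = (y $ 2 + \<i> * (t * y $ 3 - (x2\<^sup>2 * y $ 3 - x2 * x3 * y $ 2) / t) / x1) / 2;
      u3 = (y $ 3 - \<i> * (t * y $ 2 - (x3\<^sup>2 * y $ 2 - x2 * x3 * y $ 3) / t) / x1) / 2
    in vector [- \<i> * (x2 * u3 - x3 * u2) / t, u2, u3])"

lemma jump_linear: "jump \<tau> \<xi> (u + v) = jump \<tau> \<xi> u + jump \<tau> \<xi> v" "jump \<tau> \<xi> (c *\<^sub>R u) = c *\<^sub>R jump \<tau> \<xi> u"
  by (simp_all add: jump_def Let_def vec_eq_iff forall_3 vector_3 scaleR_conv_of_real[where 'a = complex]
      add_divide_distrib diff_divide_distrib algebra_simps)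

lemma bounded_linear_jump: "bounded_linear (jump \<tau> \<xi>)"
  by (rule linear_conv_bounded_linear[THEN iffD1]) (intro linearI jump_linear)

text \<open>The tangential parts are halves of that of \<open>y\<close> with corrections
  proportional to the inverse of \<open>\<xi> $ 1\<close>, whose sign \<open>reflect\<close>
  changes; \<open>maxwell 1\<close> does not see the normal components.\<close>

lemma maxwell_1_jump: "maxwell 1 *v (jump \<tau> \<xi> y + jump \<tau> (reflect \<xi>) y) = maxwell 1 *v y"
proof -
  have "maxwell 1 *v (jump \<tau> \<xi> y + jump \<tau> (reflect \<xi>) y - y) = 0"
    unfolding maxwell_1_eq_0_iff
    by (simp add: jump_def Let_def vector_3 field_simps)
  then show ?thesis by (simp add: matrix_vector_mult_diff_distrib)
qed

context light_ray
begin

lemma symb_jump: "\<xi> $ 1 \<noteq> 0 \<Longrightarrow> symb maxwell \<tau> \<xi> (jump \<tau> \<xi> y) = 0"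
proof -
  assume x: "\<xi> $ 1 \<noteq> 0"
  define t x1 x2 x3 y2 y3 where "t = complex_of_real \<tau>" and "x1 = complex_of_real (\<xi> $ 1)"
    and "x2 = complex_of_real (\<xi> $ 2)" and "x3 = complex_of_real (\<xi> $ 3)"
    and "y2 = y $ 2" and "y3 = y $ 3"
  note d = this
  have t2: "t * t = x1 * x1 + x2 * x2 + x3 * x3"
    using arg_cong[OF dispersion, of complex_of_real]
    by (simp add: d inner_vec_def sum_3 power2_eq_square)
  have t0: "t \<noteq> 0" "x1 \<noteq> 0" using \<tau> x by (simp_all add: d)
  have i2: "\<i> * \<i> = -1" by simp
  define a where "a = t * y3 - (x2\<^sup>2 * y3 - x2 * x3 * y2) / t"
  define b where "b = t * y2 - (x3\<^sup>2 * y2 - x2 * x3 * y3) / t"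
  have a: "t * a = t * t * y3 - (x2\<^sup>2 * y3 - x2 * x3 * y2)" using t0 by (simp add: a_def field_simps)
  have b: "t * b = t * t * y2 - (x3\<^sup>2 * y2 - x2 * x3 * y3)" using t0 by (simp add: b_def field_simps)
  define u2 u3 u1 where "u2 = (y2 + \<i> * a / x1) / 2" and "u3 = (y3 - \<i> * b / x1) / 2"
    and "u1 = - \<i> * (x2 * u3 - x3 * u2) / t"
  have u2: "2 * x1 * u2 = x1 * y2 + \<i> * a" and u3: "2 * x1 * u3 = x1 * y3 - \<i> * b"
    and u1: "t * u1 = - \<i> * (x2 * u3 - x3 * u2)"
    using t0 by (simp_all add: u2_def u3_def u1_def field_simps)
  have j: "jump \<tau> \<xi> y = vector [u1, u2, u3]"
    by (simp add: jump_def Let_def u1_def u2_def u3_def a_def b_def d)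
  have "t * u1 + \<i> * (x2 * u3 - x3 * u2) = 0" using u1 by simp
  moreover have "t * u2 + \<i> * (x3 * u1 - x1 * u3) = 0"
  proof -
    \<comment> \<open>Cleared of denominators, this component is a polynomial identity modulo the
      dispersion relation; the first component was the definition of \<open>u1\<close>.\<close>
    have "2 * t * x1 * (t * u2 + \<i> * (x3 * u1 - x1 * u3)) = 0"
      using u1 u2 u3 a b t2 i2 by algebra
    then show ?thesis using t0 by simp
  qed
  moreover have "t * u3 + \<i> * (x1 * u2 - x2 * u1) = 0"
  proof -
    have "2 * t * x1 * (t * u3 + \<i> * (x1 * u2 - x2 * u1)) = 0"
      using u1 u2 u3 a b t2 i2 by algebra
    then show ?thesis using t0 by simp
  qed
  ultimately show ?thesis
    by (simp add: symb_maxwell j vec_eq_iff forall_3 vector_3 scaleR_conv_of_real[where 'a = complex] d)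
qed

text \<open>Serves twice: \<open>X = 0\<close> gives uniqueness on the interface, and the source of
  the first corrector gives the reflection coefficient.\<close>

lemma reflected_components:
  assumes x: "\<xi> $ 1 \<noteq> 0"
    and u: "symb maxwell \<tau> \<xi> u = \<i> *s X" and w: "symb maxwell \<tau> (reflect \<xi>) w = 0"
    and uw: "maxwell 1 *v (w - u) = 0"
  shows "2 * of_real (\<xi> $ 1 * \<tau>) * w $ 1 = \<i> * (of_real (\<xi> $ 2) * X $ 2 + of_real (\<xi> $ 3) * X $ 3)"
    "2 * of_real (\<xi> $ 1 * \<tau>) * w $ 2 = \<i> * of_real (\<xi> $ 2) * X $ 1 + of_real \<tau> * X $ 3"
    "2 * of_real (\<xi> $ 1 * \<tau>) * w $ 3 = \<i> * of_real (\<xi> $ 3) * X $ 1 - of_real \<tau> * X $ 2"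
proof -
  define t x1 x2 x3 u1 w1 w2 w3 X1 X2 X3
    where "t = complex_of_real \<tau>" and "x1 = complex_of_real (\<xi> $ 1)"
    and "x2 = complex_of_real (\<xi> $ 2)" and "x3 = complex_of_real (\<xi> $ 3)"
    and "u1 = u $ 1" and "w1 = w $ 1" and "w2 = w $ 2" and "w3 = w $ 3"
    and "X1 = X $ 1" and "X2 = X $ 2" and "X3 = X $ 3"
  note d = this
  have t0: "t \<noteq> 0" "x1 \<noteq> 0" using \<tau> x by (simp_all add: d)
  have i2: "\<i> * \<i> = -1" by simp
  have e: "u $ 2 = w2" "u $ 3 = w3" using uw by (simp_all add: maxwell_1_eq_0_iff d)
  have r1: "t * u1 + \<i> * (x2 * w3 - x3 * w2) = \<i> * X1" and r2: "t * w2 + \<i> * (x3 * u1 - x1 * w3) = \<i> * X2"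
    and r3: "t * w3 + \<i> * (x1 * w2 - x2 * u1) = \<i> * X3"
    using u by (simp_all add: symb_maxwell vec_eq_iff forall_3 scaleR_conv_of_real[where 'a = complex] d[symmetric] e)
  have s1: "t * w1 + \<i> * (x2 * w3 - x3 * w2) = 0" and s2: "t * w2 + \<i> * (x3 * w1 + x1 * w3) = 0"
    and s3: "t * w3 + \<i> * (- x1 * w2 - x2 * w1) = 0"
    using w by (simp_all add: symb_maxwell vec_eq_iff forall_3 scaleR_conv_of_real[where 'a = complex] d[symmetric])
  \<comment> \<open>The difference of the first equations is
    \<open>t * (u1 - w1) = \<i> * X1\<close>; the differences of the other two pairs then contain
    one tangential component each.\<close>
  have 2: "2 * (x1 * t) * w2 = \<i> * x2 * X1 + t * X3"
    using r1 r3 s1 s3 i2 by algebra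
  have 3: "2 * (x1 * t) * w3 = \<i> * x3 * X1 - t * X2"
    using r1 r2 s1 s2 i2 by algebra
  have "t * (2 * (x1 * t) * w1) = t * (\<i> * (x2 * X2 + x3 * X3))"
    using 2 3 s1 i2 by algebra
  then have 1: "2 * (x1 * t) * w1 = \<i> * (x2 * X2 + x3 * X3)" using t0 by simp
  show "2 * of_real (\<xi> $ 1 * \<tau>) * w $ 1 = \<i> * (of_real (\<xi> $ 2) * X $ 2 + of_real (\<xi> $ 3) * X $ 3)"
    "2 * of_real (\<xi> $ 1 * \<tau>) * w $ 2 = \<i> * of_real (\<xi> $ 2) * X $ 1 + of_real \<tau> * X $ 3"
    "2 * of_real (\<xi> $ 1 * \<tau>) * w $ 3 = \<i> * of_real (\<xi> $ 3) * X $ 1 - of_real \<tau> * X $ 2"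
    using 1 2 3 by (simp_all add: d)
qed

lemma jump_unique:
  assumes x: "\<xi> $ 1 \<noteq> 0"
    and u: "symb maxwell \<tau> \<xi> u = 0" and w: "symb maxwell \<tau> (reflect \<xi>) w = 0"
    and uw: "maxwell 1 *v (w - u) = 0"
  shows "u = 0" "w = 0"
proof -
  have "w $ 1 = 0" "w $ 2 = 0" "w $ 3 = 0"
    using reflected_components[OF x _ w uw, of 0] u x \<tau> by (auto simp: vec_eq_iff)
  then show w0: "w = 0" by (simp add: vec_eq_iff forall_3)
  then have "u $ 2 = 0" "u $ 3 = 0" using uw by (simp_all add: maxwell_1_eq_0_iff)
  moreover from this have "u $ 1 = 0"
    using u \<tau> by (simp add: symb_maxwell vec_eq_iff forall_3)
  ultimately show "u = 0" by (simp add: vec_eq_iff forall_3)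
qed

end

section \<open>Transport along rays\<close>

text \<open>The parameter of \<open>p\<close> on the line of direction \<open>w\<close> that starts
  on the interface. It is linear in \<open>p\<close> and equals 1 at \<open>w\<close>, as the
  primitive along \<open>w\<close> requires.\<close>

abbreviation foot :: "spacetime \<Rightarrow> spacetime \<Rightarrow> real" where "foot w p \<equiv> snd p $ 1 / snd w $ 1"

lemma bounded_linear_foot: "bounded_linear (foot w)"
  by (rule bounded_linear_compose[OF bounded_linear_divide bounded_linear_coord])

lemma mem_sets: "p \<in> left \<longleftrightarrow> snd p $ 1 \<le> 0" "p \<in> right \<longleftrightarrow> snd p $ 1 \<ge> 0" "p \<in> interface \<longleftrightarrow> snd p $ 1 = 0"
  by (auto simp: left_def right_def interface_def split: prod.split)

text \<open>Rays of direction \<open>w\<close> enter \<open>S\<close> through the interface, so each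
  point of \<open>S\<close> is joined to its foot by a segment within \<open>S\<close>.\<close>

definition outgoing :: "spacetime set \<Rightarrow> spacetime \<Rightarrow> bool"
  where "outgoing S w \<longleftrightarrow> (S = right \<and> snd w $ 1 > 0) \<or> (S = left \<and> snd w $ 1 < 0)"

lemma outgoing_closure: "outgoing S w \<Longrightarrow> closure (interior S) = S"
  using closure_interior_left closure_interior_right unfolding outgoing_def by blast

lemma outgoing_foot:
  assumes "outgoing S w" "p \<in> S"
  shows "foot w p \<ge> 0" "p - foot w p *\<^sub>R w \<in> interface"
    "s \<in> {0..1} \<Longrightarrow> p - (s * foot w p) *\<^sub>R w \<in> S"
    "s \<in> {0..1} \<Longrightarrow> (p - foot w p *\<^sub>R w) + s *\<^sub>R (foot w p *\<^sub>R w) \<in> S"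
proof -
  have w: "snd w $ 1 \<noteq> 0" using assms by (auto simp: outgoing_def)
  show "foot w p \<ge> 0" using assms
    by (auto simp: outgoing_def mem_sets zero_le_divide_iff divide_le_0_iff)
  show "p - foot w p *\<^sub>R w \<in> interface" using w by (simp add: mem_sets)
  have *: "snd (p - (s * foot w p) *\<^sub>R w) $ 1 = (1 - s) * snd p $ 1" for s
    using w by (simp add: algebra_simps)
  then show 3: "p - (s * foot w p) *\<^sub>R w \<in> S" if "s \<in> {0..1}" for s
    using assms that unfolding outgoing_def mem_sets by (auto simp: mem_sets * mult_nonneg_nonpos)
  show "(p - foot w p *\<^sub>R w) + s *\<^sub>R (foot w p *\<^sub>R w) \<in> S" if "s \<in> {0..1}"
  proof -
    have "(p - r *\<^sub>R w) + s *\<^sub>R (r *\<^sub>R w) = p - ((1 - s) * r) *\<^sub>R w" for r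
      by (simp add: algebra_simps)
    then show ?thesis by (simp only:) (rule 3, use that in auto)
  qed
qed

text \<open>With \<open>ddir w K = k\<close> the factor \<open>exp K\<close> is integrating:
  \<open>exp (K p) *s g p\<close> is constant along the segment from the interface to
  \<open>p\<close>.\<close>

lemma ray_unique:
  fixes g :: "spacetime \<Rightarrow> complex^'n"
  assumes S: "outgoing S w" and g: "smooth g" and k: "smooth k"
    and eq: "\<And>p. p \<in> S \<Longrightarrow> ddir w g p + k p *\<^sub>R g p = 0"
    and 0: "\<And>p. p \<in> interface \<Longrightarrow> g p = 0" and p: "p \<in> S"
  shows "g p = 0"
proof -
  have fw: "foot w w = 1" using S by (auto simp: outgoing_def)
  have ck: "smooth (\<lambda>p. complex_of_real (k p))"
    by (rule bounded_linear.smooth_image[OF bounded_linear_of_real k])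
  obtain K where K: "smooth K" "ddir w K = (\<lambda>p. complex_of_real (k p))"
    by (rule smooth_directional_primitive[OF ck bounded_linear_foot fw])
  define h where "h = (\<lambda>p. exp (K p) *s g p)"
  have h: "smooth h" unfolding h_def by (intro smooth_smult smooth_exp K g)
  have "ddir w h q = 0" if "q \<in> S" for q
  proof -
    have "ddir w h q = exp (K q) *s (ddir w g q + k q *\<^sub>R g q)"
      unfolding h_def
      by (simp add: ddir_smult smooth_exp K(1) g ddir_exp[OF smooth_differentiable[OF K(1)]] K(2))
        (simp add: vec_eq_iff scaleR_conv_of_real[where 'a = complex] algebra_simps)
    then show ?thesis using eq[OF that] by simp
  qed
  then have z: "ddir (foot w p *\<^sub>R w) h ((p - foot w p *\<^sub>R w) + s *\<^sub>R (foot w p *\<^sub>R w)) = 0" if "s \<in> {0..1}" for s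
    using outgoing_foot(4)[OF S p that] by (simp add: ddir_dir_scaleR[OF h])
  have "h p - h (p - foot w p *\<^sub>R w)
      = integral {0..1} (\<lambda>s. ddir (foot w p *\<^sub>R w) h ((p - foot w p *\<^sub>R w) + s *\<^sub>R (foot w p *\<^sub>R w)))"
    using smooth_line_increment[OF h, of "foot w p *\<^sub>R w" "p - foot w p *\<^sub>R w"] by simp
  also have "\<dots> = integral {0..1} (\<lambda>s::real. 0 :: complex^'n)"
    using z by (intro Henstock_Kurzweil_Integration.integral_cong) auto
  finally have "h p = 0"
    using 0[OF outgoing_foot(2)[OF S p]] by (simp add: h_def)
  then show ?thesis by (simp add: h_def vec_eq_iff)
qed

text \<open>Variation of constants with the integrating factor \<open>exp K\<close>. The last
  conclusion records propagation along a single segment; the zero initial values rest on it.\<close>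

lemma ray_solve:
  fixes f b :: "spacetime \<Rightarrow> complex^'n"
  assumes w: "snd w $ 1 \<noteq> 0" and f: "smooth f" and b: "smooth b" and k: "smooth k"
  obtains u where "smooth u" "\<And>p. ddir w u p + k p *\<^sub>R u p = f p" "\<And>p. p \<in> interface \<Longrightarrow> u p = b p"
    "\<And>p. (\<forall>s\<in>{0..1}. f (p - (s * foot w p) *\<^sub>R w) = 0) \<Longrightarrow> b (p - foot w p *\<^sub>R w) = 0 \<Longrightarrow> u p = 0"
proof -
  have fw: "foot w w = 1" using w by simp
  have ck: "smooth (\<lambda>p. complex_of_real (k p))"
    by (rule bounded_linear.smooth_image[OF bounded_linear_of_real k])
  obtain K where K: "smooth K" "ddir w K = (\<lambda>p. complex_of_real (k p))" "\<And>p. foot w p = 0 \<Longrightarrow> K p = 0"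
    by (rule smooth_directional_primitive[OF ck bounded_linear_foot fw]) (rule that; assumption)
  have ef: "smooth (\<lambda>p. exp (K p) *s f p)" by (intro smooth_smult smooth_exp K f)
  obtain F where F: "smooth F" "ddir w F = (\<lambda>p. exp (K p) *s f p)"
    "\<And>p. (\<forall>s\<in>{0..1}. exp (K (p - (s * foot w p) *\<^sub>R w)) *s f (p - (s * foot w p) *\<^sub>R w) = 0) \<Longrightarrow> F p = 0"
    "\<And>p. foot w p = 0 \<Longrightarrow> F p = 0"
    by (rule smooth_directional_primitive[OF ef bounded_linear_foot fw]) (rule that; assumption)
  have sf: "smooth (foot w)" by (rule smooth_bounded_linear[OF bounded_linear_foot])
  \<comment> \<open>\<open>q\<close> slides \<open>p\<close> along the ray to the interface, so that
    \<open>b (q p)\<close> is constant along rays and extends the interface values of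
    \<open>b\<close>.\<close>
  define q where "q = (\<lambda>p. p - foot w p *\<^sub>R w)"
  have q: "smooth q" unfolding q_def by (intro smooth_diff smooth_scaleR smooth_id smooth_const sf)
  have dq: "ddir w q p = 0" for p
  proof -
    have "ddir w (\<lambda>p. foot w p *\<^sub>R w) p = foot w w *\<^sub>R w"
      by (simp add: ddir_scaleR[OF sf] ddir_bounded_linear[OF bounded_linear_foot])
    then show ?thesis unfolding q_def
      using w by (simp add: ddir_diff smooth_id smooth_scaleR[OF sf] ddir_bounded_linear bounded_linear_ident)
  qed
  define v where "v = (\<lambda>p. b (q p) + F p)"
  have v: "smooth v" unfolding v_def by (intro smooth_add smooth_compose[OF b q] F)
  have dv: "ddir w v = (\<lambda>p. exp (K p) *s f p)"
    unfolding v_def by (simp add: ddir_add smooth_compose[OF b q] F fun_eq_iff ddir_compose[OF b q] dq ddir_dir_zero[OF b])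
  define u where "u = (\<lambda>p. exp (- K p) *s v p)"
  have "smooth u" unfolding u_def by (intro smooth_smult smooth_exp smooth_uminus K v)
  moreover have "ddir w u p + k p *\<^sub>R u p = f p" for p
  proof -
    have "ddir w u p = exp (- K p) *s (exp (K p) *s f p) + (exp (- K p) * (- of_real (k p))) *s v p"
      unfolding u_def
      using ddir_exp[OF smooth_differentiable[OF smooth_uminus[OF K(1)]], of w p]
      by (simp add: ddir_smult smooth_exp smooth_uminus K(1) v dv ddir_uminus K(2))
    also have "exp (- K p) *s (exp (K p) *s f p) = f p"
      by (simp add: vector_smult_assoc exp_minus_inverse exp_add[symmetric])
    finally show ?thesis
      by (simp add: u_def vec_eq_iff scaleR_conv_of_real[where 'a = complex])
  qed
  moreover have "u p = b p" if "p \<in> interface" for p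
    using that K(3)[of p] F(4)[of p] by (simp add: u_def v_def q_def mem_sets)
  moreover have "u p = 0" if "\<forall>s\<in>{0..1}. f (p - (s * foot w p) *\<^sub>R w) = 0" "b (p - foot w p *\<^sub>R w) = 0" for p
    using F(3)[of p] that by (simp add: u_def v_def q_def)
  ultimately show ?thesis by (rule that)
qed

section \<open>Determining one coefficient from the preceding one\<close>

lemma lower_op_linear:
  assumes "smooth f" "smooth g"
  shows "lower_op \<A> \<kappa> C (\<lambda>p. f p + g p) p = lower_op \<A> \<kappa> C f p + lower_op \<A> \<kappa> C g p"
    "lower_op \<A> \<kappa> C (\<lambda>p. f p - g p) p = lower_op \<A> \<kappa> C f p - lower_op \<A> \<kappa> C g p"
  using assms
  by (simp_all add: lower_op_def principal_def ddir_add ddir_diff matrix_vector_right_distrib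
      matrix_vector_mult_diff_distrib sum.distrib sum_subtractf algebra_simps)

lemma lower_op_zero [simp]: "lower_op \<A> \<kappa> C (\<lambda>p. 0) p = 0"
  by (simp add: lower_op_def principal_def)

lemma lower_op_eq_0:
  assumes f: "smooth f" and \<kappa>: "smooth \<kappa>" and S: "closure (interior S) = S"
    and 0: "\<And>p. p \<in> S \<Longrightarrow> f p = 0" and p: "p \<in> S"
  shows "lower_op \<A> \<kappa> C f p = 0"
proof (rule vanish_on_closure[OF smooth_lower_op[OF f \<kappa>] _ S p])
  fix q assume q: "q \<in> interior S"
  have "lower_op \<A> \<kappa> C f q = lower_op \<A> \<kappa> C (\<lambda>p. 0) q"
    by (rule lower_op_cong_open[OF open_interior q]) (use 0 interior_subset in auto)
  then show "lower_op \<A> \<kappa> C f q = 0" by simp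
qed

lemma group_velocity_reflect: "group_velocity \<tau> (reflect \<xi>) $ 1 = - group_velocity \<tau> \<xi> $ 1"
  by (simp add: group_velocity_def)

context light_ray
begin

text \<open>On the kernel the absorption matrix compresses to the scalar \<open>c\<close>, so it
  contributes only a zeroth-order term to the transport equation.\<close>

lemma proj_lower_op:
  assumes f: "smooth f" and D: "\<And>u. proj \<tau> \<xi> (D *v proj \<tau> \<xi> u) = c *\<^sub>R proj \<tau> \<xi> u"
  shows "proj \<tau> \<xi> (lower_op maxwell \<kappa> D (\<lambda>p. proj \<tau> \<xi> (f p)) p)
    = ddir (1, group_velocity \<tau> \<xi>) (\<lambda>p. proj \<tau> \<xi> (f p)) p + (c * \<kappa> p) *\<^sub>R proj \<tau> \<xi> (f p)"
  unfolding lower_op_def proj_linear proj_principal[OF f] D by (simp add: mult.commute)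

lemma transport_unique:
  assumes S: "outgoing S (1, group_velocity \<tau> \<xi>)" and f: "smooth f" and \<kappa>: "smooth \<kappa>"
    and D: "\<And>u. proj \<tau> \<xi> (D *v proj \<tau> \<xi> u) = c *\<^sub>R proj \<tau> \<xi> u"
    and k: "\<And>p. p \<in> S \<Longrightarrow> symb maxwell \<tau> \<xi> (f p) = 0"
    and eq: "\<And>p. p \<in> S \<Longrightarrow> proj \<tau> \<xi> (lower_op maxwell \<kappa> D f p) = 0"
    and 0: "\<And>p. p \<in> interface \<Longrightarrow> f p = 0" and p: "p \<in> S"
  shows "f p = 0"
proof -
  define g where "g = (\<lambda>p. proj \<tau> \<xi> (f p))"
  have g: "smooth g" unfolding g_def by (rule smooth_proj[OF f])
  have fg: "f q = g q" if "q \<in> S" for q using proj_eqI[OF k[OF that]] by (simp add: g_def)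
  have "g p = 0"
  proof (rule ray_unique[OF S g, where k = "\<lambda>p. c * \<kappa> p"])
    show "smooth (\<lambda>p. c * \<kappa> p)" by (intro smooth_mult smooth_const \<kappa>)
    show "g q = 0" if "q \<in> interface" for q using 0[OF that] by (simp add: g_def proj_linear)
    fix q assume q: "q \<in> S"
    show "ddir (1, group_velocity \<tau> \<xi>) g q + (c * \<kappa> q) *\<^sub>R g q = 0"
    proof (rule vanish_on_closure[OF _ _ outgoing_closure[OF S] q])
      show "smooth (\<lambda>q. ddir (1, group_velocity \<tau> \<xi>) g q + (c * \<kappa> q) *\<^sub>R g q)"
        by (intro smooth_intros g \<kappa>)
      fix r assume r: "r \<in> interior S"
      then have rS: "r \<in> S" using interior_subset by blast
      have "lower_op maxwell \<kappa> D f r = lower_op maxwell \<kappa> D g r"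
        by (rule lower_op_cong_open[OF open_interior r _ g]) (use fg interior_subset in blast)
      then show "ddir (1, group_velocity \<tau> \<xi>) g r + (c * \<kappa> r) *\<^sub>R g r = 0"
        using eq[OF rS] proj_lower_op[OF f D, of \<kappa> r] by (simp add: g_def)
    qed
  qed (rule p)
  then show ?thesis using fg[OF p] by simp
qed

text \<open>The symbol equation fixes the part \<open>pinv \<tau> \<xi> (\<i> *s X p)\<close>; the
  kernel part is transported so that the equation for the next index becomes solvable. The sets
  \<open>Z\<close> are closed under following rays back to the interface, as the past halves of the
  half spaces are.\<close>

lemma wave_solve:
  assumes v: "group_velocity \<tau> \<xi> $ 1 \<noteq> 0"
    and X: "smooth X" "\<And>p. proj \<tau> \<xi> (X p) = 0" and b: "smooth b" "\<And>p. symb maxwell \<tau> \<xi> (b p) = 0"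
    and \<kappa>: "smooth \<kappa>" and D: "\<And>u. proj \<tau> \<xi> (D *v proj \<tau> \<xi> u) = c *\<^sub>R proj \<tau> \<xi> u"
  obtains T where "smooth T" "\<And>p. \<i> *s symb maxwell \<tau> \<xi> (T p) + X p = 0"
    "\<And>p. proj \<tau> \<xi> (lower_op maxwell \<kappa> D T p) = 0"
    "\<And>p. p \<in> interface \<Longrightarrow> T p = b p + pinv \<tau> \<xi> (\<i> *s X p)"
    "\<And>Z p. closure (interior Z) = Z \<Longrightarrow> \<forall>p\<in>Z. X p = 0
      \<Longrightarrow> \<forall>p\<in>Z. \<forall>s\<in>{0..1}. p - (s * foot (1, group_velocity \<tau> \<xi>) p) *\<^sub>R (1, group_velocity \<tau> \<xi>) \<in> Z
      \<Longrightarrow> \<forall>p\<in>Z \<inter> interface. b p = 0 \<Longrightarrow> p \<in> Z \<Longrightarrow> T p = 0"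
proof -
  define w :: spacetime where "w = (1, group_velocity \<tau> \<xi>)"
  define y where "y = (\<lambda>p. pinv \<tau> \<xi> (\<i> *s X p))"
  have y: "smooth y" unfolding y_def by (intro smooth_pinv smooth_smult_const X)
  have sy: "symb maxwell \<tau> \<xi> (y p) = \<i> *s X p" for p
    unfolding y_def by (rule symb_pinv_eq) (simp add: proj_linear X)
  define f where "f = (\<lambda>p. - proj \<tau> \<xi> (lower_op maxwell \<kappa> D y p))"
  have f: "smooth f" unfolding f_def by (intro smooth_uminus smooth_proj smooth_lower_op y \<kappa>)
  have pf: "proj \<tau> \<xi> (f p) = f p" for p by (simp add: f_def proj_linear proj_proj)
  have "smooth (\<lambda>p. c * \<kappa> p)" by (intro smooth_mult smooth_const \<kappa>)
  from ray_solve[OF _ f b(1) this, of w] v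
  obtain u where u: "smooth u" "\<And>p. ddir w u p + (c * \<kappa> p) *\<^sub>R u p = f p" "\<And>p. p \<in> interface \<Longrightarrow> u p = b p"
    "\<And>p. (\<forall>s\<in>{0..1}. f (p - (s * foot w p) *\<^sub>R w) = 0) \<Longrightarrow> b (p - foot w p *\<^sub>R w) = 0 \<Longrightarrow> u p = 0"
    by (auto simp: w_def)
  define T where "T = (\<lambda>p. proj \<tau> \<xi> (u p) + y p)"
  have pu: "smooth (\<lambda>p. proj \<tau> \<xi> (u p))" by (rule smooth_proj[OF u(1)])
  have "smooth T" unfolding T_def by (intro smooth_add pu y)
  moreover have "\<i> *s symb maxwell \<tau> \<xi> (T p) + X p = 0" for p
    by (simp add: T_def symb_linear symb_proj sy vec_eq_iff)
  moreover have "proj \<tau> \<xi> (lower_op maxwell \<kappa> D T p) = 0" for p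
  proof -
    have "proj \<tau> \<xi> (ddir w u p + (c * \<kappa> p) *\<^sub>R u p) = f p" unfolding u(2) by (rule pf)
    then have "ddir w (\<lambda>p. proj \<tau> \<xi> (u p)) p + (c * \<kappa> p) *\<^sub>R proj \<tau> \<xi> (u p) = f p"
      by (simp add: bounded_linear.ddir_image[OF bounded_linear_proj u(1)] proj_linear)
    then show ?thesis
      unfolding T_def lower_op_linear(1)[OF pu y] proj_linear proj_lower_op[OF u(1) D]
      by (simp add: f_def w_def)
  qed
  moreover have "T p = b p + pinv \<tau> \<xi> (\<i> *s X p)" if "p \<in> interface" for p
    using u(3)[OF that] proj_eqI[OF b(2)] by (simp add: T_def y_def)
  moreover have "T p = 0" if Z: "closure (interior Z) = Z" and XZ: "\<forall>p\<in>Z. X p = 0"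
    and sg: "\<forall>p\<in>Z. \<forall>s\<in>{0..1}. p - (s * foot w p) *\<^sub>R w \<in> Z"
    and bZ: "\<forall>p\<in>Z \<inter> interface. b p = 0" and p: "p \<in> Z" for Z p
  proof -
    have yZ: "y q = 0" if "q \<in> Z" for q
      using XZ that linear_0[OF bounded_linear.linear[OF bounded_linear_pinv]] by (simp add: y_def)
    have fZ: "f q = 0" if "q \<in> Z" for q
      using lower_op_eq_0[OF y \<kappa> Z yZ that, of maxwell D] by (simp add: f_def proj_linear)
    have "p - foot w p *\<^sub>R w \<in> interface" using v by (simp add: mem_sets w_def)
    moreover have "p - foot w p *\<^sub>R w \<in> Z" using bspec[OF bspec[OF sg p], of 1] by simp
    ultimately have "u p = 0" using fZ sg p bZ by (intro u(4)) auto
    then show ?thesis using yZ[OF p] by (simp add: T_def proj_linear)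
  qed
  ultimately show ?thesis using that unfolding w_def by blast
qed

end

locale incidence = light_ray +
  assumes v1: "group_velocity \<tau> \<xi> $ 1 > 0"
begin

sublocale reflected: light_ray \<tau> "reflect \<xi>"
  by (rule light_ray_reflect)

lemma xi1: "\<xi> $ 1 \<noteq> 0"
  using v1 by (auto simp: group_velocity_def)

lemma outgoing_right: "outgoing right (1, group_velocity \<tau> \<xi>)"
  and outgoing_left: "outgoing left (1, group_velocity \<tau> (reflect \<xi>))"
  using v1 by (auto simp: outgoing_def group_velocity_reflect)

lemma interface_subset: "p \<in> interface \<Longrightarrow> p \<in> left" "p \<in> interface \<Longrightarrow> p \<in> right"
  by (auto simp: mem_sets)

text \<open>\<open>D\<close> is left general: the smart layer has its own matrix, while the Berenger
  layer has an effective one acting on the sum of the split fields.\<close>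

lemma transmission_unique_step:
  assumes R: "smooth R" and T: "smooth T" and \<kappa>: "smooth \<kappa>"
    and D: "\<And>u. proj \<tau> \<xi> (D *v proj \<tau> \<xi> u) = c *\<^sub>R proj \<tau> \<xi> u"
    and kT: "\<And>p. p \<in> right \<Longrightarrow> symb maxwell \<tau> \<xi> (T p) = 0"
    and kR: "\<And>p. p \<in> left \<Longrightarrow> symb maxwell \<tau> (reflect \<xi>) (R p) = 0"
    and eT: "\<And>p. p \<in> right \<Longrightarrow> proj \<tau> \<xi> (lower_op maxwell \<kappa> D T p) = 0"
    and eR: "\<And>p. p \<in> left \<Longrightarrow> proj \<tau> (reflect \<xi>) (lower_op maxwell (\<lambda>_. 0) 0 R p) = 0"
    and j: "\<And>p. p \<in> interface \<Longrightarrow> maxwell 1 *v (R p - T p) = 0"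
  shows "p \<in> right \<Longrightarrow> T p = 0" "p \<in> left \<Longrightarrow> R p = 0"
proof -
  have 0: "T p = 0" "R p = 0" if "p \<in> interface" for p
    using jump_unique[OF xi1 kT[OF interface_subset(2)[OF that]] kR[OF interface_subset(1)[OF that]] j[OF that]] by auto
  show "p \<in> right \<Longrightarrow> T p = 0"
    by (rule transport_unique[OF outgoing_right T \<kappa> D kT eT 0(1)])
  show "p \<in> left \<Longrightarrow> R p = 0"
    by (rule reflected.transport_unique[OF outgoing_left R _ _ kR eR 0(2), where c = 0])
      (auto simp: reflected.proj_symb proj_linear)
qed

end

section \<open>The smart layer\<close>

lemma maxwell_1_cube: "maxwell 1 *v (maxwell 1 *v (maxwell 1 *v u)) = maxwell 1 *v u"
  unfolding maxwell_vector curl_curl_curl by (simp add: inner_axis)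

text \<open>For \<open>M = maxwell 1\<close> the relation \<open>M^3 = M\<close> leaves the
  eigenvalues 0, 1 and -1, and the projector for \<open>s\<close> is \<open>(M^2 + s M) / 2\<close>.
  The conditions on \<open>\<Lambda>\<close> single out \<open>s\<close> among the three.\<close>

lemma spectral_projector_maxwell_1:
  assumes \<Lambda>: "0 \<notin> \<Lambda>" "s = 1 \<or> s = -1" "of_real s \<in> \<Lambda>" "of_real (- s) \<notin> \<Lambda>"
  shows "spectral_projector \<Lambda> (maxwell 1) *v u = (1 / 2) *\<^sub>R (maxwell 1 *v (maxwell 1 *v u) + s *\<^sub>R (maxwell 1 *v u))"
proof -
  define M where "M = maxwell 1"
  define P where "P = (1 / 2 :: real) *\<^sub>R (M ** M + s *\<^sub>R M)"
  have P: "P *v u = (1 / 2) *\<^sub>R (M *v (M *v u) + s *\<^sub>R (M *v u))" for u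
    by (simp add: P_def scaleR_matrix_vector matrix_vector_mult_add_rdistrib matrix_vector_mul_assoc)
  have eig: "\<forall>l u. M *v u = l *s u \<longrightarrow> P *v u = (if l \<in> \<Lambda> then u else 0)"
  proof (intro allI impI)
    fix l u assume u: "M *v u = l *s u"
    have "(l * l * l) *s u = l *s u"
      using maxwell_1_cube[of u] u by (simp add: M_def[symmetric] vector_scalar_commute vector_smult_assoc mult_ac)
    then have "(l * l * l - l) *s u = 0" by (simp add: vec_eq_iff algebra_simps)
    then have "u = 0 \<or> l * l * l - l = 0" by (auto simp: vec_eq_iff)
    moreover have "l * l * l - l = l * (l - 1) * (l + 1)" by (simp add: algebra_simps)
    ultimately have l: "u = 0 \<or> l = 0 \<or> l = 1 \<or> l = -1" by (auto simp: eq_neg_iff_add_eq_0)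
    have Pu: "P *v u = ((l * l + of_real s * l) / 2) *s u"
      by (simp add: P u vector_scalar_commute vector_smult_assoc vec_eq_iff scaleR_conv_of_real[where 'a = complex] field_simps)
    show "P *v u = (if l \<in> \<Lambda> then u else 0)"
      using l \<Lambda> by (elim disjE) (auto simp: Pu)
  qed
  have "spectral_projector \<Lambda> M = P"
    unfolding spectral_projector_def
  proof (rule the_equality)
    show "\<forall>l u. M *v u = l *s u \<longrightarrow> P *v u = (if l \<in> \<Lambda> then u else 0)" by (rule eig)
    fix P' assume P': "\<forall>l u. M *v u = l *s u \<longrightarrow> P' *v u = (if l \<in> \<Lambda> then u else 0)"
    have e: "P' *v u = P *v u" if "M *v u = l *s u" for l u
    proof -
      have "P' *v u = (if l \<in> \<Lambda> then u else 0)" "P *v u = (if l \<in> \<Lambda> then u else 0)"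
        using P' eig that by blast+
      then show ?thesis by simp
    qed
    show "P' = P"
      unfolding matrix_eq
    proof
      fix u
      \<comment> \<open>Up to factors these are the components of \<open>u\<close> in the three
        eigenspaces; as they recombine to \<open>u\<close>, the action on eigenvectors determines
        the matrix.\<close>
      define a b c where "a = u - M *v (M *v u)" and "b = M *v (M *v u) + M *v u"
        and "c = M *v (M *v u) - M *v u"
      have "M *v a = 0 *s a" "M *v b = 1 *s b" "M *v c = (-1) *s c"
        using maxwell_1_cube[of u]
        by (simp_all add: a_def b_def c_def M_def matrix_vector_mult_diff_distrib matrix_vector_right_distrib
            vec_eq_iff)
      from e[OF this(1)] e[OF this(2)] e[OF this(3)]
      have "P' *v (a + (1 / 2) *\<^sub>R (b + c)) = P *v (a + (1 / 2) *\<^sub>R (b + c))"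
        by (simp add: matrix_vector_right_distrib matrix_vector_scaleR)
      moreover have "a + (1 / 2) *\<^sub>R (b + c) = u"
        by (simp add: a_def b_def c_def scaleR_2[symmetric])
      ultimately show "P' *v u = P *v u" by simp
    qed
  qed
  then show ?thesis unfolding M_def[symmetric] using P by simp
qed

definition smart_matrix :: "real \<Rightarrow> complex^3^3"
  where "smart_matrix \<nu> = spectral_projector (complex_of_real ` {0<..}) (maxwell 1)
      + \<nu> *\<^sub>R spectral_projector (complex_of_real ` {..<0}) (maxwell 1)"

lemma smart_C_vector: "smart_C \<sigma> \<nu> x *v u = \<sigma> x *\<^sub>R (smart_matrix \<nu> *v u)"
  by (simp add: smart_C_def smart_matrix_def scaleR_matrix_vector)

lemma smart_matrix_vector:
  "smart_matrix \<nu> *v u = ((1 + \<nu>) / 2) *\<^sub>R (maxwell 1 *v (maxwell 1 *v u)) + ((1 - \<nu>) / 2) *\<^sub>R (maxwell 1 *v u)"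
proof -
  have mem: "complex_of_real x \<in> complex_of_real ` A \<longleftrightarrow> x \<in> A" for x A
    by (auto simp: image_iff)
  have z: "0 \<in> complex_of_real ` A \<longleftrightarrow> 0 \<in> A" for A
    using mem[of 0 A] by simp
  have "spectral_projector (complex_of_real ` {0<..}) (maxwell 1) *v u
      = (1 / 2) *\<^sub>R (maxwell 1 *v (maxwell 1 *v u) + 1 *\<^sub>R (maxwell 1 *v u))"
    by (rule spectral_projector_maxwell_1) (unfold mem z, simp_all)
  moreover have "spectral_projector (complex_of_real ` {..<0}) (maxwell 1) *v u
      = (1 / 2) *\<^sub>R (maxwell 1 *v (maxwell 1 *v u) + (-1) *\<^sub>R (maxwell 1 *v u))"
    by (rule spectral_projector_maxwell_1) (unfold mem z, simp_all)
  ultimately show ?thesis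
    by (simp add: smart_matrix_def matrix_vector_mult_add_rdistrib scaleR_matrix_vector)
      (simp add: vec_eq_iff scaleR_conv_of_real[where 'a = complex] field_simps)
qed

text \<open>The weights of the second and the first power of \<open>maxwell 1\<close> in the smart
  matrix, each times the scalar to which that power compresses on the kernel.\<close>

definition (in light_ray) smart_rate :: "real \<Rightarrow> real"
  where "smart_rate \<nu> = ((1 + \<nu>) / 2) * ((1 + (group_velocity \<tau> \<xi> $ 1)\<^sup>2) / 2) + ((1 - \<nu>) / 2) * group_velocity \<tau> \<xi> $ 1"

lemma (in light_ray) proj_smart:
  "proj \<tau> \<xi> (smart_matrix \<nu> *v proj \<tau> \<xi> u) = smart_rate \<nu> *\<^sub>R proj \<tau> \<xi> u"
  unfolding smart_matrix_vector proj_linear proj_maxwell_proj proj_maxwell_maxwell_proj smart_rate_def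
  by (simp add: scaleR_add_left)

lemma absorption_extension:
  assumes "absorption \<sigma>"
  obtains s where "smooth s" "\<forall>x>0. \<sigma> x = s x"
  using assms unfolding absorption_def smooth_upto_def by auto

lemma smooth_coord:
  fixes s :: "real \<Rightarrow> real"
  assumes "smooth s"
  shows "smooth (\<lambda>p::spacetime. \<mu> * s (snd p $ 1))"
  by (rule smooth_mult[OF smooth_const smooth_compose[OF assms smooth_bounded_linear[OF bounded_linear_coord]]])

lemma ddir_coord:
  assumes s: "smooth s"
  shows "ddir v (\<lambda>p::spacetime. \<mu> * s (snd p $ 1)) = (\<lambda>p. snd v $ 1 * (\<mu> * ddir 1 s (snd p $ 1)))"
proof
  fix p :: spacetime
  note c = smooth_bounded_linear[OF bounded_linear_coord, of 1]
  have "ddir v (\<lambda>p::spacetime. s (snd p $ 1)) p = ddir (snd v $ 1) s (snd p $ 1)"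
    by (subst ddir_compose[OF s c]) (simp add: ddir_bounded_linear[OF bounded_linear_coord])
  also have "\<dots> = snd v $ 1 * ddir 1 s (snd p $ 1)"
    using ddir_dir_scaleR[OF s, of "snd v $ 1" 1] by simp
  finally show "ddir v (\<lambda>p::spacetime. \<mu> * s (snd p $ 1)) p = snd v $ 1 * (\<mu> * ddir 1 s (snd p $ 1))"
    using fun_cong[OF ddir_scaleR_const[OF smooth_compose[OF s c], of v \<mu>], of p] by simp
qed

section \<open>Uniqueness of the coefficients\<close>

lemma wkb_diff:
  assumes "wkb \<A> \<kappa> C \<tau> \<xi> S G" "wkb \<A> \<kappa> C \<tau> \<xi> S H" "\<And>j. smooth (G j)" "\<And>j. smooth (H j)"
  shows "wkb \<A> \<kappa> C \<tau> \<xi> S (\<lambda>j p. G j p - H j p)"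
  unfolding wkb_def
proof (intro allI ballI)
  fix j p assume "p \<in> S"
  then have "\<i> *s symb \<A> \<tau> \<xi> (G j p) + (if j = 0 then 0 else lower_op \<A> \<kappa> C (G (j - 1)) p) = 0"
    "\<i> *s symb \<A> \<tau> \<xi> (H j p) + (if j = 0 then 0 else lower_op \<A> \<kappa> C (H (j - 1)) p) = 0"
    using assms(1,2) unfolding wkb_def by blast+
  then show "\<i> *s symb \<A> \<tau> \<xi> (G j p - H j p)
      + (if j = 0 then 0 else lower_op \<A> \<kappa> C (\<lambda>p. G (j - 1) p - H (j - 1) p) p) = 0"
    by (simp add: symb_linear lower_op_linear(2)[OF assms(3,4)] vec_eq_iff algebra_simps add_eq_0_iff split: if_splits)
qed

text \<open>Uniqueness examines the first index not yet known to vanish: its symbol equation is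
  homogeneous, and its lower-order term lies in the range of the symbol.\<close>

lemma wkb_first:
  assumes w: "wkb \<A> \<kappa> C \<tau> \<xi> S G" and G: "\<And>j. smooth (G j)" and \<kappa>: "smooth \<kappa>"
    and S: "closure (interior S) = S" and 0: "\<And>i p. i < j \<Longrightarrow> p \<in> S \<Longrightarrow> G i p = 0" and p: "p \<in> S"
  shows "symb \<A> \<tau> \<xi> (G j p) = 0" "lower_op \<A> \<kappa> C (G j) p = - (\<i> *s symb \<A> \<tau> \<xi> (G (Suc j) p))"
proof -
  have "(if j = 0 then 0 else lower_op \<A> \<kappa> C (G (j - 1)) p) = 0"
    using lower_op_eq_0[OF G \<kappa> S 0 p, of "j - 1" \<A> C] by auto
  moreover have "\<i> *s symb \<A> \<tau> \<xi> (G j p) + (if j = 0 then 0 else lower_op \<A> \<kappa> C (G (j - 1)) p) = 0"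
    using w p unfolding wkb_def by blast
  ultimately show "symb \<A> \<tau> \<xi> (G j p) = 0" by (simp add: vec_eq_iff)
  have "\<i> *s symb \<A> \<tau> \<xi> (G (Suc j) p) + lower_op \<A> \<kappa> C (G j) p = 0"
    using w[unfolded wkb_def, THEN spec, of "Suc j"] p by simp
  then show "lower_op \<A> \<kappa> C (G j) p = - (\<i> *s symb \<A> \<tau> \<xi> (G (Suc j) p))"
    by (simp add: eq_neg_iff_add_eq_0 add.commute)
qed

lemma layer_transmission_iff:
  fixes \<A> :: "3 \<Rightarrow> complex^'n^'n"
  assumes C: "\<And>x u. C x *v u = \<sigma> x *\<^sub>R (C\<^sub>0 *v u)"
    and "\<And>j. smooth (aI j)" and "smooth s" "\<forall>x>0. \<sigma> x = s x"
    and "\<And>j. smooth (HR j)" "\<forall>j. \<forall>p\<in>left. aR j p = HR j p"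
    and "\<And>j. smooth (HT j)" "\<forall>j. \<forall>p\<in>right. aT j p = HT j p"
  shows "transmission \<A> C \<mu> \<tau> \<xi> aI aR aT \<longleftrightarrow>
    (\<forall>j x. ((0, x) \<in> left \<longrightarrow> HR j (0, x) = 0) \<and> ((0, x) \<in> right \<longrightarrow> HT j (0, x) = 0))
    \<and> wkb \<A> (\<lambda>_. 0) 0 \<tau> \<xi> UNIV aI
    \<and> wkb \<A> (\<lambda>_. 0) 0 \<tau> (reflect \<xi>) left HR
    \<and> wkb \<A> (\<lambda>p. \<mu> * s (snd p $ 1)) C\<^sub>0 \<tau> \<xi> right HT
    \<and> (\<forall>j. \<forall>p\<in>interface. \<A> 1 *v (aI j p + HR j p - HT j p) = 0)"
  by (rule transmission_iff[OF assms(2,5) _ assms(7) _ smooth_coord[OF assms(3)]])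
    (use assms(4,6,8) in \<open>auto simp: C\<close>)

text \<open>By linearity the difference of two answers solves the problem without incident wave;
  only \<open>unique\<close> depends on the layer.\<close>

lemma layer_transmission_unique:
  fixes \<A> :: "3 \<Rightarrow> complex^'n^'n"
  assumes C: "\<And>x u. C x *v u = \<sigma> x *\<^sub>R (C\<^sub>0 *v u)"
    and \<sigma>: "absorption \<sigma>" and aI: "\<And>j. smooth (aI j)"
    and unique: "\<And>R T \<kappa> j. (\<And>j. smooth (R j)) \<Longrightarrow> (\<And>j. smooth (T j)) \<Longrightarrow> smooth \<kappa> \<Longrightarrow>
      wkb \<A> (\<lambda>_. 0) 0 \<tau> (reflect \<xi>) left R \<Longrightarrow> wkb \<A> \<kappa> C\<^sub>0 \<tau> \<xi> right T \<Longrightarrow>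
      (\<And>j p. p \<in> interface \<Longrightarrow> \<A> 1 *v (R j p - T j p) = 0) \<Longrightarrow>
      (\<forall>p\<in>right. T j p = 0) \<and> (\<forall>p\<in>left. R j p = 0)"
    and 1: "transmission \<A> C \<mu> \<tau> \<xi> aI aR aT"
    and 2: "transmission \<A> C \<mu> \<tau> \<xi> aI aR' aT'"
  shows "(\<forall>p\<in>left. aR' j p = aR j p) \<and> (\<forall>p\<in>right. aT' j p = aT j p)"
proof -
  obtain s where s: "smooth s" "\<forall>x>0. \<sigma> x = s x" using absorption_extension[OF \<sigma>] by blast
  obtain HR HT where H: "\<And>j. smooth (HR j)" "\<forall>j. \<forall>p\<in>left. aR j p = HR j p"
    "\<And>j. smooth (HT j)" "\<forall>j. \<forall>p\<in>right. aT j p = HT j p" using transmission_extensions[OF 1] by metis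
  obtain HR' HT' where H': "\<And>j. smooth (HR' j)" "\<forall>j. \<forall>p\<in>left. aR' j p = HR' j p"
    "\<And>j. smooth (HT' j)" "\<forall>j. \<forall>p\<in>right. aT' j p = HT' j p" using transmission_extensions[OF 2] by metis
  note 1 = layer_transmission_iff[OF C aI s H, THEN iffD1, OF 1]
  note 2 = layer_transmission_iff[OF C aI s H', THEN iffD1, OF 2]
  have "(\<forall>p\<in>right. HT' j p - HT j p = 0) \<and> (\<forall>p\<in>left. HR' j p - HR j p = 0)"
  proof (rule unique)
    show "wkb \<A> (\<lambda>_. 0) 0 \<tau> (reflect \<xi>) left (\<lambda>j p. HR' j p - HR j p)"
      using 1 2 H H' by (intro wkb_diff) auto
    show "wkb \<A> (\<lambda>p. \<mu> * s (snd p $ 1)) C\<^sub>0 \<tau> \<xi> right (\<lambda>j p. HT' j p - HT j p)"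
      using 1 2 H H' by (intro wkb_diff) auto
    fix j p assume p: "p \<in> interface"
    have "\<A> 1 *v (aI j p + HR' j p - HT' j p) - \<A> 1 *v (aI j p + HR j p - HT j p) = 0"
      using 1 2 p by simp
    then show "\<A> 1 *v (HR' j p - HR j p - (HT' j p - HT j p)) = 0"
      by (simp add: matrix_vector_mult_diff_distrib matrix_vector_right_distrib algebra_simps)
  qed (auto intro: smooth_diff H H' smooth_coord s)
  then show ?thesis using H H' by simp
qed

lemmas smart_transmission_iff =
  layer_transmission_iff[where C = "smart_C \<sigma> \<nu>" and \<sigma> = \<sigma> and C\<^sub>0 = "smart_matrix \<nu>" for \<sigma> \<nu>, OF smart_C_vector]

context incidence
begin

lemma smart_wkb_unique:
  assumes R: "\<And>j. smooth (R j)" and T: "\<And>j. smooth (T j)" and \<kappa>: "smooth \<kappa>"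
    and wR: "wkb maxwell (\<lambda>_. 0) 0 \<tau> (reflect \<xi>) left R"
    and wT: "wkb maxwell \<kappa> (smart_matrix \<nu>) \<tau> \<xi> right T"
    and j: "\<And>j p. p \<in> interface \<Longrightarrow> maxwell 1 *v (R j p - T j p) = 0"
  shows "(\<forall>p\<in>right. T j p = 0) \<and> (\<forall>p\<in>left. R j p = 0)"
proof (induction j rule: less_induct)
  case (less n)
  have "T n p = 0" if "p \<in> right" for p
    by (rule transmission_unique_step(1)[OF R[of n] T[of n] \<kappa> proj_smart[of \<nu>] _ _ _ _ j that])
      (use less wkb_first[OF wT T \<kappa> closure_interior_right] wkb_first[OF wR R _ closure_interior_left]
        in \<open>auto simp: proj_linear proj_symb reflected.proj_symb\<close>)
  moreover have "R n p = 0" if "p \<in> left" for p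
    by (rule transmission_unique_step(2)[OF R[of n] T[of n] \<kappa> proj_smart[of \<nu>] _ _ _ _ j that])
      (use less wkb_first[OF wT T \<kappa> closure_interior_right] wkb_first[OF wR R _ closure_interior_left]
        in \<open>auto simp: proj_linear proj_symb reflected.proj_symb\<close>)
  ultimately show ?case by blast
qed

lemma smart_transmission_unique:
  assumes "absorption \<sigma>" "\<And>j. smooth (aI j)"
    and "transmission maxwell (smart_C \<sigma> \<nu>) \<mu> \<tau> \<xi> aI aR aT"
    and "transmission maxwell (smart_C \<sigma> \<nu>) \<mu> \<tau> \<xi> aI aR' aT'"
  shows "(\<forall>p\<in>left. aR' j p = aR j p) \<and> (\<forall>p\<in>right. aT' j p = aT j p)"
  by (rule layer_transmission_unique[where C = "smart_C \<sigma> \<nu>" and \<sigma> = \<sigma> and C\<^sub>0 = "smart_matrix \<nu>", OF smart_C_vector assms(1,2) _ assms(3,4)])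
    (rule smart_wkb_unique; assumption)

section \<open>Existence for the smart layer, with zero initial values\<close>

lemma incident_zero:
  assumes inc: "incident \<A> \<tau> \<xi> aI" and p: "fst p \<le> 0" "p \<in> right"
  shows "aI j p = 0"
proof (rule ccontr)
  assume "aI j p \<noteq> 0"
  then obtain K where K: "K \<subseteq> {x. x $ 1 < 0}" "p \<in> tube (group_velocity \<tau> \<xi>) K"
    using inc unfolding incident_def by blast
  then have "(snd p - fst p *\<^sub>R group_velocity \<tau> \<xi>) $ 1 < 0"
    by (auto simp: tube_def split: prod.splits)
  \<comment> \<open>Since \<open>v_1 > 0\<close>, before time zero the tube lies further to the left
    than at time zero.\<close>
  moreover have "fst p * group_velocity \<tau> \<xi> $ 1 \<le> 0" using p(1) v1 by (simp add: mult_nonpos_nonneg)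
  ultimately show False using p(2) by (simp add: mem_sets)
qed

text \<open>Vanishing is propagated on all of \<open>t \<le> 0\<close> instead of
  \<open>t = 0\<close>: derivatives inherit it because the interior is dense, and rays followed back
  to the interface stay inside.\<close>

definition past_right :: "spacetime set" where "past_right = {p. fst p \<le> 0} \<inter> right"
definition past_left :: "spacetime set" where "past_left = {p. fst p \<le> 0} \<inter> left"

lemma closure_past: "closure (interior past_right) = past_right" "closure (interior past_left) = past_left"
proof -
  have h: "{p :: spacetime. fst p \<le> 0} = {p. (1, 0) \<bullet> p \<le> 0}" by (simp add: inner_prod_def)
  have cl: "closed {p :: spacetime. fst p \<le> 0}" "convex {p :: spacetime. fst p \<le> 0}"
    unfolding h by (rule closed_halfspace_le convex_halfspace_le)+
  have op: "open {p :: spacetime. fst p < 0}"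
    by (intro open_Collect_less continuous_intros)
  have "{p. fst p < 0} \<inter> interior right \<subseteq> interior past_right" "{p. fst p < 0} \<inter> interior left \<subseteq> interior past_left"
    unfolding past_right_def past_left_def using interior_subset op
    by (intro interior_maximal open_Int open_interior; force)+
  moreover have "(-1, axis 1 1) \<in> {p. fst p < 0} \<inter> interior right" "(-1, axis 1 (-1)) \<in> {p. fst p < 0} \<inter> interior left"
    by (simp_all add: interior_left interior_right axis_def)
  ultimately have "interior past_right \<noteq> {}" "interior past_left \<noteq> {}" by blast+
  moreover have "convex past_right" "convex past_left" "closed past_right" "closed past_left"
    unfolding past_right_def past_left_def
    by (intro convex_Int closed_Int cl convex_left convex_right closed_left closed_right)+
  ultimately show "closure (interior past_right) = past_right" "closure (interior past_left) = past_left"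
    using convex_closure_interior closure_closed by metis+
qed

lemma past_segment:
  "p \<in> past_right \<Longrightarrow> s \<in> {0..1} \<Longrightarrow>
    p - (s * foot (1, group_velocity \<tau> \<xi>) p) *\<^sub>R (1, group_velocity \<tau> \<xi>) \<in> past_right"
  "p \<in> past_left \<Longrightarrow> s \<in> {0..1} \<Longrightarrow>
    p - (s * foot (1, group_velocity \<tau> (reflect \<xi>)) p) *\<^sub>R (1, group_velocity \<tau> (reflect \<xi>)) \<in> past_left"
proof -
  assume p: "p \<in> past_right" and s: "s \<in> {0..1}"
  have pr: "p \<in> right" and p0: "fst p \<le> 0" using p by (auto simp: past_right_def)
  have "s * foot (1, group_velocity \<tau> \<xi>) p \<ge> 0"
    using outgoing_foot(1)[OF outgoing_right pr] s by (intro mult_nonneg_nonneg) auto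
  with p0 outgoing_foot(3)[OF outgoing_right pr s]
  show "p - (s * foot (1, group_velocity \<tau> \<xi>) p) *\<^sub>R (1, group_velocity \<tau> \<xi>) \<in> past_right"
    unfolding past_right_def by simp
next
  assume p: "p \<in> past_left" and s: "s \<in> {0..1}"
  have pr: "p \<in> left" and p0: "fst p \<le> 0" using p by (auto simp: past_left_def)
  have "s * foot (1, group_velocity \<tau> (reflect \<xi>)) p \<ge> 0"
    using outgoing_foot(1)[OF outgoing_left pr] s by (intro mult_nonneg_nonneg) auto
  with p0 outgoing_foot(3)[OF outgoing_left pr s]
  show "p - (s * foot (1, group_velocity \<tau> (reflect \<xi>)) p) *\<^sub>R (1, group_velocity \<tau> (reflect \<xi>)) \<in> past_left"
    unfolding past_left_def by simp
qed

lemma smart_step: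
  assumes y: "smooth y" "\<forall>p\<in>interface. fst p \<le> 0 \<longrightarrow> y p = 0" and \<kappa>: "smooth \<kappa>"
    and XT: "smooth XT" "\<And>p. proj \<tau> \<xi> (XT p) = 0" "\<forall>p\<in>past_right. XT p = 0"
    and XR: "smooth XR" "\<And>p. proj \<tau> (reflect \<xi>) (XR p) = 0" "\<forall>p\<in>past_left. XR p = 0"
  obtains R T where "smooth R" "smooth T"
    "\<And>p. \<i> *s symb maxwell \<tau> \<xi> (T p) + XT p = 0" "\<And>p. \<i> *s symb maxwell \<tau> (reflect \<xi>) (R p) + XR p = 0"
    "\<And>p. proj \<tau> \<xi> (lower_op maxwell \<kappa> (smart_matrix \<nu>) T p) = 0"
    "\<And>p. proj \<tau> (reflect \<xi>) (lower_op maxwell (\<lambda>_. 0) 0 R p) = 0"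
    "\<And>p. p \<in> past_right \<Longrightarrow> T p = 0" "\<And>p. p \<in> past_left \<Longrightarrow> R p = 0"
    "\<And>p. p \<in> interface \<Longrightarrow> maxwell 1 *v (y p + R p - T p) = 0"
proof -
  \<comment> \<open>The tangential mismatch left by the parts that the symbols determine; the kernel
    vectors \<open>jump \<tau> \<xi> (z p)\<close> and
    \<open>- jump \<tau> (reflect \<xi>) (z p)\<close> remove it.\<close>
  define z where "z = (\<lambda>p. y p + pinv \<tau> (reflect \<xi>) (\<i> *s XR p) - pinv \<tau> \<xi> (\<i> *s XT p))"
  have z: "smooth z" unfolding z_def by (intro smooth_add smooth_diff smooth_pinv smooth_smult_const y XT XR)
  have z0: "z p = 0" if "p \<in> interface" "fst p \<le> 0" for p
    using that interface_subset[OF that(1)]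
      linear_0[OF bounded_linear.linear[OF bounded_linear_pinv]]
    by (simp add: z_def y XT XR past_left_def past_right_def)
  have j0: "jump \<tau> \<eta> 0 = 0" for \<eta> by (rule linear_0[OF bounded_linear.linear[OF bounded_linear_jump]])
  have v: "group_velocity \<tau> \<xi> $ 1 \<noteq> 0" "group_velocity \<tau> (reflect \<xi>) $ 1 \<noteq> 0"
    using v1 by (auto simp: group_velocity_reflect)
  have x: "reflect \<xi> $ 1 \<noteq> 0" using xi1 by simp
  have bT: "smooth (\<lambda>p. jump \<tau> \<xi> (z p))" by (rule bounded_linear.smooth_image[OF bounded_linear_jump z])
  have bR: "smooth (\<lambda>p. - jump \<tau> (reflect \<xi>) (z p))"
    by (rule smooth_uminus[OF bounded_linear.smooth_image[OF bounded_linear_jump z]])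
  obtain T where T: "smooth T" "\<And>p. \<i> *s symb maxwell \<tau> \<xi> (T p) + XT p = 0"
    "\<And>p. proj \<tau> \<xi> (lower_op maxwell \<kappa> (smart_matrix \<nu>) T p) = 0"
    "\<And>p. p \<in> interface \<Longrightarrow> T p = jump \<tau> \<xi> (z p) + pinv \<tau> \<xi> (\<i> *s XT p)"
    and T0: "\<And>Z p. closure (interior Z) = Z \<Longrightarrow> \<forall>p\<in>Z. XT p = 0
      \<Longrightarrow> \<forall>p\<in>Z. \<forall>s\<in>{0..1}. p - (s * foot (1, group_velocity \<tau> \<xi>) p) *\<^sub>R (1, group_velocity \<tau> \<xi>) \<in> Z
      \<Longrightarrow> \<forall>p\<in>Z \<inter> interface. jump \<tau> \<xi> (z p) = 0 \<Longrightarrow> p \<in> Z \<Longrightarrow> T p = 0"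
    by (rule wave_solve[OF v(1) XT(1,2) bT symb_jump[OF xi1] \<kappa> proj_smart[of \<nu>]]) (rule that; assumption)
  obtain R where R: "smooth R" "\<And>p. \<i> *s symb maxwell \<tau> (reflect \<xi>) (R p) + XR p = 0"
    "\<And>p. proj \<tau> (reflect \<xi>) (lower_op maxwell (\<lambda>_. 0) 0 R p) = 0"
    "\<And>p. p \<in> interface \<Longrightarrow> R p = - jump \<tau> (reflect \<xi>) (z p) + pinv \<tau> (reflect \<xi>) (\<i> *s XR p)"
    and R0: "\<And>Z p. closure (interior Z) = Z \<Longrightarrow> \<forall>p\<in>Z. XR p = 0
      \<Longrightarrow> \<forall>p\<in>Z. \<forall>s\<in>{0..1}. p - (s * foot (1, group_velocity \<tau> (reflect \<xi>)) p) *\<^sub>R (1, group_velocity \<tau> (reflect \<xi>)) \<in> Z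
      \<Longrightarrow> \<forall>p\<in>Z \<inter> interface. - jump \<tau> (reflect \<xi>) (z p) = 0 \<Longrightarrow> p \<in> Z \<Longrightarrow> R p = 0"
  proof -
    have b: "symb maxwell \<tau> (reflect \<xi>) (- jump \<tau> (reflect \<xi>) (z p)) = 0" for p
      by (simp add: symb_linear reflected.symb_jump[OF x])
    have D: "proj \<tau> (reflect \<xi>) (0 *v proj \<tau> (reflect \<xi>) u) = 0 *\<^sub>R proj \<tau> (reflect \<xi>) u" for u
      by (simp add: proj_linear)
    show ?thesis
      by (rule reflected.wave_solve[OF v(2) XR(1,2) bR b smooth_const D]) (rule that; assumption)
  qed
  have TZ: "T p = 0" if "p \<in> past_right" for p
    by (rule T0[OF closure_past(1) XT(3) _ _ that]) (use past_segment(1) in \<open>auto simp: past_right_def z0 j0\<close>)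
  have RZ: "R p = 0" if "p \<in> past_left" for p
    by (rule R0[OF closure_past(2) XR(3) _ _ that]) (use past_segment(2) in \<open>auto simp: past_left_def z0 j0\<close>)
  have "maxwell 1 *v (y p + R p - T p) = 0" if "p \<in> interface" for p
  proof -
    have "y p + R p - T p = z p - (jump \<tau> \<xi> (z p) + jump \<tau> (reflect \<xi>) (z p))"
      using T(4)[OF that] R(4)[OF that] by (simp add: z_def)
    then show ?thesis using maxwell_1_jump[of \<tau> \<xi> "z p"] by (simp add: matrix_vector_mult_diff_distrib)
  qed
  then show ?thesis using that[OF R(1) T(1,2) R(2) T(3) R(3) TZ RZ] by blast
qed

lemma smart_transmission_exists:
  assumes \<sigma>: "absorption \<sigma>" and inc: "incident maxwell \<tau> \<xi> aI"
  shows "\<exists>aR aT. transmission maxwell (smart_C \<sigma> \<nu>) \<mu> \<tau> \<xi> aI aR aT"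
proof -
  have aI: "smooth (aI j)" for j using inc by (auto simp: incident_def)
  obtain s where s: "smooth s" "\<forall>x>0. \<sigma> x = s x" using absorption_extension[OF \<sigma>] by blast
  define \<kappa> where "\<kappa> = (\<lambda>p::spacetime. \<mu> * s (snd p $ 1))"
  have \<kappa>: "smooth \<kappa>" unfolding \<kappa>_def by (rule smooth_coord[OF s(1)])
  have aI0: "\<forall>p\<in>interface. fst p \<le> 0 \<longrightarrow> aI j p = 0" for j
    using incident_zero[OF inc] interface_subset by blast
  define LT where "LT = lower_op maxwell \<kappa> (smart_matrix \<nu>)"
  define LR where "LR = lower_op maxwell (\<lambda>_. 0) 0"
  \<comment> \<open>A state is the pair of reflected and transmitted coefficient of index
    \<open>n\<close>. It carries the solvability condition for the next index; the symbol equation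
    links two consecutive indices and belongs to \<open>Q\<close>, except for
    \<open>n = 0\<close>.\<close>
  define P where "P n x \<longleftrightarrow> smooth (fst x) \<and> smooth (snd x)
    \<and> (n = 0 \<longrightarrow> (\<forall>p. symb maxwell \<tau> \<xi> (snd x p) = 0 \<and> symb maxwell \<tau> (reflect \<xi>) (fst x p) = 0))
    \<and> (\<forall>p. proj \<tau> \<xi> (LT (snd x) p) = 0) \<and> (\<forall>p. proj \<tau> (reflect \<xi>) (LR (fst x) p) = 0)
    \<and> (\<forall>p\<in>past_right. snd x p = 0) \<and> (\<forall>p\<in>past_left. fst x p = 0)
    \<and> (\<forall>p\<in>interface. maxwell 1 *v (aI n p + fst x p - snd x p) = 0)" for n :: nat and x
  define Q where "Q x y \<longleftrightarrow> (\<forall>p. \<i> *s symb maxwell \<tau> \<xi> (snd y p) + LT (snd x) p = 0)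
    \<and> (\<forall>p. \<i> *s symb maxwell \<tau> (reflect \<xi>) (fst y p) + LR (fst x) p = 0)"
    for x y :: "(spacetime \<Rightarrow> complex^3) \<times> (spacetime \<Rightarrow> complex^3)"
  have "\<exists>f. \<forall>n. P n (f n) \<and> Q (f n) (f (Suc n))"
  proof (rule dependent_nat_choice)
    have z: "\<forall>p\<in>S. (0 :: complex^3) = 0" for S :: "spacetime set" by simp
    obtain R T where *: "smooth R" "smooth T"
      "\<And>p. \<i> *s symb maxwell \<tau> \<xi> (T p) + 0 = 0" "\<And>p. \<i> *s symb maxwell \<tau> (reflect \<xi>) (R p) + 0 = 0"
      "\<And>p. proj \<tau> \<xi> (lower_op maxwell \<kappa> (smart_matrix \<nu>) T p) = 0"
      "\<And>p. proj \<tau> (reflect \<xi>) (lower_op maxwell (\<lambda>_. 0) 0 R p) = 0"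
      "\<And>p. p \<in> past_right \<Longrightarrow> T p = 0" "\<And>p. p \<in> past_left \<Longrightarrow> R p = 0"
      "\<And>p. p \<in> interface \<Longrightarrow> maxwell 1 *v (aI 0 p + R p - T p) = 0"
      by (rule smart_step[OF aI[of 0] aI0 \<kappa> smooth_const proj_linear(5) z smooth_const proj_linear(5) z, where \<nu> = \<nu>])
        (rule that; assumption)
    from *(3,4) have "symb maxwell \<tau> \<xi> (T p) = 0" "symb maxwell \<tau> (reflect \<xi>) (R p) = 0" for p
      by (simp_all add: vec_eq_iff)
    with * have "P 0 (R, T)" unfolding P_def LT_def LR_def by simp
    then show "\<exists>x. P 0 x" ..
  next
    fix x n assume x: "P n x"
    have XT: "smooth (LT (snd x))" "\<And>p. proj \<tau> \<xi> (LT (snd x) p) = 0"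
      using x unfolding P_def LT_def by (auto intro: smooth_lower_op \<kappa>)
    have "LT (snd x) p = 0" if "p \<in> past_right" for p
      unfolding LT_def by (rule lower_op_eq_0[OF _ \<kappa> closure_past(1) _ that]) (use x in \<open>auto simp: P_def\<close>)
    then have XT0: "\<forall>p\<in>past_right. LT (snd x) p = 0" by blast
    have XR: "smooth (LR (fst x))" "\<And>p. proj \<tau> (reflect \<xi>) (LR (fst x) p) = 0"
      using x unfolding P_def LR_def by (auto intro: smooth_lower_op)
    have "LR (fst x) p = 0" if "p \<in> past_left" for p
      unfolding LR_def by (rule lower_op_eq_0[OF _ _ closure_past(2) _ that]) (use x in \<open>auto simp: P_def\<close>)
    then have XR0: "\<forall>p\<in>past_left. LR (fst x) p = 0" by blast
    obtain R T where "smooth R" "smooth T"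
      "\<And>p. \<i> *s symb maxwell \<tau> \<xi> (T p) + LT (snd x) p = 0"
      "\<And>p. \<i> *s symb maxwell \<tau> (reflect \<xi>) (R p) + LR (fst x) p = 0"
      "\<And>p. proj \<tau> \<xi> (lower_op maxwell \<kappa> (smart_matrix \<nu>) T p) = 0"
      "\<And>p. proj \<tau> (reflect \<xi>) (lower_op maxwell (\<lambda>_. 0) 0 R p) = 0"
      "\<And>p. p \<in> past_right \<Longrightarrow> T p = 0" "\<And>p. p \<in> past_left \<Longrightarrow> R p = 0"
      "\<And>p. p \<in> interface \<Longrightarrow> maxwell 1 *v (aI (Suc n) p + R p - T p) = 0"
      by (rule smart_step[OF aI[of "Suc n"] aI0 \<kappa> XT XT0 XR XR0, where \<nu> = \<nu>]) (rule that; assumption)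
    then have "P (Suc n) (R, T) \<and> Q x (R, T)" unfolding P_def Q_def by (simp add: LT_def[symmetric] LR_def[symmetric])
    then show "\<exists>y. P (Suc n) y \<and> Q x y" ..
  qed
  then obtain f where f: "\<And>n. P n (f n)" "\<And>n. Q (f n) (f (Suc n))" by blast
  define aR where "aR = (\<lambda>n. fst (f n))"
  define aT where "aT = (\<lambda>n. snd (f n))"
  have "wkb maxwell (\<lambda>_. 0) 0 \<tau> (reflect \<xi>) left aR" "wkb maxwell \<kappa> (smart_matrix \<nu>) \<tau> \<xi> right aT"
    unfolding wkb_def
  proof (safe)
    fix j and t :: real and x :: "real^3"
    show "\<i> *s symb maxwell \<tau> (reflect \<xi>) (aR j (t, x))
        + (if j = 0 then 0 else lower_op maxwell (\<lambda>_. 0) 0 (aR (j - 1)) (t, x)) = 0"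
      using f(1)[of 0] f(2)[of "j - 1"]
      by (cases j) (auto simp: P_def Q_def LR_def aR_def)
    show "\<i> *s symb maxwell \<tau> \<xi> (aT j (t, x))
        + (if j = 0 then 0 else lower_op maxwell \<kappa> (smart_matrix \<nu>) (aT (j - 1)) (t, x)) = 0"
      using f(1)[of 0] f(2)[of "j - 1"]
      by (cases j) (auto simp: P_def Q_def LT_def aT_def)
  qed
  moreover have "smooth (aR j)" "smooth (aT j)" for j
    using f(1)[of j] by (auto simp: P_def aR_def aT_def)
  moreover have "\<forall>j x. ((0, x) \<in> left \<longrightarrow> aR j (0, x) = 0) \<and> ((0, x) \<in> right \<longrightarrow> aT j (0, x) = 0)"
    using f(1) by (auto simp: P_def aR_def aT_def past_left_def past_right_def)
  moreover have "\<forall>j. \<forall>p\<in>interface. maxwell 1 *v (aI j p + aR j p - aT j p) = 0"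
    using f(1) by (auto simp: P_def aR_def aT_def)
  ultimately have "transmission maxwell (smart_C \<sigma> \<nu>) \<mu> \<tau> \<xi> aI aR aT"
    using incident_wkb[OF inc] by (subst smart_transmission_iff[OF aI s]) (auto simp: \<kappa>_def)
  then show ?thesis by blast
qed

end

section \<open>The Berenger layer\<close>

text \<open>The unsplit field: summing the blocks intertwines \<open>berenger\<close> with
  \<open>maxwell\<close>.\<close>

definition total :: "complex^(3 \<times> 3) \<Rightarrow> complex^3"
  where "total U = (\<chi> m. \<Sum>l\<in>UNIV. U $ (l, m))"

definition layer_matrix :: "complex^(3 \<times> 3)^(3 \<times> 3)"
  where "layer_matrix = (\<chi> r c. if r = c \<and> fst r = 1 then 1 else 0)"

lemma total_linear:
  "total (U + V) = total U + total V" "total (r *\<^sub>R U) = r *\<^sub>R total U" "total (c *s U) = c *s total U"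
  "total 0 = 0" "total (- U) = - total U"
  by (simp_all add: total_def vec_eq_iff sum.distrib scaleR_sum_right sum_distrib_left sum_negf)

lemma bounded_linear_total: "bounded_linear total"
  by (rule linear_conv_bounded_linear[THEN iffD1]) (intro linearI total_linear)

lemma sum_UNIV_prod: "(\<Sum>c\<in>UNIV. f c) = (\<Sum>m\<in>UNIV. \<Sum>l\<in>UNIV. f (l, m))"
  for f :: "'a::finite \<times> 'b::finite \<Rightarrow> 'c::comm_monoid_add"
  unfolding UNIV_Times_UNIV[symmetric] sum.cartesian_product' by (rule sum.swap)

lemma berenger_nth: "(berenger l *v U) $ r = (if fst r = l then (maxwell l *v total U) $ snd r else 0)"
  by (simp add: berenger_def matrix_vector_mult_def total_def sum_UNIV_prod sum_distrib_left)

lemma layer_matrix_nth: "(layer_matrix *v U) $ r = (if fst r = 1 then U $ r else 0)"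
  by (cases "fst r = 1")
    (auto simp: layer_matrix_def matrix_vector_mult_def if_distrib[of "\<lambda>z. z * _"] cong: if_cong)

lemma total_berenger: "total (berenger l *v U) = maxwell l *v total U"
  by (simp add: total_def[of "berenger l *v U"] berenger_nth vec_eq_iff)

lemma berenger_C_vector: "berenger_C \<sigma> x *v U = \<sigma> x *\<^sub>R (layer_matrix *v U)"
  by (simp add: berenger_C_def layer_matrix_def scaleR_matrix_vector)

lemma total_principal: "smooth f \<Longrightarrow> total (principal berenger f p) = principal maxwell (\<lambda>p. total (f p)) p"
  by (simp add: principal_def total_linear linear_sum[OF bounded_linear.linear[OF bounded_linear_total]]
      total_berenger bounded_linear.ddir_image[OF bounded_linear_total])

lemma symb_berenger_nth: "symb berenger \<tau> \<xi> U $ (l, m) = \<tau> *\<^sub>R U $ (l, m) + \<xi> $ l *\<^sub>R (maxwell l *v total U) $ m"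
  by (simp add: symb_def berenger_nth if_distrib[of "\<lambda>z. _ *\<^sub>R z"] cong: if_cong)

lemma total_symb: "total (symb berenger \<tau> \<xi> U) = symb maxwell \<tau> \<xi> (total U)"
  by (simp add: symb_def total_linear linear_sum[OF bounded_linear.linear[OF bounded_linear_total]] total_berenger)

text \<open>Since \<open>\<tau>\<close> is nonzero, every block of a kernel vector is recovered from
  the total field.\<close>

lemma symb_berenger_eq_0:
  assumes "\<tau> \<noteq> 0" "symb berenger \<tau> \<xi> U = 0"
  shows "U $ (l, m) = - ((\<xi> $ l / \<tau>) *\<^sub>R (maxwell l *v total U) $ m)"
proof -
  have "\<tau> *\<^sub>R U $ (l, m) + \<xi> $ l *\<^sub>R (maxwell l *v total U) $ m = 0"
    using assms(2) symb_berenger_nth[of \<tau> \<xi> U l m] by simp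
  then have "(1 / \<tau>) *\<^sub>R (\<tau> *\<^sub>R U $ (l, m) + \<xi> $ l *\<^sub>R (maxwell l *v total U) $ m) = 0" by simp
  then show ?thesis using assms(1) by (simp add: scaleR_add_right add_eq_0_iff2)
qed

lemma symb_berenger_eq_0_total:
  assumes "\<tau> \<noteq> 0" "symb berenger \<tau> \<xi> U = 0" "total U = 0"
  shows "U = 0"
proof -
  have "U $ (l, m) = 0" for l m
    using symb_berenger_eq_0[OF assms(1,2), of l m] by (simp add: assms(3))
  then show ?thesis by (simp add: vec_eq_iff)
qed

context incidence
begin

text \<open>The totals satisfy the hypotheses of \<open>transmission_unique_step\<close>; once they
  vanish, the kernel equation makes the split fields vanish too.\<close>

lemma berenger_wkb_unique:
  assumes R: "\<And>j. smooth (R j)" and T: "\<And>j. smooth (T j)" and \<kappa>: "smooth \<kappa>"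
    and wR: "wkb berenger (\<lambda>_. 0) 0 \<tau> (reflect \<xi>) left R"
    and wT: "wkb berenger \<kappa> layer_matrix \<tau> \<xi> right T"
    and j: "\<And>j p. p \<in> interface \<Longrightarrow> berenger 1 *v (R j p - T j p) = 0"
  shows "(\<forall>p\<in>right. T j p = 0) \<and> (\<forall>p\<in>left. R j p = 0)"
proof (induction j rule: less_induct)
  case (less n)
  have sT: "symb berenger \<tau> \<xi> (T n p) = 0"
    "lower_op berenger \<kappa> layer_matrix (T n) p = - (\<i> *s symb berenger \<tau> \<xi> (T (Suc n) p))" if "p \<in> right" for p
    using wkb_first[OF wT T \<kappa> closure_interior_right, of n p] less that by blast+
  have sR: "symb berenger \<tau> (reflect \<xi>) (R n p) = 0"
    "lower_op berenger (\<lambda>_. 0) 0 (R n) p = - (\<i> *s symb berenger \<tau> (reflect \<xi>) (R (Suc n) p))" if "p \<in> left" for p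
    using wkb_first[OF wR R _ closure_interior_left, of n p] less that by auto
  define VT where "VT = (\<lambda>p. total (T n p))"
  define VR where "VR = (\<lambda>p. total (R n p))"
  have VT: "smooth VT" and VR: "smooth VR"
    unfolding VT_def VR_def by (intro bounded_linear.smooth_image[OF bounded_linear_total] R T)+
  \<comment> \<open>On kernel vectors the first block is \<open>v_1\<close> times
    \<open>maxwell 1\<close> applied to the total, so the layer acts on the total through this
    matrix, with rate \<open>v_1^2\<close>.\<close>
  define D where "D = group_velocity \<tau> \<xi> $ 1 *\<^sub>R maxwell 1"
  have D: "proj \<tau> \<xi> (D *v proj \<tau> \<xi> u) = (group_velocity \<tau> \<xi> $ 1 * group_velocity \<tau> \<xi> $ 1) *\<^sub>R proj \<tau> \<xi> u" for u
    by (simp add: D_def scaleR_matrix_vector proj_linear proj_maxwell_proj)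
  have kT: "symb maxwell \<tau> \<xi> (VT p) = 0" if "p \<in> right" for p
    using sT(1)[OF that] by (simp add: VT_def total_symb[symmetric] total_linear)
  have kR: "symb maxwell \<tau> (reflect \<xi>) (VR p) = 0" if "p \<in> left" for p
    using sR(1)[OF that] by (simp add: VR_def total_symb[symmetric] total_linear)
  have eT: "proj \<tau> \<xi> (lower_op maxwell \<kappa> D VT p) = 0" if "p \<in> right" for p
  proof -
    have "total (layer_matrix *v T n p) = D *v VT p"
    proof -
      have "total (layer_matrix *v T n p) $ m = T n p $ (1, m)" for m
        by (simp add: total_def layer_matrix_nth)
      moreover have "D *v VT p = (- (\<xi> $ 1 / \<tau>)) *\<^sub>R (maxwell 1 *v total (T n p))"
        unfolding D_def scaleR_matrix_vector VT_def by (simp add: group_velocity_def)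
      ultimately show ?thesis
        using symb_berenger_eq_0[OF \<tau> sT(1)[OF that], of 1] by (simp add: vec_eq_iff[of "total _"])
    qed
    then have "lower_op maxwell \<kappa> D VT p = total (lower_op berenger \<kappa> layer_matrix (T n) p)"
      by (simp add: lower_op_def total_linear total_principal[OF T] VT_def)
    also have "\<dots> = - (\<i> *s symb maxwell \<tau> \<xi> (total (T (Suc n) p)))"
      unfolding sT(2)[OF that] by (simp add: total_linear total_symb)
    finally show ?thesis by (simp add: proj_linear proj_symb)
  qed
  have eR: "proj \<tau> (reflect \<xi>) (lower_op maxwell (\<lambda>_. 0) 0 VR p) = 0" if "p \<in> left" for p
  proof -
    have "lower_op maxwell (\<lambda>_. 0) 0 VR p = total (lower_op berenger (\<lambda>_. 0) 0 (R n) p)"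
      by (simp add: lower_op_def total_principal[OF R] VR_def)
    also have "\<dots> = - (\<i> *s symb maxwell \<tau> (reflect \<xi>) (total (R (Suc n) p)))"
      unfolding sR(2)[OF that] by (simp add: total_linear total_symb)
    finally show ?thesis by (simp add: proj_linear reflected.proj_symb)
  qed
  have jV: "maxwell 1 *v (VR p - VT p) = 0" if "p \<in> interface" for p
  proof -
    have "total (berenger 1 *v (R n p - T n p)) = 0" using j[OF that] by (simp add: total_linear)
    then show ?thesis
      by (simp add: total_berenger VR_def VT_def linear_diff[OF bounded_linear.linear[OF bounded_linear_total]])
  qed
  note z = transmission_unique_step[OF VR VT \<kappa> D kT kR eT eR jV]
  have "T n p = 0" if "p \<in> right" for p
    using z(1)[of p] symb_berenger_eq_0_total[OF \<tau> sT(1)[OF that]] that by (simp add: VT_def)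
  moreover have "R n p = 0" if "p \<in> left" for p
    using z(2)[of p] symb_berenger_eq_0_total[OF \<tau> sR(1)[OF that]] that by (simp add: VR_def)
  ultimately show ?case by blast
qed

lemma berenger_transmission_unique:
  assumes "absorption \<sigma>" "\<And>j. smooth (aI j)"
    and "transmission berenger (berenger_C \<sigma>) \<mu> \<tau> \<xi> aI aR aT"
    and "transmission berenger (berenger_C \<sigma>) \<mu> \<tau> \<xi> aI aR' aT'"
  shows "(\<forall>p\<in>left. aR' j p = aR j p) \<and> (\<forall>p\<in>right. aT' j p = aT j p)"
  by (rule layer_transmission_unique[where C = "berenger_C \<sigma>" and \<sigma> = \<sigma> and C\<^sub>0 = layer_matrix, OF berenger_C_vector assms(1,2) _ assms(3,4)])
    (rule berenger_wkb_unique; assumption)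

end

text \<open>With \<open>D\<^sub>t = i\<tau>/\<epsilon> + \<partial>\<^sub>t\<close> and \<open>D\<^sub>1 = i\<xi>\<^sub>1/\<epsilon> + \<partial>\<^sub>1\<close> acting on formal series of amplitudes, the
  stretching of the variable \<open>x\<^sub>1\<close> by the layer is \<open>exp (\<theta> D\<^sub>1 D\<^sub>t\<^sup>-\<^sup>1)\<close>, where \<open>\<theta> = \<mu> \<integral> \<sigma>\<close>. Here
  \<open>dt_inv\<close> is \<open>(\<tau> - i\<epsilon>\<partial>\<^sub>t)\<^sup>-\<^sup>1\<close>, \<open>quot\<close> is \<open>D\<^sub>1 D\<^sub>t\<^sup>-\<^sup>1\<close> and \<open>nilp\<close> is its part of order \<open>\<epsilon>\<close>, of
  which only finitely many powers contribute to a coefficient of \<open>stretch\<close>.\<close>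

type_synonym 'n series = "nat \<Rightarrow> spacetime \<Rightarrow> complex^'n"

primrec dt_inv :: "complex \<Rightarrow> 'n::finite series \<Rightarrow> 'n series"
  where
    "dt_inv t a 0 = (\<lambda>p. (1 / t) *s a 0 p)"
  | "dt_inv t a (Suc j) = (\<lambda>p. (1 / t) *s (a (Suc j) p + \<i> *s Dt (dt_inv t a j) p))"

text \<open>Multiplication of the formal series by \<epsilon>.\<close>

definition shift :: "'n::finite series \<Rightarrow> 'n series"
  where "shift a j = (if j = 0 then (\<lambda>p. 0) else a (j - 1))"

definition quot :: "complex \<Rightarrow> complex \<Rightarrow> 'n::finite series \<Rightarrow> 'n series"
  where "quot t x a j = (\<lambda>p. x *s dt_inv t a j p - \<i> *s shift (\<lambda>j. Dx 1 (dt_inv t a j)) j p)"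

definition nilp :: "complex \<Rightarrow> complex \<Rightarrow> 'n::finite series \<Rightarrow> 'n series"
  where "nilp t x a j = (\<lambda>p. quot t x a j p - (x / t) *s a j p)"

definition stretch :: "complex \<Rightarrow> complex \<Rightarrow> (spacetime \<Rightarrow> real) \<Rightarrow> 'n::finite series \<Rightarrow> 'n series"
  where "stretch t x \<theta> a j = (\<lambda>p. exp (x / t * of_real (\<theta> p)) *s
    (\<Sum>k\<le>j. (of_real (\<theta> p) ^ k / fact k) *s (nilp t x ^^ k) a j p))"

definition series_smooth :: "'n::finite series \<Rightarrow> bool"
  where "series_smooth a \<longleftrightarrow> (\<forall>j. smooth (a j))"

section \<open>Calculus of the stretching operators\<close>

lemma smooth_dt_inv: "series_smooth a \<Longrightarrow> smooth (dt_inv t a j)"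
  by (induction j) (auto simp: series_smooth_def intro!: smooth_smult_const smooth_add smooth_ddir)

lemma smooth_shift: "series_smooth a \<Longrightarrow> smooth (shift a j)"
  by (auto simp: shift_def series_smooth_def)

lemma smooth_quot: "series_smooth a \<Longrightarrow> series_smooth (quot t x a)"
  unfolding series_smooth_def[of "quot t x a"] quot_def
  by (intro allI smooth_diff smooth_smult_const smooth_dt_inv smooth_shift)
    (auto simp: series_smooth_def[of "\<lambda>j. Dx 1 (dt_inv t a j)"] intro: smooth_dt_inv)

lemma smooth_nilp: "series_smooth a \<Longrightarrow> series_smooth (nilp t x a)"
  using smooth_quot[of a t x] unfolding series_smooth_def nilp_def
  by (auto intro!: smooth_diff smooth_smult_const)

lemma smooth_nilp_pow: "series_smooth a \<Longrightarrow> series_smooth ((nilp t x ^^ k) a)"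
  by (induction k) (auto intro: smooth_nilp)

lemma smooth_of_real: "smooth f \<Longrightarrow> smooth (\<lambda>p. complex_of_real (f p))"
  by (rule bounded_linear.smooth_image[OF bounded_linear_of_real])

lemma smooth_power: "smooth f \<Longrightarrow> smooth (\<lambda>p. f p ^ k :: complex)"
  by (induction k) (auto intro: smooth_mult)

lemma ddir_power:
  "smooth f \<Longrightarrow> ddir v (\<lambda>p. f p ^ k :: complex) p = of_nat k * f p ^ (k - 1) * ddir v f p"
proof (induction k)
  case (Suc k)
  then show ?case
    by (cases k) (simp_all add: ddir_mult smooth_power smooth_mult algebra_simps)
qed simp

text \<open>Common frame for directional derivatives and constant complex-linear maps: having
  constant coefficients, they pass through \<open>dt_inv\<close>, \<open>quot\<close> and the powers
  of \<open>nilp\<close>.\<close>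

locale commuting =
  fixes \<Lambda> :: "(spacetime \<Rightarrow> complex^'n) \<Rightarrow> spacetime \<Rightarrow> complex^'m"
  assumes smooth_op: "smooth f \<Longrightarrow> smooth (\<Lambda> f)"
    and add: "smooth f \<Longrightarrow> smooth g \<Longrightarrow> \<Lambda> (\<lambda>p. f p + g p) = (\<lambda>p. \<Lambda> f p + \<Lambda> g p)"
    and smult: "smooth f \<Longrightarrow> \<Lambda> (\<lambda>p. c *s f p) = (\<lambda>p. c *s \<Lambda> f p)"
    and ddir: "smooth f \<Longrightarrow> \<Lambda> (ddir v f) = ddir v (\<Lambda> f)"
begin

lemma zero: "\<Lambda> (\<lambda>p. 0) = (\<lambda>p. 0)"
  using smult[of "\<lambda>p. 0" 0] by simp

lemma diff:
  assumes "smooth f" "smooth g"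
  shows "\<Lambda> (\<lambda>p. f p - g p) = (\<lambda>p. \<Lambda> f p - \<Lambda> g p)"
  using add[OF assms(1) smooth_smult_const[OF assms(2), of "- 1"]] smult[OF assms(2), of "- 1"] by simp

lemma dt_inv: "series_smooth a \<Longrightarrow> dt_inv t (\<lambda>j. \<Lambda> (a j)) j = \<Lambda> (dt_inv t a j)"
proof (induction j)
  case 0
  then show ?case by (simp add: smult series_smooth_def)
next
  case (Suc j)
  have "smooth (a (Suc j))" "smooth (Dt (dt_inv t a j))"
    using Suc.prems smooth_dt_inv[OF Suc.prems] by (auto simp: series_smooth_def)
  then show ?case
    using Suc by (simp add: smult add ddir[OF smooth_dt_inv[OF Suc.prems], symmetric] smooth_smult_const)
qed

lemma shift: "shift (\<lambda>j. \<Lambda> (a j)) j = \<Lambda> (shift a j)"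
  by (simp add: shift_def zero)

lemma quot:
  assumes a: "series_smooth a"
  shows "quot t x (\<lambda>j. \<Lambda> (a j)) = (\<lambda>j. \<Lambda> (quot t x a j))"
proof
  fix j
  have s: "series_smooth (\<lambda>j. Dx 1 (dt_inv t a j))"
    using a by (auto simp: series_smooth_def[of "\<lambda>j. Dx 1 (dt_inv t a j)"] intro: smooth_dt_inv)
  have "(\<lambda>j. Dx 1 (dt_inv t (\<lambda>j. \<Lambda> (a j)) j)) = (\<lambda>j. \<Lambda> (Dx 1 (dt_inv t a j)))"
    by (simp add: dt_inv[OF a] ddir[OF smooth_dt_inv[OF a]])
  then show "quot t x (\<lambda>j. \<Lambda> (a j)) j = \<Lambda> (quot t x a j)"
    unfolding quot_def dt_inv[OF a]
    by (simp add: shift diff smult smooth_smult_const smooth_dt_inv[OF a] smooth_shift[OF s])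
qed

lemma nilp:
  assumes a: "series_smooth a"
  shows "nilp t x (\<lambda>j. \<Lambda> (a j)) = (\<lambda>j. \<Lambda> (nilp t x a j))"
proof -
  have "smooth (a j)" "smooth (quot t x a j)" for j
    using a smooth_quot[OF a] by (auto simp: series_smooth_def)
  then show ?thesis
    by (intro ext) (simp add: nilp_def quot[OF a] diff smult smooth_smult_const)
qed

lemma nilp_pow:
  "series_smooth a \<Longrightarrow> (nilp t x ^^ k) (\<lambda>j. \<Lambda> (a j)) = (\<lambda>j. \<Lambda> ((nilp t x ^^ k) a j))"
  by (induction k) (simp_all add: nilp smooth_nilp_pow)

end

lemma commuting_ddir: "commuting (ddir v :: (spacetime \<Rightarrow> complex^'n) \<Rightarrow> _)"
  by unfold_locales (auto simp: ddir_add ddir_smult_const ddir_commute)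

lemma commuting_linear:
  assumes L: "bounded_linear L" and c: "\<And>c u. L (c *s u) = c *s L u"
  shows "commuting (\<lambda>f p. L (f p))"
  by unfold_locales
    (auto simp: bounded_linear.smooth_image[OF L] bounded_linear.ddir_image[OF L] c
      linear_add[OF bounded_linear.linear[OF L]])

lemma series_add:
  fixes a b :: "'n::finite series"
  assumes a: "series_smooth a" and b: "series_smooth b"
  shows "nilp t x (\<lambda>j p. a j p + b j p) = (\<lambda>j p. nilp t x a j p + nilp t x b j p)"
    and "series_smooth (\<lambda>j p. a j p + b j p)"
proof -
  have d: "dt_inv t (\<lambda>j p. a j p + b j p) j = (\<lambda>p. dt_inv t a j p + dt_inv t b j p)" for j
  proof (induction j)
    case (Suc j)
    show ?case
      unfolding dt_inv.simps Suc by (intro ext) (simp add: ddir_add smooth_dt_inv a b vector_add_ldistrib)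
  qed (simp add: vector_add_ldistrib)
  have q: "quot t x (\<lambda>j p. a j p + b j p) j p = quot t x a j p + quot t x b j p" for j p
    by (simp add: quot_def d shift_def ddir_add smooth_dt_inv a b vector_add_ldistrib)
  then show "nilp t x (\<lambda>j p. a j p + b j p) = (\<lambda>j p. nilp t x a j p + nilp t x b j p)"
    by (simp add: fun_eq_iff nilp_def vector_add_ldistrib)
  show "series_smooth (\<lambda>j p. a j p + b j p)" using a b by (auto simp: series_smooth_def)
qed

lemma series_add_pow:
  fixes a b :: "'n::finite series"
  assumes a: "series_smooth a" and b: "series_smooth b"
  shows "(nilp t x ^^ k) (\<lambda>j p. a j p + b j p) = (\<lambda>j p. (nilp t x ^^ k) a j p + (nilp t x ^^ k) b j p)"
  by (induction k) (simp_all add: series_add(1) smooth_nilp_pow a b)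

lemma dt_inv_shift: "dt_inv t (shift a) (Suc j) = dt_inv t a j"
  by (induction j) (simp_all add: shift_def)

lemma quot_shift: "quot t x (shift a) = shift (quot t x a)"
proof
  fix j
  have 0: "dt_inv t (shift a) 0 = (\<lambda>p. 0)" by (simp add: shift_def)
  show "quot t x (shift a) j = shift (quot t x a) j"
  proof (cases j)
    case 0
    then show ?thesis by (simp add: quot_def shift_def)
  next
    case (Suc i)
    then show ?thesis
      by (cases i) (simp_all add: quot_def shift_def[of "\<lambda>j. Dx 1 (dt_inv t (shift a) j)"]
          shift_def[of "\<lambda>j. Dx 1 (dt_inv t a j)"] shift_def[of "quot t x a"] dt_inv_shift 0 del: dt_inv.simps)
  qed
qed

lemma nilp_shift: "nilp t x (shift a) = shift (nilp t x a)"
  by (rule ext) (simp add: nilp_def quot_shift shift_def[of "quot t x a"] shift_def[of "nilp t x a"] shift_def[of a])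

lemma nilp_pow_shift: "(nilp t x ^^ k) (shift a) = shift ((nilp t x ^^ k) a)"
  by (induction k) (simp_all add: nilp_shift)

lemma nilp_Suc:
  assumes "t \<noteq> 0"
  shows "nilp t x a (Suc j) p = (x / t * \<i>) *s Dt (dt_inv t a j) p - \<i> *s Dx 1 (dt_inv t a j) p"
  using assms by (simp add: nilp_def quot_def shift_def vec_eq_iff field_simps)

lemma nilp_0: "t \<noteq> 0 \<Longrightarrow> nilp t x a 0 p = 0"
  by (simp add: nilp_def quot_def shift_def vec_eq_iff)

text \<open>The part of order zero in \<epsilon> has been subtracted from \<open>quot\<close>, so
  each application raises the order by one and the exponential series is finite in each
  coefficient.\<close>

lemma nilp_order:
  assumes t: "t \<noteq> 0" and a: "\<And>i. i < m \<Longrightarrow> a i = (\<lambda>p. 0)" and i: "i < Suc m"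
  shows "nilp t x a i = (\<lambda>p. 0)"
proof (cases i)
  case 0
  then show ?thesis using t by (simp add: nilp_0 fun_eq_iff)
next
  case (Suc l)
  have "dt_inv t a l = (\<lambda>p. 0)" if "l < m" for l
    using that by (induction l) (simp_all add: a)
  then show ?thesis using Suc i t by (intro ext) (simp add: nilp_Suc)
qed

lemma nilp_pow_order: "t \<noteq> 0 \<Longrightarrow> i < k \<Longrightarrow> (nilp t x ^^ k) a i = (\<lambda>p. 0)"
proof (induction k arbitrary: i)
  case (Suc k)
  then show ?case using nilp_order[of t k "(nilp t x ^^ k) a" i x] by simp
qed simp

text \<open>Any cutoff beyond \<open>j\<close> gives the same sum, so that coefficients of different
  index can be compared term by term.\<close>

lemma stretch_sum:
  assumes "t \<noteq> 0" "j < n"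
  shows "stretch t x \<theta> a j p = exp (x / t * of_real (\<theta> p)) *s
    (\<Sum>k<n. (of_real (\<theta> p) ^ k / fact k) *s (nilp t x ^^ k) a j p)"
proof -
  have "(\<Sum>k\<le>j. (of_real (\<theta> p) ^ k / fact k) *s (nilp t x ^^ k) a j p)
    = (\<Sum>k<n. (of_real (\<theta> p) ^ k / fact k) *s (nilp t x ^^ k) a j p)"
    using assms by (intro sum.mono_neutral_left) (auto simp: nilp_pow_order)
  then show ?thesis by (simp add: stretch_def)
qed

lemma stretch_shift:
  assumes t: "t \<noteq> 0"
  shows "stretch t x \<theta> (shift a) j p = shift (stretch t x \<theta> a) j p"
proof (cases j)
  case 0
  then show ?thesis by (simp add: stretch_def shift_def)
next
  case (Suc i)
  then show ?thesis
    using t stretch_sum[OF t, of j "Suc j" x \<theta> "shift a" p] stretch_sum[OF t, of i "Suc j" x \<theta> a p]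
    by (simp add: nilp_pow_shift shift_def)
qed

lemma stretch_linear:
  assumes L: "bounded_linear L" and c: "\<And>c u. L (c *s u) = c *s L u" and a: "series_smooth a"
  shows "stretch t x \<theta> (\<lambda>j p. L (a j p)) j p = L (stretch t x \<theta> a j p)"
proof -
  interpret commuting "\<lambda>f p. L (f p)" by (rule commuting_linear[OF L c])
  show ?thesis
    by (simp add: stretch_def nilp_pow[OF a] c linear_sum[OF bounded_linear.linear[OF L]])
qed

lemma stretch_add:
  assumes a: "series_smooth a" and b: "series_smooth b"
  shows "stretch t x \<theta> (\<lambda>j p. a j p + b j p) j p = stretch t x \<theta> a j p + stretch t x \<theta> b j p"
  by (simp add: stretch_def series_add_pow[OF a b] vector_add_ldistrib sum.distrib)

lemma smooth_stretch:
  assumes "series_smooth a" "smooth \<theta>"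
  shows "smooth (stretch t x \<theta> a j)"
proof -
  have "smooth (\<lambda>p. of_real (\<theta> p) ^ k / fact k :: complex)" for k
    using smooth_mult[OF smooth_power[OF smooth_of_real[OF assms(2)]] smooth_const[of "1 / fact k"], of k] by simp
  moreover have "smooth ((nilp t x ^^ k) a j)" for k
    using smooth_nilp_pow[OF assms(1)] by (auto simp: series_smooth_def)
  moreover have "smooth (\<lambda>p. exp (x / t * of_real (\<theta> p)))"
    by (intro smooth_exp smooth_mult smooth_const smooth_of_real assms)
  ultimately show ?thesis
    unfolding stretch_def by (intro smooth_smult smooth_sum)
qed

text \<open>The rule for differentiating \<open>exp (\<theta> Q)\<close> holds although
  \<open>Q\<close> need not commute with multiplication by \<open>\<theta>\<close>: in
  \<open>stretch\<close> all powers of \<open>\<theta>\<close> stand to the left of the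
  operators.\<close>

lemma ddir_stretch:
  fixes a :: "'n::finite series"
  assumes t: "t \<noteq> 0" and a: "series_smooth a" and \<theta>: "smooth \<theta>"
  shows "ddir v (stretch t x \<theta> a j) p = stretch t x \<theta> (\<lambda>j. ddir v (a j)) j p
    + ddir v \<theta> p *\<^sub>R stretch t x \<theta> (quot t x a) j p"
proof -
  interpret commuting "ddir v :: (spacetime \<Rightarrow> complex^'n) \<Rightarrow> _" by (rule commuting_ddir)
  define c where "c = (\<lambda>k p. of_real (\<theta> p) ^ k / fact k :: complex)"
  define F where "F = (\<lambda>k. (nilp t x ^^ k) a j)"
  define e where "e = (\<lambda>p. exp (x / t * of_real (\<theta> p)))"
  define \<delta> where "\<delta> = complex_of_real (ddir v \<theta> p)"
  have \<theta>c: "smooth (\<lambda>p. complex_of_real (\<theta> p))" and dc: "ddir v (\<lambda>p. complex_of_real (\<theta> p)) p = \<delta>"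
    by (simp_all add: smooth_of_real \<theta> bounded_linear.ddir_image[OF bounded_linear_of_real] \<delta>_def)
  have e: "smooth e" unfolding e_def by (intro smooth_exp smooth_mult smooth_const \<theta>c)
  have m: "smooth (\<lambda>p. x / t * complex_of_real (\<theta> p))" by (intro smooth_mult smooth_const \<theta>c)
  have "ddir v (\<lambda>p. x / t * complex_of_real (\<theta> p)) p = x / t * \<delta>"
    using ddir_mult[OF smooth_const \<theta>c, of v "x / t"] dc by simp
  then have de: "ddir v e p = e p * (x / t * \<delta>)"
    unfolding e_def by (simp only: ddir_exp[OF smooth_differentiable[OF m]])
  have c: "smooth (c k)" for k
    unfolding c_def using smooth_mult[OF smooth_power[OF \<theta>c] smooth_const[of "1 / fact k"], of k] by simp
  have dck: "ddir v (c k) p = (if k = 0 then 0 else \<delta> * c (k - 1) p)" for k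
  proof -
    have "ddir v (c k) p = of_nat k * of_real (\<theta> p) ^ (k - 1) * \<delta> * (1 / fact k)"
      unfolding c_def
      using ddir_mult[OF smooth_power[OF \<theta>c] smooth_const[of "1 / fact k"], of v k] ddir_power[OF \<theta>c, of v k p]
      by (simp add: dc)
    then show ?thesis by (cases k) (simp_all add: c_def field_simps del: of_nat_Suc)
  qed
  have F: "smooth (F k)" for k using smooth_nilp_pow[OF a] by (auto simp: F_def series_smooth_def)
  have dF: "ddir v (F k) = (nilp t x ^^ k) (\<lambda>j. ddir v (a j)) j" for k by (simp add: F_def nilp_pow[OF a])
  have F0: "F k p = 0" if "k > j" for k p by (simp add: F_def nilp_pow_order[OF t that])
  define G where "G = (\<lambda>p. \<Sum>k<Suc j. c k p *s F k p)"
  have G: "smooth G" unfolding G_def by (intro smooth_sum smooth_smult c F)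
  have dG: "ddir v G p = (\<Sum>k<Suc j. c k p *s ddir v (F k) p) + \<delta> *s (\<Sum>k<Suc j. c k p *s F (Suc k) p)"
  proof -
    have "ddir v G p = (\<Sum>k<Suc j. c k p *s ddir v (F k) p) + (\<Sum>k<Suc j. ddir v (c k) p *s F k p)"
      unfolding G_def by (simp add: ddir_sum smooth_smult c F ddir_smult sum.distrib del: sum.lessThan_Suc)
    also have "(\<Sum>k<Suc j. ddir v (c k) p *s F k p) = (\<Sum>k<j. (\<delta> * c k p) *s F (Suc k) p)"
      by (subst sum.lessThan_Suc_shift) (simp add: dck)
    \<comment> \<open>The added term contains the power \<open>Suc j\<close> of \<open>nilp\<close>,
      which has no coefficient of index \<open>j\<close>.\<close>
    also have "\<dots> = (\<Sum>k<Suc j. (\<delta> * c k p) *s F (Suc k) p)" by (simp add: F0)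
    also have "\<dots> = \<delta> *s (\<Sum>k<Suc j. c k p *s F (Suc k) p)"
      by (simp add: linear_sum[OF bounded_linear.linear[OF bounded_linear_smult]] vector_smult_assoc vector_add_ldistrib)
    finally show ?thesis .
  qed
  have st: "stretch t x \<theta> b j q = e q *s (\<Sum>k<Suc j. c k q *s (nilp t x ^^ k) b j q)" for b :: "'n series" and q
    unfolding stretch_sum[OF t lessI] e_def c_def ..
  have "stretch t x \<theta> a j = (\<lambda>q. e q *s G q)" by (intro ext) (simp only: st G_def F_def)
  then have "ddir v (stretch t x \<theta> a j) p = e p *s ddir v G p + (e p * (x / t * \<delta>)) *s G p"
    by (simp add: ddir_smult[OF e G] de)
  also have "\<dots> = e p *s (\<Sum>k<Suc j. c k p *s ddir v (F k) p)
      + \<delta> *s (e p *s (\<Sum>k<Suc j. c k p *s F (Suc k) p) + (x / t) *s (e p *s G p))"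
    unfolding dG by (simp add: vec_eq_iff algebra_simps del: sum.lessThan_Suc)
  also have "e p *s (\<Sum>k<Suc j. c k p *s F (Suc k) p) = stretch t x \<theta> (nilp t x a) j p"
    unfolding st F_def by (simp add: funpow_swap1 del: sum.lessThan_Suc)
  also have "e p *s G p = stretch t x \<theta> a j p" unfolding st G_def F_def ..
  also have "e p *s (\<Sum>k<Suc j. c k p *s ddir v (F k) p) = stretch t x \<theta> (\<lambda>j. ddir v (a j)) j p"
    unfolding st dF ..
  also have "stretch t x \<theta> (nilp t x a) j p + (x / t) *s stretch t x \<theta> a j p = stretch t x \<theta> (quot t x a) j p"
  proof -
    have sa: "series_smooth (\<lambda>j p. (x / t) *s a j p)"
      using a by (auto simp: series_smooth_def intro: smooth_smult_const)
    have "quot t x a = (\<lambda>j p. nilp t x a j p + (x / t) *s a j p)"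
      by (simp add: fun_eq_iff nilp_def vec_eq_iff)
    then show ?thesis
      using stretch_add[OF smooth_nilp[OF a] sa] stretch_linear[OF bounded_linear_smult _ a, of "x / t"]
      by (simp add: vector_smult_assoc mult.commute)
  qed
  finally show ?thesis by (simp add: \<delta>_def vec_eq_iff scaleR_conv_of_real[where 'a = complex])
qed

text \<open>\<open>(\<tau> - i\<epsilon>\<partial>\<^sub>t) (D\<^sub>1 D\<^sub>t\<^sup>-\<^sup>1) a = (\<xi>\<^sub>1 - i\<epsilon>\<partial>\<^sub>1) a\<close>\<close>

lemma dt_quot:
  assumes t: "t \<noteq> 0" and a: "series_smooth a"
  shows "t *s quot t x a j p - \<i> *s shift (\<lambda>j. Dt (quot t x a j)) j p
    = x *s a j p - \<i> *s shift (\<lambda>j. Dx 1 (a j)) j p"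
proof -
  define b where "b = dt_inv t a"
  have b: "smooth (b j)" for j by (simp add: b_def smooth_dt_inv[OF a])
  have ab: "a j = (\<lambda>p. t *s b j p - \<i> *s shift (\<lambda>j. Dt (b j)) j p)" for j
    using t by (cases j) (simp_all add: b_def shift_def vec_eq_iff fun_eq_iff)
  have sh: "smooth (shift (\<lambda>j. ddir v (b j)) j)" for v j
    by (rule smooth_shift) (simp add: series_smooth_def b smooth_ddir)
  have q: "quot t x a j = (\<lambda>p. x *s b j p - \<i> *s shift (\<lambda>j. Dx 1 (b j)) j p)" for j
    by (simp add: quot_def b_def)
  have dq: "Dt (quot t x a j) p = x *s Dt (b j) p - \<i> *s Dt (shift (\<lambda>j. Dx 1 (b j)) j) p" for j p
    unfolding q by (simp add: ddir_diff ddir_smult_const smooth_smult_const b sh)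
  have da: "Dx 1 (a j) p = t *s Dx 1 (b j) p - \<i> *s Dx 1 (shift (\<lambda>j. Dt (b j)) j) p" for j p
    by (subst ab) (simp add: ddir_diff ddir_smult_const smooth_smult_const b sh)
  have cm: "Dt (shift (\<lambda>j. Dx 1 (b j)) i) p = Dx 1 (shift (\<lambda>j. Dt (b j)) i) p" for i p
    using ddir_commute[OF b, of "(1, 0)" "(0, axis 1 1)"] by (simp add: shift_def)
  show ?thesis
  proof (cases j)
    case 0
    then show ?thesis
      using ab[of 0] by (simp add: q shift_def vec_eq_iff)
  next
    case (Suc i)
    have "t *s quot t x a (Suc i) p - \<i> *s Dt (quot t x a i) p = x *s a (Suc i) p - \<i> *s Dx 1 (a i) p"
      unfolding dq da
      unfolding q cm
      by (subst ab) (simp add: shift_def[of _ "Suc i"] vec_eq_iff algebra_simps)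
    then show ?thesis using Suc by (simp add: shift_def)
  qed
qed

section \<open>The stretched incident wave in the layer\<close>

lemma layer_berenger: "layer_matrix *v (berenger l *v U) = (if l = 1 then berenger 1 *v U else 0)"
  by (auto simp: vec_eq_iff layer_matrix_nth berenger_nth)

lemma ddir_vanish:
  assumes "smooth f" "closure (interior Z) = Z" "\<forall>p\<in>Z. f p = 0" "p \<in> Z"
  shows "ddir v f p = 0"
proof (rule vanish_on_closure[OF smooth_ddir[OF assms(1)] _ assms(2,4)])
  fix q assume q: "q \<in> interior Z"
  have "ddir v f q = ddir v (\<lambda>p. 0) q"
    by (rule ddir_cong_open[OF open_interior q]) (use assms(3) interior_subset in auto)
  then show "ddir v f q = 0" by simp
qed

lemma stretch_vanish:
  assumes a: "series_smooth a" and Z: "closure (interior Z) = Z" and 0: "\<forall>j. \<forall>p\<in>Z. a j p = 0" and p: "p \<in> Z"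
  shows "stretch t x \<theta> a j p = 0"
proof -
  have d: "\<forall>p\<in>Z. dt_inv t b j p = 0" if b: "series_smooth b" "\<forall>j. \<forall>p\<in>Z. b j p = 0" for b :: "'a series" and j
    by (induction j) (use b ddir_vanish[OF smooth_dt_inv[OF b(1)] Z] in auto)
  have n: "\<forall>p\<in>Z. nilp t x b j p = 0" if b: "series_smooth b" "\<forall>j. \<forall>p\<in>Z. b j p = 0" for b :: "'a series" and j
    using d[OF b] b(2) ddir_vanish[OF smooth_dt_inv[OF b(1)] Z d[OF b]]
    by (auto simp: nilp_def quot_def shift_def)
  have "\<forall>j. \<forall>p\<in>Z. (nilp t x ^^ k) a j p = 0" for k
    by (induction k) (use 0 n[OF smooth_nilp_pow[OF a]] in auto)
  then show ?thesis using p by (simp add: stretch_def)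
qed

context incidence
begin

text \<open>Differentiating the stretching produces \<open>\<mu> \<sigma> A_1 D_1 D_t^-1\<close> of
  the total field; by the first split equation of the incident wave this cancels the absorption of
  the first block.\<close>

lemma berenger_transmission_exists:
  assumes \<sigma>: "absorption \<sigma>" and inc: "incident berenger \<tau> \<xi> aI"
  shows "\<exists>aT. transmission berenger (berenger_C \<sigma>) \<mu> \<tau> \<xi> aI (\<lambda>j p. 0) aT"
proof -
  have aI: "smooth (aI j)" for j using inc by (auto simp: incident_def)
  have sI: "series_smooth aI" using aI by (simp add: series_smooth_def)
  obtain s where s: "smooth s" "\<forall>x>0. \<sigma> x = s x" using absorption_extension[OF \<sigma>] by blast
  \<comment> \<open>The primitive of the absorption vanishes at \<open>0\<close>; hence nothing is
    stretched on the interface, and the transmission condition holds with zero reflected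
    wave.\<close>
  obtain S where S: "smooth S" "ddir 1 S = s" "\<And>x. x = 0 \<Longrightarrow> S x = 0"
    by (rule smooth_directional_primitive[OF s(1) bounded_linear_ident, of 1]) simp_all
  define \<theta> where "\<theta> = (\<lambda>p::spacetime. \<mu> * S (snd p $ 1))"
  have \<theta>: "smooth \<theta>" unfolding \<theta>_def by (rule smooth_coord[OF S(1)])
  have d\<theta>: "ddir v \<theta> p = snd v $ 1 * (\<mu> * s (snd p $ 1))" for v p
    unfolding \<theta>_def ddir_coord[OF S(1)] S(2) ..
  define t where "t = complex_of_real \<tau>"
  define x where "x = complex_of_real (\<xi> $ 1)"
  have t: "t \<noteq> 0" using \<tau> by (simp add: t_def)
  define E :: "(3 \<times> 3) series \<Rightarrow> (3 \<times> 3) series" where "E = stretch t x \<theta>"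
  define aT where "aT = E aI"
  have aT: "smooth (aT j)" for j unfolding aT_def E_def by (rule smooth_stretch[OF sI \<theta>])
  note wI = incident_wkb[OF inc]
  have wI': "\<i> *s symb berenger \<tau> \<xi> (aI j p) + shift (\<lambda>j. principal berenger (aI j)) j p = 0" for j p
    using bspec[OF spec[OF wI[unfolded wkb_def], of j] UNIV_I[of p]] by (cases j) (simp_all add: shift_def lower_op_def)
  define c where "c = (\<lambda>j p. layer_matrix *v aI j p)"
  define d where "d = (\<lambda>j p. berenger 1 *v aI j p)"
  have c: "series_smooth c" and d: "series_smooth d"
    unfolding series_smooth_def c_def d_def by (auto intro: smooth_matrix_vector aI)
  \<comment> \<open>The first block of the incident equations as formal series, up to a constant
    factor: \<open>D_t\<close> of the first split field plus \<open>D_1\<close> of \<open>d\<close>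
    is zero.\<close>
  have cd: "t *s c j p - \<i> *s shift (\<lambda>j. Dt (c j)) j p + (x *s d j p - \<i> *s shift (\<lambda>j. Dx 1 (d j)) j p) = 0" for j p
  proof -
    have 1: "layer_matrix *v symb berenger \<tau> \<xi> u = t *s (layer_matrix *v u) + x *s (berenger 1 *v u)" for u
      by (simp add: symb_def sum_3 matrix_vector_right_distrib matrix_vector_scaleR layer_berenger)
        (simp add: t_def x_def vec_eq_iff scaleR_conv_of_real[where 'a = complex])
    have 2: "layer_matrix *v principal berenger (aI i) p = Dt (c i) p + Dx 1 (d i) p" for i
      by (simp add: principal_def sum_3 matrix_vector_right_distrib layer_berenger c_def d_def ddir_matrix_vector[OF aI])
    have "layer_matrix *v (\<i> *s symb berenger \<tau> \<xi> (aI j p) + shift (\<lambda>j. principal berenger (aI j)) j p) = 0"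
      unfolding wI' by simp
    moreover have "layer_matrix *v shift (\<lambda>j. principal berenger (aI j)) j p = shift (\<lambda>j p. Dt (c j) p + Dx 1 (d j) p) j p"
      by (simp add: shift_def 2)
    ultimately have eq: "\<i> *s (t *s c j p + x *s d j p) + shift (\<lambda>j p. Dt (c j) p + Dx 1 (d j) p) j p = 0"
      unfolding matrix_vector_right_distrib vector_scalar_commute 1 by (simp add: c_def d_def)
    have "t *s c j p - \<i> *s shift (\<lambda>j. Dt (c j)) j p + (x *s d j p - \<i> *s shift (\<lambda>j. Dx 1 (d j)) j p)
      = (- \<i>) *s (\<i> *s (t *s c j p + x *s d j p) + shift (\<lambda>j p. Dt (c j) p + Dx 1 (d j) p) j p)"
      by (simp add: shift_def vec_eq_iff algebra_simps)
    then show ?thesis unfolding eq by simp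
  qed
  \<comment> \<open>\<open>D_t\<close> can be inverted on formal series because
    \<open>\<tau>\<close> is nonzero; the inversion takes the form of an induction over the
    index.\<close>
  have e0: "c j p + quot t x d j p = 0" for j p
  proof (induction j arbitrary: p)
    case 0
    have "t *s (c 0 p + quot t x d 0 p) = 0"
      using cd[of 0 p] dt_quot[OF t d, of x 0 p] by (simp add: shift_def vector_add_ldistrib)
    then show ?case using t vector_mul_eq_0 by blast
  next
    case (Suc j)
    have sc: "smooth (c j)" and sq: "smooth (quot t x d j)"
      using c smooth_quot[OF d, of t x] by (auto simp: series_smooth_def)
    have "(\<lambda>p. c j p + quot t x d j p) = (\<lambda>p. 0)" using Suc by simp
    then have "Dt (c j) p + Dt (quot t x d j) p = 0"
      using fun_cong[OF ddir_add[OF sc sq, of "(1, 0)"], of p] by simp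
    moreover have "t *s c (Suc j) p - \<i> *s Dt (c j) p + (t *s quot t x d (Suc j) p - \<i> *s Dt (quot t x d j) p) = 0"
      using cd[of "Suc j" p] dt_quot[OF t d, of x "Suc j" p] by (simp add: shift_def)
    moreover have "t *s (c (Suc j) p + quot t x d (Suc j) p)
      = (t *s c (Suc j) p - \<i> *s Dt (c j) p + (t *s quot t x d (Suc j) p - \<i> *s Dt (quot t x d j) p))
        + \<i> *s (Dt (c j) p + Dt (quot t x d j) p)"
      by (simp add: vec_eq_iff algebra_simps)
    ultimately have "t *s (c (Suc j) p + quot t x d (Suc j) p) = 0" by simp
    then show ?case using t vector_mul_eq_0 by blast
  qed
  have sD: "series_smooth (\<lambda>j. ddir v (aI j))" for v using aI by (auto simp: series_smooth_def)
  have sM: "series_smooth (\<lambda>j p. M *v ddir v (aI j) p)" for v and M :: "complex^(3 \<times> 3)^(3 \<times> 3)"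
    using aI by (auto simp: series_smooth_def intro!: smooth_matrix_vector)
  have sq: "series_smooth (quot t x aI)" by (rule smooth_quot[OF sI])
  have EM: "E (\<lambda>j p. M *v b j p) j p = M *v E b j p" if "series_smooth b" for M b j p
    unfolding E_def
    by (rule stretch_linear[OF matrix_vector_mul_bounded_linear _ that]) (simp add: vector_scalar_commute)
  define \<kappa> where "\<kappa> = (\<lambda>p::spacetime. \<mu> * s (snd p $ 1))"
  have Et: "Dt (E aI j) p = E (\<lambda>j. Dt (aI j)) j p" for j p
    unfolding E_def by (simp add: ddir_stretch[OF t sI \<theta>] d\<theta>)
  have Ex: "Dx l (E aI j) p = E (\<lambda>j. Dx l (aI j)) j p + (if l = 1 then \<kappa> p else 0) *\<^sub>R E (quot t x aI) j p" for l j p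
    unfolding E_def by (simp add: ddir_stretch[OF t sI \<theta>] d\<theta> axis_def \<kappa>_def)
  have pr: "principal berenger (E aI j) p = E (\<lambda>j. principal berenger (aI j)) j p + \<kappa> p *\<^sub>R (berenger 1 *v E (quot t x aI) j p)" for j p
  proof -
    have "E (\<lambda>j. principal berenger (aI j)) j p = E (\<lambda>j. Dt (aI j)) j p + (\<Sum>l\<in>UNIV. berenger l *v E (\<lambda>j. Dx l (aI j)) j p)"
    proof -
      have "(\<lambda>j. principal berenger (aI j)) = (\<lambda>j p. ((Dt (aI j) p + berenger 1 *v Dx 1 (aI j) p) + berenger 2 *v Dx 2 (aI j) p) + berenger 3 *v Dx 3 (aI j) p)"
        by (simp add: principal_def sum_3 fun_eq_iff add.assoc)
      then show ?thesis
        unfolding E_def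
        by (simp add: stretch_add series_add(2) sD sM sum_3 EM[unfolded E_def, OF sD] add.assoc)
    qed
    then show ?thesis
      unfolding principal_def Et Ex by (simp add: sum_3 matrix_vector_right_distrib matrix_vector_scaleR)
  qed
  have "wkb berenger \<kappa> layer_matrix \<tau> \<xi> right aT"
    unfolding wkb_def
  proof (intro allI ballI)
    fix j p
    have lo: "lower_op berenger \<kappa> layer_matrix (aT i) p = E (\<lambda>j. principal berenger (aI j)) i p" for i
    proof -
      have "berenger 1 *v E (quot t x aI) i p + layer_matrix *v E aI i p = E (\<lambda>j p. d' j p + c j p) i p"
        if "d' = (\<lambda>j p. berenger 1 *v quot t x aI j p)" for d'
      proof -
        have "series_smooth d'" using sq unfolding that series_smooth_def by (auto intro: smooth_matrix_vector)
        then show ?thesis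
          using EM[OF sq, of "berenger 1" i p] EM[OF sI, of layer_matrix i p] stretch_add[OF _ c, of d' t x \<theta> i p]
          unfolding E_def that c_def by simp
      qed
      moreover have "quot t x d j q = berenger 1 *v quot t x aI j q" for j q
      proof -
        interpret commuting "\<lambda>f p. berenger 1 *v f p"
          by (rule commuting_linear[OF matrix_vector_mul_bounded_linear]) (simp add: vector_scalar_commute)
        show ?thesis using fun_cong[OF fun_cong[OF quot[OF sI, of t x], of j], of q] by (simp add: d_def)
      qed
      ultimately have "berenger 1 *v E (quot t x aI) i p + layer_matrix *v E aI i p = E (\<lambda>j p. 0) i p"
        using e0 by (simp add: add.commute)
      also have "E (\<lambda>j p. 0) i p = 0"
        using EM[OF sI, of 0 i p] by simp
      finally have z: "berenger 1 *v E (quot t x aI) i p + layer_matrix *v E aI i p = 0" .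
      have "lower_op berenger \<kappa> layer_matrix (aT i) p = E (\<lambda>j. principal berenger (aI j)) i p
          + \<kappa> p *\<^sub>R (berenger 1 *v E (quot t x aI) i p + layer_matrix *v E aI i p)"
        by (simp add: lower_op_def aT_def pr scaleR_add_right)
      then show ?thesis unfolding z by simp
    qed
    have sp: "series_smooth (\<lambda>j. principal berenger (aI j))"
      using aI by (auto simp: series_smooth_def intro: smooth_principal)
    have ss: "series_smooth (\<lambda>j p. \<i> *s symb berenger \<tau> \<xi> (aI j p))"
      using aI by (auto simp: series_smooth_def intro!: smooth_smult_const smooth_symb)
    have bl: "bounded_linear (\<lambda>u. \<i> *s symb berenger \<tau> \<xi> u)"
      by (rule bounded_linear_compose[OF bounded_linear_smult bounded_linear_symb])
    have "\<i> *s symb berenger \<tau> \<xi> (aT j p) + (if j = 0 then 0 else lower_op berenger \<kappa> layer_matrix (aT (j - 1)) p)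
      = \<i> *s symb berenger \<tau> \<xi> (E aI j p) + shift (E (\<lambda>j. principal berenger (aI j))) j p"
      unfolding lo by (simp add: aT_def shift_def)
    also have "\<dots> = E (\<lambda>j p. \<i> *s symb berenger \<tau> \<xi> (aI j p)) j p + E (shift (\<lambda>j. principal berenger (aI j))) j p"
      unfolding E_def
      by (subst stretch_linear[OF bl _ sI]) (simp_all add: symb_smult vector_smult_assoc mult.commute stretch_shift[OF t])
    also have "\<dots> = E (\<lambda>j p. \<i> *s symb berenger \<tau> \<xi> (aI j p) + shift (\<lambda>j. principal berenger (aI j)) j p) j p"
      unfolding E_def
      by (rule stretch_add[symmetric, OF ss]) (simp add: series_smooth_def smooth_shift[OF sp])
    also have "\<dots> = 0"
      unfolding wI' using EM[OF sI, of 0 j p] by simp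
    finally show "\<i> *s symb berenger \<tau> \<xi> (aT j p) + (if j = 0 then 0 else lower_op berenger \<kappa> layer_matrix (aT (j - 1)) p) = 0" .
  qed
  moreover have "aT j p = 0" if "p \<in> past_right" for j p
    unfolding aT_def E_def
    by (rule stretch_vanish[OF sI closure_past(1) _ that])
      (use incident_zero[OF inc] in \<open>auto simp: past_right_def\<close>)
  then have "\<forall>j x. (0, x) \<in> right \<longrightarrow> aT j (0, x) = 0" by (simp add: past_right_def)
  moreover have "aT j p = aI j p" if "p \<in> interface" for j p
  proof -
    have "\<theta> p = 0" using that S(3) by (simp add: \<theta>_def mem_sets)
    then show ?thesis
      using stretch_sum[OF t, of j "Suc j" x \<theta> aI p]
      by (simp add: aT_def E_def sum.lessThan_Suc_shift del: sum.lessThan_Suc)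
  qed
  moreover have "wkb berenger (\<lambda>_. 0) 0 \<tau> (reflect \<xi>) left (\<lambda>j p. 0)"
    by (simp add: wkb_def symb_linear)
  ultimately have "transmission berenger (berenger_C \<sigma>) \<mu> \<tau> \<xi> aI (\<lambda>j p. 0) aT"
    using wI aT by (subst layer_transmission_iff[where C = "berenger_C \<sigma>" and \<sigma> = \<sigma> and C\<^sub>0 = layer_matrix
        and HR = "\<lambda>j p. 0" and HT = aT, OF berenger_C_vector aI s]) (auto simp: \<kappa>_def)
  then show ?thesis by blast
qed

end

section \<open>Traces on the interface\<close>

abbreviation jet :: "nat \<Rightarrow> (spacetime \<Rightarrow> 'b::real_normed_vector) \<Rightarrow> spacetime \<Rightarrow> 'b"
  where "jet j f \<equiv> (Dx 1 ^^ j) f"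

lemma smooth_jet: "smooth f \<Longrightarrow> smooth (jet j f)"
  by (rule smooth_ddir_funpow)

lemma jet_vanish:
  assumes "smooth f" "closure (interior S) = S" "\<forall>p\<in>S. f p = 0" "p \<in> S"
  shows "jet j f p = 0"
proof -
  have "\<forall>p\<in>S. jet j f p = 0"
    using assms(3) by (induction j) (auto intro: ddir_vanish[OF smooth_jet[OF assms(1)] assms(2)])
  then show ?thesis using assms(4) by blast
qed

lemma jet_diff: "smooth f \<Longrightarrow> smooth g \<Longrightarrow> jet j (\<lambda>p. f p - g p) = (\<lambda>p. jet j f p - jet j g p)"
  by (induction j) (simp_all add: ddir_diff smooth_jet)

lemma jet_cong:
  assumes "smooth f" "smooth g" "closure (interior S) = S" "\<And>p. p \<in> S \<Longrightarrow> f p = g p" "p \<in> S"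
  shows "jet j f p = jet j g p"
  using jet_vanish[OF smooth_diff[OF assms(1,2)] assms(3) _ assms(5), of j] assms(4)
  by (simp add: jet_diff[OF assms(1,2)])

lemma jet_principal:
  assumes f: "smooth f"
  shows "jet j (principal \<A> f) = principal \<A> (jet j f)"
proof -
  have s: "smooth (\<lambda>p. \<A> l *v Dx l f p)" for l by (intro smooth_matrix_vector smooth_ddir f)
  have s2: "smooth (\<lambda>p. \<Sum>l\<in>UNIV. \<A> l *v Dx l f p)" by (intro smooth_sum s)
  have "jet j (principal \<A> f) = jet j (\<lambda>p. Dt f p + (\<Sum>l\<in>UNIV. \<A> l *v Dx l f p))"
    by (simp add: principal_def[abs_def])
  also have "\<dots> = (\<lambda>p. jet j (Dt f) p + (\<Sum>l\<in>UNIV. \<A> l *v jet j (Dx l f) p))"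
    unfolding ddir_funpow_add[OF smooth_ddir[OF f] s2] ddir_funpow_sum[OF s]
      ddir_funpow_bounded_linear[OF matrix_vector_mul_bounded_linear smooth_ddir[OF f]] ..
  finally show ?thesis
    by (simp add: principal_def[abs_def] ddir_funpow_commute[OF f])
qed

lemma ddir_tangential:
  assumes f: "smooth f" and g: "smooth g" and v: "snd v $ 1 = 0"
    and fg: "\<And>q. q \<in> interface \<Longrightarrow> f q = g q" and p: "p \<in> interface"
  shows "ddir v f p = ddir v g p"
proof -
  have "f (p + s *\<^sub>R v) = g (p + s *\<^sub>R v)" for s
    using p v by (intro fg) (simp add: mem_sets)
  then have "(\<lambda>s. f (p + s *\<^sub>R v)) = (\<lambda>s. g (p + s *\<^sub>R v))" by simp
  then show ?thesis
    using has_vector_derivative_line[OF f, of p v 0 UNIV] has_vector_derivative_line[OF g, of p v 0 UNIV]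
    by (simp add: vector_derivative_unique_at)
qed

text \<open>The normal derivatives of the coefficients on the interface are obtained from each other by a few
  operations; each of the two claims about them comes from a filtration \<open>P\<close> that these operations respect.
  The parameter \<open>\<mu>\<close> ranges over \<open>U\<close>.\<close>

locale jet_class =
  fixes U :: "real set" and P :: "nat \<Rightarrow> (real \<Rightarrow> spacetime \<Rightarrow> complex^3) \<Rightarrow> bool"
  assumes P_zero: "P d (\<lambda>\<mu> p. 0)"
    and P_mono: "P d f \<Longrightarrow> d \<le> d' \<Longrightarrow> P d' f"
    and P_add: "P d f \<Longrightarrow> P d g \<Longrightarrow> P d (\<lambda>\<mu> p. f \<mu> p + g \<mu> p)"
    and P_linear: "bounded_linear L \<Longrightarrow> P d f \<Longrightarrow> P d (\<lambda>\<mu> p. L (f \<mu> p))"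
    and P_tangential: "(\<And>\<mu>. \<mu> \<in> U \<Longrightarrow> smooth (f \<mu>)) \<Longrightarrow> snd v $ 1 = 0 \<Longrightarrow> P d f \<Longrightarrow> P d (\<lambda>\<mu>. ddir v (f \<mu>))"
    and P_scale: "smooth k \<Longrightarrow> P d f \<Longrightarrow> P d (\<lambda>\<mu> p. k p *\<^sub>R f \<mu> p)"
    and P_cong: "P d f \<Longrightarrow> (\<And>\<mu> p. \<mu> \<in> U \<Longrightarrow> p \<in> interface \<Longrightarrow> g \<mu> p = f \<mu> p) \<Longrightarrow> P d g"
begin

lemma P_principal:
  assumes F: "\<And>\<mu>. \<mu> \<in> U \<Longrightarrow> smooth (F \<mu>)" and P: "P d F" and P1: "P (Suc d) (\<lambda>\<mu>. Dx 1 (F \<mu>))"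
  shows "P (Suc d) (\<lambda>\<mu>. principal \<A> (F \<mu>))"
proof -
  have t: "P (Suc d) (\<lambda>\<mu>. ddir v (F \<mu>))" if "snd v $ 1 = 0" for v
    by (rule P_mono[OF P_tangential[OF F that P]]) auto
  have "P (Suc d) (\<lambda>\<mu> p. Dt (F \<mu>) p + (\<A> 1 *v Dx 1 (F \<mu>) p + (\<A> 2 *v Dx 2 (F \<mu>) p + \<A> 3 *v Dx 3 (F \<mu>) p)))"
    by (intro P_add P_linear[OF matrix_vector_mul_bounded_linear] P1 t) (simp_all add: axis_def)
  then show ?thesis
    by (rule P_cong) (simp add: principal_def sum_3 add.assoc)
qed

text \<open>Tangential derivatives keep the index and a normal one raises it by one, so a
  first-order operator costs one.\<close>

lemma P_jet_principal:
  assumes F: "\<And>\<mu>. \<mu> \<in> U \<Longrightarrow> smooth (F \<mu>)" and P: "\<And>j. P (d + j) (\<lambda>\<mu>. jet j (F \<mu>))"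
  shows "P (Suc (d + j)) (\<lambda>\<mu>. jet j (principal \<A> (F \<mu>)))"
proof -
  have "P (Suc (d + j)) (\<lambda>\<mu>. principal \<A> (jet j (F \<mu>)))"
    by (rule P_principal) (use smooth_jet F P[of j] P[of "Suc j"] in auto)
  then show ?thesis by (rule P_cong) (simp add: jet_principal[OF F])
qed

lemma P_jet_linear:
  assumes "\<And>\<mu>. \<mu> \<in> U \<Longrightarrow> smooth (F \<mu>)" "bounded_linear L" "P d (\<lambda>\<mu>. jet j (F \<mu>))"
  shows "P d (\<lambda>\<mu>. jet j (\<lambda>p. L (F \<mu> p)))"
  using P_linear[OF assms(2,3)]
  by (rule P_cong) (simp add: ddir_funpow_bounded_linear[OF assms(2,1)])

lemma P_jet_add:
  assumes "\<And>\<mu>. \<mu> \<in> U \<Longrightarrow> smooth (F \<mu>)" "\<And>\<mu>. \<mu> \<in> U \<Longrightarrow> smooth (G \<mu>)"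
    "P d (\<lambda>\<mu>. jet j (F \<mu>))" "P d (\<lambda>\<mu>. jet j (G \<mu>))"
  shows "P d (\<lambda>\<mu>. jet j (\<lambda>p. F \<mu> p + G \<mu> p))"
  using P_add[OF assms(3,4)] by (rule P_cong) (simp add: ddir_funpow_add assms)

lemma P_jet_scale:
  assumes "smooth k" "\<And>\<mu>. \<mu> \<in> U \<Longrightarrow> smooth (F \<mu>)" "\<And>m. m \<le> j \<Longrightarrow> P (d + m) (\<lambda>\<mu>. jet m (F \<mu>))"
  shows "P (d + j) (\<lambda>\<mu>. jet j (\<lambda>p. k p *\<^sub>R F \<mu> p))"
  using assms
proof (induction j arbitrary: k F d)
  case 0
  then show ?case using P_scale[OF 0(1) 0(3)[of 0]] by simp
next
  case (Suc j)
  note k = Suc.prems(1) and F = Suc.prems(2)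
  have "P (Suc d + j) (\<lambda>\<mu>. jet j (\<lambda>p. k p *\<^sub>R Dx 1 (F \<mu>) p))"
  proof (rule Suc.IH[OF k smooth_ddir[OF F]])
    show "P (Suc d + m) (\<lambda>\<mu>. jet m (Dx 1 (F \<mu>)))" if "m \<le> j" for m
      using Suc.prems(3)[of "Suc m"] that by (simp add: funpow_swap1)
  qed
  moreover have "P (d + j) (\<lambda>\<mu>. jet j (\<lambda>p. Dx 1 k p *\<^sub>R F \<mu> p))"
    by (rule Suc.IH[OF smooth_ddir[OF k] F Suc.prems(3)]) auto
  then have "P (Suc d + j) (\<lambda>\<mu>. jet j (\<lambda>p. Dx 1 k p *\<^sub>R F \<mu> p))"
    by (rule P_mono) simp
  ultimately have "P (Suc d + j) (\<lambda>\<mu>. jet j (\<lambda>p. k p *\<^sub>R Dx 1 (F \<mu>) p + Dx 1 k p *\<^sub>R F \<mu> p))"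
    by (intro P_jet_add smooth_scaleR k F smooth_ddir)
  then have "P (Suc d + j) (\<lambda>\<mu>. jet (Suc j) (\<lambda>p. k p *\<^sub>R F \<mu> p))"
    by (rule P_cong) (simp add: funpow_Suc_right ddir_scaleR k F del: funpow.simps)
  then show ?case by simp
qed

text \<open>Split \<open>f\<close> into its component in the kernel of the symbol, which is transported along the rays, and the
  component given by \<open>X\<close>.\<close>

lemma P_jet_wave:
  assumes ray: "light_ray \<tau> \<xi>" and v: "group_velocity \<tau> \<xi> $ 1 \<noteq> 0"
    and S: "closure (interior S) = S" "interface \<subseteq> S"
    and f: "\<And>\<mu>. \<mu> \<in> U \<Longrightarrow> smooth (f \<mu>)" and X: "\<And>\<mu>. \<mu> \<in> U \<Longrightarrow> smooth (X \<mu>)"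
    and G: "\<And>\<mu>. \<mu> \<in> U \<Longrightarrow> smooth (G \<mu>)"
    and fX: "\<And>\<mu> p. \<mu> \<in> U \<Longrightarrow> p \<in> S \<Longrightarrow> symb maxwell \<tau> \<xi> (f \<mu> p) = \<i> *s X \<mu> p"
    and tr: "\<And>\<mu> p. \<mu> \<in> U \<Longrightarrow> p \<in> S \<Longrightarrow> proj \<tau> \<xi> (principal maxwell (f \<mu>) p + G \<mu> p) = 0"
    and PX: "\<And>j. P (d + j) (\<lambda>\<mu>. jet j (X \<mu>))"
    and P0: "P d (\<lambda>\<mu> p. proj \<tau> \<xi> (f \<mu> p))"
    and PG: "\<And>j. (\<And>m. m \<le> j \<Longrightarrow> P (d + m) (\<lambda>\<mu>. jet m (f \<mu>))) \<Longrightarrow> P (Suc (d + j)) (\<lambda>\<mu>. jet j (G \<mu>))"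
  shows "P (d + j) (\<lambda>\<mu>. jet j (f \<mu>))"
proof -
  interpret light_ray \<tau> \<xi> by (rule ray)
  define v1 where "v1 = group_velocity \<tau> \<xi> $ 1"
  \<comment> \<open>The tangential part of the ray direction. Since \<open>v1\<close> is nonzero,
    the transport equation can be solved for the normal derivative.\<close>
  define vt :: spacetime where "vt = (1, group_velocity \<tau> \<xi>) - v1 *\<^sub>R (0, axis 1 1)"
  have vt: "snd vt $ 1 = 0" by (simp add: vt_def v1_def)
  define e where "e = (\<lambda>\<mu> p. proj \<tau> \<xi> (f \<mu> p))"
  define Y where "Y = (\<lambda>\<mu> p. pinv \<tau> \<xi> (\<i> *s X \<mu> p))"
  have bY: "bounded_linear (\<lambda>u. pinv \<tau> \<xi> (\<i> *s u))"
    by (rule bounded_linear_compose[OF bounded_linear_pinv bounded_linear_smult])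
  have e: "smooth (e \<mu>)" and Y: "smooth (Y \<mu>)" if "\<mu> \<in> U" for \<mu>
    unfolding e_def Y_def by (intro smooth_proj smooth_pinv smooth_smult_const f X that)+
  have eY: "f \<mu> p = e \<mu> p + Y \<mu> p" if "\<mu> \<in> U" "p \<in> S" for \<mu> p
    using pinv_symb[of "f \<mu> p"] fX[OF that] by (simp add: e_def Y_def)
  have PY: "P (d + j) (\<lambda>\<mu>. jet j (Y \<mu>))" for j
    unfolding Y_def by (rule P_jet_linear[OF X bY PX])
  have feY: "P (d + j) (\<lambda>\<mu>. jet j (f \<mu>))" if "P (d + j) (\<lambda>\<mu>. jet j (e \<mu>))" for j
    using P_jet_add[OF e Y that PY]
  proof (rule P_cong)
    fix \<mu> p assume "\<mu> \<in> U" "p \<in> interface"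
    then show "jet j (f \<mu>) p = jet j (\<lambda>p. e \<mu> p + Y \<mu> p) p"
      using S(2) by (intro jet_cong[OF f smooth_add[OF e Y] S(1) eY]) auto
  qed
  \<comment> \<open>Proved on all of \<open>S\<close> and not just on the interface, so that it can
    be differentiated again in the normal direction.\<close>
  have De: "Dx 1 (e \<mu>) p = (- 1 / v1) *\<^sub>R (ddir vt (e \<mu>) p + proj \<tau> \<xi> (principal maxwell (Y \<mu>) p + G \<mu> p))"
    if \<mu>: "\<mu> \<in> U" and p: "p \<in> S" for \<mu> p
  proof (rule vanish_on_closure[of "\<lambda>p. Dx 1 (e \<mu>) p - (- 1 / v1) *\<^sub>R (ddir vt (e \<mu>) p + proj \<tau> \<xi> (principal maxwell (Y \<mu>) p + G \<mu> p))" S p,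
          unfolded right_minus_eq, OF _ _ S(1) p])
    show "smooth (\<lambda>p. Dx 1 (e \<mu>) p - (- 1 / v1) *\<^sub>R (ddir vt (e \<mu>) p + proj \<tau> \<xi> (principal maxwell (Y \<mu>) p + G \<mu> p)))"
      by (intro smooth_diff smooth_ddir smooth_scaleR_const smooth_add smooth_proj smooth_principal e Y G \<mu>)
    fix q assume q: "q \<in> interior S"
    then have qS: "q \<in> S" using interior_subset by blast
    have "principal maxwell (f \<mu>) q = principal maxwell (\<lambda>p. e \<mu> p + Y \<mu> p) q"
      by (rule principal_cong_open[OF open_interior q _ smooth_add[OF e[OF \<mu>] Y[OF \<mu>]]])
        (use eY[OF \<mu>] interior_subset in blast)
    also have "\<dots> = principal maxwell (e \<mu>) q + principal maxwell (Y \<mu>) q"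
      using lower_op_linear(1)[OF e[OF \<mu>] Y[OF \<mu>], of maxwell "\<lambda>_. 0" 0 q] by (simp add: lower_op_def)
    finally have "ddir (1, group_velocity \<tau> \<xi>) (e \<mu>) q + proj \<tau> \<xi> (principal maxwell (Y \<mu>) q + G \<mu> q) = 0"
      using tr[OF \<mu> qS] proj_principal[OF f[OF \<mu>], of q] by (simp add: proj_linear e_def add.assoc)
    moreover have "ddir (1, group_velocity \<tau> \<xi>) (e \<mu>) q = ddir vt (e \<mu>) q + v1 *\<^sub>R Dx 1 (e \<mu>) q"
    proof -
      have "(1, group_velocity \<tau> \<xi>) = vt + v1 *\<^sub>R (0, axis 1 1)" by (simp add: vt_def)
      then show ?thesis by (simp only: ddir_dir_add[OF e[OF \<mu>]] ddir_dir_scaleR[OF e[OF \<mu>]])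
    qed
    ultimately have "v1 *\<^sub>R Dx 1 (e \<mu>) q = - (ddir vt (e \<mu>) q + proj \<tau> \<xi> (principal maxwell (Y \<mu>) q + G \<mu> q))"
      by (simp add: eq_neg_iff_add_eq_0 algebra_simps)
    then have "(1 / v1) *\<^sub>R (v1 *\<^sub>R Dx 1 (e \<mu>) q)
      = (1 / v1) *\<^sub>R (- (ddir vt (e \<mu>) q + proj \<tau> \<xi> (principal maxwell (Y \<mu>) q + G \<mu> q)))" by simp
    then show "Dx 1 (e \<mu>) q = (- 1 / v1) *\<^sub>R (ddir vt (e \<mu>) q + proj \<tau> \<xi> (principal maxwell (Y \<mu>) q + G \<mu> q))"
      using v by (simp add: v1_def scaleR_add_right scaleR_diff_right)
  qed
  \<comment> \<open>All orders up to \<open>j\<close> are carried along, because the assumption on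
    the jet of order \<open>j\<close> of \<open>G\<close> refers to all jets of \<open>f\<close> up
    to that order.\<close>
  have "P (d + m) (\<lambda>\<mu>. jet m (e \<mu>))" if "m \<le> j" for m j
    using that
  proof (induction j arbitrary: m)
    case 0
    then show ?case using P0 by (simp add: e_def)
  next
    case (Suc j)
    show ?case
    proof (cases "m = Suc j")
      case True
      have PGj: "P (Suc (d + j)) (\<lambda>\<mu>. jet j (G \<mu>))" by (rule PG) (rule feY[OF Suc.IH])
      have 1: "P (Suc (d + j)) (\<lambda>\<mu>. jet j (ddir vt (e \<mu>)))"
      proof -
        have "P (d + j) (\<lambda>\<mu>. ddir vt (jet j (e \<mu>)))"
          by (rule P_tangential[OF _ vt Suc.IH]) (auto intro: smooth_jet e)
        from P_mono[OF this, of "Suc (d + j)"] show ?thesis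
          by (rule P_cong) (simp_all add: ddir_funpow_commute[OF e])
      qed
      have pr: "smooth (\<lambda>p. principal maxwell (Y \<mu>) p + G \<mu> p)" if "\<mu> \<in> U" for \<mu>
        by (intro smooth_add smooth_principal Y G that)
      have 2: "P (Suc (d + j)) (\<lambda>\<mu>. jet j (\<lambda>p. principal maxwell (Y \<mu>) p + G \<mu> p))"
        by (rule P_jet_add[OF smooth_principal[OF Y] G P_jet_principal[OF Y PY] PGj])
      have 3: "P (Suc (d + j)) (\<lambda>\<mu>. jet j (\<lambda>p. proj \<tau> \<xi> (principal maxwell (Y \<mu>) p + G \<mu> p)))"
        by (rule P_jet_linear[OF pr bounded_linear_proj 2])
      have 4: "P (Suc (d + j)) (\<lambda>\<mu>. jet j (\<lambda>p. ddir vt (e \<mu>) p + proj \<tau> \<xi> (principal maxwell (Y \<mu>) p + G \<mu> p)))"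
        by (rule P_jet_add[OF smooth_ddir[OF e] smooth_proj[OF pr] 1 3])
      have "P (Suc (d + j)) (\<lambda>\<mu>. jet j (\<lambda>p. (- 1 / v1) *\<^sub>R (ddir vt (e \<mu>) p + proj \<tau> \<xi> (principal maxwell (Y \<mu>) p + G \<mu> p))))"
        by (rule P_jet_linear[OF smooth_add[OF smooth_ddir[OF e] smooth_proj[OF pr]] bounded_linear_scaleR_right 4])
      then have "P (Suc (d + j)) (\<lambda>\<mu>. jet (Suc j) (e \<mu>))"
      proof (rule P_cong)
        fix \<mu> p assume \<mu>: "\<mu> \<in> U" and p: "p \<in> interface"
        have "jet (Suc j) (e \<mu>) p = jet j (Dx 1 (e \<mu>)) p" by (simp add: funpow_swap1)
        also have "\<dots> = jet j (\<lambda>p. (- 1 / v1) *\<^sub>R (ddir vt (e \<mu>) p + proj \<tau> \<xi> (principal maxwell (Y \<mu>) p + G \<mu> p))) p"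
          by (rule jet_cong[OF smooth_ddir[OF e[OF \<mu>]] smooth_scaleR_const[OF smooth_add[OF smooth_ddir[OF e[OF \<mu>]]
                  smooth_proj[OF pr[OF \<mu>]]]] S(1) De[OF \<mu>]]) (use p S(2) in auto)
        finally show "jet (Suc j) (e \<mu>) p
          = jet j (\<lambda>p. (- 1 / v1) *\<^sub>R (ddir vt (e \<mu>) p + proj \<tau> \<xi> (principal maxwell (Y \<mu>) p + G \<mu> p))) p" .
      qed
      then show ?thesis using True by simp
    next
      case False
      then show ?thesis using Suc by auto
    qed
  qed
  then show ?thesis by (intro feY) blast
qed

end

locale smart_waves = incidence + jet_class +
  fixes \<nu> :: real and s :: "real \<Rightarrow> real" and aI :: "nat \<Rightarrow> spacetime \<Rightarrow> complex^3"
    and R T :: "real \<Rightarrow> nat \<Rightarrow> spacetime \<Rightarrow> complex^3"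
  assumes s: "smooth s" and aI: "smooth (aI i)" and wI: "wkb maxwell (\<lambda>_. 0) 0 \<tau> \<xi> UNIV aI"
    and R: "\<mu> \<in> U \<Longrightarrow> smooth (R \<mu> i)" and T: "\<mu> \<in> U \<Longrightarrow> smooth (T \<mu> i)"
    and wR: "\<mu> \<in> U \<Longrightarrow> wkb maxwell (\<lambda>_. 0) 0 \<tau> (reflect \<xi>) left (R \<mu>)"
    and wT: "\<mu> \<in> U \<Longrightarrow> wkb maxwell (\<lambda>p. \<mu> * s (snd p $ 1)) (smart_matrix \<nu>) \<tau> \<xi> right (T \<mu>)"
    and RT: "\<mu> \<in> U \<Longrightarrow> p \<in> interface \<Longrightarrow> maxwell 1 *v (aI i p + R \<mu> i p - T \<mu> i p) = 0"
begin

definition source :: "real \<Rightarrow> nat \<Rightarrow> spacetime \<Rightarrow> complex^3"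
  where "source \<mu> i = (\<lambda>p. (\<mu> * s (snd p $ 1)) *\<^sub>R (smart_matrix \<nu> *v T \<mu> i p))"

definition diff :: "real \<Rightarrow> nat \<Rightarrow> spacetime \<Rightarrow> complex^3"
  where "diff \<mu> i = (\<lambda>p. T \<mu> i p - aI i p)"

lemma smooth_source: "\<mu> \<in> U \<Longrightarrow> smooth (source \<mu> i)"
  unfolding source_def by (intro smooth_scaleR smooth_coord s smooth_matrix_vector T)

lemma smooth_diff_T: "\<mu> \<in> U \<Longrightarrow> smooth (diff \<mu> i)"
  unfolding diff_def by (intro smooth_diff T aI)

lemma diff_eq:
  assumes \<mu>: "\<mu> \<in> U" and p: "p \<in> right"
  shows "\<i> *s symb maxwell \<tau> \<xi> (diff \<mu> i p)
    + (if i = 0 then 0 else principal maxwell (diff \<mu> (i - 1)) p + source \<mu> (i - 1) p) = 0"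
proof -
  have 1: "\<i> *s symb maxwell \<tau> \<xi> (T \<mu> i p) + (if i = 0 then 0 else principal maxwell (T \<mu> (i - 1)) p + source \<mu> (i - 1) p) = 0"
    using wT[OF \<mu>, unfolded wkb_def, THEN spec, of i] p by (auto simp: lower_op_def source_def)
  have 2: "\<i> *s symb maxwell \<tau> \<xi> (aI i p) + (if i = 0 then 0 else principal maxwell (aI (i - 1)) p) = 0"
    using bspec[OF spec[OF wI[unfolded wkb_def], of i] UNIV_I[of p]] by (auto simp: lower_op_def)
  have 3: "principal maxwell (diff \<mu> (i - 1)) p = principal maxwell (T \<mu> (i - 1)) p - principal maxwell (aI (i - 1)) p"
    using lower_op_linear(2)[OF T[OF \<mu>] aI, of maxwell "\<lambda>_. 0" 0 "i - 1" "i - 1" p] by (simp add: lower_op_def diff_def)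
  have "\<i> *s symb maxwell \<tau> \<xi> (diff \<mu> i p)
    + (if i = 0 then 0 else principal maxwell (diff \<mu> (i - 1)) p + source \<mu> (i - 1) p)
    = (\<i> *s symb maxwell \<tau> \<xi> (T \<mu> i p) + (if i = 0 then 0 else principal maxwell (T \<mu> (i - 1)) p + source \<mu> (i - 1) p))
      - (\<i> *s symb maxwell \<tau> \<xi> (aI i p) + (if i = 0 then 0 else principal maxwell (aI (i - 1)) p))"
    unfolding 3 by (simp add: diff_def symb_linear vec_eq_iff algebra_simps)
  then show ?thesis unfolding 1 2 by simp
qed

lemma R_eq:
  assumes \<mu>: "\<mu> \<in> U" and p: "p \<in> left"
  shows "\<i> *s symb maxwell \<tau> (reflect \<xi>) (R \<mu> i p) + (if i = 0 then 0 else principal maxwell (R \<mu> (i - 1)) p) = 0"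
  using wR[OF \<mu>, unfolded wkb_def, THEN spec, of i] p by (auto simp: lower_op_def)

lemma symb_eqI: "\<i> *s symb maxwell \<tau> \<eta> u + X = 0 \<Longrightarrow> symb maxwell \<tau> \<eta> u = \<i> *s X"
proof -
  assume "\<i> *s symb maxwell \<tau> \<eta> u + X = 0"
  then have "\<i> *s (\<i> *s symb maxwell \<tau> \<eta> u + X) = 0" by simp
  then have "- symb maxwell \<tau> \<eta> u + \<i> *s X = 0"
    by (simp add: vector_add_ldistrib vector_smult_assoc)
  then show ?thesis by (simp add: add_eq_0_iff)
qed

lemma diff_transport:
  assumes "\<mu> \<in> U" "p \<in> right"
  shows "proj \<tau> \<xi> (principal maxwell (diff \<mu> i) p + source \<mu> i p) = 0"
proof -
  have "principal maxwell (diff \<mu> i) p + source \<mu> i p = - (\<i> *s symb maxwell \<tau> \<xi> (diff \<mu> (Suc i) p))"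
    using diff_eq[OF assms, of "Suc i"] by (simp add: eq_neg_iff_add_eq_0 add.commute)
  then show ?thesis by (simp only: proj_linear proj_symb) simp
qed

lemma R_transport:
  assumes "\<mu> \<in> U" "p \<in> left"
  shows "proj \<tau> (reflect \<xi>) (principal maxwell (R \<mu> i) p) = 0"
proof -
  have "principal maxwell (R \<mu> i) p = - (\<i> *s symb maxwell \<tau> (reflect \<xi>) (R \<mu> (Suc i) p))"
    using R_eq[OF assms, of "Suc i"] by (simp add: eq_neg_iff_add_eq_0 add.commute)
  then show ?thesis by (simp only: proj_linear reflected.proj_symb) simp
qed

lemma jump_diff: "\<mu> \<in> U \<Longrightarrow> p \<in> interface \<Longrightarrow> maxwell 1 *v (R \<mu> i p - diff \<mu> i p) = 0"
  using RT[of \<mu> p i] by (simp add: diff_def algebra_simps)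

text \<open>Subtracting the incident wave leaves the layer as the only source. \<open>src\<close>
  asks that it raise the index by one, as a step in \<epsilon> does; everything else is common to
  all filtrations.\<close>

lemma P_traces:
  assumes src: "\<And>i j. (\<And>m. m \<le> j \<Longrightarrow> P (i + m) (\<lambda>\<mu>. jet m (diff \<mu> i))) \<Longrightarrow> P (Suc (i + j)) (\<lambda>\<mu>. jet j (source \<mu> i))"
  shows "(\<forall>j. P (i + j) (\<lambda>\<mu>. jet j (diff \<mu> i))) \<and> (\<forall>j. P (i + j) (\<lambda>\<mu>. jet j (R \<mu> i)))"
proof (induction i rule: less_induct)
  case (less i)
  define X where "X = (\<lambda>\<mu>. if i = 0 then (\<lambda>p. 0) else (\<lambda>p. principal maxwell (diff \<mu> (i - 1)) p + source \<mu> (i - 1) p))"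
  define Z where "Z = (\<lambda>\<mu>. if i = 0 then (\<lambda>p. 0) else principal maxwell (R \<mu> (i - 1)))"
  have X: "smooth (X \<mu>)" and Z: "smooth (Z \<mu>)" if "\<mu> \<in> U" for \<mu>
    using that by (auto simp: X_def Z_def intro!: smooth_add smooth_principal smooth_source smooth_diff_T R)
  have jet0: "jet j (\<lambda>p. 0 :: complex^3) = (\<lambda>p. 0)" for j by (induction j) auto
  have PX: "P (i + j) (\<lambda>\<mu>. jet j (X \<mu>))" for j
  proof (cases i)
    case 0
    then show ?thesis by (simp add: X_def jet0 P_zero)
  next
    case (Suc k)
    then have IH: "P (k + j) (\<lambda>\<mu>. jet j (diff \<mu> k))" for j using less[of k] by auto
    have "P (Suc (k + j)) (\<lambda>\<mu>. jet j (\<lambda>p. principal maxwell (diff \<mu> k) p + source \<mu> k p))"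
      by (rule P_jet_add[OF smooth_principal[OF smooth_diff_T] smooth_source P_jet_principal[OF smooth_diff_T IH] src[OF IH]])
    then show ?thesis by (simp add: X_def Suc)
  qed
  have PZ: "P (i + j) (\<lambda>\<mu>. jet j (Z \<mu>))" for j
  proof (cases i)
    case 0
    then show ?thesis by (simp add: Z_def jet0 P_zero)
  next
    case (Suc k)
    then have IH: "P (k + j) (\<lambda>\<mu>. jet j (R \<mu> k))" for j using less[of k] by auto
    show ?thesis using P_jet_principal[OF R IH] by (simp add: Z_def Suc)
  qed
  have dX: "symb maxwell \<tau> \<xi> (diff \<mu> i p) = \<i> *s X \<mu> p" if "\<mu> \<in> U" "p \<in> right" for \<mu> p
    using symb_eqI[OF diff_eq[OF that]] by (simp add: X_def)
  have RZ: "symb maxwell \<tau> (reflect \<xi>) (R \<mu> i p) = \<i> *s Z \<mu> p" if "\<mu> \<in> U" "p \<in> left" for \<mu> p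
    using symb_eqI[OF R_eq[OF that]] by (simp add: Z_def)
  \<comment> \<open>The tangential mismatch of the parts off the two kernels; through
    \<open>jump\<close> it fixes the interface values of both kernel parts.\<close>
  define y where "y = (\<lambda>\<mu> p. pinv \<tau> (reflect \<xi>) (\<i> *s Z \<mu> p) + (- 1) *\<^sub>R pinv \<tau> \<xi> (\<i> *s X \<mu> p))"
  have Py: "P i y"
    unfolding y_def using PX[of 0] PZ[of 0]
    by (intro P_add P_linear[OF bounded_linear_scaleR_right] P_linear[OF bounded_linear_pinv] P_linear[OF bounded_linear_smult]) auto
  have x: "reflect \<xi> $ 1 \<noteq> 0" using xi1 by simp
  have tr: "proj \<tau> \<xi> (diff \<mu> i p) = jump \<tau> \<xi> (y \<mu> p)"
    "proj \<tau> (reflect \<xi>) (R \<mu> i p) = (- 1) *\<^sub>R jump \<tau> (reflect \<xi>) (y \<mu> p)" if \<mu>: "\<mu> \<in> U" and p: "p \<in> interface" for \<mu> p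
  proof -
    define u w where "u = proj \<tau> \<xi> (diff \<mu> i p)" and "w = proj \<tau> (reflect \<xi>) (R \<mu> i p)"
    have d: "diff \<mu> i p = u + pinv \<tau> \<xi> (\<i> *s X \<mu> p)"
      using pinv_symb[of "diff \<mu> i p"] dX[OF \<mu> interface_subset(2)[OF p]] by (simp add: u_def)
    have r: "R \<mu> i p = w + pinv \<tau> (reflect \<xi>) (\<i> *s Z \<mu> p)"
      using reflected.pinv_symb[of "R \<mu> i p"] RZ[OF \<mu> interface_subset(1)[OF p]] by (simp add: w_def)
    have "maxwell 1 *v (w - u + y \<mu> p) = 0"
      using jump_diff[OF \<mu> p, of i] unfolding d r y_def by (simp add: algebra_simps)
    then have "maxwell 1 *v ((w + jump \<tau> (reflect \<xi>) (y \<mu> p)) - (u - jump \<tau> \<xi> (y \<mu> p))) = 0"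
      using maxwell_1_jump[of \<tau> \<xi> "y \<mu> p"]
      by (simp add: matrix_vector_mult_diff_distrib matrix_vector_right_distrib algebra_simps)
    moreover have "symb maxwell \<tau> \<xi> (u - jump \<tau> \<xi> (y \<mu> p)) = 0"
      by (simp add: symb_linear u_def symb_proj symb_jump[OF xi1])
    moreover have "symb maxwell \<tau> (reflect \<xi>) (w + jump \<tau> (reflect \<xi>) (y \<mu> p)) = 0"
      by (simp add: symb_linear w_def reflected.symb_proj reflected.symb_jump[OF x])
    ultimately have "u - jump \<tau> \<xi> (y \<mu> p) = 0" "w + jump \<tau> (reflect \<xi>) (y \<mu> p) = 0"
      using jump_unique[OF xi1] by blast+
    then show "proj \<tau> \<xi> (diff \<mu> i p) = jump \<tau> \<xi> (y \<mu> p)"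
      "proj \<tau> (reflect \<xi>) (R \<mu> i p) = (- 1) *\<^sub>R jump \<tau> (reflect \<xi>) (y \<mu> p)"
      by (simp_all add: u_def w_def add_eq_0_iff2)
  qed
  have P0: "P i (\<lambda>\<mu> p. proj \<tau> \<xi> (diff \<mu> i p))" "P i (\<lambda>\<mu> p. proj \<tau> (reflect \<xi>) (R \<mu> i p))"
    by (rule P_cong[OF P_linear[OF bounded_linear_jump Py] tr(1)], assumption+)
      (rule P_cong[OF P_linear[OF bounded_linear_scaleR_right P_linear[OF bounded_linear_jump Py]] tr(2)], assumption+)
  have I: "interface \<subseteq> right" "interface \<subseteq> left" using interface_subset by blast+
  have v: "group_velocity \<tau> \<xi> $ 1 \<noteq> 0" "group_velocity \<tau> (reflect \<xi>) $ 1 \<noteq> 0"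
    using v1 by (auto simp: group_velocity_reflect)
  have "P (i + j) (\<lambda>\<mu>. jet j (diff \<mu> i))" for j
    by (rule P_jet_wave[OF light_ray_axioms v(1) closure_interior_right I(1) smooth_diff_T X smooth_source dX diff_transport PX P0(1) src])
  moreover have "P (i + j) (\<lambda>\<mu>. jet j (R \<mu> i))" for j
    by (rule P_jet_wave[OF light_ray_reflect v(2) closure_interior_left I(2) R Z _ RZ _ PZ P0(2), where G = "\<lambda>\<mu> p. 0"])
      (simp_all add: R_transport jet0 P_zero)
  ultimately show ?case by blast
qed

end

text \<open>The lower limit \<open>a = 1\<close> encodes divisibility by \<open>\<mu>\<close>, the
  upper limit the degree. The coefficients are smooth functions so that tangential derivatives can
  be taken term by term.\<close>

definition poly_traces :: "nat \<Rightarrow> nat \<Rightarrow> (real \<Rightarrow> spacetime \<Rightarrow> complex^3) \<Rightarrow> bool"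
  where "poly_traces a d f \<longleftrightarrow> (\<exists>c. (\<forall>m. smooth (c m)) \<and>
    (\<forall>\<mu>\<ge>0. \<forall>p\<in>interface. f \<mu> p = (\<Sum>m\<in>{a..d}. \<mu> ^ m *\<^sub>R c m p)))"

lemma jet_class_poly_traces: "jet_class {0..} (poly_traces a)"
proof
  fix d show "poly_traces a d (\<lambda>\<mu> p. 0)"
    unfolding poly_traces_def by (rule exI[of _ "\<lambda>m p. 0"]) simp
next
  fix d d' f assume "poly_traces a d f" and d: "d \<le> d'"
  then obtain c where c: "\<forall>m. smooth (c m)" "\<forall>\<mu>\<ge>0. \<forall>p\<in>interface. f \<mu> p = (\<Sum>m\<in>{a..d}. \<mu> ^ m *\<^sub>R c m p)"
    unfolding poly_traces_def by blast
  define c' where "c' m = (if m \<le> d then c m else (\<lambda>p. 0))" for m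
  have "(\<Sum>m\<in>{a..d}. \<mu> ^ m *\<^sub>R c m p) = (\<Sum>m\<in>{a..d'}. \<mu> ^ m *\<^sub>R c' m p)" for \<mu> p
    using d by (intro sum.mono_neutral_cong_left) (auto simp: c'_def)
  moreover have "smooth (c' m)" for m using c(1) by (simp add: c'_def)
  ultimately show "poly_traces a d' f"
    unfolding poly_traces_def using c(2) by (intro exI[of _ c']) auto
next
  fix d f g assume f: "poly_traces a d f" and g: "poly_traces a d g"
  from f obtain b where "\<forall>m. smooth (b m)" "\<forall>\<mu>\<ge>0. \<forall>p\<in>interface. f \<mu> p = (\<Sum>m\<in>{a..d}. \<mu> ^ m *\<^sub>R b m p)"
    unfolding poly_traces_def by blast
  moreover from g obtain c where
    "\<forall>m. smooth (c m)" "\<forall>\<mu>\<ge>0. \<forall>p\<in>interface. g \<mu> p = (\<Sum>m\<in>{a..d}. \<mu> ^ m *\<^sub>R c m p)"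
    unfolding poly_traces_def by blast
  ultimately show "poly_traces a d (\<lambda>\<mu> p. f \<mu> p + g \<mu> p)"
    unfolding poly_traces_def
    by (intro exI[of _ "\<lambda>m p. b m p + c m p"]) (auto simp: scaleR_add_right sum.distrib)
next
  fix L :: "complex^3 \<Rightarrow> complex^3" and d f assume L: "bounded_linear L" and "poly_traces a d f"
  then obtain c where c: "\<forall>m. smooth (c m)" "\<forall>\<mu>\<ge>0. \<forall>p\<in>interface. f \<mu> p = (\<Sum>m\<in>{a..d}. \<mu> ^ m *\<^sub>R c m p)"
    unfolding poly_traces_def by blast
  then show "poly_traces a d (\<lambda>\<mu> p. L (f \<mu> p))"
    unfolding poly_traces_def
    by (intro exI[of _ "\<lambda>m p. L (c m p)"])
      (auto simp: bounded_linear.smooth_image[OF L] linear_sum[OF bounded_linear.linear[OF L]]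
        linear_cmul[OF bounded_linear.linear[OF L]])
next
  fix f :: "real \<Rightarrow> spacetime \<Rightarrow> complex^3" and v :: spacetime and d
  assume f: "\<And>\<mu>. \<mu> \<in> {0..} \<Longrightarrow> smooth (f \<mu>)" and v: "snd v $ 1 = 0" and "poly_traces a d f"
  then obtain c where c: "\<forall>m. smooth (c m)" "\<forall>\<mu>\<ge>0. \<forall>p\<in>interface. f \<mu> p = (\<Sum>m\<in>{a..d}. \<mu> ^ m *\<^sub>R c m p)"
    unfolding poly_traces_def by blast
  have "ddir v (f \<mu>) p = (\<Sum>m\<in>{a..d}. \<mu> ^ m *\<^sub>R ddir v (c m) p)" if "\<mu> \<ge> 0" "p \<in> interface" for \<mu> p
  proof -
    have "ddir v (f \<mu>) p = ddir v (\<lambda>p. \<Sum>m\<in>{a..d}. \<mu> ^ m *\<^sub>R c m p) p"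
      by (rule ddir_tangential[OF f _ v _ that(2)]) (use c that in \<open>auto intro!: smooth_sum smooth_scaleR_const\<close>)
    also have "\<dots> = (\<Sum>m\<in>{a..d}. \<mu> ^ m *\<^sub>R ddir v (c m) p)"
      using c(1) by (simp add: ddir_sum smooth_scaleR_const ddir_scaleR_const)
    finally show ?thesis .
  qed
  then show "poly_traces a d (\<lambda>\<mu>. ddir v (f \<mu>))"
    unfolding poly_traces_def using c(1) by (intro exI[of _ "\<lambda>m. ddir v (c m)"]) auto
next
  fix k :: "spacetime \<Rightarrow> real" and d f assume k: "smooth k" and "poly_traces a d f"
  then obtain c where c: "\<forall>m. smooth (c m)" "\<forall>\<mu>\<ge>0. \<forall>p\<in>interface. f \<mu> p = (\<Sum>m\<in>{a..d}. \<mu> ^ m *\<^sub>R c m p)"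
    unfolding poly_traces_def by blast
  then show "poly_traces a d (\<lambda>\<mu> p. k p *\<^sub>R f \<mu> p)"
    unfolding poly_traces_def
    by (intro exI[of _ "\<lambda>m p. k p *\<^sub>R c m p"])
      (auto simp: smooth_scaleR[OF k] scaleR_sum_right mult.commute)
next
  fix d f g assume "poly_traces a d f" "\<And>\<mu> p. \<mu> \<in> {0..} \<Longrightarrow> p \<in> interface \<Longrightarrow> g \<mu> p = f \<mu> p"
  then show "poly_traces a d g" unfolding poly_traces_def by auto
qed

lemma poly_traces_weaken:
  assumes "poly_traces 1 d f"
  shows "poly_traces 0 d f"
proof -
  from assms obtain c where c: "\<forall>m. smooth (c m)" "\<forall>\<mu>\<ge>0. \<forall>p\<in>interface. f \<mu> p = (\<Sum>m\<in>{1..d}. \<mu> ^ m *\<^sub>R c m p)"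
    unfolding poly_traces_def by blast
  define c' where "c' m = (if 1 \<le> m then c m else (\<lambda>p. 0))" for m
  have "(\<Sum>m\<in>{1..d}. \<mu> ^ m *\<^sub>R c m p) = (\<Sum>m\<in>{0..d}. \<mu> ^ m *\<^sub>R c' m p)" for \<mu> p
    by (intro sum.mono_neutral_cong_left) (auto simp: c'_def)
  moreover have "smooth (c' m)" for m using c(1) by (simp add: c'_def)
  ultimately show ?thesis
    unfolding poly_traces_def using c(2) by (intro exI[of _ c']) auto
qed

lemma poly_traces_const: "smooth g \<Longrightarrow> poly_traces 0 d (\<lambda>\<mu>. g)"
proof -
  assume g: "smooth g"
  have "poly_traces 0 0 (\<lambda>\<mu>. g)"
    unfolding poly_traces_def using g by (intro exI[of _ "\<lambda>m. g"]) simp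
  then show ?thesis by (rule jet_class.P_mono[OF jet_class_poly_traces]) simp
qed

lemma poly_traces_mult:
  assumes "poly_traces 0 d f"
  shows "poly_traces 1 (Suc d) (\<lambda>\<mu> p. \<mu> *\<^sub>R f \<mu> p)"
proof -
  from assms obtain c where c: "\<forall>m. smooth (c m)" "\<forall>\<mu>\<ge>0. \<forall>p\<in>interface. f \<mu> p = (\<Sum>m\<in>{0..d}. \<mu> ^ m *\<^sub>R c m p)"
    unfolding poly_traces_def by blast
  have "\<mu> *\<^sub>R (\<Sum>m\<in>{0..d}. \<mu> ^ m *\<^sub>R c m p) = (\<Sum>m\<in>{1..Suc d}. \<mu> ^ m *\<^sub>R c (m - 1) p)" for \<mu> p
    unfolding One_nat_def by (subst sum.atLeast_Suc_atMost_Suc_shift) (simp add: scaleR_sum_right)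
  then show ?thesis
    unfolding poly_traces_def using c by (intro exI[of _ "\<lambda>m. c (m - 1)"]) auto
qed

lemma in_mu_times_if_poly_traces:
  assumes "poly_traces 1 d f" "p \<in> interface"
  shows "in_mu_times (\<lambda>\<mu>. f \<mu> p) (poly_space (int d - 1))"
proof -
  from assms obtain c where c: "\<forall>\<mu>\<ge>0. f \<mu> p = (\<Sum>m\<in>{1..d}. \<mu> ^ m *\<^sub>R c m p)"
    unfolding poly_traces_def by blast
  define q where "q l = (\<Sum>m\<in>{1..d}. monom (c m p $ l) (m - 1))" for l
  define Q where "Q = (\<lambda>\<mu>. \<chi> l. poly (q l) (complex_of_real \<mu>))"
  \<comment> \<open>For \<open>d = 0\<close> the sum is empty and \<open>q l = 0\<close>, which
    matches the convention for the degree bound \<open>-1\<close>.\<close>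
  have "q l = 0 \<or> int (degree (q l)) \<le> int d - 1" for l
  proof (cases "d = 0")
    case False
    have "degree (q l) \<le> d - 1"
      unfolding q_def by (intro degree_sum_le) (auto intro: order_trans[OF degree_monom_le])
    then show ?thesis using False by auto
  qed (simp add: q_def)
  then have "Q \<in> poly_space (int d - 1)"
    unfolding poly_space_def Q_def by blast
  moreover have "f \<mu> p = \<mu> *\<^sub>R Q \<mu>" if "\<mu> \<ge> 0" for \<mu>
  proof -
    have "\<mu> ^ m *\<^sub>R z = \<mu> *\<^sub>R (z * complex_of_real \<mu> ^ (m - 1))" if m: "1 \<le> m" for m and z :: complex
    proof -
      obtain n where "m = Suc n" using m by (cases m) auto
      then show ?thesis by (simp add: scaleR_conv_of_real)
    qed
    then show ?thesis
      using c that
      by (simp add: vec_eq_iff Q_def q_def poly_sum poly_monom scaleR_sum_right)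
  qed
  ultimately show ?thesis unfolding in_mu_times_def by blast
qed

text \<open>The index counts steps towards order \<open>k\<close>; beyond \<open>k\<close> nothing
  is claimed, which makes the family increasing in \<open>d\<close>.\<close>

definition zero_traces :: "real set \<Rightarrow> nat \<Rightarrow> nat \<Rightarrow> (real \<Rightarrow> spacetime \<Rightarrow> complex^3) \<Rightarrow> bool"
  where "zero_traces U k d f \<longleftrightarrow> (d \<le> k \<longrightarrow> (\<forall>\<mu>\<in>U. \<forall>p\<in>interface. f \<mu> p = 0))"

lemma jet_class_zero_traces: "jet_class U (zero_traces U k)"
proof
  fix f :: "real \<Rightarrow> spacetime \<Rightarrow> complex^3" and v :: spacetime and d
  assume f: "\<And>\<mu>. \<mu> \<in> U \<Longrightarrow> smooth (f \<mu>)" and v: "snd v $ 1 = 0" and z: "zero_traces U k d f"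
  show "zero_traces U k d (\<lambda>\<mu>. ddir v (f \<mu>))"
    unfolding zero_traces_def
  proof (intro impI ballI)
    fix \<mu> p assume d: "d \<le> k" and \<mu>: "\<mu> \<in> U" and p: "p \<in> interface"
    have "ddir v (f \<mu>) p = ddir v (\<lambda>p. 0) p"
      by (rule ddir_tangential[OF f[OF \<mu>] _ v _ p]) (use z d \<mu> in \<open>auto simp: zero_traces_def\<close>)
    then show "ddir v (f \<mu>) p = 0" by simp
  qed
qed (auto simp: zero_traces_def linear_0 bounded_linear.linear)

lemma jet_scale_zero:
  assumes "smooth k" "smooth f" "\<And>m p. m \<le> j \<Longrightarrow> p \<in> interface \<Longrightarrow> jet m k p = 0" "p \<in> interface"
  shows "jet j (\<lambda>p. k p *\<^sub>R f p :: complex^'n) p = 0"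
  using assms(1-3)
proof (induction j arbitrary: k f)
  case 0
  then show ?case using 0(3)[of 0 p] assms(4) by simp
next
  case (Suc j)
  note k = Suc.prems(1) and f = Suc.prems(2)
  have "jet (Suc j) (\<lambda>p. k p *\<^sub>R f p) p = jet j (\<lambda>p. k p *\<^sub>R Dx 1 f p) p + jet j (\<lambda>p. Dx 1 k p *\<^sub>R f p) p"
    using k f by (simp add: funpow_Suc_right ddir_scaleR ddir_funpow_add smooth_scaleR smooth_ddir del: funpow.simps)
  also have "jet j (\<lambda>p. k p *\<^sub>R Dx 1 f p) p = 0"
    by (rule Suc.IH[OF k smooth_ddir[OF f] Suc.prems(3)]) auto
  also have "jet j (\<lambda>p. Dx 1 k p *\<^sub>R f p) p = 0"
  proof (rule Suc.IH[OF smooth_ddir[OF k] f])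
    show "jet m (Dx 1 k) p = 0" if "m \<le> j" "p \<in> interface" for m p
      using Suc.prems(3)[of "Suc m" p] that by (simp add: funpow_swap1)
  qed
  finally show ?case by simp
qed

lemma jet_coord:
  fixes s :: "real \<Rightarrow> real"
  assumes s: "smooth s"
  shows "jet m (\<lambda>p::spacetime. \<mu> * s (snd p $ 1)) = (\<lambda>p. \<mu> * (ddir 1 ^^ m) s (snd p $ 1))"
  by (induction m) (simp_all add: ddir_coord[OF smooth_ddir_funpow[OF s]] axis_def)

text \<open>The layer acts on \<open>T\<close>, the sum of \<open>diff\<close> and
  \<open>aI\<close>; as \<open>aI\<close> is constant in \<open>\<mu>\<close>, divisibility by
  \<open>\<mu>\<close> is lost. The factor \<open>\<mu>\<close> of the source restores it and raises
  the degree by one.\<close>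

lemma (in smart_waves) poly_source:
  assumes U: "U = {0..}" and P: "P = poly_traces 1"
    and d: "\<And>m. m \<le> j \<Longrightarrow> P (i + m) (\<lambda>\<mu>. jet m (diff \<mu> i))"
  shows "P (Suc (i + j)) (\<lambda>\<mu>. jet j (source \<mu> i))"
proof -
  interpret Q: jet_class U "poly_traces 0" unfolding U by (rule jet_class_poly_traces)
  have QT: "poly_traces 0 (i + m) (\<lambda>\<mu>. jet m (T \<mu> i))" if "m \<le> j" for m
  proof -
    have "poly_traces 0 (i + m) (\<lambda>\<mu>. jet m (\<lambda>p. diff \<mu> i p + aI i p))"
      by (rule Q.P_jet_add[OF smooth_diff_T aI poly_traces_weaken poly_traces_const])
        (use d[OF that] in \<open>auto simp: P intro!: smooth_jet aI\<close>)
    then show ?thesis by (simp add: diff_def)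
  qed
  have "poly_traces 0 (i + m) (\<lambda>\<mu>. jet m (\<lambda>p. smart_matrix \<nu> *v T \<mu> i p))" if "m \<le> j" for m
    by (rule Q.P_jet_linear[OF T matrix_vector_mul_bounded_linear QT[OF that]])
  from Q.P_jet_scale[OF smooth_coord[OF s] smooth_matrix_vector[OF T] this]
  have "poly_traces 0 (i + j) (\<lambda>\<mu>. jet j (\<lambda>p. (1 * s (snd p $ 1)) *\<^sub>R (smart_matrix \<nu> *v T \<mu> i p)))" .
  then have "poly_traces 1 (Suc (i + j)) (\<lambda>\<mu> p. \<mu> *\<^sub>R jet j (\<lambda>p. (1 * s (snd p $ 1)) *\<^sub>R (smart_matrix \<nu> *v T \<mu> i p)) p)"
    by (rule poly_traces_mult)
  then show ?thesis
    unfolding P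
  proof (rule jet_class.P_cong[OF jet_class_poly_traces, folded U])
    fix \<mu> p assume \<mu>: "\<mu> \<in> U"
    have "source \<mu> i = (\<lambda>p. \<mu> *\<^sub>R ((1 * s (snd p $ 1)) *\<^sub>R (smart_matrix \<nu> *v T \<mu> i p)))"
      by (simp add: source_def)
    moreover have "smooth (\<lambda>p. (1 * s (snd p $ 1)) *\<^sub>R (smart_matrix \<nu> *v T \<mu> i p))"
      by (intro smooth_scaleR smooth_coord s smooth_matrix_vector T \<mu>)
    ultimately show "jet j (source \<mu> i) p = \<mu> *\<^sub>R jet j (\<lambda>p. (1 * s (snd p $ 1)) *\<^sub>R (smart_matrix \<nu> *v T \<mu> i p)) p"
      by (simp only: ddir_funpow_bounded_linear[OF bounded_linear_scaleR_right])
  qed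
qed

text \<open>Only indices with \<open>i + j < k\<close> matter, and then every term of the product
  rule contains a derivative of the layer coefficient of order below \<open>k\<close>.\<close>

lemma (in smart_waves) zero_source:
  assumes P: "P = zero_traces U k" and s0: "\<And>m. m < k \<Longrightarrow> (ddir 1 ^^ m) s 0 = 0"
  shows "P (Suc (i + j)) (\<lambda>\<mu>. jet j (source \<mu> i))"
  unfolding P zero_traces_def source_def
proof (intro impI ballI)
  fix \<mu> p assume k: "Suc (i + j) \<le> k" and \<mu>: "\<mu> \<in> U" and p: "p \<in> interface"
  show "jet j (\<lambda>p. (\<mu> * s (snd p $ 1)) *\<^sub>R (smart_matrix \<nu> *v T \<mu> i p)) p = 0"
  proof (rule jet_scale_zero[OF smooth_coord[OF s] smooth_matrix_vector[OF T[OF \<mu>]] _ p])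
    fix m q assume "m \<le> j" "q \<in> interface"
    then show "jet m (\<lambda>p. \<mu> * s (snd p $ 1)) q = 0"
      using s0[of m] k by (simp add: jet_coord[OF s] mem_sets)
  qed
qed

section \<open>From smooth extensions back to one-sided derivatives\<close>

lemma Dx1_within_eq:
  assumes S: "S = left \<or> S = right \<or> S = UNIV" and g: "smooth g" and fg: "\<And>p. p \<in> S \<Longrightarrow> f p = g p" and p: "p \<in> S"
  shows "Dx1_within S f p = Dx 1 g p"
proof -
  define T where "T = {s. p + s *\<^sub>R (0, axis 1 1) \<in> S}"
  \<comment> \<open>The one-sided derivative is unique because the admissible parameters contain a
    half line.\<close>
  have "at 0 within T \<noteq> bot"
  proof -
    have "{0<..} \<subseteq> T \<or> {..<0} \<subseteq> T"
      using S p by (auto simp: T_def mem_sets)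
    then show ?thesis
      using at_le[of "{0<..}" T 0] at_le[of "{..<0}" T 0] trivial_limit_at_right_real[of 0] trivial_limit_at_left_real[of 0]
      by (metis bot.extremum_unique)
  qed
  moreover have "((\<lambda>s. f (p + s *\<^sub>R (0, axis 1 1))) has_vector_derivative Dx 1 g p) (at 0 within T)"
  proof (rule has_vector_derivative_transform)
    show "((\<lambda>s. g (p + s *\<^sub>R (0, axis 1 1))) has_vector_derivative Dx 1 g p) (at 0 within T)"
      using has_vector_derivative_line[OF g, of p "(0, axis 1 1)" 0 T] by (simp add: zero_prod_def[symmetric])
  qed (use p fg in \<open>auto simp: T_def zero_prod_def[symmetric]\<close>)
  ultimately show ?thesis unfolding Dx1_within_def T_def[symmetric] by (rule vector_derivative_within)
qed

lemma Dx1_within_funpow: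
  assumes S: "S = left \<or> S = right \<or> S = UNIV" and g: "smooth g" and fg: "\<forall>p\<in>S. f p = g p" and p: "p \<in> S"
  shows "(Dx1_within S ^^ j) f p = jet j g p"
proof -
  have "\<forall>p\<in>S. (Dx1_within S ^^ j) f p = jet j g p"
    by (induction j) (use fg Dx1_within_eq[OF S smooth_jet[OF g]] in auto)
  then show ?thesis using p by blast
qed

lemma layer_deriv_eq:
  fixes s \<sigma> :: "real \<Rightarrow> real"
  assumes s: "smooth s" and \<sigma>: "\<forall>x>0. \<sigma> x = s x"
  shows "layer_deriv k \<sigma> = (ddir 1 ^^ k) s 0"
proof -
  have d: "(deriv ^^ k) \<sigma> x = (ddir 1 ^^ k) s x" if "x > 0" for x
    using that
  proof (induction k arbitrary: x)
    case 0
    then show ?case using \<sigma> by simp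
  next
    case (Suc k)
    have "((ddir 1 ^^ k) s has_real_derivative ddir 1 ((ddir 1 ^^ k) s) x) (at x)"
      using has_vector_derivative_line[OF smooth_ddir_funpow[OF s], where p = 0 and v = 1 and t = x and S = UNIV]
      by (simp add: has_real_derivative_iff_has_vector_derivative)
    moreover have "\<forall>\<^sub>F y in nhds x. (deriv ^^ k) \<sigma> y = (ddir 1 ^^ k) s y"
      using eventually_nhds_in_open[OF open_greaterThan[of 0], of x] Suc
      by (auto elim!: eventually_mono)
    ultimately show ?case
      using deriv_cong_ev[OF _ refl, of "(deriv ^^ k) \<sigma>" "(ddir 1 ^^ k) s" x] by (simp add: DERIV_imp_deriv)
  qed
  have "((ddir 1 ^^ k) s \<longlongrightarrow> (ddir 1 ^^ k) s 0) (at_right 0)"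
    using smooth_imp_continuous[OF smooth_ddir_funpow[OF s], where S = UNIV]
    by (auto simp: continuous_on_def intro: Lim_at_imp_Lim_at_within)
  then have "((deriv ^^ k) \<sigma> \<longlongrightarrow> (ddir 1 ^^ k) s 0) (at_right 0)"
    by (rule Lim_transform_eventually) (auto simp: eventually_at_right_less d eventually_at_filter)
  then show ?thesis
    unfolding layer_deriv_def by (intro tendsto_Lim) auto
qed

context incidence
begin

section \<open>Polynomial dependence, vanishing and the reflection coefficient for the smart
  layer\<close>

lemma smart_waves_I:
  assumes "absorption \<sigma>" and inc: "incident maxwell \<tau> \<xi> aI" and jc: "jet_class U P"
    and s: "smooth s" "\<forall>x>0. \<sigma> x = s x"
    and tr: "\<And>\<mu>. \<mu> \<in> U \<Longrightarrow> transmission maxwell (smart_C \<sigma> \<nu>) \<mu> \<tau> \<xi> aI (aR \<mu>) (aT \<mu>)"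
  obtains HR HT where "smart_waves \<tau> \<xi> U P \<nu> s aI HR HT"
    "\<forall>\<mu>\<in>U. \<forall>j. \<forall>p\<in>left. aR \<mu> j p = HR \<mu> j p" "\<forall>\<mu>\<in>U. \<forall>j. \<forall>p\<in>right. aT \<mu> j p = HT \<mu> j p"
proof -
  have aI: "smooth (aI j)" for j using inc by (auto simp: incident_def)
  have "\<forall>\<mu>. \<exists>HR HT. \<mu> \<in> U \<longrightarrow> (\<forall>j. smooth (HR j)) \<and> (\<forall>j. \<forall>p\<in>left. aR \<mu> j p = HR j p)
      \<and> (\<forall>j. smooth (HT j)) \<and> (\<forall>j. \<forall>p\<in>right. aT \<mu> j p = HT j p)"
    using transmission_extensions[OF tr] by metis
  then obtain HR HT where H: "\<And>\<mu>. \<mu> \<in> U \<Longrightarrow> (\<forall>j. smooth (HR \<mu> j)) \<and> (\<forall>j. \<forall>p\<in>left. aR \<mu> j p = HR \<mu> j p)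
      \<and> (\<forall>j. smooth (HT \<mu> j)) \<and> (\<forall>j. \<forall>p\<in>right. aT \<mu> j p = HT \<mu> j p)" by metis
  have eqs: "wkb maxwell (\<lambda>_. 0) 0 \<tau> (reflect \<xi>) left (HR \<mu>)
    \<and> wkb maxwell (\<lambda>p. \<mu> * s (snd p $ 1)) (smart_matrix \<nu>) \<tau> \<xi> right (HT \<mu>)
    \<and> (\<forall>j. \<forall>p\<in>interface. maxwell 1 *v (aI j p + HR \<mu> j p - HT \<mu> j p) = 0)" if \<mu>: "\<mu> \<in> U" for \<mu>
  proof -
    have "transmission maxwell (smart_C \<sigma> \<nu>) \<mu> \<tau> \<xi> aI (aR \<mu>) (aT \<mu>) \<longleftrightarrow>
      (\<forall>j x. ((0, x) \<in> left \<longrightarrow> HR \<mu> j (0, x) = 0) \<and> ((0, x) \<in> right \<longrightarrow> HT \<mu> j (0, x) = 0))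
      \<and> wkb maxwell (\<lambda>_. 0) 0 \<tau> \<xi> UNIV aI
      \<and> wkb maxwell (\<lambda>_. 0) 0 \<tau> (reflect \<xi>) left (HR \<mu>)
      \<and> wkb maxwell (\<lambda>p. \<mu> * s (snd p $ 1)) (smart_matrix \<nu>) \<tau> \<xi> right (HT \<mu>)
      \<and> (\<forall>j. \<forall>p\<in>interface. maxwell 1 *v (aI j p + HR \<mu> j p - HT \<mu> j p) = 0)"
      by (rule smart_transmission_iff) (use aI s H[OF \<mu>] in auto)
    then show ?thesis using tr[OF \<mu>] by blast
  qed
  interpret jet_class U P by (rule jc)
  have "smart_waves \<tau> \<xi> U P \<nu> s aI HR HT"
    by unfold_locales (use aI s H eqs incident_wkb[OF inc] in auto)
  then show ?thesis using that H by blast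
qed

lemma smart_poly:
  assumes \<sigma>: "absorption \<sigma>" and inc: "incident maxwell \<tau> \<xi> aI"
    and tr: "\<forall>\<mu>\<ge>0. transmission maxwell (smart_C \<sigma> \<nu>) \<mu> \<tau> \<xi> aI (aR \<mu>) (aT \<mu>)"
    and p: "p \<in> interface"
  shows "in_mu_times (\<lambda>\<mu>. (Dx1_within right ^^ j) (aT \<mu> i) p - (Dx1_within UNIV ^^ j) (aI i) p)
      (poly_space (int i + int j - 1))"
    and "in_mu_times (\<lambda>\<mu>. (Dx1_within left ^^ j) (aR \<mu> i) p) (poly_space (int i + int j - 1))"
proof -
  obtain s where s: "smooth s" "\<forall>x>0. \<sigma> x = s x" using absorption_extension[OF \<sigma>] by blast
  obtain HR HT where W: "smart_waves \<tau> \<xi> {0..} (poly_traces 1) \<nu> s aI HR HT"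
    and H: "\<forall>\<mu>\<in>{0..}. \<forall>j. \<forall>p\<in>left. aR \<mu> j p = HR \<mu> j p" "\<forall>\<mu>\<in>{0..}. \<forall>j. \<forall>p\<in>right. aT \<mu> j p = HT \<mu> j p"
    by (rule smart_waves_I[OF \<sigma> inc jet_class_poly_traces s, where aR = aR and aT = aT and \<nu> = \<nu>]) (use tr in auto)
  interpret smart_waves \<tau> \<xi> "{0..}" "poly_traces 1" \<nu> s aI HR HT by (rule W)
  have P: "poly_traces 1 (i + j) (\<lambda>\<mu>. jet j (diff \<mu> i))" "poly_traces 1 (i + j) (\<lambda>\<mu>. jet j (HR \<mu> i))"
    using P_traces[OF poly_source[OF refl refl]] by blast+
  have "poly_traces 1 (i + j) (\<lambda>\<mu> p. (Dx1_within right ^^ j) (aT \<mu> i) p - (Dx1_within UNIV ^^ j) (aI i) p)"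
    using P(1)
  proof (rule P_cong)
    fix \<mu> p assume "\<mu> \<in> {0::real..}" "p \<in> interface"
    then show "(Dx1_within right ^^ j) (aT \<mu> i) p - (Dx1_within UNIV ^^ j) (aI i) p = jet j (diff \<mu> i) p"
      using Dx1_within_funpow[of right "HT \<mu> i" "aT \<mu> i" p j] Dx1_within_funpow[of UNIV "aI i" "aI i" p j] H(2) T aI
      by (simp add: diff_def jet_diff interface_subset)
  qed
  from in_mu_times_if_poly_traces[OF this p]
  show "in_mu_times (\<lambda>\<mu>. (Dx1_within right ^^ j) (aT \<mu> i) p - (Dx1_within UNIV ^^ j) (aI i) p)
      (poly_space (int i + int j - 1))" by simp
  have "poly_traces 1 (i + j) (\<lambda>\<mu> p. (Dx1_within left ^^ j) (aR \<mu> i) p)"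
    using P(2)
  proof (rule P_cong)
    fix \<mu> p assume "\<mu> \<in> {0::real..}" "p \<in> interface"
    then show "(Dx1_within left ^^ j) (aR \<mu> i) p = jet j (HR \<mu> i) p"
      using Dx1_within_funpow[of left "HR \<mu> i" "aR \<mu> i" p j] H(1) R by (simp add: interface_subset)
  qed
  from in_mu_times_if_poly_traces[OF this p]
  show "in_mu_times (\<lambda>\<mu>. (Dx1_within left ^^ j) (aR \<mu> i) p) (poly_space (int i + int j - 1))" by simp
qed

text \<open>The source raises the index by one, so the layer derivative of order \<open>k\<close>
  can enter only at index \<open>k + 1\<close>; this is why \<open>i = k\<close> is still
  included.\<close>

lemma smart_nonreflecting:
  assumes \<sigma>: "absorption \<sigma>" and inc: "incident maxwell \<tau> \<xi> aI"
    and tr: "transmission maxwell (smart_C \<sigma> \<nu>) \<mu> \<tau> \<xi> aI aR aT"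
    and k: "\<forall>m<k. layer_deriv m \<sigma> = 0" and i: "i \<le> k" and p: "p \<in> interface"
  shows "aR i p = 0"
proof -
  obtain s where se: "smooth s" "\<forall>x>0. \<sigma> x = s x" using absorption_extension[OF \<sigma>] by blast
  obtain HR HT where W: "smart_waves \<tau> \<xi> {\<mu>} (zero_traces {\<mu>} k) \<nu> s aI HR HT"
    and H: "\<forall>\<mu>'\<in>{\<mu>}. \<forall>j. \<forall>p\<in>left. aR j p = HR \<mu>' j p"
    by (rule smart_waves_I[OF \<sigma> inc jet_class_zero_traces se,
          where aR = "\<lambda>_. aR" and aT = "\<lambda>_. aT" and \<nu> = \<nu> and U = "{\<mu>}"]) (use tr in auto)
  interpret smart_waves \<tau> \<xi> "{\<mu>}" "zero_traces {\<mu>} k" \<nu> s aI HR HT by (rule W)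
  have "(ddir 1 ^^ m) s 0 = 0" if "m < k" for m using k that layer_deriv_eq[OF se] by simp
  then have "zero_traces {\<mu>} k (i + 0) (\<lambda>\<mu>. jet 0 (HR \<mu> i))"
    using P_traces[OF zero_source[OF refl]] by blast
  then show ?thesis using i p H by (simp add: zero_traces_def interface_subset)
qed

lemma symb_\<Phi>: "symb maxwell \<tau> \<xi> (\<Phi> \<tau> \<xi>) = 0"
proof -
  define t x y z where "t = complex_of_real \<tau>" and "x = complex_of_real (\<xi> $ 1)"
    and "y = complex_of_real (\<xi> $ 2)" and "z = complex_of_real (\<xi> $ 3)"
  note d = this
  have t2: "t * t = x * x + y * y + z * z"
    using arg_cong[OF dispersion, of complex_of_real]
    by (simp add: d inner_vec_def sum_3 power2_eq_square)
  have x0: "x \<noteq> 0" using xi1 by (simp add: d)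
  have i2: "\<i> * \<i> = -1" by simp
  define k where "k = t / x"
  have k: "k * x = t" using x0 by (simp add: k_def)
  have P: "\<Phi> \<tau> \<xi> = vector [x - k * t, y + \<i> * k * z, z - \<i> * k * y]"
    by (simp add: \<Phi>_def d k_def power2_eq_square)
  have "t * (x - k * t) + \<i> * (y * (z - \<i> * k * y) - z * (y + \<i> * k * z)) = 0"
    using t2 i2 unfolding k[symmetric] by algebra
  moreover have "t * (y + \<i> * k * z) + \<i> * (z * (x - k * t) - x * (z - \<i> * k * y)) = 0"
    using t2 i2 unfolding k[symmetric] by algebra
  moreover have "t * (z - \<i> * k * y) + \<i> * (x * (y + \<i> * k * z) - y * (x - k * t)) = 0"
    using t2 i2 unfolding k[symmetric] by algebra
  ultimately show ?thesis
    by (simp add: symb_maxwell P vec_eq_iff forall_3 vector_3 scaleR_conv_of_real[where 'a = complex] d)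
qed

lemma indicator_absorption: "absorption (indicator {0<..})"
  unfolding absorption_def smooth_upto_def by (auto intro!: exI[of _ "\<lambda>_. 1"])

text \<open>The source term of the first corrector is \<open>X = \<mu> (C a - c / v\<^sub>1 A\<^sub>1 a)\<close>, where \<open>a = \<alpha> \<Phi>\<close> is the
  incident amplitude and \<open>c\<close> its rate of absorption.\<close>

lemma reflection_coefficient:
  assumes w: "symb maxwell \<tau> (reflect \<xi>) w = 0" and uw: "maxwell 1 *v (w - u) = 0"
    and u: "symb maxwell \<tau> \<xi> u = \<i> *s X"
    and X: "X = \<mu> *\<^sub>R (smart_matrix \<nu> *v (\<alpha> *s \<Phi> \<tau> \<xi>))
      - (\<mu> * smart_rate \<nu> / group_velocity \<tau> \<xi> $ 1) *\<^sub>R (maxwell 1 *v (\<alpha> *s \<Phi> \<tau> \<xi>))"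
  shows "w = (refl_coeff \<mu> \<nu> \<tau> \<xi> * \<alpha>) *s \<Phi> \<tau> (reflect \<xi>)"
proof -
  define t x y z n m where "t = complex_of_real \<tau>" and "x = complex_of_real (\<xi> $ 1)"
    and "y = complex_of_real (\<xi> $ 2)" and "z = complex_of_real (\<xi> $ 3)"
    and "n = complex_of_real \<nu>" and "m = complex_of_real \<mu>"
  note d = this
  have t2: "t * t = x * x + y * y + z * z"
    using arg_cong[OF dispersion, of complex_of_real]
    by (simp add: d inner_vec_def sum_3 power2_eq_square)
  have x0: "x \<noteq> 0" "t \<noteq> 0" using xi1 \<tau> by (simp_all add: d)
  have i2: "\<i> * \<i> = -1" by simp
  define k k' where "k = t / x" and "k' = x / t"
  have k: "k * x = t" "k' * t = x" "k * k' = 1" using x0 by (simp_all add: k_def k'_def)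
  define P1 P2 P3 where "P1 = x - k * t" and "P2 = y + \<i> * k * z" and "P3 = z - \<i> * k * y"
  have P: "\<Phi> \<tau> \<xi> = vector [P1, P2, P3]"
    by (simp add: \<Phi>_def d P1_def P2_def P3_def k_def power2_eq_square)
  have P': "\<Phi> \<tau> (reflect \<xi>) = vector [- P1, y - \<i> * k * z, z + \<i> * k * y]"
    by (simp add: \<Phi>_def d P1_def k_def power2_eq_square)
  \<comment> \<open>\<open>k'\<close> is \<open>- v_1\<close> and \<open>k\<close> is
    \<open>- 1 / v_1\<close>, so \<open>- r\<close> is the absorption rate divided by
    \<open>v_1\<close>.\<close>
  define r where "r = (1 + n) / 4 * (k + k') - (1 - n) / 2"
  have r: "4 * r = (1 + n) * (k + k') - 2 * (1 - n)" by (simp add: r_def field_simps)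
  define \<rho> where "\<rho> = \<mu> * smart_rate \<nu> / group_velocity \<tau> \<xi> $ 1"
  have rate: "complex_of_real \<rho> = - m * r"
    using x0 xi1 \<tau>
    by (simp add: \<rho>_def smart_rate_def group_velocity_def d r_def k_def k'_def field_simps power2_eq_square)
  have Xn: "2 * X $ 1 = 0" "2 * X $ 2 = m * \<alpha> * ((1 + n) * P2 - (1 - n) * \<i> * P3 - 2 * r * \<i> * P3)"
    "2 * X $ 3 = m * \<alpha> * ((1 + n) * P3 + (1 - n) * \<i> * P2 + 2 * r * \<i> * P2)"
    unfolding X \<rho>_def[symmetric] smart_matrix_vector maxwell_vector
    by (simp_all add: P vector_3 axis_def scaleR_conv_of_real[where 'a = complex] rate d[symmetric])
      (simp_all add: field_simps)
  \<comment> \<open>The range of \<open>maxwell 1\<close> is tangential; this removes one term from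
    each of the tangential \<open>reflected_components\<close>.\<close>
  have X1: "X $ 1 = 0" using Xn(1) by simp
  have X2: "4 * X $ 2 = m * \<alpha> * (1 + n) * (1 - k * k) * (y - \<i> * k' * z)"
    using Xn(2) r k i2 unfolding P2_def P3_def by algebra
  have X3: "4 * X $ 3 = m * \<alpha> * (1 + n) * (1 - k * k) * (z + \<i> * k' * y)"
    using Xn(3) r k i2 unfolding P2_def P3_def by algebra
  have c: "2 * (x * t) * w $ 1 = \<i> * (y * X $ 2 + z * X $ 3)" "2 * (x * t) * w $ 2 = t * X $ 3"
    "2 * (x * t) * w $ 3 = - t * X $ 2"
    using reflected_components[OF xi1 u w uw] by (simp_all add: X1 d)
  define R where "R = refl_coeff \<mu> \<nu> \<tau> \<xi>"
  have R: "8 * t * R = \<i> * m * (1 + n) * (1 - k * k)"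
    using x0 xi1 \<tau> by (simp add: R_def refl_coeff_def d k_def field_simps power2_eq_square)
  have nz: "8 * x * t \<noteq> 0" using x0 by simp
  have "8 * x * t * (w $ 1) = 8 * x * t * (R * \<alpha> * (- P1))"
    using c(1) X2 X3 R k t2 i2 unfolding P1_def by algebra
  then have w1: "w $ 1 = R * \<alpha> * (- P1)" using mult_left_cancel[OF nz] by blast
  have "8 * x * t * (w $ 2) = 8 * x * t * (R * \<alpha> * (y - \<i> * k * z))"
    using c(2) X3 R k i2 by algebra
  then have w2: "w $ 2 = R * \<alpha> * (y - \<i> * k * z)" using mult_left_cancel[OF nz] by blast
  have "8 * x * t * (w $ 3) = 8 * x * t * (R * \<alpha> * (z + \<i> * k * y))"
    using c(3) X2 R k i2 by algebra
  then have w3: "w $ 3 = R * \<alpha> * (z + \<i> * k * y)" using mult_left_cancel[OF nz] by blast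
  show ?thesis
    by (simp add: P' vec_eq_iff forall_3 vector_3 R_def[symmetric] w1 w2 w3)
qed

text \<open>\<open>diff \<mu> 0\<close> vanishes on the interface, but its normal derivative is
  driven by the jump of the absorption; together with the layer term it is the source of the first
  reflected coefficient.\<close>

lemma smart_reflection:
  assumes inc: "incident maxwell \<tau> \<xi> aI"
    and tr: "transmission maxwell (smart_C (indicator {0<..}) \<nu>) \<mu> \<tau> \<xi> aI aR aT"
  shows "p \<in> left \<Longrightarrow> aR 0 p = 0"
    and "p \<in> interface \<Longrightarrow> aI 0 p = \<alpha> *s \<Phi> \<tau> \<xi> \<Longrightarrow>
      aR 1 p = (refl_coeff \<mu> \<nu> \<tau> \<xi> * \<alpha>) *s \<Phi> \<tau> (reflect \<xi>)"
proof -
  define s where "s = (\<lambda>x::real. 1 :: real)"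
  have s: "smooth s" "\<forall>x>0. (indicator {0<..} x :: real) = s x" by (auto simp: s_def)
  obtain HR HT where W: "smart_waves \<tau> \<xi> {\<mu>} (zero_traces {\<mu>} 0) \<nu> s aI HR HT"
    and H: "\<forall>\<mu>'\<in>{\<mu>}. \<forall>j. \<forall>p\<in>left. aR j p = HR \<mu>' j p"
    by (rule smart_waves_I[OF indicator_absorption inc jet_class_zero_traces s,
          where aR = "\<lambda>_. aR" and aT = "\<lambda>_. aT" and \<nu> = \<nu> and U = "{\<mu>}"]) (use tr in auto)
  interpret smart_waves \<tau> \<xi> "{\<mu>}" "zero_traces {\<mu>} 0" \<nu> s aI HR HT by (rule W)
  have "zero_traces {\<mu>} 0 (0 + 0) (\<lambda>\<mu>. jet 0 (HR \<mu> 0))" "zero_traces {\<mu>} 0 (0 + 0) (\<lambda>\<mu>. jet 0 (diff \<mu> 0))"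
    using P_traces[OF zero_source[OF refl]] by blast+
  then have 0: "HR \<mu> 0 p = 0" "diff \<mu> 0 p = 0" if "p \<in> interface" for p
    using that by (auto simp: zero_traces_def)
  have HR: "smooth (HR \<mu> i)" and df: "smooth (diff \<mu> i)" and HT: "smooth (HT \<mu> i)" for i
    using R T smooth_diff_T by auto
  have HR0: "HR \<mu> 0 p = 0" if "p \<in> left" for p
  proof (rule reflected.transport_unique[OF outgoing_left HR smooth_const[of 0] _ _ _ 0(1) that, where D = 0 and c = 0])
    show "symb maxwell \<tau> (reflect \<xi>) (HR \<mu> 0 p) = 0" if "p \<in> left" for p
      using R_eq[of \<mu> p 0] that by (simp add: vec_eq_iff)
    show "proj \<tau> (reflect \<xi>) (lower_op maxwell (\<lambda>_. 0) 0 (HR \<mu> 0) p) = 0" if "p \<in> left" for p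
      using R_transport[of \<mu> p 0] that by (simp add: lower_op_def)
  qed (auto simp: proj_linear)
  then show "p \<in> left \<Longrightarrow> aR 0 p = 0" using H by simp
  assume p: "p \<in> interface" and \<alpha>: "aI 0 p = \<alpha> *s \<Phi> \<tau> \<xi>"
  have pl: "p \<in> left" and pr: "p \<in> right" using interface_subset[OF p] by auto
  have "principal maxwell (HR \<mu> 0) p = 0"
    using lower_op_eq_0[OF HR[of 0] smooth_const[of 0] closure_interior_left HR0 pl, of maxwell 0]
    by (simp add: lower_op_def)
  then have w: "symb maxwell \<tau> (reflect \<xi>) (HR \<mu> 1 p) = 0"
    using R_eq[of \<mu> p 1] pl by (simp add: vec_eq_iff)
  \<comment> \<open>The tangential derivatives of \<open>diff \<mu> 0\<close> vanish at
    \<open>p\<close>, so \<open>g\<close> is the only first derivative left, and the transport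
    equation expresses it by the incident amplitude.\<close>
  define g where "g = Dx 1 (diff \<mu> 0) p"
  define X where "X = principal maxwell (diff \<mu> 0) p + source \<mu> 0 p"
  have u: "symb maxwell \<tau> \<xi> (diff \<mu> 1 p) = \<i> *s X"
    using symb_eqI[OF diff_eq[of \<mu> p 1]] pr by (simp add: X_def)
  have tang: "ddir v (diff \<mu> 0) p = 0" if "snd v $ 1 = 0" for v
    using ddir_tangential[OF df smooth_const[of 0] that 0(2) p] by simp
  \<comment> \<open>\<open>diff \<mu> 0\<close> lies in the kernel on all of \<open>right\<close>,
    and its normal derivative inherits this.\<close>
  have pg: "proj \<tau> \<xi> g = g"
  proof -
    have z: "proj \<tau> \<xi> (diff \<mu> 0 q) - diff \<mu> 0 q = 0" if "q \<in> right" for q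
    proof -
      have "symb maxwell \<tau> \<xi> (diff \<mu> 0 q) = 0" using diff_eq[of \<mu> q 0] that by (simp add: vec_eq_iff)
      from proj_eqI[OF this] show ?thesis by simp
    qed
    have "Dx 1 (\<lambda>q. proj \<tau> \<xi> (diff \<mu> 0 q) - diff \<mu> 0 q) p = 0"
      by (rule ddir_vanish[OF smooth_diff[OF smooth_proj[OF df] df] closure_interior_right _ pr]) (use z in blast)
    then show ?thesis
      by (simp add: ddir_diff smooth_proj df bounded_linear.ddir_image[OF bounded_linear_proj df] g_def)
  qed
  have src: "source \<mu> 0 p = \<mu> *\<^sub>R (smart_matrix \<nu> *v (\<alpha> *s \<Phi> \<tau> \<xi>))"
    using 0(2)[OF p] \<alpha> unfolding source_def diff_def by (simp add: s_def)
  have prin: "principal maxwell (diff \<mu> 0) p = maxwell 1 *v g"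
    by (simp add: principal_def sum_3 tang axis_def g_def)
  have a1: "proj \<tau> \<xi> (maxwell 1 *v g) = group_velocity \<tau> \<xi> $ 1 *\<^sub>R g"
    using proj_maxwell_proj[of 1 g] unfolding pg .
  have "proj \<tau> \<xi> (\<alpha> *s \<Phi> \<tau> \<xi>) = \<alpha> *s \<Phi> \<tau> \<xi>"
    by (simp add: proj_linear proj_eqI[OF symb_\<Phi>])
  then have a2: "proj \<tau> \<xi> (smart_matrix \<nu> *v (\<alpha> *s \<Phi> \<tau> \<xi>)) = smart_rate \<nu> *\<^sub>R (\<alpha> *s \<Phi> \<tau> \<xi>)"
    using proj_smart[of \<nu> "\<alpha> *s \<Phi> \<tau> \<xi>"] by metis
  have "proj \<tau> \<xi> (maxwell 1 *v g + \<mu> *\<^sub>R (smart_matrix \<nu> *v (\<alpha> *s \<Phi> \<tau> \<xi>))) = 0"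
    using diff_transport[of \<mu> p 0] pr unfolding prin src by simp
  then have "group_velocity \<tau> \<xi> $ 1 *\<^sub>R g + (\<mu> * smart_rate \<nu>) *\<^sub>R (\<alpha> *s \<Phi> \<tau> \<xi>) = 0"
    by (simp only: proj_linear(1,3) a1 a2 scaleR_scaleR)
  then have "group_velocity \<tau> \<xi> $ 1 *\<^sub>R g = - ((\<mu> * smart_rate \<nu>) *\<^sub>R (\<alpha> *s \<Phi> \<tau> \<xi>))"
    by (simp add: eq_neg_iff_add_eq_0)
  then have "(1 / group_velocity \<tau> \<xi> $ 1) *\<^sub>R (group_velocity \<tau> \<xi> $ 1 *\<^sub>R g)
    = (1 / group_velocity \<tau> \<xi> $ 1) *\<^sub>R (- ((\<mu> * smart_rate \<nu>) *\<^sub>R (\<alpha> *s \<Phi> \<tau> \<xi>)))" by simp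
  then have g: "g = (- (\<mu> * smart_rate \<nu> / group_velocity \<tau> \<xi> $ 1)) *\<^sub>R (\<alpha> *s \<Phi> \<tau> \<xi>)"
    using v1 by simp
  have X: "X = \<mu> *\<^sub>R (smart_matrix \<nu> *v (\<alpha> *s \<Phi> \<tau> \<xi>))
      - (\<mu> * smart_rate \<nu> / group_velocity \<tau> \<xi> $ 1) *\<^sub>R (maxwell 1 *v (\<alpha> *s \<Phi> \<tau> \<xi>))"
    unfolding X_def src prin unfolding g matrix_vector_scaleR by simp
  have "HR \<mu> 1 p = (refl_coeff \<mu> \<nu> \<tau> \<xi> * \<alpha>) *s \<Phi> \<tau> (reflect \<xi>)"
    by (rule reflection_coefficient[OF w _ u X]) (rule jump_diff[OF _ p], simp)
  then show "aR 1 p = (refl_coeff \<mu> \<nu> \<tau> \<xi> * \<alpha>) *s \<Phi> \<tau> (reflect \<xi>)" using H pl by simp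
qed

section \<open>From coefficients to amplitudes on the interface\<close>

lemma expansion_O_eps:
  fixes bR :: "real \<Rightarrow> spacetime \<Rightarrow> complex^'n"
  assumes b: "expansion left bR aR" and 0: "\<And>i p. i < n \<Longrightarrow> p \<in> interface \<Longrightarrow> aR i p = 0"
  shows "O_eps n interface bR"
proof -
  obtain g e where g: "smooth g" "e > 0" "\<And>\<epsilon> p. 0 < \<epsilon> \<Longrightarrow> \<epsilon> < e \<Longrightarrow> p \<in> left \<Longrightarrow> bR \<epsilon> p = g (\<epsilon>, p)"
    "\<And>j p. p \<in> left \<Longrightarrow> aR j p = taylor j g p" using b by (rule expansionE) (rule that; simp)
  have "O_eps (n - 0) interface bR"
  proof (rule O_eps_if_taylor_zero[OF g(1) _ g(2)])
    show "(ddir (1, 0) ^^ i) g (0, p) = 0" if "i < n" "p \<in> interface" for i p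
      using 0[OF that] g(4)[OF interface_subset(1)[OF that(2)], of i] by simp
  qed (use g(3) interface_subset in auto)
  then show ?thesis by simp
qed

lemma expansion_O_eps_first:
  fixes bR :: "real \<Rightarrow> spacetime \<Rightarrow> complex^'n"
  assumes b: "expansion left bR aR" and 0: "\<And>p. p \<in> interface \<Longrightarrow> aR 0 p = 0"
    and 1: "\<And>p. p \<in> interface \<Longrightarrow> aR 1 p = c p"
  shows "O_eps 2 interface (\<lambda>\<epsilon> p. bR \<epsilon> p - \<epsilon> *\<^sub>R c p)"
proof -
  obtain g e where g: "smooth g" "e > 0" "\<And>\<epsilon> p. 0 < \<epsilon> \<Longrightarrow> \<epsilon> < e \<Longrightarrow> p \<in> left \<Longrightarrow> bR \<epsilon> p = g (\<epsilon>, p)"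
    "\<And>j p. p \<in> left \<Longrightarrow> aR j p = taylor j g p" using b by (rule expansionE) (rule that; simp)
  \<comment> \<open>The first-order term is subtracted with \<open>taylor 1 g\<close> in place of
    \<open>c\<close>: both agree on the interface, and the former is smooth everywhere.\<close>
  define h where "h = (\<lambda>q. g q - fst q *\<^sub>R taylor 1 g (snd q))"
  have t: "smooth (\<lambda>q::real \<times> spacetime. taylor 1 g (snd q))"
    by (rule smooth_compose[OF smooth_taylor[OF g(1)]]) (intro smooth_intros)
  have ft: "smooth (\<lambda>q::real \<times> spacetime. fst q *\<^sub>R taylor 1 g (snd q))"
    by (rule smooth_scaleR[OF _ t]) (intro smooth_intros)
  have h: "smooth h" unfolding h_def by (rule smooth_diff[OF g(1) ft])
  have c: "taylor 1 g p = c p" if "p \<in> interface" for p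
    using 1[OF that] g(4)[OF interface_subset(1)[OF that], of 1] by simp
  have "O_eps (2 - 0) interface (\<lambda>\<epsilon> p. bR \<epsilon> p - \<epsilon> *\<^sub>R c p)"
  proof (rule O_eps_if_taylor_zero[OF h _ g(2)])
    fix i p assume i: "i < (2::nat)" and p: "p \<in> interface"
    have "g (0, p) = 0" using 0[OF p] g(4)[OF interface_subset(1)[OF p], of 0] by simp
    then have h0: "h (0, p) = 0" by (simp add: h_def)
    have "ddir (1, 0) h = (\<lambda>q. ddir (1, 0) g q - ddir (1, 0) (\<lambda>q. fst q *\<^sub>R taylor 1 g (snd q)) q)"
      unfolding h_def by (rule ddir_diff[OF g(1) ft])
    then have "ddir (1, 0) h (0, p) = 0"
      using fun_cong[OF ddir_funpow_fst_scaleR[OF t, of 1], of "(0, p)"] by simp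
    with h0 i show "(ddir (1, 0) ^^ i) h (0, p) = 0" by (auto simp: less_2_cases_iff)
  qed (use g(3) interface_subset c in \<open>auto simp: h_def\<close>)
  then show ?thesis by simp
qed

end

theorem theorem6p1:
  fixes \<tau> \<nu> :: real and \<xi> :: "real^3"
  assumes "\<tau> \<noteq> 0" and "\<tau> = norm \<xi> \<or> \<tau> = - norm \<xi>"
    and "group_velocity \<tau> \<xi> $ 1 > 0" and "\<nu> \<ge> 0"
  shows
    \<comment> \<open>(i), smart layer\<close>
    "(\<forall>\<sigma> \<mu> aI. absorption \<sigma> \<and> \<mu> \<ge> 0 \<and> incident maxwell \<tau> \<xi> aI \<longrightarrow>
        (\<exists>aR aT. transmission maxwell (smart_C \<sigma> \<nu>) \<mu> \<tau> \<xi> aI aR aT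
          \<and> (\<forall>aR' aT'. transmission maxwell (smart_C \<sigma> \<nu>) \<mu> \<tau> \<xi> aI aR' aT' \<longrightarrow>
               (\<forall>j. (\<forall>p\<in>left. aR' j p = aR j p) \<and> (\<forall>p\<in>right. aT' j p = aT j p)))))
     \<comment> \<open>(i), Berenger layer\<close>
     \<and> (\<forall>\<sigma> \<mu> aI. absorption \<sigma> \<and> \<mu> \<ge> 0 \<and> incident berenger \<tau> \<xi> aI \<longrightarrow>
        (\<exists>aR aT. transmission berenger (berenger_C \<sigma>) \<mu> \<tau> \<xi> aI aR aT
          \<and> (\<forall>aR' aT'. transmission berenger (berenger_C \<sigma>) \<mu> \<tau> \<xi> aI aR' aT' \<longrightarrow>
               (\<forall>j. (\<forall>p\<in>left. aR' j p = aR j p) \<and> (\<forall>p\<in>right. aT' j p = aT j p)))))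
     \<comment> \<open>(ii)\<close>
     \<and> (\<forall>\<sigma> \<mu> aI aR aT. absorption \<sigma> \<and> \<mu> \<ge> 0 \<and> incident berenger \<tau> \<xi> aI
          \<and> transmission berenger (berenger_C \<sigma>) \<mu> \<tau> \<xi> aI aR aT \<longrightarrow>
          (\<forall>j. \<forall>p\<in>left. aR j p = 0))
     \<comment> \<open>(iii)\<close>
     \<and> (\<forall>\<mu> aI aR aT. \<mu> \<ge> 0 \<and> incident maxwell \<tau> \<xi> aI
          \<and> transmission maxwell (smart_C (indicator {0<..}) \<nu>) \<mu> \<tau> \<xi> aI aR aT \<longrightarrow>
          (\<forall>p\<in>left. aR 0 p = 0)
          \<and> (\<forall>\<alpha>. (\<forall>p\<in>interface. aI 0 p = \<alpha> p *s \<Phi> \<tau> \<xi>) \<longrightarrow>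
               (\<forall>bR. expansion left bR aR \<longrightarrow>
                  O_eps 2 interface
                    (\<lambda>\<epsilon> p. bR \<epsilon> p
                       - (of_real \<epsilon> * refl_coeff \<mu> \<nu> \<tau> \<xi> * \<alpha> p) *s \<Phi> \<tau> (reflect \<xi>)))))
     \<and> (\<forall>\<mu>\<ge>0. refl_coeff \<mu> \<nu> \<tau> \<xi> =
          \<i> * of_real (\<mu> * (1 + \<nu>) / (8 * \<tau>)
                * (((group_velocity \<tau> \<xi> $ 1)\<^sup>2 - 1) / (group_velocity \<tau> \<xi> $ 1)\<^sup>2)))
     \<and> (\<forall>aI aR aT. incident maxwell \<tau> \<xi> aI
          \<and> (\<forall>\<mu>\<ge>0. transmission maxwell (smart_C (indicator {0<..}) \<nu>) \<mu> \<tau> \<xi> aI (aR \<mu>) (aT \<mu>)) \<longrightarrow>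
          (\<forall>i j. (i = 0 \<and> j \<le> 1) \<or> i \<ge> 1 \<longrightarrow>
             (\<forall>p\<in>interface.
                in_mu_times
                  (\<lambda>\<mu>. (Dx1_within right ^^ j) (aT \<mu> i) p - (Dx1_within UNIV ^^ j) (aI i) p)
                  (poly_space (int i + int j - 1))
                \<and> in_mu_times (\<lambda>\<mu>. (Dx1_within left ^^ j) (aR \<mu> i) p)
                  (poly_space (int i + int j - 1)))))
     \<comment> \<open>(iv)\<close>
     \<and> (\<forall>k. \<forall>\<mu>\<ge>0. \<exists>Rk :: complex. \<forall>\<sigma> aI aR aT \<alpha> bR.
          absorption \<sigma> \<and> (\<forall>m<k. layer_deriv m \<sigma> = 0) \<and> layer_deriv k \<sigma> \<noteq> 0
          \<and> incident maxwell \<tau> \<xi> aI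
          \<and> transmission maxwell (smart_C \<sigma> \<nu>) \<mu> \<tau> \<xi> aI aR aT
          \<and> (\<forall>p\<in>interface. aI 0 p = \<alpha> p *s \<Phi> \<tau> \<xi>)
          \<and> expansion left bR aR \<longrightarrow>
          O_eps (k + 1) interface
            (\<lambda>\<epsilon> p. bR \<epsilon> p
               - (of_real (\<epsilon> ^ k * layer_deriv k \<sigma>) * Rk * \<alpha> p) *s \<Phi> \<tau> (reflect \<xi>)))
     \<and> (\<forall>k \<sigma> aI aR aT. absorption \<sigma> \<and> (\<forall>m<k. layer_deriv m \<sigma> = 0) \<and> layer_deriv k \<sigma> \<noteq> 0
          \<and> incident maxwell \<tau> \<xi> aI
          \<and> (\<forall>\<mu>\<ge>0. transmission maxwell (smart_C \<sigma> \<nu>) \<mu> \<tau> \<xi> aI (aR \<mu>) (aT \<mu>)) \<longrightarrow>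
          (\<forall>i\<ge>k. \<forall>p\<in>interface.
             in_mu_times (\<lambda>\<mu>. aR \<mu> i p) (poly_space (int i - 1))
             \<and> in_mu_times (\<lambda>\<mu>. aT \<mu> i p - aI i p) (poly_space (int i - 1))))"
proof -
  \<comment> \<open>Only the square of \<open>\<tau>\<close> enters the dispersion relation, so both
    signs are treated together.\<close>
  have "(norm \<xi>)\<^sup>2 = \<xi> \<bullet> \<xi>" by (rule power2_norm_eq_inner)
  then interpret incidence \<tau> \<xi>
    using assms by unfold_locales auto
  have 1: "\<exists>aR aT. transmission maxwell (smart_C \<sigma> \<nu>) \<mu> \<tau> \<xi> aI aR aT
          \<and> (\<forall>aR' aT'. transmission maxwell (smart_C \<sigma> \<nu>) \<mu> \<tau> \<xi> aI aR' aT' \<longrightarrow>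
               (\<forall>j. (\<forall>p\<in>left. aR' j p = aR j p) \<and> (\<forall>p\<in>right. aT' j p = aT j p)))"
    if \<sigma>: "absorption \<sigma>" and inc: "incident maxwell \<tau> \<xi> aI" for \<sigma> \<mu> aI
  proof -
    have aI: "smooth (aI j)" for j using inc by (auto simp: incident_def)
    obtain aR aT where t: "transmission maxwell (smart_C \<sigma> \<nu>) \<mu> \<tau> \<xi> aI aR aT"
      using smart_transmission_exists[OF \<sigma> inc] by blast
    show ?thesis
      by (intro exI[of _ aR] exI[of _ aT] conjI t allI impI) (use smart_transmission_unique[OF \<sigma> aI t] in blast)+
  qed
  \<comment> \<open>Existence with zero reflected coefficients; combined with uniqueness it gives
    both (i) and (ii) for this layer.\<close>
  have 2: "\<exists>aT. transmission berenger (berenger_C \<sigma>) \<mu> \<tau> \<xi> aI (\<lambda>j p. 0) aT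
          \<and> (\<forall>aR' aT'. transmission berenger (berenger_C \<sigma>) \<mu> \<tau> \<xi> aI aR' aT' \<longrightarrow>
               (\<forall>j. (\<forall>p\<in>left. aR' j p = 0) \<and> (\<forall>p\<in>right. aT' j p = aT j p)))"
    if \<sigma>: "absorption \<sigma>" and inc: "incident berenger \<tau> \<xi> aI" for \<sigma> \<mu> aI
  proof -
    have aI: "smooth (aI j)" for j using inc by (auto simp: incident_def)
    obtain aT where t: "transmission berenger (berenger_C \<sigma>) \<mu> \<tau> \<xi> aI (\<lambda>j p. 0) aT"
      using berenger_transmission_exists[OF \<sigma> inc] by blast
    show ?thesis
      by (intro exI[of _ aT] conjI t allI impI) (use berenger_transmission_unique[OF \<sigma> aI t] in blast)+
  qed
  have 3: "O_eps 2 interface (\<lambda>\<epsilon> p. bR \<epsilon> p - (of_real \<epsilon> * refl_coeff \<mu> \<nu> \<tau> \<xi> * \<alpha> p) *s \<Phi> \<tau> (reflect \<xi>))"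
    if inc: "incident maxwell \<tau> \<xi> aI"
      and tr: "transmission maxwell (smart_C (indicator {0<..}) \<nu>) \<mu> \<tau> \<xi> aI aR aT"
      and \<alpha>: "\<forall>p\<in>interface. aI 0 p = \<alpha> p *s \<Phi> \<tau> \<xi>" and b: "expansion left bR aR" for \<mu> aI aR aT \<alpha> bR
  proof -
    have "O_eps 2 interface (\<lambda>\<epsilon> p. bR \<epsilon> p - \<epsilon> *\<^sub>R ((refl_coeff \<mu> \<nu> \<tau> \<xi> * \<alpha> p) *s \<Phi> \<tau> (reflect \<xi>)))"
      by (rule expansion_O_eps_first[OF b])
        (use smart_reflection[OF inc tr] \<alpha> interface_subset in auto)
    moreover have "\<epsilon> *\<^sub>R ((c * a) *s u) = (of_real \<epsilon> * c * a) *s u" for \<epsilon> c a and u :: "complex^3"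
      by (simp add: vec_eq_iff scaleR_conv_of_real[where 'a = complex])
    ultimately show ?thesis by simp
  qed
  have 4: "refl_coeff \<mu> \<nu> \<tau> \<xi> =
          \<i> * of_real (\<mu> * (1 + \<nu>) / (8 * \<tau>)
                * (((group_velocity \<tau> \<xi> $ 1)\<^sup>2 - 1) / (group_velocity \<tau> \<xi> $ 1)\<^sup>2))" for \<mu>
  proof -
    have "((\<xi> $ 1)\<^sup>2 - \<tau>\<^sup>2) / (8 * \<tau> * (\<xi> $ 1)\<^sup>2)
      = 1 / (8 * \<tau>) * (((group_velocity \<tau> \<xi> $ 1)\<^sup>2 - 1) / (group_velocity \<tau> \<xi> $ 1)\<^sup>2)"
      using xi1 \<tau> by (simp add: group_velocity_def field_simps)
    then show ?thesis unfolding refl_coeff_def by simp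
  qed
  have 5: "\<exists>Rk :: complex. \<forall>\<sigma> aI aR aT \<alpha> bR.
          absorption \<sigma> \<and> (\<forall>m<k. layer_deriv m \<sigma> = 0) \<and> layer_deriv k \<sigma> \<noteq> 0
          \<and> incident maxwell \<tau> \<xi> aI
          \<and> transmission maxwell (smart_C \<sigma> \<nu>) \<mu> \<tau> \<xi> aI aR aT
          \<and> (\<forall>p\<in>interface. aI 0 p = \<alpha> p *s \<Phi> \<tau> \<xi>)
          \<and> expansion left bR aR \<longrightarrow>
          O_eps (k + 1) interface
            (\<lambda>\<epsilon> p. bR \<epsilon> p
               - (of_real (\<epsilon> ^ k * layer_deriv k \<sigma>) * Rk * \<alpha> p) *s \<Phi> \<tau> (reflect \<xi>))" for k \<mu>
  proof (rule exI[of _ 0], intro allI impI, elim conjE)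
    fix \<sigma> :: "real \<Rightarrow> real" and aI aR aT :: "nat \<Rightarrow> spacetime \<Rightarrow> complex^3" and \<alpha> :: "spacetime \<Rightarrow> complex" and bR
    assume "absorption \<sigma>" "\<forall>m<k. layer_deriv m \<sigma> = 0" "incident maxwell \<tau> \<xi> aI"
      "transmission maxwell (smart_C \<sigma> \<nu>) \<mu> \<tau> \<xi> aI aR aT" and b: "expansion left bR aR"
    then have "O_eps (k + 1) interface bR"
      using smart_nonreflecting by (intro expansion_O_eps[OF b]) auto
    then show "O_eps (k + 1) interface
            (\<lambda>\<epsilon> p. bR \<epsilon> p - (of_real (\<epsilon> ^ k * layer_deriv k \<sigma>) * 0 * \<alpha> p) *s \<Phi> \<tau> (reflect \<xi>))" by simp
  qed
  have 6: "in_mu_times (\<lambda>\<mu>. aR \<mu> i p) (poly_space (int i - 1))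
      \<and> in_mu_times (\<lambda>\<mu>. aT \<mu> i p - aI i p) (poly_space (int i - 1))"
    if "absorption \<sigma>" "incident maxwell \<tau> \<xi> aI"
      "\<forall>\<mu>\<ge>0. transmission maxwell (smart_C \<sigma> \<nu>) \<mu> \<tau> \<xi> aI (aR \<mu>) (aT \<mu>)" "p \<in> interface" for \<sigma> aI aR aT i p
    using smart_poly[OF that, of 0 i] by simp
  show ?thesis
    apply (intro conjI)
    subgoal using 1 by blast
    subgoal using 2 by blast
    subgoal using 2 by blast
    subgoal using 3 smart_reflection(1) by blast
    subgoal using 4 by blast
    subgoal using smart_poly[OF indicator_absorption] by blast
    subgoal using 5 by blast
    subgoal using 6 by blast
    done
qed

end
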